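(* Let $s_0,s_1\in\mathbb{R}$, $0<p_0,p_1<\infty$, $0<q_0,q_1,r_0,r_1\le\infty$. The (continuous) embedding $$B^{s_0}_{q_0}[L^{p_0,r_0}]\hookrightarrow B^{s_1}_{q_1}[L^{p_1,r_1}]$$ holds if and only if one of the following four conditions is satisfied: (i) $s_0-s_1>d/p_0-d/p_1>0$. (ii) $s_0>s_1$, $p_0=p_1$, $r_0\le r_1$. (iii) $s_0-s_1=d/p_0-d/p_1>0$, $q_0\le q_1$. (iv) $s_0=s_1$, $p_0=p_1$, $r_0\le r_1$, $q_0\le q_1$.
   Context: All function spaces consist of tempered distributions on $\mathbb{R}^d$. For a measurable function $f$ on $\mathbb{R}^d$ with Lebesgue measure, let $f^*(t)=\inf\{\alpha:\ |\{x:|f(x)|>\alpha\}|\le t\}$ be the nonincreasing rearrangement. For $0<p,r<\infty$ the Lorentz quasi-norm is $\|f\|_{p,r}=\big(\frac rp\int_0^\infty[t^{1/p}f^*(t)]^r\frac{dt}{t}\big)^{1/r}$, and $\|f\|_{p,\infty}=\sup_{t>0}t^{1/p}f^*(t)$; $L^{p,r}$ is the space of functions with finite quasi-norm. Inhomogeneous Littlewood-Paley decomposition: let $\beta_0\in C^\infty(\mathbb{R}^d)$ with $\beta_0(\xi)=1$ for $|\xi|\le 3/2$ and $\beta_0(\xi)=0$ for $|\xi|\ge 7/4$; for $k\ge1$ let $\beta_k(\xi)=\beta_0(2^{-k}\xi)-\beta_0(2^{1-k}\xi)$. Define $\Lambda_k$ by $\widehat{\Lambda_kf}=\beta_k\widehat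 f$, $k=0,1,2,\dots$. For $s\in\mathbb{R}$, $0<q\le\infty$, $0<p<\infty$, $0<r\le\infty$ the space $B^s_q[L^{p,r}]$ consists of the tempered distributions $f$ for which $$\|f\|_{B^s_q[L^{p,r}]}=\Big(\sum_{k\ge 0}2^{ksq}\|\Lambda_kf\|_{p,r}^q\Big)^{1/q}$$ is finite (sum replaced by supremum over $k$ when $q=\infty$). $X\hookrightarrow Y$ means $X\subset Y$ with $\|f\|_Y\le C\|f\|_X$ for all $f\in X$, with $C$ independent of $f$. *)

theory Defs
  imports "HOL-Analysis.Analysis"
begin

section \<open>Tempered distributions\<close>

text \<open>
  The iterated partial derivative \<^term>\<open>iter_deriv [v1, v2] f\<close> is
  \<open>\<partial>\<^sub>v\<^sub>1 \<partial>\<^sub>v\<^sub>2 f\<close>. Lists over \<^term>\<open>Basis\<close> play the role of multi-indices.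
\<close>

primrec iter_deriv :: "'a::euclidean_space list \<Rightarrow> ('a \<Rightarrow> complex) \<Rightarrow> 'a \<Rightarrow> complex" where
  "iter_deriv [] f = f"
| "iter_deriv (v # vs) f = (\<lambda>x. frechet_derivative (iter_deriv vs f) (at x) v)"

text \<open>
  Differentiability of all iterated partial derivatives makes each of them continuous,
  so this is the usual class of infinitely differentiable functions.
\<close>

definition smooth :: "('a::euclidean_space \<Rightarrow> complex) \<Rightarrow> bool" where
  "smooth f \<longleftrightarrow> (\<forall>vs\<in>lists Basis. \<forall>x. iter_deriv vs f differentiable (at x))"

definition schwartz :: "('a::euclidean_space \<Rightarrow> complex) set" where
  "schwartz = {\<phi>. smooth \<phi> \<and>
     (\<forall>N::nat. \<forall>vs\<in>lists Basis. \<exists>B::real. \<forall>x. (1 + norm x) ^ N * norm (iter_deriv vs \<phi> x) \<le> B)}"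

text \<open>
  For \<^term>\<open>\<phi> \<in> schwartz\<close> the following is a supremum of a bounded set of reals, since
  there are only finitely many lists over \<^term>\<open>Basis\<close> of length at most \<open>N\<close>.
\<close>

definition schwartz_seminorm :: "nat \<Rightarrow> ('a::euclidean_space \<Rightarrow> complex) \<Rightarrow> real" where
  "schwartz_seminorm N \<phi> =
     (SUP (vs, x) \<in> {vs \<in> lists Basis. length vs \<le> N} \<times> UNIV.
        (1 + norm x) ^ N * norm (iter_deriv vs \<phi> x))"

type_synonym 'a distr = "('a \<Rightarrow> complex) \<Rightarrow> complex"

text \<open>
  Functionals on \<^term>\<open>schwartz\<close> are total functions taking the value \<^term>\<open>undefined\<close>
  off \<^term>\<open>schwartz\<close>, so that equality of distributions is equality of functions.
\<close>

definition tempered :: "'a::euclidean_space distr set" where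
  "tempered = {u \<in> extensional schwartz.
     (\<forall>\<phi>\<in>schwartz. \<forall>\<psi>\<in>schwartz. u (\<lambda>x. \<phi> x + \<psi> x) = u \<phi> + u \<psi>) \<and>
     (\<forall>c. \<forall>\<phi>\<in>schwartz. u (\<lambda>x. c * \<phi> x) = c * u \<phi>) \<and>
     (\<exists>C N. \<forall>\<phi>\<in>schwartz. norm (u \<phi>) \<le> C * schwartz_seminorm N \<phi>)}"

text \<open>Normalization: \<open>\<phi>\<close> is mapped to \<open>\<xi> \<mapsto> \<integral> e\<^sup>-\<^sup>i\<^sup>x\<^sup>\<xi> \<phi>(x) dx\<close>.\<close>

definition fourier :: "('a::euclidean_space \<Rightarrow> complex) \<Rightarrow> 'a \<Rightarrow> complex" where
  "fourier \<phi> \<xi> = (\<integral>x. cis (- (x \<bullet> \<xi>)) * \<phi> x \<partial>lborel)"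

definition inv_fourier :: "('a::euclidean_space \<Rightarrow> complex) \<Rightarrow> 'a \<Rightarrow> complex" where
  "inv_fourier \<phi> x = complex_of_real (1 / (2 * pi) ^ DIM('a)) * (\<integral>\<xi>. cis (x \<bullet> \<xi>) * \<phi> \<xi> \<partial>lborel)"

definition distr_fourier :: "'a::euclidean_space distr \<Rightarrow> 'a distr" where
  "distr_fourier u = (\<lambda>\<phi>\<in>schwartz. u (fourier \<phi>))"

definition distr_inv_fourier :: "'a::euclidean_space distr \<Rightarrow> 'a distr" where
  "distr_inv_fourier u = (\<lambda>\<phi>\<in>schwartz. u (inv_fourier \<phi>))"

definition distr_mult :: "('a::euclidean_space \<Rightarrow> complex) \<Rightarrow> 'a distr \<Rightarrow> 'a distr" where
  "distr_mult m u = (\<lambda>\<phi>\<in>schwartz. u (\<lambda>\<xi>. m \<xi> * \<phi> \<xi>))"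

definition represents :: "('a::euclidean_space \<Rightarrow> complex) \<Rightarrow> 'a distr \<Rightarrow> bool" where
  "represents g u \<longleftrightarrow> g \<in> borel_measurable lebesgue \<and>
     (\<forall>\<phi>\<in>schwartz. integrable lebesgue (\<lambda>x. g x * \<phi> x) \<and> u \<phi> = (\<integral>x. g x * \<phi> x \<partial>lebesgue))"


section \<open>Lorentz quasi-norms\<close>

text \<open>Only used for exponents \<^prop>\<open>a > 0\<close>.\<close>

definition epowr :: "ennreal \<Rightarrow> real \<Rightarrow> ennreal" where
  "epowr x a = (if x = \<infinity> then \<infinity> else ennreal (enn2real x powr a))"

text \<open>
  Negative \<open>\<alpha>\<close> never belong to the set in the definition of the rearrangement, because
  the whole space has infinite measure; the infimum of the empty set is \<open>\<infinity>\<close>.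
\<close>

definition rearrangement :: "('a::euclidean_space \<Rightarrow> complex) \<Rightarrow> real \<Rightarrow> ennreal" where
  "rearrangement f t =
     (INF \<alpha> \<in> {\<alpha>::real. 0 \<le> \<alpha> \<and> emeasure lebesgue {x. norm (f x) > \<alpha>} \<le> ennreal t}. ennreal \<alpha>)"

definition lorentz_qnorm :: "real \<Rightarrow> ennreal \<Rightarrow> ('a::euclidean_space \<Rightarrow> complex) \<Rightarrow> ennreal" where
  "lorentz_qnorm p r f =
     (if r = \<infinity> then (SUP t\<in>{0<..}. ennreal (t powr (1 / p)) * rearrangement f t)
      else epowr
        (ennreal (enn2real r / p) *
          (\<integral>\<^sup>+t\<in>{0<..}. epowr (ennreal (t powr (1 / p)) * rearrangement f t) (enn2real r) * ennreal (1 / t) \<partial>lborel))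
        (1 / enn2real r))"

text \<open>
  A distribution given by a function is identified with that function. Representatives
  agree almost everywhere and so have the same quasi-norm; the infimum is
  \<open>\<infinity>\<close> for a distribution that is not given by a function.
\<close>

definition distr_lorentz_qnorm :: "real \<Rightarrow> ennreal \<Rightarrow> 'a::euclidean_space distr \<Rightarrow> ennreal" where
  "distr_lorentz_qnorm p r u = (INF g \<in> {g. represents g u}. lorentz_qnorm p r g)"


section \<open>Besov-Lorentz spaces\<close>

definition LP_cutoff :: "('a::euclidean_space \<Rightarrow> complex) \<Rightarrow> bool" where
  "LP_cutoff \<beta>0 \<longleftrightarrow> smooth \<beta>0 \<and>
     (\<forall>\<xi>. norm \<xi> \<le> 3 / 2 \<longrightarrow> \<beta>0 \<xi> = 1) \<and> (\<forall>\<xi>. norm \<xi> \<ge> 7 / 4 \<longrightarrow> \<beta>0 \<xi> = 0)"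

definition LP_beta :: "('a::euclidean_space \<Rightarrow> complex) \<Rightarrow> nat \<Rightarrow> 'a \<Rightarrow> complex" where
  "LP_beta \<beta>0 k \<xi> =
     (if k = 0 then \<beta>0 \<xi>
      else \<beta>0 ((2 powr (- real k)) *\<^sub>R \<xi>) - \<beta>0 ((2 powr (1 - real k)) *\<^sub>R \<xi>))"

definition LP_piece :: "('a::euclidean_space \<Rightarrow> complex) \<Rightarrow> nat \<Rightarrow> 'a distr \<Rightarrow> 'a distr" where
  "LP_piece \<beta>0 k f = distr_inv_fourier (distr_mult (LP_beta \<beta>0 k) (distr_fourier f))"

definition besov_lorentz_qnorm ::
  "('a::euclidean_space \<Rightarrow> complex) \<Rightarrow> real \<Rightarrow> ennreal \<Rightarrow> real \<Rightarrow> ennreal \<Rightarrow> 'a distr \<Rightarrow> ennreal" where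
  "besov_lorentz_qnorm \<beta>0 s q p r f =
     (if q = \<infinity> then (SUP k. ennreal (2 powr (real k * s)) * distr_lorentz_qnorm p r (LP_piece \<beta>0 k f))
      else epowr
        (\<Sum>k. ennreal (2 powr (real k * s * enn2real q)) *
               epowr (distr_lorentz_qnorm p r (LP_piece \<beta>0 k f)) (enn2real q))
        (1 / enn2real q))"

definition besov_lorentz ::
  "('a::euclidean_space \<Rightarrow> complex) \<Rightarrow> real \<Rightarrow> ennreal \<Rightarrow> real \<Rightarrow> ennreal \<Rightarrow> 'a distr set" where
  "besov_lorentz \<beta>0 s q p r = {f \<in> tempered. besov_lorentz_qnorm \<beta>0 s q p r f < \<infinity>}"

definition cont_embeds :: "'b set \<Rightarrow> ('b \<Rightarrow> ennreal) \<Rightarrow> 'b set \<Rightarrow> ('b \<Rightarrow> ennreal) \<Rightarrow> bool" where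
  "cont_embeds X NX Y NY \<longleftrightarrow> X \<subseteq> Y \<and> (\<exists>C::real. \<forall>f\<in>X. NY f \<le> ennreal C * NX f)"

end

theory Submission
  imports Defs "HOL-Probability.Probability"
begin

text \<open>
  Sufficiency reduces to the Nikolskii inequality
  \<open>\<parallel>\<Lambda>\<^sub>k f\<parallel>\<^sub>\<infinity> \<le> C 2\<^sup>k\<^sup>d\<^sup>/\<^sup>p \<parallel>\<Lambda>\<^sub>k f\<parallel>\<^sub>p\<^sub>,\<^sub>\<infinity>\<close>. The piece \<open>g = \<Lambda>\<^sub>k f\<close> is reproduced by a kernel \<open>\<psi>\<close>
  with \<open>\<parallel>\<psi>\<parallel>\<^sub>1\<close> bounded and \<open>sup |\<psi>|\<close> of size \<open>2\<^sup>k\<^sup>d\<close>. If the set where \<open>|g| > \<alpha>\<close> has measure at most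
  \<open>1 / (2 sup |\<psi>|)\<close>, then \<open>sup |g| \<le> \<alpha> \<parallel>\<psi>\<parallel>\<^sub>1 + sup |g| / 2\<close>, so that \<open>sup |g| \<le> 2 \<alpha> \<parallel>\<psi>\<parallel>\<^sub>1\<close>, also for \<open>p < 1\<close>.
  Temperedness only gives polynomial growth of \<open>g\<close>, hence the argument is run with the weights
  \<open>(1 + \<delta> |x|)\<^sup>-\<^sup>N\<close> and \<open>\<delta> \<rightarrow> 0\<close>. Interpolating between the bounds \<open>A t\<^sup>-\<^sup>1\<^sup>/\<^sup>p\<^sup>0\<close> and
  \<open>C 2\<^sup>k\<^sup>d\<^sup>/\<^sup>p\<^sup>0 A\<close> for the rearrangement controls every quasi-norm with larger first exponent, which is
  why \<open>r\<^sub>0\<close> and \<open>r\<^sub>1\<close> play no role when \<open>p\<^sub>0 < p\<^sub>1\<close>.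

  For necessity, dilates of a low-frequency function give \<open>p\<^sub>0 \<le> p\<^sub>1\<close>, dilates \<open>F(2\<^sup>k x)\<close> of a function
  with spectrum in an annulus where only one \<open>\<beta>\<^sub>k\<close> is nonzero give \<open>s\<^sub>0 - s\<^sub>1 \<ge> d/p\<^sub>0 - d/p\<^sub>1\<close>, and
  lacunary sums of such dilates with normalized pieces give \<open>q\<^sub>0 \<le> q\<^sub>1\<close> in the case of equality.
  If \<open>p\<^sub>0 = p\<^sub>1 = p\<close>, the sums \<open>\<Sum>\<^sub>j\<^sub>\<le>\<^sub>J 2\<^sup>-\<^sup>j\<^sup>d\<^sup>/\<^sup>p \<eta>(2\<^sup>-\<^sup>j x)\<close> with \<open>\<eta> \<ge> 0\<close> band-limited have rearrangement
  comparable to \<open>t\<^sup>-\<^sup>1\<^sup>/\<^sup>p\<close> for \<open>1 \<le> t \<le> 2\<^sup>J\<^sup>d\<close>, hence \<open>L\<^sup>p\<^sup>,\<^sup>r\<close> quasi-norm of size \<open>J\<^sup>1\<^sup>/\<^sup>r\<close>, and \<open>r\<^sub>0 \<le> r\<^sub>1\<close> follows.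
\<close>

section \<open>Schwartz functions\<close>

text \<open>A piece of a distribution becomes a function only through \<open>represents\<close>,
  that is, through integrals against Schwartz functions, so no pointwise statement about it is
  available for free. Pointwise bounds are extracted by duality: if all pairings are dominated by
  those of \<open>|\<phi>|\<close> with a continuous weight \<open>W\<close>, then
  \<open>|g| \<le> W\<close> almost everywhere. This one principle, \<open>dual_bound\<close>,
  yields the polynomial growth of the pieces, every improvement in the iteration behind the
  Nikolskii inequality and, with \<open>W = 0\<close>, the uniqueness of representatives.

  For necessity, Schwartz functions suffice as tests because their pieces have explicit
  representatives. A spectrum in \<open>|\<xi>| \<le> 3/2\<close> leaves a single piece, and the
  embedding becomes an inequality between Lorentz quasi-norms in which \<open>s\<close> and
  \<open>q\<close> have disappeared. Spectra in dilated annuli turn it into an inequality between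
  sequence quasi-norms in which the profile enters only through two numbers. Each necessary
  condition then follows by comparing exponential growth rates in one integer parameter.\<close>

definition pdv :: "'a::euclidean_space \<Rightarrow> ('a \<Rightarrow> complex) \<Rightarrow> 'a \<Rightarrow> complex" where
  "pdv v f = (\<lambda>x. frechet_derivative f (at x) v)"

lemma iter_deriv_Cons: "iter_deriv (v # vs) f = pdv v (iter_deriv vs f)"
  by (simp add: pdv_def)

lemma iter_deriv_snoc: "iter_deriv (vs @ [v]) f = iter_deriv vs (pdv v f)"
  by (induction vs) (simp_all add: pdv_def)

lemma pdv_eqI: "(\<And>x. (f has_derivative f' x) (at x)) \<Longrightarrow> pdv v f = (\<lambda>x. f' x v)"
  by (metis pdv_def frechet_derivative_at)

text \<open>
  Closure properties of Schwartz functions are proved by coinduction: a class of differentiable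
  functions that is closed under partial derivatives consists of smooth functions, and of
  Schwartz functions if its members decay rapidly. No Leibniz rule for iterated derivatives is
  needed.
\<close>

definition pd_closed :: "('a::euclidean_space \<Rightarrow> complex) set \<Rightarrow> bool" where
  "pd_closed X \<longleftrightarrow> (\<forall>f\<in>X. (\<forall>x. f differentiable (at x)) \<and> (\<forall>b\<in>Basis. pdv b f \<in> X))"

lemma pd_closedI:
  assumes "\<And>f. f \<in> X \<Longrightarrow> \<exists>f'. (\<forall>x. (f has_derivative f' x) (at x)) \<and> (\<forall>b\<in>Basis. (\<lambda>x. f' x b) \<in> X)"
  shows "pd_closed X"
  unfolding pd_closed_def
proof (intro ballI conjI)
  fix f assume "f \<in> X"
  then obtain f' where f': "\<forall>x. (f has_derivative f' x) (at x)" "\<forall>b\<in>Basis. (\<lambda>x. f' x b) \<in> X"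
    using assms by blast
  then show "\<forall>x. f differentiable (at x)" by (auto simp: differentiable_def)
  fix b :: 'a assume "b \<in> Basis"
  then show "pdv b f \<in> X" using f' pdv_eqI[of f f' b] by simp
qed

text \<open>Expansion in the basis keeps the derivative within reach of the class: its coefficients
  are again members of \<open>X\<close>, which computations with the product and chain rules
  need.\<close>

lemma pd_closed_has_derivative:
  assumes "pd_closed X" "f \<in> X"
  shows "(f has_derivative (\<lambda>v. \<Sum>b\<in>Basis. of_real (v \<bullet> b) * pdv b f x)) (at x)"
proof -
  have d: "f differentiable (at x)" using assms by (auto simp: pd_closed_def)
  have "(f has_derivative frechet_derivative f (at x)) (at x)"
    using d frechet_derivative_works by blast
  moreover have "frechet_derivative f (at x) v = (\<Sum>b\<in>Basis. of_real (v \<bullet> b) * pdv b f x)" for v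
  proof -
    have "linear (frechet_derivative f (at x))" using d by (rule linear_frechet_derivative)
    then have "frechet_derivative f (at x) (\<Sum>b\<in>Basis. (v \<bullet> b) *\<^sub>R b) = (\<Sum>b\<in>Basis. (v \<bullet> b) *\<^sub>R frechet_derivative f (at x) b)"
      by (simp add: linear_sum linear_scale o_def)
    then show ?thesis by (simp add: euclidean_representation pdv_def scaleR_conv_of_real)
  qed
  ultimately show ?thesis by (metis (no_types, lifting) ext)
qed

lemma pd_closed_continuous:
  assumes "pd_closed X" "f \<in> X" shows "continuous_on S f"
  using pd_closed_has_derivative[OF assms]
  by (meson continuous_at_imp_continuous_on has_derivative_continuous)

lemma pd_closed_iter_deriv:
  assumes "pd_closed X" "f \<in> X" "vs \<in> lists Basis"
  shows "iter_deriv vs f \<in> X"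
  using assms(3)
proof (induction vs)
  case Nil
  then show ?case using assms by simp
next
  case (Cons v vs)
  then have "iter_deriv vs f \<in> X" "v \<in> Basis" by auto
  then show ?case using assms(1) unfolding iter_deriv_Cons pd_closed_def by blast
qed

lemma pd_closed_smooth:
  assumes "pd_closed X" "f \<in> X" shows "smooth f"
  unfolding smooth_def using pd_closed_iter_deriv[OF assms] assms(1)
  by (auto simp: pd_closed_def)

text \<open>A derivative of \<open>pdv b f\<close> along \<open>vs\<close> is the derivative of
  \<open>f\<close> along \<open>vs @ [b]\<close>, so every condition on all iterated derivatives is
  inherited. The instances are smoothness, rapid decay and polynomial growth.\<close>

lemma pd_closed_derivs:
  "pd_closed {f. smooth f \<and> (\<forall>vs\<in>lists Basis. P (iter_deriv vs f))}"
  unfolding pd_closed_def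
proof (intro ballI conjI)
  fix f :: "'a \<Rightarrow> complex"
  assume "f \<in> {f. smooth f \<and> (\<forall>vs\<in>lists Basis. P (iter_deriv vs f))}"
  then have f: "smooth f" "\<And>vs. vs\<in>lists Basis \<Longrightarrow> P (iter_deriv vs f)" by auto
  show "\<forall>x. f differentiable (at x)"
    using f(1)[unfolded smooth_def, rule_format, of "[]"] by simp
  fix b :: 'a assume b: "b \<in> Basis"
  have "iter_deriv vs (pdv b f) differentiable (at x)" if "vs \<in> lists Basis" for vs x
    using f(1)[unfolded smooth_def, rule_format, of "vs @ [b]" x] that b
    by (simp add: iter_deriv_snoc)
  moreover have "P (iter_deriv vs (pdv b f))" if "vs \<in> lists Basis" for vs
    using f(2)[of "vs @ [b]"] that b by (simp add: iter_deriv_snoc)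
  ultimately show "pdv b f \<in> {f. smooth f \<and> (\<forall>vs\<in>lists Basis. P (iter_deriv vs f))}"
    by (auto simp: smooth_def)
qed

lemma pd_closed_smooth_set: "pd_closed {f. smooth f}"
  using pd_closed_derivs[of "\<lambda>_. True"] by simp

section \<open>Rapid decay, polynomial growth and multipliers\<close>

definition rapid :: "('a::real_normed_vector \<Rightarrow> 'b::real_normed_vector) \<Rightarrow> bool" where
  "rapid f \<longleftrightarrow> (\<forall>N::nat. \<exists>B::real. \<forall>x. (1 + norm x) ^ N * norm (f x) \<le> B)"

definition slow :: "('a::real_normed_vector \<Rightarrow> 'b::real_normed_vector) \<Rightarrow> bool" where
  "slow f \<longleftrightarrow> (\<exists>(N::nat) (B::real). \<forall>x. norm (f x) \<le> B * (1 + norm x) ^ N)"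

text \<open>The multiplier algebra of the Schwartz space, often written O_M.\<close>

definition multipliers :: "('a::euclidean_space \<Rightarrow> complex) set" where
  "multipliers = {m. smooth m \<and> (\<forall>vs\<in>lists Basis. slow (iter_deriv vs m))}"

lemma schwartz_eq: "schwartz = {f. smooth f \<and> (\<forall>vs\<in>lists Basis. rapid (iter_deriv vs f))}"
  unfolding schwartz_def rapid_def by auto

lemma pd_closed_schwartz: "pd_closed (schwartz :: ('a::euclidean_space \<Rightarrow> complex) set)"
  unfolding schwartz_eq by (rule pd_closed_derivs)

lemma pd_closed_multipliers: "pd_closed (multipliers :: ('a::euclidean_space \<Rightarrow> complex) set)"
  unfolding multipliers_def by (rule pd_closed_derivs)

lemma schwartz_coinduct:
  assumes "pd_closed X" "f \<in> X" "\<And>g. g \<in> X \<Longrightarrow> rapid g"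
  shows "f \<in> schwartz"
  unfolding schwartz_eq using pd_closed_smooth[OF assms(1,2)] pd_closed_iter_deriv[OF assms(1,2)] assms(3)
  by auto

lemma multipliers_coinduct:
  assumes "pd_closed X" "f \<in> X" "\<And>g. g \<in> X \<Longrightarrow> slow g"
  shows "f \<in> multipliers"
  unfolding multipliers_def using pd_closed_smooth[OF assms(1,2)] pd_closed_iter_deriv[OF assms(1,2)] assms(3)
  by auto

lemma schwartz_rapid: "f \<in> schwartz \<Longrightarrow> rapid f"
  unfolding schwartz_eq by (metis (mono_tags, lifting) iter_deriv.simps(1) lists.Nil mem_Collect_eq)

lemma multipliers_slow: "f \<in> multipliers \<Longrightarrow> slow f"
  unfolding multipliers_def by (metis (mono_tags, lifting) iter_deriv.simps(1) lists.Nil mem_Collect_eq)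

lemma schwartz_pdv: "f \<in> schwartz \<Longrightarrow> b \<in> Basis \<Longrightarrow> pdv b f \<in> schwartz"
  using pd_closed_schwartz unfolding pd_closed_def by blast

lemma schwartz_iter_deriv: "f \<in> schwartz \<Longrightarrow> vs \<in> lists Basis \<Longrightarrow> iter_deriv vs f \<in> schwartz"
  using pd_closed_schwartz pd_closed_iter_deriv by blast

lemma schwartz_continuous: "f \<in> schwartz \<Longrightarrow> continuous_on S f"
  using pd_closed_schwartz pd_closed_continuous by blast

lemma schwartz_measurable [measurable_dest]: "f \<in> schwartz \<Longrightarrow> f \<in> borel_measurable borel"
  by (simp add: borel_measurable_continuous_onI schwartz_continuous)

lemma schwartz_has_derivative:
  "f \<in> schwartz \<Longrightarrow> (f has_derivative (\<lambda>v. \<Sum>b\<in>Basis. of_real (v \<bullet> b) * pdv b f x)) (at x)"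
  using pd_closed_schwartz pd_closed_has_derivative by blast

lemma one_le_one_plus_norm_power: "1 \<le> (1 + norm x) ^ N"
  by (simp add: one_le_power)

lemma rapid_slow: "rapid f \<Longrightarrow> slow f"
  unfolding rapid_def slow_def
proof -
  assume "\<forall>N::nat. \<exists>B. \<forall>x. (1 + norm x) ^ N * norm (f x) \<le> B"
  then obtain B where "\<forall>x. (1 + norm x) ^ 0 * norm (f x) \<le> B" by blast
  then have "\<forall>x. norm (f x) \<le> B * (1 + norm x) ^ 0" by simp
  then show "\<exists>N B. \<forall>x. norm (f x) \<le> B * (1 + norm x) ^ N" by blast
qed

lemma rapid_bound:
  assumes "rapid f"
  obtains B where "B > 0" "\<And>x. (1 + norm x) ^ N * norm (f x) \<le> B"
proof -
  obtain B where "\<forall>x. (1 + norm x) ^ N * norm (f x) \<le> B" using assms unfolding rapid_def by blast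
  then have "(1 + norm x) ^ N * norm (f x) \<le> max B 1" for x by (simp add: le_max_iff_disj)
  then show ?thesis using that[of "max B 1"] by simp
qed

lemma rapid_add:
  assumes "rapid f" "rapid g" shows "rapid (\<lambda>x. f x + g x)"
  unfolding rapid_def
proof
  fix N :: nat
  obtain B where B: "\<And>x. (1 + norm x) ^ N * norm (f x) \<le> B" using rapid_bound[OF assms(1)] by metis
  obtain C where C: "\<And>x. (1 + norm x) ^ N * norm (g x) \<le> C" using rapid_bound[OF assms(2)] by metis
  have "(1 + norm x) ^ N * norm (f x + g x) \<le> B + C" for x
  proof -
    have "(1 + norm x) ^ N * norm (f x + g x) \<le> (1 + norm x) ^ N * (norm (f x) + norm (g x))"
      by (intro mult_left_mono norm_triangle_ineq) simp
    then show ?thesis using B[of x] C[of x] by (simp add: distrib_left)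
  qed
  then show "\<exists>B. \<forall>x. (1 + norm x) ^ N * norm (f x + g x) \<le> B" by blast
qed

lemma rapid_slow_mult:
  fixes f g :: "'a::real_normed_vector \<Rightarrow> complex"
  assumes "rapid f" "slow g" shows "rapid (\<lambda>x. f x * g x)"
  unfolding rapid_def
proof
  fix N :: nat
  obtain C and M :: nat where C: "\<And>x. norm (g x) \<le> C * (1 + norm x) ^ M" using assms(2) unfolding slow_def by blast
  have C0: "C \<ge> 0" using order_trans[OF norm_ge_zero C[of 0]] by simp
  obtain B where B: "\<And>x. (1 + norm x) ^ (N + M) * norm (f x) \<le> B" using rapid_bound[OF assms(1)] by metis
  have "(1 + norm x) ^ N * norm (f x * g x) \<le> C * B" for x
  proof -
    have "(1 + norm x) ^ N * norm (f x * g x) = ((1 + norm x) ^ N * norm (f x)) * norm (g x)"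
      by (simp add: norm_mult)
    also have "\<dots> \<le> ((1 + norm x) ^ N * norm (f x)) * (C * (1 + norm x) ^ M)"
      by (intro mult_left_mono C) simp
    also have "\<dots> = C * ((1 + norm x) ^ (N + M) * norm (f x))" by (simp add: power_add)
    also have "\<dots> \<le> C * B" by (intro mult_left_mono B C0)
    finally show ?thesis .
  qed
  then show "\<exists>B. \<forall>x. (1 + norm x) ^ N * norm (f x * g x) \<le> B" by blast
qed

lemma slow_add:
  assumes "slow f" "slow g" shows "slow (\<lambda>x. f x + g x)"
proof -
  obtain B and M :: nat where B: "\<And>x. norm (f x) \<le> B * (1 + norm x) ^ M" using assms(1) unfolding slow_def by blast
  obtain C and N :: nat where C: "\<And>x. norm (g x) \<le> C * (1 + norm x) ^ N" using assms(2) unfolding slow_def by blast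
  have B0: "B \<ge> 0" using order_trans[OF norm_ge_zero B[of 0]] by simp
  have C0: "C \<ge> 0" using order_trans[OF norm_ge_zero C[of 0]] by simp
  have "norm (f x + g x) \<le> (B + C) * (1 + norm x) ^ (M + N)" for x
  proof -
    have "norm (f x + g x) \<le> B * (1 + norm x) ^ M + C * (1 + norm x) ^ N"
      using norm_triangle_ineq[of "f x" "g x"] B[of x] C[of x] by linarith
    also have "\<dots> \<le> B * (1 + norm x) ^ (M + N) + C * (1 + norm x) ^ (M + N)"
      by (intro add_mono mult_left_mono power_increasing B0 C0) auto
    finally show ?thesis by (simp add: distrib_right)
  qed
  then show ?thesis unfolding slow_def by blast
qed

lemma slow_mult:
  fixes f g :: "'a::real_normed_vector \<Rightarrow> complex"
  assumes "slow f" "slow g" shows "slow (\<lambda>x. f x * g x)"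
proof -
  obtain B and M :: nat where B: "\<And>x. norm (f x) \<le> B * (1 + norm x) ^ M" using assms(1) unfolding slow_def by blast
  obtain C and N :: nat where C: "\<And>x. norm (g x) \<le> C * (1 + norm x) ^ N" using assms(2) unfolding slow_def by blast
  have B0: "B \<ge> 0" using order_trans[OF norm_ge_zero B[of 0]] by simp
  have "norm (f x * g x) \<le> (B * C) * (1 + norm x) ^ (M + N)" for x
  proof -
    have "norm (f x * g x) \<le> (B * (1 + norm x) ^ M) * (C * (1 + norm x) ^ N)"
      unfolding norm_mult by (intro mult_mono B C) (simp_all add: B0)
    then show ?thesis by (simp add: power_add mult_ac)
  qed
  then show ?thesis unfolding slow_def by blast
qed

lemma slow_const: "slow (\<lambda>x. c)"
  unfolding slow_def by (rule exI[of _ 0], rule exI[of _ "norm c"]) simp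

lemma slow_inner: "slow (\<lambda>x. complex_of_real (x \<bullet> v))"
  unfolding slow_def
proof (intro exI allI)
  fix x :: 'a
  have "\<bar>x \<bullet> v\<bar> \<le> norm x * norm v" by (rule Cauchy_Schwarz_ineq2)
  also have "\<dots> \<le> norm v * (1 + norm x) ^ 1" by (simp add: algebra_simps)
  finally show "norm (complex_of_real (x \<bullet> v)) \<le> norm v * (1 + norm x) ^ 1" by simp
qed

text \<open>The Leibniz rule turns one product into a sum of two products of the same kind, so
  products together with finite sums form a class closed under partial derivatives. Suitable
  \<open>A\<close> and \<open>B\<close> give closure under multiplication, and the constant
  multiplier 1 gives closure under addition.\<close>

inductive_set prodsums :: "('a \<Rightarrow> complex) set \<Rightarrow> ('a \<Rightarrow> complex) set \<Rightarrow> ('a \<Rightarrow> complex) set"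
  for A B where
  prod: "f \<in> A \<Longrightarrow> g \<in> B \<Longrightarrow> (\<lambda>x. f x * g x) \<in> prodsums A B"
| add: "h \<in> prodsums A B \<Longrightarrow> k \<in> prodsums A B \<Longrightarrow> (\<lambda>x. h x + k x) \<in> prodsums A B"

lemma pd_closed_prodsums:
  assumes "pd_closed A" "pd_closed B" shows "pd_closed (prodsums A B)"
proof (rule pd_closedI)
  fix h assume "h \<in> prodsums A B"
  then show "\<exists>h'. (\<forall>x. (h has_derivative h' x) (at x)) \<and> (\<forall>b\<in>Basis. (\<lambda>x. h' x b) \<in> prodsums A B)"
  proof induction
    case (prod f g)
    let ?f = "\<lambda>x v. \<Sum>b\<in>Basis. of_real (v \<bullet> b) * pdv b f x"
    let ?g = "\<lambda>x v. \<Sum>b\<in>Basis. of_real (v \<bullet> b) * pdv b g x"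
    have 1: "(f has_derivative ?f x) (at x)" "(g has_derivative ?g x) (at x)" for x
      using prod assms pd_closed_has_derivative by blast+
    have "((\<lambda>x. f x * g x) has_derivative (\<lambda>v. f x * ?g x v + ?f x v * g x)) (at x)" for x
      by (rule has_derivative_mult[OF 1])
    moreover have "(\<lambda>x. f x * ?g x b + ?f x b * g x) \<in> prodsums A B" if b: "b \<in> Basis" for b
    proof -
      have "(\<Sum>b'\<in>Basis. complex_of_real (b \<bullet> b') * F b') = F b" for F
        using b by (subst sum.remove[of _ b]) (auto intro!: sum.neutral dest: inner_not_same_Basis[of b])
      moreover have "pdv b f \<in> A" "pdv b g \<in> B" using prod assms b unfolding pd_closed_def by blast+
      ultimately show ?thesis using prod by (auto intro!: prodsums.intros)
    qed
    ultimately show ?case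
      by (intro exI[of _ "\<lambda>x v. f x * ?g x v + ?f x v * g x"]) blast
  next
    case (add h k)
    then obtain h' k' where
      "\<forall>x. (h has_derivative h' x) (at x)" "\<forall>b\<in>Basis. (\<lambda>x. h' x b) \<in> prodsums A B"
      "\<forall>x. (k has_derivative k' x) (at x)" "\<forall>b\<in>Basis. (\<lambda>x. k' x b) \<in> prodsums A B" by blast
    then show ?case
      by (intro exI[of _ "\<lambda>x v. h' x v + k' x v"]) (auto intro!: has_derivative_add prodsums.add)
  qed
qed

lemma schwartz_mult:
  assumes "f \<in> schwartz" "m \<in> multipliers" shows "(\<lambda>x. f x * m x) \<in> schwartz"
proof (rule schwartz_coinduct)
  show "pd_closed (prodsums schwartz multipliers)"
    by (intro pd_closed_prodsums pd_closed_schwartz pd_closed_multipliers)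
  show "(\<lambda>x. f x * m x) \<in> prodsums schwartz multipliers" using assms by (rule prodsums.prod)
  fix g :: "'a \<Rightarrow> complex" assume "g \<in> prodsums schwartz multipliers"
  then show "rapid g"
    by induction (auto intro: rapid_add rapid_slow_mult schwartz_rapid multipliers_slow)
qed

lemma schwartz_multiplier: "f \<in> schwartz \<Longrightarrow> f \<in> multipliers"
  by (rule multipliers_coinduct[OF pd_closed_schwartz]) (auto intro: rapid_slow schwartz_rapid)

lemma multipliers_mult:
  assumes "f \<in> multipliers" "m \<in> multipliers" shows "(\<lambda>x. f x * m x) \<in> multipliers"
proof (rule multipliers_coinduct)
  show "pd_closed (prodsums multipliers multipliers)"
    by (intro pd_closed_prodsums pd_closed_multipliers)
  show "(\<lambda>x. f x * m x) \<in> prodsums multipliers multipliers" using assms by (rule prodsums.prod)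
  fix g :: "'a \<Rightarrow> complex" assume "g \<in> prodsums multipliers multipliers"
  then show "slow g"
    by induction (auto intro: slow_add slow_mult multipliers_slow)
qed

text \<open>Linear forms alone are not closed under differentiation, since their derivatives are
  constants; the coinduction needs a class that contains both.\<close>

lemma affine_multiplier: "(\<lambda>x. complex_of_real (x \<bullet> v) + c) \<in> multipliers"
proof (rule multipliers_coinduct)
  let ?X = "{(\<lambda>x::'a. complex_of_real (x \<bullet> v) + c) | v c. True}"
  show "pd_closed ?X"
  proof (rule pd_closedI)
    fix f assume "f \<in> ?X"
    then obtain v c where f: "f = (\<lambda>x. complex_of_real (x \<bullet> v) + c)" by blast
    have "(f has_derivative (\<lambda>h. complex_of_real (h \<bullet> v))) (at x)" for x
      unfolding f by (auto intro!: derivative_eq_intros)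
    moreover have "(\<lambda>x::'a. complex_of_real (b \<bullet> v)) \<in> ?X" for b
      by (rule CollectI, rule exI[of _ 0], rule exI[of _ "complex_of_real (b \<bullet> v)"]) simp
    ultimately show "\<exists>f'. (\<forall>x. (f has_derivative f' x) (at x)) \<and> (\<forall>b\<in>Basis. (\<lambda>x. f' x b) \<in> ?X)"
      by (intro exI[of _ "\<lambda>x h. complex_of_real (h \<bullet> v)"]) blast
  qed
  fix g assume "g \<in> ?X"
  then show "slow g" by (auto intro!: slow_add slow_inner slow_const)
qed blast

lemma inner_multiplier: "(\<lambda>x. complex_of_real (x \<bullet> v)) \<in> multipliers"
  using affine_multiplier[of v 0] by simp

lemma const_multiplier: "(\<lambda>x. c) \<in> multipliers"
  using affine_multiplier[of 0 c] by simp

lemma schwartz_cmult: "f \<in> schwartz \<Longrightarrow> (\<lambda>x. c * f x) \<in> schwartz"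
  using schwartz_mult[OF _ const_multiplier, of f c] by (simp add: mult.commute)

lemma schwartz_add:
  assumes "f \<in> schwartz" "g \<in> schwartz" shows "(\<lambda>x. f x + g x) \<in> schwartz"
proof (rule schwartz_coinduct)
  have "(\<lambda>x. f x * 1 + g x * 1) \<in> prodsums schwartz multipliers"
    using assms by (intro prodsums.intros const_multiplier)
  then show "(\<lambda>x. f x + g x) \<in> prodsums schwartz multipliers" by simp
  show "pd_closed (prodsums schwartz multipliers)"
    by (intro pd_closed_prodsums pd_closed_schwartz pd_closed_multipliers)
  fix g :: "'a \<Rightarrow> complex" assume "g \<in> prodsums schwartz multipliers"
  then show "rapid g"
    by induction (auto intro: rapid_add rapid_slow_mult schwartz_rapid multipliers_slow)
qed

lemma schwartz_diff:
  assumes "f \<in> schwartz" "g \<in> schwartz" shows "(\<lambda>x. f x - g x) \<in> schwartz"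
  using schwartz_add[OF assms(1) schwartz_cmult[OF assms(2), of "-1"]] by simp

lemma schwartz_zero: "(\<lambda>x. 0) \<in> schwartz"
proof (rule schwartz_coinduct[of "{\<lambda>x. 0}"])
  show "pd_closed {\<lambda>x::'a. 0}" by (rule pd_closedI) (auto intro!: exI[of _ "\<lambda>x h. 0"])
qed (auto simp: rapid_def)

lemma schwartz_sum:
  "(\<And>i. i \<in> I \<Longrightarrow> f i \<in> schwartz) \<Longrightarrow> (\<lambda>x. \<Sum>i\<in>I. f i x) \<in> schwartz"
  by (induction I rule: infinite_finite_induct) (auto intro: schwartz_zero schwartz_add)

lemma rapid_dilate:
  assumes "rapid f" "c \<noteq> 0" shows "rapid (\<lambda>x. f (c *\<^sub>R x))"
  unfolding rapid_def
proof
  fix N :: nat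
  \<comment> \<open>For \<open>|c| < 1\<close> the weight at \<open>x\<close> exceeds the weight at
    \<open>c x\<close> by a factor of at most \<open>1 / |c|\<close>; the maximum with 1 covers
    \<open>|c| \<ge> 1\<close> and the constant term of the weight.\<close>
  define K where "K = max 1 (1 / \<bar>c\<bar>)"
  have K: "1 + norm x \<le> K * (1 + norm (c *\<^sub>R x))" for x :: 'a
  proof -
    have "norm x = 1 / \<bar>c\<bar> * norm (c *\<^sub>R x)" using assms(2) by simp
    also have "\<dots> \<le> K * norm (c *\<^sub>R x)" by (intro mult_right_mono) (auto simp: K_def)
    finally show ?thesis by (simp add: K_def algebra_simps)
  qed
  obtain B where B: "\<And>x. (1 + norm x) ^ N * norm (f x) \<le> B" using rapid_bound[OF assms(1)] by metis
  have "(1 + norm x) ^ N * norm (f (c *\<^sub>R x)) \<le> K ^ N * B" for x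
  proof -
    have "(1 + norm x) ^ N * norm (f (c *\<^sub>R x)) \<le> (K * (1 + norm (c *\<^sub>R x))) ^ N * norm (f (c *\<^sub>R x))"
      by (intro mult_right_mono power_mono K) auto
    also have "\<dots> = K ^ N * ((1 + norm (c *\<^sub>R x)) ^ N * norm (f (c *\<^sub>R x)))"
      by (simp add: power_mult_distrib)
    also have "\<dots> \<le> K ^ N * B" by (intro mult_left_mono B) (simp add: K_def)
    finally show ?thesis .
  qed
  then show "\<exists>B. \<forall>x. (1 + norm x) ^ N * norm (f (c *\<^sub>R x)) \<le> B" by blast
qed

lemma schwartz_dilate:
  assumes "f \<in> schwartz" "c \<noteq> 0" shows "(\<lambda>x. f (c *\<^sub>R x)) \<in> schwartz"
proof (rule schwartz_coinduct)
  let ?X = "{(\<lambda>x::'a. f (c *\<^sub>R x)) | f. f \<in> schwartz}"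
  show "pd_closed ?X"
  proof (rule pd_closedI)
    fix h assume "h \<in> ?X"
    then obtain f where f: "f \<in> schwartz" "h = (\<lambda>x. f (c *\<^sub>R x))" by blast
    let ?f = "\<lambda>x v. \<Sum>b\<in>Basis. of_real (v \<bullet> b) * pdv b f x"
    have "(h has_derivative (\<lambda>v. ?f (c *\<^sub>R x) (c *\<^sub>R v))) (at x)" for x
      unfolding f(2)
      by (rule has_derivative_compose[OF _ schwartz_has_derivative[OF f(1)]]) (auto intro!: derivative_eq_intros)
    moreover have "(\<lambda>x. ?f (c *\<^sub>R x) (c *\<^sub>R b)) \<in> ?X" for b
    proof -
      have "(\<lambda>y. ?f y (c *\<^sub>R b)) \<in> schwartz"
        using f(1) by (intro schwartz_sum schwartz_cmult schwartz_pdv)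
      then show ?thesis by (intro CollectI exI[of _ "\<lambda>y. ?f y (c *\<^sub>R b)"] conjI refl)
    qed
    ultimately show "\<exists>f'. (\<forall>x. (h has_derivative f' x) (at x)) \<and> (\<forall>b\<in>Basis. (\<lambda>x. f' x b) \<in> ?X)"
      by (intro exI[of _ "\<lambda>x v. ?f (c *\<^sub>R x) (c *\<^sub>R v)"]) blast
  qed
  fix g assume "g \<in> ?X"
  then show "rapid g" using rapid_dilate schwartz_rapid assms(2) by blast
qed (use assms in blast)

lemma schwartz_cnj:
  assumes "f \<in> schwartz" shows "(\<lambda>x. cnj (f x)) \<in> schwartz"
proof (rule schwartz_coinduct)
  let ?X = "{(\<lambda>x::'a. cnj (f x)) | f. f \<in> schwartz}"
  show "pd_closed ?X"
  proof (rule pd_closedI)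
    fix h assume "h \<in> ?X"
    then obtain f where f: "f \<in> schwartz" "h = (\<lambda>x. cnj (f x))" by blast
    let ?f = "\<lambda>x v. \<Sum>b\<in>Basis. of_real (v \<bullet> b) * pdv b f x"
    have "(h has_derivative (\<lambda>v. cnj (?f x v))) (at x)" for x
      unfolding f(2) by (rule has_derivative_cnj[OF schwartz_has_derivative[OF f(1)]])
    moreover have "(\<lambda>x. cnj (?f x b)) \<in> ?X" for b
    proof -
      have "(\<lambda>y. ?f y b) \<in> schwartz"
        using f(1) by (intro schwartz_sum schwartz_cmult schwartz_pdv)
      then show ?thesis by (intro CollectI exI[of _ "\<lambda>y. ?f y b"] conjI refl)
    qed
    ultimately show "\<exists>f'. (\<forall>x. (h has_derivative f' x) (at x)) \<and> (\<forall>b\<in>Basis. (\<lambda>x. f' x b) \<in> ?X)"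
      by (intro exI[of _ "\<lambda>x v. cnj (?f x v)"]) blast
  qed
  fix g assume "g \<in> ?X"
  then obtain f where "f \<in> schwartz" "g = (\<lambda>x. cnj (f x))" by blast
  then show "rapid g" using schwartz_rapid[of f] by (simp add: rapid_def)
qed (use assms in blast)

lemma compact_support_schwartz:
  assumes "smooth f" "\<And>x. norm x \<ge> R \<Longrightarrow> f x = 0" shows "f \<in> schwartz"
proof (rule schwartz_coinduct)
  let ?X = "{f::'a \<Rightarrow> complex. smooth f \<and> (\<exists>R. \<forall>x. norm x \<ge> R \<longrightarrow> f x = 0)}"
  show "pd_closed ?X"
    unfolding pd_closed_def
  proof (intro ballI conjI)
    fix f :: "'a \<Rightarrow> complex" assume "f \<in> ?X"
    then obtain R where f: "smooth f" "\<And>x. norm x \<ge> R \<Longrightarrow> f x = 0" by blast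
    show "\<forall>x. f differentiable (at x)" using f(1) pd_closed_smooth_set unfolding pd_closed_def by blast
    fix b :: 'a assume b: "b \<in> Basis"
    \<comment> \<open>The radius grows by 1 because the function must vanish in a neighbourhood of
      \<open>x\<close>, not just at \<open>x\<close>. This is why the radius is existentially
      quantified inside the class.\<close>
    have "pdv b f x = 0" if x: "norm x \<ge> R + 1" for x
    proof -
      have "((\<lambda>_. 0) has_derivative (\<lambda>_. 0)) (at x)" by simp
      then have "(f has_derivative (\<lambda>_. 0)) (at x)"
      proof (rule has_derivative_transform_within_open)
        show "open {y::'a. norm y > R}" by (intro open_Collect_less continuous_intros)
      qed (use x f in auto)
      then have "frechet_derivative f (at x) = (\<lambda>_. 0)" using frechet_derivative_at by metis
      then show ?thesis by (simp add: pdv_def)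
    qed
    moreover have "smooth (pdv b f)" using f(1) b pd_closed_smooth_set unfolding pd_closed_def by blast
    ultimately show "pdv b f \<in> ?X" by blast
  qed
  show "f \<in> ?X" using assms by blast
  fix g assume "g \<in> ?X"
  then obtain R where g: "smooth g" "\<And>x. norm x \<ge> R \<Longrightarrow> g x = 0" by blast
  show "rapid g"
    unfolding rapid_def
  proof
    fix N :: nat
    have "continuous_on (cball 0 R) g" using g(1) pd_closed_smooth_set pd_closed_continuous by blast
    then have "compact ((\<lambda>x. (1 + norm x) ^ N * norm (g x)) ` cball 0 R)"
      by (intro compact_continuous_image continuous_intros) auto
    then obtain B where B: "\<And>x. x \<in> cball 0 R \<Longrightarrow> norm ((1 + norm x) ^ N * norm (g x)) \<le> B"
      using compact_imp_bounded bounded_iff by (metis (no_types, lifting) image_eqI)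
    have "(1 + norm x) ^ N * norm (g x) \<le> max B 0" for x
      using B[of x] g(2)[of x] by (cases "norm x \<le> R") (auto simp: le_max_iff_disj dest: abs_le_D1)
    then show "\<exists>B. \<forall>x. (1 + norm x) ^ N * norm (g x) \<le> B" by blast
  qed
qed

section \<open>The Schwartz seminorms as suprema\<close>

lemma bdd_above_schwartz_seminorm:
  fixes \<phi> :: "'a::euclidean_space \<Rightarrow> complex"
  assumes "\<phi> \<in> schwartz"
  shows "bdd_above ((\<lambda>(vs, x). (1 + norm x) ^ N * norm (iter_deriv vs \<phi> x)) `
    ({vs \<in> lists Basis. length vs \<le> N} \<times> UNIV))"
proof -
  let ?L = "{vs \<in> lists (Basis::'a set). length vs \<le> N}"
  have fin: "finite ?L" using finite_lists_length_le[of "Basis::'a set" N] by (simp add: lists_eq_set conj_commute)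
  have "\<forall>vs\<in>?L. \<exists>B. \<forall>x. (1 + norm x) ^ N * norm (iter_deriv vs \<phi> x) \<le> B"
    using schwartz_rapid[OF schwartz_iter_deriv[OF assms]] unfolding rapid_def by blast
  then obtain B where B: "\<And>vs x. vs \<in> ?L \<Longrightarrow> (1 + norm x) ^ N * norm (iter_deriv vs \<phi> x) \<le> B vs"
    by metis
  show ?thesis
  proof (rule bdd_aboveI2)
    fix p :: "'a list \<times> 'a" assume "p \<in> ?L \<times> UNIV"
    then obtain vs x where p: "p = (vs, x)" "vs \<in> ?L" by auto
    have "(1 + norm x) ^ N * norm (iter_deriv vs \<phi> x) \<le> B vs" using B p by blast
    also have "\<dots> \<le> Max (B ` ?L)" using p fin by (intro Max_ge) auto
    finally show "(case p of (vs, x) \<Rightarrow> (1 + norm x) ^ N * norm (iter_deriv vs \<phi> x)) \<le> Max (B ` ?L)"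
      by (simp add: p(1))
  qed
qed

lemma schwartz_seminorm_upper:
  assumes "\<phi> \<in> schwartz" "vs \<in> lists Basis" "length vs \<le> N"
  shows "(1 + norm x) ^ N * norm (iter_deriv vs \<phi> x) \<le> schwartz_seminorm N \<phi>"
  using cSUP_upper[OF _ bdd_above_schwartz_seminorm[OF assms(1), of N], of "(vs, x)"] assms
  unfolding schwartz_seminorm_def by simp

lemma schwartz_seminorm_nonneg: "\<phi> \<in> schwartz \<Longrightarrow> 0 \<le> schwartz_seminorm N \<phi>"
  using order_trans[OF norm_ge_zero, of "\<phi> 0" "schwartz_seminorm N \<phi>"] schwartz_seminorm_upper[of \<phi> "[]" N 0] by simp

lemma schwartz_seminorm_least:
  fixes \<phi> :: "'a::euclidean_space \<Rightarrow> complex"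
  assumes "\<And>vs x. vs \<in> lists Basis \<Longrightarrow> length vs \<le> N \<Longrightarrow> (1 + norm x) ^ N * norm (iter_deriv vs \<phi> x) \<le> K"
  shows "schwartz_seminorm N \<phi> \<le> K"
proof -
  have "([], 0) \<in> {vs \<in> lists (Basis::'a set). length vs \<le> N} \<times> (UNIV::'a set)" by simp
  then have "{vs \<in> lists (Basis::'a set). length vs \<le> N} \<times> (UNIV::'a set) \<noteq> {}" by blast
  then show ?thesis unfolding schwartz_seminorm_def using assms by (intro cSUP_least) auto
qed

section \<open>Parameter integrals and the Fourier transform\<close>

lemma integrable_inverse_one_plus_square: "integrable lborel (\<lambda>x::real. inverse (1 + x^2))"
  using integrable_inverse_1_plus_square by (simp add: set_integrable_def einterval_def)

lemma norm_inner_square_le: "b \<in> Basis \<Longrightarrow> (x \<bullet> b)\<^sup>2 \<le> (norm x)\<^sup>2"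
  by (metis Basis_le_norm abs_ge_zero power2_abs power_mono)

text \<open>Every factor \<open>1 + (x \<bullet> b)^2\<close> is at most \<open>(1 + |x|)^2\<close>.
  The weight is therefore dominated by a product of functions \<open>1 / (1 + x^2)\<close> of one
  coordinate each, which explains the exponent \<open>2 * DIM('a)\<close>.\<close>

lemma integrable_inverse_one_plus_norm:
  "integrable lborel (\<lambda>x::'a::euclidean_space. inverse ((1 + norm x) ^ (2 * DIM('a))))"
proof (rule integrableI_bounded)
  have "(\<integral>\<^sup>+x. ennreal (norm (inverse ((1 + norm (x::'a)) ^ (2 * DIM('a))))) \<partial>lborel)
     \<le> (\<integral>\<^sup>+x. (\<Prod>b\<in>(Basis::'a set). ennreal (inverse (1 + (x \<bullet> b)^2))) \<partial>lborel)"
  proof (rule nn_integral_mono)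
    fix x :: 'a
    have "(\<Prod>b\<in>(Basis::'a set). 1 + (x \<bullet> b)^2) \<le> (\<Prod>b\<in>(Basis::'a set). (1 + norm x)^2)"
    proof (rule prod_mono)
      fix b :: 'a assume "b \<in> Basis"
      then have "(x \<bullet> b)\<^sup>2 \<le> (norm x)\<^sup>2" by (rule norm_inner_square_le)
      then show "0 \<le> 1 + (x \<bullet> b)\<^sup>2 \<and> 1 + (x \<bullet> b)\<^sup>2 \<le> (1 + norm x)\<^sup>2"
        by (simp add: power2_sum add_increasing2)
    qed
    also have "\<dots> = (1 + norm x) ^ (2 * DIM('a))" by (simp add: power_mult)
    finally have "inverse ((1 + norm x) ^ (2 * DIM('a))) \<le> inverse (\<Prod>b\<in>(Basis::'a set). 1 + (x \<bullet> b)^2)"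
      by (intro le_imp_inverse_le prod_pos) (auto intro: add_pos_nonneg)
    then show "ennreal (norm (inverse ((1 + norm x) ^ (2 * DIM('a))))) \<le> (\<Prod>b\<in>Basis. ennreal (inverse (1 + (x \<bullet> b)^2)))"
      by (subst prod_ennreal) (auto simp: prod_inversef[symmetric] comp_def intro!: ennreal_leI)
  qed
  also have "\<dots> = (\<Prod>b\<in>(Basis::'a set). (\<integral>\<^sup>+x. ennreal (inverse (1 + x^2)) \<partial>lborel))"
    by (rule nn_integral_lborel_prod) auto
  also have "\<dots> < \<infinity>"
    using integrable_inverse_one_plus_square
    by (auto simp: integrable_iff_bounded less_top[symmetric] ennreal_prod_eq_top prod_constant power_eq_top_ennreal)
  finally show "(\<integral>\<^sup>+x. ennreal (norm (inverse ((1 + norm (x::'a)) ^ (2 * DIM('a))))) \<partial>lborel) < \<infinity>" .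
qed simp

lemma rapid_le_weight:
  fixes f :: "'a::euclidean_space \<Rightarrow> 'b::real_normed_vector"
  assumes "rapid f"
  obtains B where "B > 0" "\<And>x. (1 + norm x) ^ N * norm (f x) \<le> B * inverse ((1 + norm x) ^ M)"
proof -
  obtain B where B: "B > 0" "\<And>x. (1 + norm x) ^ (N + M) * norm (f x) \<le> B"
    using rapid_bound[OF assms] by metis
  have "(1 + norm x) ^ N * norm (f x) \<le> B * inverse ((1 + norm x) ^ M)" for x
  proof -
    have "0 < (1 + norm x) ^ M" by (simp add: add_pos_nonneg)
    then show ?thesis using B(2)[of x] by (simp add: field_simps power_add)
  qed
  then show ?thesis using that B(1) by blast
qed

lemma rapid_integrable_weight:
  fixes f :: "'a::euclidean_space \<Rightarrow> complex"
  assumes "rapid f" and [measurable]: "f \<in> borel_measurable borel"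
  shows "integrable lborel (\<lambda>x. (1 + norm x) ^ N * norm (f x))"
proof -
  obtain B where B: "B > 0" "\<And>x. (1 + norm x) ^ N * norm (f x) \<le> B * inverse ((1 + norm x) ^ (2 * DIM('a)))"
    using rapid_le_weight[OF assms(1)] by metis
  show ?thesis
    by (rule Bochner_Integration.integrable_bound[OF integrable_mult_right[OF integrable_inverse_one_plus_norm, of B]])
       (use B in \<open>auto simp: abs_mult intro!: AE_I2\<close>)
qed

lemma rapid_integrable:
  fixes f :: "'a::euclidean_space \<Rightarrow> complex"
  assumes "rapid f" and [measurable]: "f \<in> borel_measurable borel"
  shows "integrable lborel f"
  using rapid_integrable_weight[OF assms, of 0] integrable_norm_cancel[of lborel f] by simp

lemma schwartz_integrable: "f \<in> schwartz \<Longrightarrow> integrable lborel f"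
  by (intro rapid_integrable schwartz_rapid schwartz_measurable)

text \<open>Differentiation under the integral sign: the mean value inequality bounds the quotient
  of the remainder by \<open>2 * D\<close>, so dominated convergence applies along every sequence
  tending to zero.\<close>

lemma has_derivative_integral:
  fixes h :: "'a::euclidean_space \<Rightarrow> 'b \<Rightarrow> complex"
  assumes int: "\<And>z. z \<in> ball x 1 \<Longrightarrow> integrable M (h z)"
    and der: "\<And>z y. z \<in> ball x 1 \<Longrightarrow> y \<in> space M \<Longrightarrow> ((\<lambda>z. h z y) has_derivative h' z y) (at z)"
    and bnd: "\<And>z y v. z \<in> ball x 1 \<Longrightarrow> y \<in> space M \<Longrightarrow> norm (h' z y v) \<le> D y * norm v"
    and D: "integrable M D"
    and meas: "\<And>v. (\<lambda>y. h' x y v) \<in> borel_measurable M"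
  shows "((\<lambda>z. \<integral>y. h z y \<partial>M) has_derivative (\<lambda>v. \<integral>y. h' x y v \<partial>M)) (at x)"
proof -
  have x: "x \<in> ball x 1" by simp
  have D0: "0 \<le> D y" if "y \<in> space M" for y
  proof -
    obtain b :: 'a where b: "b \<in> Basis" using nonempty_Basis by blast
    show ?thesis using order_trans[OF norm_ge_zero bnd[OF x that, of b]] b by simp
  qed
  have int': "integrable M (\<lambda>y. h' x y v)" for v
    by (rule Bochner_Integration.integrable_bound[OF integrable_mult_left[OF D, of "norm v"] meas])
       (use bnd[OF x] D0 in \<open>auto intro!: AE_I2\<close>)
  have lin: "bounded_linear (h' x y)" if "y \<in> space M" for y
    using der[OF x that] by (rule has_derivative_bounded_linear)
  have "linear (\<lambda>v. \<integral>y. h' x y v \<partial>M)"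
  proof (rule linearI)
    fix v w
    have "(\<integral>y. h' x y (v + w) \<partial>M) = (\<integral>y. h' x y v + h' x y w \<partial>M)"
      by (intro Bochner_Integration.integral_cong refl) (use lin in \<open>auto simp: linear_simps\<close>)
    then show "(\<integral>y. h' x y (v + w) \<partial>M) = (\<integral>y. h' x y v \<partial>M) + (\<integral>y. h' x y w \<partial>M)"
      by (simp add: int')
  next
    fix c v
    have "(\<integral>y. h' x y (c *\<^sub>R v) \<partial>M) = (\<integral>y. c *\<^sub>R h' x y v \<partial>M)"
      by (intro Bochner_Integration.integral_cong refl) (use lin in \<open>auto simp: linear_simps\<close>)
    then show "(\<integral>y. h' x y (c *\<^sub>R v) \<partial>M) = c *\<^sub>R (\<integral>y. h' x y v \<partial>M)" by simp
  qed
  moreover have "((\<lambda>v. norm ((\<integral>y. h (x + v) y \<partial>M) - (\<integral>y. h x y \<partial>M) - (\<integral>y. h' x y v \<partial>M)) / norm v) \<longlongrightarrow> 0) (at 0)"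
    unfolding tendsto_at_iff_sequentially
  proof (intro allI impI)
    fix X :: "nat \<Rightarrow> 'a" assume "\<forall>i. X i \<in> UNIV - {0}" and X0: "X \<longlonglongrightarrow> 0"
    then have Xn: "X i \<noteq> 0" for i by auto
    \<comment> \<open>The quotient is replaced by 0 while \<open>x + X n\<close> may lie outside the
      unit ball, where neither the bound by \<open>D\<close> nor integrability is known. Only
      finitely many indices are affected.\<close>
    define F where "F n y = (if norm (X n) < 1 then norm (h (x + X n) y - h x y - h' x y (X n)) / norm (X n) else 0)" for n y
    have ev: "\<forall>\<^sub>F n in sequentially. norm (X n) < 1"
      using tendstoD[OF X0, of 1] by simp
    have bF: "F n y \<le> 2 * D y" if y: "y \<in> space M" for n y
    proof (cases "norm (X n) < 1")
      case True
      have "norm (h (x + X n) y - h x y) \<le> D y * norm (x + X n - x)"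
      proof (rule differentiable_bound)
        show "convex (ball x 1)" by simp
        fix z assume z: "z \<in> ball x 1"
        show "((\<lambda>z. h z y) has_derivative h' z y) (at z within ball x 1)"
          using der[OF z y] has_derivative_at_withinI by blast
        show "onorm (h' z y) \<le> D y" by (rule onorm_bound[OF D0[OF y] bnd[OF z y]])
      qed (use True in \<open>auto simp: dist_norm\<close>)
      moreover have "norm (h (x + X n) y - h x y - h' x y (X n)) \<le> norm (h (x + X n) y - h x y) + norm (h' x y (X n))"
        by (rule norm_triangle_ineq4)
      ultimately have "norm (h (x + X n) y - h x y - h' x y (X n)) \<le> 2 * D y * norm (X n)"
        using bnd[OF x y, of "X n"] by simp
      then show ?thesis using True Xn[of n] by (simp add: F_def field_simps)
    qed (simp add: F_def D0[OF y])
    have "(\<lambda>n. \<integral>y. F n y \<partial>M) \<longlonglongrightarrow> (\<integral>y. 0 \<partial>M)"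
    proof (rule integral_dominated_convergence[where w="\<lambda>y. 2 * D y"])
      show "integrable M (\<lambda>y. 2 * D y)" using D by simp
      show "F n \<in> borel_measurable M" for n
      proof (cases "norm (X n) < 1")
        case True
        then have "h (x + X n) \<in> borel_measurable M" "h x \<in> borel_measurable M"
          using int[of "x + X n"] int[of x] by (auto simp: dist_norm)
        then show ?thesis using True meas[of "X n"] unfolding F_def by simp
      next
        case False
        then have "F n = (\<lambda>y. 0)" by (simp add: F_def fun_eq_iff)
        then show ?thesis by simp
      qed
      show "AE y in M. (\<lambda>n. F n y) \<longlonglongrightarrow> 0"
      proof (rule AE_I2)
        fix y assume y: "y \<in> space M"
        have "((\<lambda>v. norm (h (x + v) y - h x y - h' x y v) / norm v) \<longlongrightarrow> 0) (at 0)"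
          using der[OF x y] by (simp add: has_derivative_at)
        then have "(\<lambda>n. norm (h (x + X n) y - h x y - h' x y (X n)) / norm (X n)) \<longlonglongrightarrow> 0"
          using X0 Xn unfolding tendsto_at_iff_sequentially comp_def by auto
        then show "(\<lambda>n. F n y) \<longlonglongrightarrow> 0"
          by (rule Lim_transform_eventually) (use ev in \<open>auto simp: F_def elim!: eventually_mono\<close>)
      qed
      show "AE y in M. norm (F n y) \<le> 2 * D y" for n
        using bF by (auto intro!: AE_I2 simp: F_def)
    qed simp
    then have lim: "(\<lambda>n. \<integral>y. F n y \<partial>M) \<longlonglongrightarrow> 0" by simp
    have le: "\<forall>\<^sub>F n in sequentially. norm ((\<integral>y. h (x + X n) y \<partial>M) - (\<integral>y. h x y \<partial>M) - (\<integral>y. h' x y (X n) \<partial>M)) / norm (X n) \<le> (\<integral>y. F n y \<partial>M)"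
      using ev
    proof eventually_elim
      case (elim n)
      have i: "integrable M (h (x + X n))" "integrable M (h x)"
        using int[of "x + X n"] int[of x] elim by (auto simp: dist_norm)
      then have "(\<integral>y. h (x + X n) y \<partial>M) - (\<integral>y. h x y \<partial>M) - (\<integral>y. h' x y (X n) \<partial>M) = (\<integral>y. h (x + X n) y - h x y - h' x y (X n) \<partial>M)"
        by (simp add: int')
      then have "norm ((\<integral>y. h (x + X n) y \<partial>M) - (\<integral>y. h x y \<partial>M) - (\<integral>y. h' x y (X n) \<partial>M)) \<le> (\<integral>y. norm (h (x + X n) y - h x y - h' x y (X n)) \<partial>M)"
        by simp
      then show ?case using elim by (simp add: F_def divide_right_mono)
    qed
    show "((\<lambda>v. norm ((\<integral>y. h (x + v) y \<partial>M) - (\<integral>y. h x y \<partial>M) - (\<integral>y. h' x y v \<partial>M)) / norm v) \<circ> X) \<longlonglongrightarrow> 0"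
      unfolding comp_def
      by (rule tendsto_sandwich[OF _ le tendsto_const lim]) simp
  qed
  ultimately show ?thesis
    unfolding has_derivative_at using linear_conv_bounded_linear by blast
qed

section \<open>The Fourier transform on Schwartz functions\<close>

lemma cis_measurable [measurable]: "f \<in> borel_measurable M \<Longrightarrow> (\<lambda>x. cis (f x)) \<in> borel_measurable M"
  unfolding cis_conv_exp by measurable

lemma norm_cis_mult [simp]: "norm (cis a * z) = norm z"
  by (simp add: norm_mult)

lemma integrable_cis_mult:
  fixes \<phi> :: "'a::euclidean_space \<Rightarrow> complex"
  assumes "integrable lborel \<phi>" shows "integrable lborel (\<lambda>x. cis (x \<bullet> \<xi>) * \<phi> x)"
proof -
  have [measurable]: "\<phi> \<in> borel_measurable borel" using assms by auto
  show ?thesis by (rule Bochner_Integration.integrable_bound[OF assms]) auto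
qed

lemma integrable_cis_minus_mult:
  fixes \<phi> :: "'a::euclidean_space \<Rightarrow> complex"
  assumes "integrable lborel \<phi>" shows "integrable lborel (\<lambda>x. cis (- (x \<bullet> \<xi>)) * \<phi> x)"
  using integrable_cis_mult[OF assms, of "- \<xi>"] by simp

lemma norm_fourier_le: "norm (fourier \<phi> \<xi>) \<le> (\<integral>x. norm (\<phi> x) \<partial>lborel)"
  unfolding fourier_def
  by (rule order_trans[OF integral_norm_bound]) simp

lemma fourier_cmult: "fourier (\<lambda>x. c * f x) \<xi> = c * fourier f \<xi>"
  unfolding fourier_def by (simp add: mult.left_commute[of _ c])

lemma fourier_has_derivative:
  assumes \<phi>: "\<phi> \<in> schwartz"
  shows "(fourier \<phi> has_derivative (\<lambda>v. fourier (\<lambda>x. \<phi> x * (- \<i> * of_real (x \<bullet> v))) \<xi>)) (at \<xi>)"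
  unfolding fourier_def
proof (rule has_derivative_integral[where D="\<lambda>x. (1 + norm x) ^ 1 * norm (\<phi> x)"])
  have [measurable]: "\<phi> \<in> borel_measurable borel" by (rule schwartz_measurable[OF \<phi>])
  show "integrable lborel (\<lambda>x. cis (- (x \<bullet> z)) * \<phi> x)" for z
    by (intro integrable_cis_minus_mult schwartz_integrable \<phi>)
  show "integrable lborel (\<lambda>x. (1 + norm x) ^ 1 * norm (\<phi> x))"
    by (intro rapid_integrable_weight schwartz_rapid \<phi>) simp
  show "(\<lambda>x. cis (- (x \<bullet> \<xi>)) * (\<phi> x * (- \<i> * of_real (x \<bullet> v)))) \<in> borel_measurable lborel" for v
    by simp
  show "((\<lambda>z. cis (- (x \<bullet> z)) * \<phi> x) has_derivative (\<lambda>v. cis (- (x \<bullet> z)) * (\<phi> x * (- \<i> * of_real (x \<bullet> v))))) (at z)" for z x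
  proof -
    have "((\<lambda>z. \<i> * complex_of_real (- (x \<bullet> z))) has_derivative (\<lambda>h. \<i> * complex_of_real (- (x \<bullet> h)))) (at z)"
      by (auto intro!: derivative_eq_intros)
    from has_derivative_mult_left[OF has_derivative_compose[OF this DERIV_exp[unfolded has_field_derivative_def]], of "\<phi> x"]
    show ?thesis unfolding cis_conv_exp by (simp add: mult_ac)
  qed
  show "norm (cis (- (x \<bullet> z)) * (\<phi> x * (- \<i> * of_real (x \<bullet> v)))) \<le> (1 + norm x) ^ 1 * norm (\<phi> x) * norm v" for z x v
  proof -
    have "\<bar>x \<bullet> v\<bar> \<le> norm x * norm v" by (rule Cauchy_Schwarz_ineq2)
    also have "\<dots> \<le> (1 + norm x) * norm v" by (simp add: mult_right_mono)
    finally have "norm (\<phi> x) * \<bar>x \<bullet> v\<bar> \<le> norm (\<phi> x) * ((1 + norm x) * norm v)" by (intro mult_left_mono) auto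
    then show ?thesis by (simp add: norm_mult mult_ac)
  qed
qed

lemma schwartz_mult_inner: "\<phi> \<in> schwartz \<Longrightarrow> (\<lambda>x. \<phi> x * (c * of_real (x \<bullet> v))) \<in> schwartz"
  using schwartz_mult[OF _ multipliers_mult[OF const_multiplier inner_multiplier], of \<phi> c v] by simp

text \<open>A derivative in \<xi> brings down the factor \<open>- \<i> * (x \<bullet> v)\<close>,
  and \<phi> times this factor is again Schwartz, so derivatives of transforms are
  transforms.\<close>

lemma pd_closed_fourier: "pd_closed (fourier ` schwartz)"
proof (rule pd_closedI)
  fix f :: "'a \<Rightarrow> complex" assume "f \<in> fourier ` schwartz"
  then obtain \<phi> where \<phi>: "\<phi> \<in> schwartz" "f = fourier \<phi>" by blast
  show "\<exists>f'. (\<forall>x. (f has_derivative f' x) (at x)) \<and> (\<forall>b\<in>Basis. (\<lambda>x. f' x b) \<in> fourier ` schwartz)"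
    by (rule exI[of _ "\<lambda>\<xi> v. fourier (\<lambda>x. \<phi> x * (- \<i> * of_real (x \<bullet> v))) \<xi>"])
       (use \<phi> fourier_has_derivative schwartz_mult_inner[of \<phi> "-\<i>"] in auto)
qed

lemma lborel_integral_translate:
  fixes f :: "'a::euclidean_space \<Rightarrow> 'b::{banach, second_countable_topology}"
  assumes "f \<in> borel_measurable borel"
  shows "(\<integral>x. f (x + z) \<partial>lborel) = (\<integral>x. f x \<partial>lborel)"
proof -
  have "(\<integral>x. f x \<partial>lborel) = (\<integral>x. f x \<partial>(distr lborel borel ((+) z)))" by (simp add: lborel_distr_plus)
  also have "\<dots> = (\<integral>x. f (z + x) \<partial>lborel)" using assms by (intro integral_distr) auto
  finally show ?thesis by (simp add: add.commute)
qed

text \<open>A Peetre-type inequality: translation by \<open>z\<close> costs at most the factor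
  \<open>1 + |z|\<close> in the weight.\<close>

lemma one_plus_norm_le_mult: "1 + norm (x::'a::real_normed_vector) \<le> (1 + norm (x + z)) * (1 + norm z)"
proof -
  have "norm x \<le> norm (x + z) + norm z" using norm_triangle_ineq4[of "x + z" z] by simp
  moreover have "0 \<le> norm (x + z) * norm z" by simp
  moreover have "(1 + norm (x + z)) * (1 + norm z) = 1 + norm z + norm (x + z) + norm (x + z) * norm z"
    by (simp add: algebra_simps)
  ultimately show ?thesis by linarith
qed

lemma sum_norm_pdv_le: "norm (\<Sum>b\<in>Basis. complex_of_real (v \<bullet> b) * F b) \<le> (\<Sum>b\<in>Basis. norm (F b)) * norm v"
proof -
  have "norm (\<Sum>b\<in>Basis. complex_of_real (v \<bullet> b) * F b) \<le> (\<Sum>b\<in>Basis. \<bar>v \<bullet> b\<bar> * norm (F b))"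
    by (rule order_trans[OF norm_sum]) (simp add: norm_mult)
  also have "\<dots> \<le> (\<Sum>b\<in>Basis. norm v * norm (F b))"
    by (intro sum_mono mult_right_mono) (auto simp: Basis_le_norm)
  finally show ?thesis by (simp add: sum_distrib_left mult.commute)
qed

lemma basis_inner_sum: "b \<in> Basis \<Longrightarrow> (\<Sum>b'\<in>Basis. complex_of_real (b \<bullet> b') * F b') = F b"
  by (subst sum.remove[of _ b]) (auto intro!: sum.neutral dest: inner_not_same_Basis[of b])

text \<open>
  Integration by parts: \<open>\<integral> e\<^sup>-\<^sup>i\<^sup>x\<^sup>\<xi> \<phi>(x + z) dx = e\<^sup>i\<^sup>z\<^sup>\<xi> \<integral> e\<^sup>-\<^sup>i\<^sup>x\<^sup>\<xi> \<phi>(x) dx\<close> is differentiated at \<open>z = 0\<close> in both forms.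
\<close>

lemma fourier_pdv:
  assumes \<phi>: "\<phi> \<in> schwartz" and b: "b \<in> Basis"
  shows "fourier (pdv b \<phi>) \<xi> = \<i> * of_real (b \<bullet> \<xi>) * fourier \<phi> \<xi>"
proof -
  have [measurable]: "\<phi> \<in> borel_measurable borel" by (rule schwartz_measurable[OF \<phi>])
  have [measurable]: "pdv b' \<phi> \<in> borel_measurable borel" if "b' \<in> Basis" for b'
    by (rule schwartz_measurable[OF schwartz_pdv[OF \<phi> that]])
  let ?h = "\<lambda>z x. cis (- (x \<bullet> \<xi>)) * \<phi> (x + z)"
  let ?G = "\<lambda>z. \<integral>x. ?h z x \<partial>lborel"
  let ?d = "\<lambda>z x v. cis (- (x \<bullet> \<xi>)) * (\<Sum>b\<in>Basis. of_real (v \<bullet> b) * pdv b \<phi> (x + z))"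
  have "\<exists>B. B \<ge> 0 \<and> (\<forall>x. norm (pdv b' \<phi> x) \<le> B * inverse ((1 + norm x) ^ (2 * DIM('a))))" if "b' \<in> Basis" for b'
    using rapid_le_weight[OF schwartz_rapid[OF schwartz_pdv[OF \<phi> that]], of 0 "2 * DIM('a)"]
    by (metis less_imp_le mult_1 power_0)
  then obtain B where B: "\<And>b'. b' \<in> Basis \<Longrightarrow> B b' \<ge> 0"
    "\<And>b' x. b' \<in> Basis \<Longrightarrow> norm (pdv b' \<phi> x) \<le> B b' * inverse ((1 + norm x) ^ (2 * DIM('a)))" by metis
  define D where "D x = (\<Sum>b'\<in>Basis. B b') * 2 ^ (2 * DIM('a)) * inverse ((1 + norm x) ^ (2 * DIM('a)))" for x :: 'a
  \<comment> \<open>As \<open>|z| < 1\<close>, a translation by \<open>z\<close> raises the inverse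
    weight by a factor of at most \<open>2^n\<close>; hence one integrable function \<open>D\<close>
    dominates all translates at once.\<close>
  have w: "inverse ((1 + norm (x + z)) ^ n) \<le> 2 ^ n * inverse ((1 + norm x) ^ n)" if "z \<in> ball 0 1" for x z :: 'a and n
  proof -
    have "1 + norm x \<le> (1 + norm (x + z)) * (1 + norm z)" by (rule one_plus_norm_le_mult)
    also have "\<dots> \<le> (1 + norm (x + z)) * 2" using that by (intro mult_left_mono) auto
    finally have "(1 + norm x) ^ n \<le> ((1 + norm (x + z)) * 2) ^ n" by (intro power_mono) auto
    then have "(1 + norm x) ^ n \<le> (1 + norm (x + z)) ^ n * 2 ^ n" unfolding power_mult_distrib .
    moreover have "0 < (1 + norm x) ^ n" "0 < (1 + norm (x + z)) ^ n" by (simp_all add: add_pos_nonneg)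
    ultimately show ?thesis by (simp add: divide_simps) (simp add: mult.commute)
  qed
  have der: "(?G has_derivative (\<lambda>v. \<integral>x. ?d 0 x v \<partial>lborel)) (at 0)"
  proof (rule has_derivative_integral[where D=D])
    fix z :: 'a
    have "integrable lborel (\<lambda>x. \<phi> (x + z))"
      using integrable_distr[of "(+) z" lborel borel \<phi>] schwartz_integrable[OF \<phi>]
      unfolding lborel_distr_plus by (simp add: add.commute)
    then show "integrable lborel (?h z)" by (rule integrable_cis_minus_mult)
    fix x
    have "((\<lambda>z. \<phi> (x + z)) has_derivative (\<lambda>v. \<Sum>b\<in>Basis. of_real (v \<bullet> b) * pdv b \<phi> (x + z))) (at z)"
      by (rule has_derivative_compose[OF _ schwartz_has_derivative[OF \<phi>]]) (auto intro!: derivative_eq_intros)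
    then show "((\<lambda>z. ?h z x) has_derivative ?d z x) (at z)" by (rule has_derivative_mult_right)
  next
    fix z x v :: 'a assume z: "z \<in> ball 0 1"
    have "norm (?d z x v) \<le> (\<Sum>b\<in>Basis. norm (pdv b \<phi> (x + z))) * norm v"
      by (simp add: sum_norm_pdv_le)
    also have "(\<Sum>b\<in>Basis. norm (pdv b \<phi> (x + z))) \<le> (\<Sum>b\<in>Basis. B b * (2 ^ (2 * DIM('a)) * inverse ((1 + norm x) ^ (2 * DIM('a)))))"
      by (intro sum_mono order_trans[OF B(2)] mult_left_mono w z B(1))
    also have "\<dots> = D x" by (simp add: D_def sum_distrib_right mult.assoc)
    finally show "norm (?d z x v) \<le> D x * norm v" by (simp add: mult_right_mono)
  next
    show "integrable lborel D" unfolding D_def by (intro integrable_mult_right integrable_inverse_one_plus_norm)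
  next
    fix v show "(\<lambda>y. ?d 0 y v) \<in> borel_measurable lborel" by (simp add: borel_measurable_sum)
  qed
  have G: "?G z = cis (z \<bullet> \<xi>) * fourier \<phi> \<xi>" for z
  proof -
    have "?G z = (\<integral>x. cis (z \<bullet> \<xi>) * (cis (- ((x + z) \<bullet> \<xi>)) * \<phi> (x + z)) \<partial>lborel)"
      by (intro Bochner_Integration.integral_cong refl) (simp add: mult.assoc[symmetric] cis_mult inner_add_left)
    also have "\<dots> = cis (z \<bullet> \<xi>) * (\<integral>x. cis (- ((x + z) \<bullet> \<xi>)) * \<phi> (x + z) \<partial>lborel)" by simp
    also have "(\<integral>x. cis (- ((x + z) \<bullet> \<xi>)) * \<phi> (x + z) \<partial>lborel) = fourier \<phi> \<xi>"
      unfolding fourier_def by (rule lborel_integral_translate) simp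
    finally show ?thesis .
  qed
  have "((\<lambda>z. \<i> * complex_of_real (z \<bullet> \<xi>)) has_derivative (\<lambda>h. \<i> * complex_of_real (h \<bullet> \<xi>))) (at 0)"
    by (auto intro!: derivative_eq_intros)
  from has_derivative_mult_left[OF has_derivative_compose[OF this DERIV_exp[unfolded has_field_derivative_def]], of "fourier \<phi> \<xi>"]
  have "((\<lambda>z. cis (z \<bullet> \<xi>) * fourier \<phi> \<xi>) has_derivative (\<lambda>v. \<i> * of_real (v \<bullet> \<xi>) * fourier \<phi> \<xi>)) (at 0)"
    unfolding cis_conv_exp by (simp add: mult_ac)
  then have "(?G has_derivative (\<lambda>v. \<i> * of_real (v \<bullet> \<xi>) * fourier \<phi> \<xi>)) (at 0)"
    by (simp only: G)
  from has_derivative_unique[OF der this]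
  have "(\<integral>x. ?d 0 x b \<partial>lborel) = \<i> * of_real (b \<bullet> \<xi>) * fourier \<phi> \<xi>" by metis
  then show ?thesis unfolding fourier_def using b by (simp add: basis_inner_sum)
qed

text \<open>One power of \<open>|\<xi>|\<close> is exchanged for one derivative of \<phi> through
  \<open>fourier_pdv\<close>. The induction runs over all Schwartz functions simultaneously, since
  its step appeals to the partial derivatives of \<phi>.\<close>

lemma rapid_fourier: "\<phi> \<in> schwartz \<Longrightarrow> rapid (fourier \<phi>)"
  unfolding rapid_def
proof
  fix N :: nat assume "\<phi> \<in> schwartz"
  then show "\<exists>B. \<forall>\<xi>. (1 + norm \<xi>) ^ N * norm (fourier \<phi> \<xi>) \<le> B"
  proof (induction N arbitrary: \<phi>)
    case 0
    then show ?case using norm_fourier_le[of \<phi>] by auto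
  next
    case (Suc N)
    obtain B where B: "\<And>\<xi>. (1 + norm \<xi>) ^ N * norm (fourier \<phi> \<xi>) \<le> B" using Suc by blast
    have "\<forall>b\<in>Basis. \<exists>B. \<forall>\<xi>. (1 + norm \<xi>) ^ N * norm (fourier (pdv b \<phi>) \<xi>) \<le> B"
      using Suc schwartz_pdv by blast
    then obtain C where C: "\<And>b \<xi>. b \<in> Basis \<Longrightarrow> (1 + norm \<xi>) ^ N * norm (fourier (pdv b \<phi>) \<xi>) \<le> C b" by metis
    have "(1 + norm \<xi>) ^ Suc N * norm (fourier \<phi> \<xi>) \<le> B + (\<Sum>b\<in>Basis. C b)" for \<xi>
    proof -
      let ?w = "(1 + norm \<xi>) ^ N"
      have "norm \<xi> \<le> (\<Sum>b\<in>Basis. \<bar>\<xi> \<bullet> b\<bar>)" by (rule norm_le_l1)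
      then have "(1 + norm \<xi>) * (?w * norm (fourier \<phi> \<xi>)) \<le> (1 + (\<Sum>b\<in>Basis. \<bar>\<xi> \<bullet> b\<bar>)) * (?w * norm (fourier \<phi> \<xi>))"
        by (intro mult_right_mono) auto
      also have "\<dots> = ?w * norm (fourier \<phi> \<xi>) + (\<Sum>b\<in>Basis. ?w * norm (fourier (pdv b \<phi>) \<xi>))"
        by (simp add: fourier_pdv[OF Suc.prems] norm_mult distrib_right sum_distrib_right sum_distrib_left inner_commute mult_ac distrib_left)
      also have "\<dots> \<le> B + (\<Sum>b\<in>Basis. C b)" by (intro add_mono sum_mono B C)
      finally show ?thesis by (simp add: mult.assoc)
    qed
    then show ?case by blast
  qed
qed

lemma schwartz_fourier: "\<phi> \<in> schwartz \<Longrightarrow> fourier \<phi> \<in> schwartz"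
  by (rule schwartz_coinduct[OF pd_closed_fourier]) (auto intro: rapid_fourier)

lemma inv_fourier_eq:
  fixes \<phi> :: "'a::euclidean_space \<Rightarrow> complex"
  shows "inv_fourier \<phi> x = of_real (1 / (2 * pi) ^ DIM('a)) * fourier \<phi> (- x)"
  unfolding inv_fourier_def fourier_def by (simp add: inner_commute)

lemma schwartz_inv_fourier:
  fixes \<phi> :: "'a::euclidean_space \<Rightarrow> complex"
  assumes "\<phi> \<in> schwartz" shows "inv_fourier \<phi> \<in> schwartz"
proof -
  have "inv_fourier \<phi> = (\<lambda>x. of_real (1 / (2 * pi) ^ DIM('a)) * fourier \<phi> ((-1) *\<^sub>R x))"
    by (simp add: inv_fourier_eq fun_eq_iff)
  also have "\<dots> \<in> schwartz" by (intro schwartz_cmult schwartz_dilate schwartz_fourier assms) simp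
  finally show ?thesis .
qed

text \<open>Absolute integrability on the product space follows from \<open>|K| \<le> 1\<close> and
  the integrability of \<open>f\<close> and \<open>g\<close>. The later exchanges of order in
  Fourier integrals are instances in which \<open>K\<close> is a character.\<close>

lemma Fubini_bounded_kernel:
  fixes f g :: "'a::euclidean_space \<Rightarrow> complex"
  assumes K[measurable]: "case_prod K \<in> borel_measurable (borel \<Otimes>\<^sub>M borel)"
    and K1: "\<And>x y. norm (K x y) \<le> 1"
    and f: "integrable lborel f" and g: "integrable lborel g"
  shows "(\<integral>x. f x * (\<integral>y. K x y * g y \<partial>lborel) \<partial>lborel) = (\<integral>y. (\<integral>x. K x y * f x \<partial>lborel) * g y \<partial>lborel)"
proof -
  have [measurable]: "f \<in> borel_measurable borel" "g \<in> borel_measurable borel" using f g by auto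
  have Kg: "integrable lborel (\<lambda>y. K x y * g y)" for x
    by (rule Bochner_Integration.integrable_bound[OF g]) (auto simp: norm_mult K1 mult_left_le_one_le)
  have Kf: "integrable lborel (\<lambda>x. K x y * f x)" for y
    by (rule Bochner_Integration.integrable_bound[OF f]) (auto simp: norm_mult K1 mult_left_le_one_le)
  have "integrable (lborel \<Otimes>\<^sub>M lborel) (\<lambda>(x, y). f x * (K x y * g y))"
  proof (rule lborel_pair.Fubini_integrable)
    show "(\<lambda>(x, y). f x * (K x y * g y)) \<in> borel_measurable (lborel \<Otimes>\<^sub>M lborel)" by simp
    show "AE x in lborel. integrable lborel (\<lambda>y. case (x, y) of (x, y) \<Rightarrow> f x * (K x y * g y))"
      using Kg by simp
    have "integrable lborel (\<lambda>x. norm (f x) * (\<integral>y. norm (K x y * g y) \<partial>lborel))"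
    proof (rule Bochner_Integration.integrable_bound[OF integrable_mult_left[OF integrable_norm[OF f], of "\<integral>y. norm (g y) \<partial>lborel"]])
      have "norm (norm (f x) * (\<integral>y. norm (K x y * g y) \<partial>lborel)) \<le> norm (norm (f x) * (\<integral>y. norm (g y) \<partial>lborel))" for x
      proof -
        have "(\<integral>y. norm (K x y * g y) \<partial>lborel) \<le> (\<integral>y. norm (g y) \<partial>lborel)"
          by (intro integral_mono integrable_norm Kg g) (simp add: norm_mult K1 mult_left_le_one_le)
        then show ?thesis by (simp add: abs_mult mult_left_mono integral_nonneg_AE)
      qed
      then show "AE x in lborel. norm (norm (f x) * (\<integral>y. norm (K x y * g y) \<partial>lborel)) \<le> norm (norm (f x) * (\<integral>y. norm (g y) \<partial>lborel))"
        by simp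
    qed simp
    then show "integrable lborel (\<lambda>x. \<integral>y. norm (case (x, y) of (x, y) \<Rightarrow> f x * (K x y * g y)) \<partial>lborel)"
      by (simp add: norm_mult)
  qed
  from lborel_pair.Fubini_integral[OF this]
  have "(\<integral>x. (\<integral>y. f x * (K x y * g y) \<partial>lborel) \<partial>lborel) = (\<integral>y. (\<integral>x. (K x y * f x) * g y \<partial>lborel) \<partial>lborel)"
    by (simp add: mult_ac)
  then show ?thesis using Kg Kf by simp
qed

lemma fourier_multiplication_formula:
  fixes f g :: "'a::euclidean_space \<Rightarrow> complex"
  assumes "integrable lborel f" "integrable lborel g"
  shows "(\<integral>x. f x * fourier g x \<partial>lborel) = (\<integral>x. fourier f x * g x \<partial>lborel)"
proof -
  have "(\<lambda>(x, y). cis (- (y \<bullet> x))) \<in> borel_measurable (borel \<Otimes>\<^sub>M (borel :: 'a measure))" by simp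
  from Fubini_bounded_kernel[OF this _ assms]
  show ?thesis unfolding fourier_def by (simp add: inner_commute)
qed

lemma inv_fourier_multiplication_formula:
  fixes f g :: "'a::euclidean_space \<Rightarrow> complex"
  assumes "integrable lborel f" "integrable lborel g"
  shows "(\<integral>x. f x * inv_fourier g x \<partial>lborel) = (\<integral>x. inv_fourier f x * g x \<partial>lborel)"
proof -
  have "(\<lambda>(x, y). cis (y \<bullet> x)) \<in> borel_measurable (borel \<Otimes>\<^sub>M (borel :: 'a measure))" by simp
  from Fubini_bounded_kernel[OF this _ assms]
  have "(\<integral>x. f x * (\<integral>y. cis (y \<bullet> x) * g y \<partial>lborel) \<partial>lborel) = (\<integral>y. (\<integral>x. cis (y \<bullet> x) * f x \<partial>lborel) * g y \<partial>lborel)"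
    by simp
  then show ?thesis unfolding inv_fourier_def by (simp add: inner_commute mult.assoc mult.left_commute[of _ "complex_of_real _"])
qed

section \<open>Fourier inversion and convolution\<close>

lemma
  fixes f :: "'a::euclidean_space \<Rightarrow> real \<Rightarrow> complex"
  assumes f: "\<And>b. b \<in> Basis \<Longrightarrow> integrable lborel (f b)"
  shows lborel_integrable_prod: "integrable lborel (\<lambda>x. \<Prod>b\<in>Basis. f b (x \<bullet> b))"
    and lborel_integral_prod: "(\<integral>x. (\<Prod>b\<in>Basis. f b (x \<bullet> b)) \<partial>lborel) = (\<Prod>b\<in>Basis. \<integral>x. f b x \<partial>lborel)"
proof -
  interpret product_sigma_finite "\<lambda>_::'a. lborel :: real measure" by standard
  have [measurable]: "f b \<in> borel_measurable borel" if "b \<in> Basis" for b using f[OF that] by auto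
  have m[measurable]: "(\<lambda>x. \<Prod>b\<in>Basis. f b (x \<bullet> b)) \<in> borel_measurable borel"
    by (intro borel_measurable_prod) simp
  have T[measurable]: "(\<lambda>g. \<Sum>b\<in>Basis. g b *\<^sub>R b) \<in> (\<Pi>\<^sub>M b\<in>(Basis::'a set). lborel) \<rightarrow>\<^sub>M borel"
    by (intro borel_measurable_sum) simp
  have *: "(\<Prod>b\<in>Basis. f b ((\<Sum>b\<in>Basis. g b *\<^sub>R b) \<bullet> b)) = (\<Prod>b\<in>Basis. f b (g b))" for g
    by (intro prod.cong refl) (simp add: inner_sum_left_Basis)
  show "integrable lborel (\<lambda>x. \<Prod>b\<in>Basis. f b (x \<bullet> b))"
    unfolding lborel_eq[where 'a='a] integrable_distr_eq[OF T m] *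
    by (rule product_integrable_prod) (auto intro: f)
  have "(\<integral>x. (\<Prod>b\<in>Basis. f b (x \<bullet> b)) \<partial>lborel) = (\<integral>g. (\<Prod>b\<in>Basis. f b (g b)) \<partial>(\<Pi>\<^sub>M b\<in>Basis. lborel))"
    unfolding lborel_eq[where 'a='a] integral_distr[OF T m] * ..
  then show "(\<integral>x. (\<Prod>b\<in>Basis. f b (x \<bullet> b)) \<partial>lborel) = (\<Prod>b\<in>Basis. \<integral>x. f b x \<partial>lborel)"
    by (simp add: product_integral_prod f)
qed

lemma
  fixes f :: "'a::euclidean_space \<Rightarrow> 'b::{banach, second_countable_topology}"
  assumes [measurable]: "f \<in> borel_measurable borel" and c: "c \<noteq> 0"
  shows lborel_integral_affine: "(\<integral>x. f x \<partial>lborel) = \<bar>c\<bar> ^ DIM('a) *\<^sub>R (\<integral>x. f (t + c *\<^sub>R x) \<partial>lborel)"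
    and lborel_integrable_affine: "integrable lborel (\<lambda>x. f (t + c *\<^sub>R x)) \<longleftrightarrow> integrable lborel f"
proof -
  show "(\<integral>x. f x \<partial>lborel) = \<bar>c\<bar> ^ DIM('a) *\<^sub>R (\<integral>x. f (t + c *\<^sub>R x) \<partial>lborel)"
    by (subst lborel_affine[OF c, of t]) (simp add: integral_density integral_distr)
  have "integrable lborel f \<longleftrightarrow> integrable lborel (\<lambda>x. \<bar>c\<bar> ^ DIM('a) *\<^sub>R f (t + c *\<^sub>R x))"
    by (subst lborel_affine[OF c, of t]) (simp add: integrable_density integrable_distr_eq)
  moreover have "integrable lborel (\<lambda>x. f (t + c *\<^sub>R x))" if "integrable lborel (\<lambda>x. \<bar>c\<bar> ^ DIM('a) *\<^sub>R f (t + c *\<^sub>R x))"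
    using integrable_scaleR_right[of "inverse (\<bar>c\<bar> ^ DIM('a))", OF that] c by simp
  ultimately show "integrable lborel (\<lambda>x. f (t + c *\<^sub>R x)) \<longleftrightarrow> integrable lborel f" by auto
qed

lemma lborel_nn_integral_affine:
  fixes f :: "'a::euclidean_space \<Rightarrow> ennreal"
  assumes [measurable]: "f \<in> borel_measurable borel" and c: "c \<noteq> 0"
  shows "(\<integral>\<^sup>+x. f x \<partial>lborel) = \<bar>c\<bar> ^ DIM('a) * (\<integral>\<^sup>+x. f (t + c *\<^sub>R x) \<partial>lborel)"
  by (subst lborel_affine[OF c, of t]) (simp add: nn_integral_density nn_integral_distr nn_integral_cmult ennreal_power)

section \<open>The Gaussian and the inversion formula\<close>

definition gauss :: "'a::euclidean_space \<Rightarrow> complex" where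
  "gauss x = of_real (exp (- (norm x)\<^sup>2 / 2))"

lemma gauss_measurable [measurable]: "gauss \<in> borel_measurable borel"
  unfolding gauss_def by measurable

text \<open>Up to the factor \<open>sqrt (2 * pi)\<close>, this is the characteristic function of
  the standard normal distribution.\<close>

lemma gauss_real:
  fixes t :: real
  shows "integrable lborel (\<lambda>x. cis (t * x) * of_real (exp (- x\<^sup>2 / 2)))"
    and "(\<integral>x. cis (t * x) * of_real (exp (- x\<^sup>2 / 2)) \<partial>lborel) = of_real (sqrt (2 * pi) * exp (- t\<^sup>2 / 2))"
proof -
  have eq: "cis (t * x) * complex_of_real (exp (- x\<^sup>2 / 2)) = sqrt (2 * pi) *\<^sub>R (std_normal_density x *\<^sub>R iexp (t * x))" for x
    by (simp add: std_normal_density_def cis_conv_exp scaleR_conv_of_real)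
  have "integrable lborel (\<lambda>x. std_normal_density x *\<^sub>R iexp (t * x))"
    by (rule Bochner_Integration.integrable_bound[OF integrable_std_normal_moment[of 0]])
       (auto simp: norm_mult normal_density_nonneg)
  then show "integrable lborel (\<lambda>x. cis (t * x) * of_real (exp (- x\<^sup>2 / 2)))"
    unfolding eq by (rule integrable_scaleR_right)
  have "char std_normal_distribution t = (\<integral>x. std_normal_density x *\<^sub>R iexp (t * x) \<partial>lborel)"
    unfolding char_def by (subst integral_density) (auto simp: normal_density_nonneg)
  then have "(\<integral>x. std_normal_density x *\<^sub>R iexp (t * x) \<partial>lborel) = of_real (exp (- t\<^sup>2 / 2))"
    by (simp add: char_std_normal_distribution)
  then show "(\<integral>x. cis (t * x) * of_real (exp (- x\<^sup>2 / 2)) \<partial>lborel) = of_real (sqrt (2 * pi) * exp (- t\<^sup>2 / 2))"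
    unfolding eq by (simp add: scaleR_conv_of_real)
qed

lemma cis_sum: "finite A \<Longrightarrow> cis (\<Sum>a\<in>A. f a) = (\<Prod>a\<in>A. cis (f a))"
  by (induction A rule: finite_induct) (simp_all add: cis_mult[symmetric])

lemma gauss_cis_prod:
  "cis (x \<bullet> \<xi>) * gauss x = (\<Prod>b\<in>Basis. cis ((\<xi> \<bullet> b) * (x \<bullet> b)) * of_real (exp (- (x \<bullet> b)\<^sup>2 / 2)))"
proof -
  have "cis (x \<bullet> \<xi>) = (\<Prod>b\<in>Basis. cis ((\<xi> \<bullet> b) * (x \<bullet> b)))"
    by (subst euclidean_inner) (simp add: cis_sum mult.commute)
  moreover have "exp (- (norm x)\<^sup>2 / 2) = (\<Prod>b\<in>Basis. exp (- (x \<bullet> b)\<^sup>2 / 2))"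
  proof -
    have "- (norm x)\<^sup>2 / 2 = (\<Sum>b\<in>Basis. - (x \<bullet> b)\<^sup>2 / 2)"
      unfolding norm_eq_sqrt_inner by (simp add: euclidean_inner[of x x] power2_eq_square sum_negf sum_divide_distrib sum_nonneg)
    then show ?thesis by (simp add: exp_sum)
  qed
  ultimately show ?thesis by (simp add: gauss_def prod.distrib)
qed

lemma gauss_integrable: "integrable lborel (gauss :: 'a::euclidean_space \<Rightarrow> complex)"
proof -
  have "integrable lborel (\<lambda>x::'a. cis (x \<bullet> 0) * gauss x)"
    unfolding gauss_cis_prod by (rule lborel_integrable_prod, rule gauss_real)
  then show ?thesis by simp
qed

lemma gauss_fourier:
  fixes \<xi> :: "'a::euclidean_space"
  shows "(\<integral>x. cis (x \<bullet> \<xi>) * gauss x \<partial>lborel) = of_real (sqrt (2 * pi) ^ DIM('a)) * gauss \<xi>"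
proof -
  have "(\<integral>x. cis (x \<bullet> \<xi>) * gauss x \<partial>lborel) = (\<Prod>b\<in>(Basis::'a set). of_real (sqrt (2 * pi) * exp (- (\<xi> \<bullet> b)\<^sup>2 / 2)))"
    unfolding gauss_cis_prod by (subst lborel_integral_prod) (rule gauss_real(1), intro prod.cong refl gauss_real(2))
  also have "\<dots> = of_real (sqrt (2 * pi) ^ DIM('a)) * gauss \<xi>"
    using gauss_cis_prod[of \<xi> 0] by (simp add: prod.distrib)
  finally show ?thesis .
qed

text \<open>The integral over frequencies is regularised by a factor
  \<open>gauss (a n *\<^sub>R \<xi>)\<close>. The multiplication formula moves the transform to this
  Gaussian, where it is explicit, and leaves an average of \<phi> around \<open>x\<close> at scale
  \<open>a n\<close>; both sides converge as the scale tends to 0. One factor \<open>G\<close> comes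
  from the transform of the Gaussian and another from its total mass, which together make
  \<open>(2 * pi) ^ DIM('a)\<close>.\<close>

lemma fourier_inversion_integral:
  fixes \<phi> :: "'a::euclidean_space \<Rightarrow> complex"
  assumes \<phi>: "\<phi> \<in> schwartz"
  shows "(\<integral>\<xi>. cis (x \<bullet> \<xi>) * fourier \<phi> \<xi> \<partial>lborel) = of_real ((2 * pi) ^ DIM('a)) * \<phi> x"
proof -
  define G where "G = complex_of_real (sqrt (2 * pi) ^ DIM('a))"
  have [measurable]: "\<phi> \<in> borel_measurable borel" "fourier \<phi> \<in> borel_measurable borel"
    by (intro schwartz_measurable schwartz_fourier \<phi>)+
  have i\<phi>: "integrable lborel \<phi>" "integrable lborel (fourier \<phi>)"
    by (intro schwartz_integrable schwartz_fourier \<phi>)+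
  define a where "a n = 1 / real (Suc n)" for n
  have a: "a n > 0" for n by (simp add: a_def)
  have a0: "a \<longlonglongrightarrow> 0" unfolding a_def by (rule LIMSEQ_Suc[OF lim_1_over_n])
  have gn: "norm (gauss y) \<le> 1" for y :: 'a by (simp add: gauss_def)
  have gc: "isCont (gauss :: 'a \<Rightarrow> complex) y" for y unfolding gauss_def by (intro continuous_intros) auto
  obtain B where B: "\<And>x. norm (\<phi> x) \<le> B"
    using rapid_bound[OF schwartz_rapid[OF \<phi>], of 0] by (metis mult_1 power_0)
  \<comment> \<open>At the point \<open>x + a z\<close> the transform of the modulated and dilated
    Gaussian is \<open>a^(-d) G gauss z\<close>; the substitution \<open>y = x + a z\<close> cancels
    the power of \<open>a\<close>.\<close>
  have smooth_id: "(\<integral>\<xi>. cis (x \<bullet> \<xi>) * gauss (a n *\<^sub>R \<xi>) * fourier \<phi> \<xi> \<partial>lborel) = G * (\<integral>z. gauss z * \<phi> (x + a n *\<^sub>R z) \<partial>lborel)" for n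
  proof -
    let ?g = "\<lambda>\<xi>. cis (x \<bullet> \<xi>) * gauss (a n *\<^sub>R \<xi>)"
    have ig: "integrable lborel (\<lambda>\<xi>::'a. gauss (a n *\<^sub>R \<xi>))"
      using lborel_integrable_affine[OF gauss_measurable[where 'a='a], of "a n" 0] a[of n] gauss_integrable[where 'a='a] by simp
    then have "integrable lborel ?g"
      using integrable_cis_mult[OF ig, of x] by (simp add: inner_commute)
    then have "(\<integral>\<xi>. ?g \<xi> * fourier \<phi> \<xi> \<partial>lborel) = (\<integral>y. fourier ?g y * \<phi> y \<partial>lborel)"
      by (rule fourier_multiplication_formula[OF _ i\<phi>(1)])
    also have "\<dots> = \<bar>a n\<bar> ^ DIM('a) *\<^sub>R (\<integral>z. fourier ?g (x + a n *\<^sub>R z) * \<phi> (x + a n *\<^sub>R z) \<partial>lborel)"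
    proof (rule lborel_integral_affine)
      have [measurable]: "fourier ?g \<in> borel_measurable borel"
        unfolding fourier_def by measurable
      show "(\<lambda>y. fourier ?g y * \<phi> y) \<in> borel_measurable borel" by simp
    qed (use a[of n] in simp)
    also have "(\<lambda>z. fourier ?g (x + a n *\<^sub>R z) * \<phi> (x + a n *\<^sub>R z)) = (\<lambda>z. of_real (inverse (\<bar>a n\<bar> ^ DIM('a))) * (G * (gauss z * \<phi> (x + a n *\<^sub>R z))))"
    proof
      fix z
      have "fourier ?g (x + a n *\<^sub>R z) = (\<integral>\<xi>. cis (- ((a n *\<^sub>R \<xi>) \<bullet> z)) * gauss (a n *\<^sub>R \<xi>) \<partial>lborel)"
        unfolding fourier_def mult.assoc[symmetric] cis_mult
        by (intro Bochner_Integration.integral_cong refl) (simp add: inner_add_right inner_commute)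
      moreover have "(\<integral>\<xi>. cis (\<xi> \<bullet> (- z)) * gauss \<xi> \<partial>lborel) = \<bar>a n\<bar> ^ DIM('a) *\<^sub>R (\<integral>\<xi>. cis ((0 + a n *\<^sub>R \<xi>) \<bullet> (- z)) * gauss (0 + a n *\<^sub>R \<xi>) \<partial>lborel)"
        by (rule lborel_integral_affine) (use a[of n] in auto)
      ultimately have "G * gauss z = of_real (\<bar>a n\<bar> ^ DIM('a)) * fourier ?g (x + a n *\<^sub>R z)"
        unfolding gauss_fourier by (simp add: G_def gauss_def scaleR_conv_of_real)
      then show "fourier ?g (x + a n *\<^sub>R z) * \<phi> (x + a n *\<^sub>R z) = of_real (inverse (\<bar>a n\<bar> ^ DIM('a))) * (G * (gauss z * \<phi> (x + a n *\<^sub>R z)))"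
        using a[of n] by (simp add: field_simps)
    qed
    finally show ?thesis using a[of n] by (simp add: scaleR_conv_of_real)
  qed
  have "(\<lambda>n. \<integral>\<xi>. cis (x \<bullet> \<xi>) * gauss (a n *\<^sub>R \<xi>) * fourier \<phi> \<xi> \<partial>lborel) \<longlonglongrightarrow> (\<integral>\<xi>. cis (x \<bullet> \<xi>) * fourier \<phi> \<xi> \<partial>lborel)"
  proof (rule integral_dominated_convergence[where w="\<lambda>\<xi>. norm (fourier \<phi> \<xi>)"])
    show "AE \<xi> in lborel. (\<lambda>n. cis (x \<bullet> \<xi>) * gauss (a n *\<^sub>R \<xi>) * fourier \<phi> \<xi>) \<longlonglongrightarrow> cis (x \<bullet> \<xi>) * fourier \<phi> \<xi>"
    proof (rule AE_I2)
      fix \<xi> :: 'a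
      have "(\<lambda>n. gauss (a n *\<^sub>R \<xi>)) \<longlonglongrightarrow> gauss (0 *\<^sub>R \<xi>)"
        by (intro isCont_tendsto_compose[OF gc] tendsto_intros a0)
      then have "(\<lambda>n. cis (x \<bullet> \<xi>) * gauss (a n *\<^sub>R \<xi>) * fourier \<phi> \<xi>) \<longlonglongrightarrow> cis (x \<bullet> \<xi>) * gauss (0 *\<^sub>R \<xi>) * fourier \<phi> \<xi>"
        by (intro tendsto_intros)
      then show "(\<lambda>n. cis (x \<bullet> \<xi>) * gauss (a n *\<^sub>R \<xi>) * fourier \<phi> \<xi>) \<longlonglongrightarrow> cis (x \<bullet> \<xi>) * fourier \<phi> \<xi>"
        by (simp add: gauss_def)
    qed
    show "AE \<xi> in lborel. norm (cis (x \<bullet> \<xi>) * gauss (a n *\<^sub>R \<xi>) * fourier \<phi> \<xi>) \<le> norm (fourier \<phi> \<xi>)" for n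
      by (rule AE_I2) (simp add: norm_mult gn mult_left_le_one_le)
  qed (use i\<phi> in auto)
  moreover have "(\<lambda>n. \<integral>z. gauss z * \<phi> (x + a n *\<^sub>R z) \<partial>lborel) \<longlonglongrightarrow> (\<integral>z. gauss (z::'a) * \<phi> x \<partial>lborel)"
  proof (rule integral_dominated_convergence[where w="\<lambda>z::'a. B * norm (gauss z :: complex)"])
    show "AE z in lborel. (\<lambda>n. gauss z * \<phi> (x + a n *\<^sub>R z)) \<longlonglongrightarrow> gauss z * \<phi> x"
    proof (rule AE_I2)
      fix z :: 'a
      have "isCont \<phi> y" for y using schwartz_continuous[OF \<phi>, of UNIV] by (simp add: continuous_on_eq_continuous_at)
      then have "(\<lambda>n. \<phi> (x + a n *\<^sub>R z)) \<longlonglongrightarrow> \<phi> (x + 0 *\<^sub>R z)"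
        by (intro isCont_tendsto_compose[of _ \<phi>] tendsto_intros a0)
      then show "(\<lambda>n. gauss z * \<phi> (x + a n *\<^sub>R z)) \<longlonglongrightarrow> gauss z * \<phi> x" by (intro tendsto_intros) simp
    qed
    show "AE z in lborel. norm (gauss z * \<phi> (x + a n *\<^sub>R z)) \<le> B * norm (gauss z :: complex)" for n
      by (rule AE_I2) (simp add: norm_mult mult.commute[of B] B mult_left_mono)
    show "integrable lborel (\<lambda>z::'a. B * norm (gauss z :: complex))" using gauss_integrable by auto
  qed auto
  ultimately have "(\<integral>\<xi>. cis (x \<bullet> \<xi>) * fourier \<phi> \<xi> \<partial>lborel) = G * (\<integral>z. gauss (z::'a) * \<phi> x \<partial>lborel)"
    unfolding smooth_id using tendsto_mult_left LIMSEQ_unique by blast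
  also have "(\<integral>z. gauss (z::'a) * \<phi> x \<partial>lborel) = G * \<phi> x"
    using gauss_fourier[of "0::'a"] by (simp add: G_def gauss_def)
  finally have "(\<integral>\<xi>. cis (x \<bullet> \<xi>) * fourier \<phi> \<xi> \<partial>lborel) = G * G * \<phi> x" by simp
  moreover have "sqrt (2 * pi) ^ DIM('a) * sqrt (2 * pi) ^ DIM('a) = (2 * pi) ^ DIM('a)"
    unfolding power_mult_distrib[symmetric] by simp
  then have "G * G = of_real ((2 * pi) ^ DIM('a))" unfolding G_def of_real_mult[symmetric] by simp
  ultimately show ?thesis by simp
qed

lemma inv_fourier_fourier: "\<phi> \<in> schwartz \<Longrightarrow> inv_fourier (fourier \<phi>) = \<phi>"
  unfolding inv_fourier_def by (simp add: fourier_inversion_integral fun_eq_iff)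

text \<open>Reflection of the integration variable exchanges the two orders of composition, which
  reduces this to \<open>inv_fourier_fourier\<close>.\<close>

lemma fourier_inv_fourier:
  fixes \<phi> :: "'a::euclidean_space \<Rightarrow> complex"
  assumes \<phi>: "\<phi> \<in> schwartz" shows "fourier (inv_fourier \<phi>) = \<phi>"
proof
  fix \<xi>
  have [measurable]: "fourier \<phi> \<in> borel_measurable borel" by (intro schwartz_measurable schwartz_fourier \<phi>)
  have "(\<integral>x. cis (x \<bullet> \<xi>) * fourier \<phi> x \<partial>lborel) = \<bar>-1\<bar> ^ DIM('a) *\<^sub>R (\<integral>x. cis ((0 + (-1) *\<^sub>R x) \<bullet> \<xi>) * fourier \<phi> (0 + (-1) *\<^sub>R x) \<partial>lborel)"
    by (rule lborel_integral_affine) auto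
  then have "fourier (inv_fourier \<phi>) \<xi> = inv_fourier (fourier \<phi>) \<xi>"
    by (simp add: fourier_def[of "inv_fourier \<phi>"] inv_fourier_eq[of \<phi>] inv_fourier_def[of "fourier \<phi>"] inner_commute mult.left_commute[of _ "complex_of_real _"])
  then show "fourier (inv_fourier \<phi>) \<xi> = \<phi> \<xi>" by (simp add: inv_fourier_fourier[OF \<phi>])
qed

section \<open>Convolution with Schwartz kernels\<close>

definition conv :: "('a::euclidean_space \<Rightarrow> complex) \<Rightarrow> ('a \<Rightarrow> complex) \<Rightarrow> 'a \<Rightarrow> complex" where
  "conv \<psi> \<phi> x = (\<integral>y. \<psi> (x - y) * \<phi> y \<partial>lborel)"

lemma conv_has_derivative:
  fixes \<psi> \<phi> :: "'a::euclidean_space \<Rightarrow> complex"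
  assumes \<psi>: "\<psi> \<in> schwartz" and \<phi>: "integrable lborel \<phi>"
  shows "(conv \<psi> \<phi> has_derivative (\<lambda>v. \<integral>y. (\<Sum>b\<in>Basis. of_real (v \<bullet> b) * pdv b \<psi> (x - y)) * \<phi> y \<partial>lborel)) (at x)"
proof -
  have [measurable]: "\<psi> \<in> borel_measurable borel" "\<phi> \<in> borel_measurable borel"
    using schwartz_measurable[OF \<psi>] \<phi> by auto
  have [measurable]: "pdv b' \<psi> \<in> borel_measurable borel" if "b' \<in> Basis" for b'
    by (rule schwartz_measurable[OF schwartz_pdv[OF \<psi> that]])
  have "\<exists>B. \<forall>x. norm (pdv b \<psi> x) \<le> B" if "b \<in> Basis" for b
    using rapid_bound[OF schwartz_rapid[OF schwartz_pdv[OF \<psi> that]], of 0] by (metis mult_1 power_0)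
  then obtain B where B: "\<And>b x. b \<in> Basis \<Longrightarrow> norm (pdv b \<psi> x) \<le> B b" by metis
  obtain B0 where B0: "\<And>x. norm (\<psi> x) \<le> B0"
    using rapid_bound[OF schwartz_rapid[OF \<psi>], of 0] by (metis mult_1 power_0)
  have "((\<lambda>x. \<integral>y. \<psi> (x - y) * \<phi> y \<partial>lborel) has_derivative (\<lambda>v. \<integral>y. (\<Sum>b\<in>Basis. of_real (v \<bullet> b) * pdv b \<psi> (x - y)) * \<phi> y \<partial>lborel)) (at x)"
  proof (rule has_derivative_integral[where D="\<lambda>y. (\<Sum>b\<in>Basis. B b) * norm (\<phi> y)"])
    fix z :: 'a
    show "integrable lborel (\<lambda>y. \<psi> (z - y) * \<phi> y)"
      by (rule Bochner_Integration.integrable_bound[OF integrable_mult_right[OF integrable_norm[OF \<phi>], of B0]])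
         (auto intro!: AE_I2 order_trans[OF mult_right_mono[OF B0] abs_ge_self] simp: norm_mult)
    fix y
    have "((\<lambda>z. \<psi> (z - y)) has_derivative (\<lambda>v. \<Sum>b\<in>Basis. of_real (v \<bullet> b) * pdv b \<psi> (z - y))) (at z)"
      by (rule has_derivative_compose[OF _ schwartz_has_derivative[OF \<psi>]]) (auto intro!: derivative_eq_intros)
    then show "((\<lambda>z. \<psi> (z - y) * \<phi> y) has_derivative (\<lambda>v. (\<Sum>b\<in>Basis. of_real (v \<bullet> b) * pdv b \<psi> (z - y)) * \<phi> y)) (at z)"
      by (rule has_derivative_mult_left)
    fix v
    have "norm (\<Sum>b\<in>Basis. of_real (v \<bullet> b) * pdv b \<psi> (z - y)) \<le> (\<Sum>b\<in>Basis. norm (pdv b \<psi> (z - y))) * norm v"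
      by (rule sum_norm_pdv_le)
    also have "\<dots> \<le> (\<Sum>b\<in>Basis. B b) * norm v" by (intro mult_right_mono sum_mono B) auto
    finally have "norm (\<Sum>b\<in>Basis. of_real (v \<bullet> b) * pdv b \<psi> (z - y)) * norm (\<phi> y) \<le> ((\<Sum>b\<in>Basis. B b) * norm v) * norm (\<phi> y)"
      by (intro mult_right_mono) auto
    then show "norm ((\<Sum>b\<in>Basis. of_real (v \<bullet> b) * pdv b \<psi> (z - y)) * \<phi> y) \<le> (\<Sum>b\<in>Basis. B b) * norm (\<phi> y) * norm v"
      by (simp add: norm_mult mult_ac)
  qed (use \<phi> in \<open>auto intro!: borel_measurable_times borel_measurable_sum\<close>)
  then show ?thesis by (simp add: conv_def[abs_def])
qed

lemma pdv_conv:
  assumes "\<psi> \<in> schwartz" "integrable lborel \<phi>" "b \<in> Basis"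
  shows "pdv b (conv \<psi> \<phi>) = conv (pdv b \<psi>) \<phi>"
  unfolding pdv_eqI[OF conv_has_derivative[OF assms(1,2)]] unfolding conv_def[abs_def] using assms(3) by (simp add: basis_inner_sum)

lemma iter_deriv_conv:
  assumes "\<psi> \<in> schwartz" "integrable lborel \<phi>" "vs \<in> lists Basis"
  shows "iter_deriv vs (conv \<psi> \<phi>) = conv (iter_deriv vs \<psi>) \<phi>"
  using assms(3)
proof (induction vs)
  case (Cons v vs)
  then have "vs \<in> lists Basis" "v \<in> Basis" by auto
  then show ?case unfolding iter_deriv_Cons using Cons.IH pdv_conv[OF schwartz_iter_deriv[OF assms(1)] assms(2)] by simp
qed simp

text \<open>The weight at \<open>x\<close> is shared between the arguments \<open>x - y\<close> and
  \<open>y\<close> by \<open>one_plus_norm_le_mult\<close>.\<close>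

lemma conv_weight_le:
  fixes \<psi> \<phi> :: "'a::euclidean_space \<Rightarrow> complex"
  assumes [measurable]: "\<psi> \<in> borel_measurable borel"
    and i: "integrable lborel (\<lambda>y. (1 + norm y) ^ N * norm (\<phi> y))"
    and K: "\<And>x. (1 + norm x) ^ N * norm (\<psi> x) \<le> K"
  shows "(1 + norm x) ^ N * norm (conv \<psi> \<phi> x) \<le> K * (\<integral>y. (1 + norm y) ^ N * norm (\<phi> y) \<partial>lborel)"
proof -
  have K0: "0 \<le> K" using order_trans[OF _ K[of 0]] by simp
  define w where "w = (1 + norm x) ^ N"
  have w0: "w \<ge> 0" by (simp add: w_def)
  then have nw: "norm (complex_of_real w) = w" by simp
  have "norm (of_real w * conv \<psi> \<phi> x) = norm (\<integral>y. of_real w * (\<psi> (x - y) * \<phi> y) \<partial>lborel)"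
    by (simp add: conv_def)
  also have "\<dots> \<le> (\<integral>y. norm (of_real w * (\<psi> (x - y) * \<phi> y)) \<partial>lborel)"
    by (rule integral_norm_bound)
  also have "\<dots> \<le> (\<integral>y. K * ((1 + norm y) ^ N * norm (\<phi> y)) \<partial>lborel)"
  proof (rule integral_mono_AE')
    show "integrable lborel (\<lambda>y. K * ((1 + norm y) ^ N * norm (\<phi> y)))" using i by simp
    show "AE y in lborel. norm (of_real w * (\<psi> (x - y) * \<phi> y)) \<le> K * ((1 + norm y) ^ N * norm (\<phi> y))"
    proof (rule AE_I2)
      fix y :: 'a
      have "1 + norm x \<le> (1 + norm (x - y)) * (1 + norm y)"
        using one_plus_norm_le_mult[of x "- y"] by simp
      then have "(1 + norm x) ^ N \<le> ((1 + norm (x - y)) * (1 + norm y)) ^ N" by (intro power_mono) auto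
      then have "(1 + norm x) ^ N * (norm (\<psi> (x - y)) * norm (\<phi> y)) \<le> ((1 + norm (x - y)) ^ N * (1 + norm y) ^ N) * (norm (\<psi> (x - y)) * norm (\<phi> y))"
        unfolding power_mult_distrib by (intro mult_right_mono) auto
      also have "\<dots> = ((1 + norm (x - y)) ^ N * norm (\<psi> (x - y))) * ((1 + norm y) ^ N * norm (\<phi> y))" by (simp add: mult_ac)
      also have "\<dots> \<le> K * ((1 + norm y) ^ N * norm (\<phi> y))" by (intro mult_right_mono K) auto
      finally show "norm (of_real w * (\<psi> (x - y) * \<phi> y)) \<le> K * ((1 + norm y) ^ N * norm (\<phi> y))"
        unfolding norm_mult nw by (simp add: w_def)
    qed
  qed (simp add: K0)
  finally show ?thesis unfolding norm_mult nw by (simp add: w_def)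
qed

text \<open>The class of second factors for which \<open>conv\<close> stays Schwartz: it contains
  the Schwartz functions and also the indicators of compact sets, which are mollified below.\<close>

definition finite_moments :: "('a::euclidean_space \<Rightarrow> complex) \<Rightarrow> bool" where
  "finite_moments \<phi> \<longleftrightarrow> \<phi> \<in> borel_measurable borel \<and> (\<forall>N. integrable lborel (\<lambda>y. (1 + norm y) ^ N * norm (\<phi> y)))"

lemma finite_moments_integrable: "finite_moments \<phi> \<Longrightarrow> integrable lborel \<phi>"
  unfolding finite_moments_def
proof (elim conjE)
  assume "\<phi> \<in> borel_measurable borel" "\<forall>N. integrable lborel (\<lambda>y. (1 + norm y) ^ N * norm (\<phi> y))"
  then show ?thesis using integrable_norm_cancel[of lborel \<phi>] by (auto dest: spec[of _ 0])
qed

lemma schwartz_finite_moments: "\<phi> \<in> schwartz \<Longrightarrow> finite_moments \<phi>"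
  unfolding finite_moments_def by (auto intro: rapid_integrable_weight schwartz_rapid schwartz_measurable)

lemma schwartz_conv:
  assumes "\<psi> \<in> schwartz" "finite_moments \<phi>" shows "conv \<psi> \<phi> \<in> schwartz"
proof (rule schwartz_coinduct)
  let ?X = "(\<lambda>\<psi>. conv \<psi> \<phi>) ` schwartz"
  note i = finite_moments_integrable[OF assms(2)]
  show "pd_closed ?X"
    unfolding pd_closed_def
  proof (intro ballI conjI)
    fix f assume "f \<in> ?X"
    then obtain \<psi> where \<psi>: "\<psi> \<in> schwartz" "f = conv \<psi> \<phi>" by blast
    then show "\<forall>x. f differentiable (at x)" using conv_has_derivative[OF _ i] by (auto simp: differentiable_def)
    fix b :: 'a assume "b \<in> Basis"
    then show "pdv b f \<in> ?X" using \<psi> pdv_conv[OF _ i] schwartz_pdv by blast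
  qed
  show "conv \<psi> \<phi> \<in> ?X" using assms by blast
  fix g assume "g \<in> ?X"
  then obtain \<psi> where \<psi>: "\<psi> \<in> schwartz" "g = conv \<psi> \<phi>" by blast
  show "rapid g"
    unfolding rapid_def \<psi>(2)
  proof
    fix N :: nat
    obtain K where "\<And>x. (1 + norm x) ^ N * norm (\<psi> x) \<le> K" using rapid_bound[OF schwartz_rapid[OF \<psi>(1)]] by metis
    then show "\<exists>B. \<forall>x. (1 + norm x) ^ N * norm (conv \<psi> \<phi> x) \<le> B"
      using conv_weight_le[OF schwartz_measurable[OF \<psi>(1)], of N \<phi> K] assms(2) by (auto simp: finite_moments_def)
  qed
qed

lemma schwartz_seminorm_conv_le:
  assumes \<psi>: "\<psi> \<in> schwartz" and \<phi>: "finite_moments \<phi>"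
  shows "schwartz_seminorm N (conv \<psi> \<phi>) \<le> schwartz_seminorm N \<psi> * (\<integral>y. (1 + norm y) ^ N * norm (\<phi> y) \<partial>lborel)"
proof (rule schwartz_seminorm_least)
  fix vs :: "'a list" and x :: 'a assume vs: "vs \<in> lists Basis" "length vs \<le> N"
  show "(1 + norm x) ^ N * norm (iter_deriv vs (conv \<psi> \<phi>) x) \<le> schwartz_seminorm N \<psi> * (\<integral>y. (1 + norm y) ^ N * norm (\<phi> y) \<partial>lborel)"
    unfolding iter_deriv_conv[OF \<psi> finite_moments_integrable[OF \<phi>] vs(1)]
    using \<phi> vs by (intro conv_weight_le schwartz_measurable schwartz_iter_deriv schwartz_seminorm_upper \<psi>) (auto simp: finite_moments_def)
qed

text \<open>This is \<open>inv_fourier m (- x)\<close>. The reflection appears because multipliers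
  act on distributions by duality, so that a test function undergoes the inverse transform first and
  the transform last.\<close>

definition fourier_kernel :: "('a::euclidean_space \<Rightarrow> complex) \<Rightarrow> 'a \<Rightarrow> complex" where
  "fourier_kernel m x = of_real (1 / (2 * pi) ^ DIM('a)) * fourier m x"

lemma schwartz_fourier_kernel: "m \<in> schwartz \<Longrightarrow> fourier_kernel m \<in> schwartz"
  unfolding fourier_kernel_def[abs_def] by (intro schwartz_cmult schwartz_fourier)

lemma fourier_mult_inv_fourier:
  fixes m \<phi> :: "'a::euclidean_space \<Rightarrow> complex"
  assumes m: "integrable lborel m" and \<phi>: "integrable lborel \<phi>"
  shows "fourier (\<lambda>\<xi>. m \<xi> * inv_fourier \<phi> \<xi>) = conv (fourier_kernel m) \<phi>"
proof
  fix x
  let ?c = "complex_of_real (1 / (2 * pi) ^ DIM('a))"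
  have "(\<lambda>(\<xi>, y). cis (\<xi> \<bullet> y)) \<in> borel_measurable (borel \<Otimes>\<^sub>M (borel :: 'a measure))" by simp
  from Fubini_bounded_kernel[OF this _ integrable_cis_minus_mult[OF m, of x] \<phi>]
  have "(\<integral>\<xi>. cis (- (\<xi> \<bullet> x)) * m \<xi> * (\<integral>y. cis (\<xi> \<bullet> y) * \<phi> y \<partial>lborel) \<partial>lborel)
      = (\<integral>y. (\<integral>\<xi>. cis (\<xi> \<bullet> y) * (cis (- (\<xi> \<bullet> x)) * m \<xi>) \<partial>lborel) * \<phi> y \<partial>lborel)" by simp
  moreover have "(\<integral>\<xi>. cis (\<xi> \<bullet> y) * (cis (- (\<xi> \<bullet> x)) * m \<xi>) \<partial>lborel) = fourier m (x - y)" for y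
    unfolding fourier_def mult.assoc[symmetric] cis_mult by (simp add: inner_diff_right)
  ultimately have "?c * (\<integral>\<xi>. cis (- (\<xi> \<bullet> x)) * m \<xi> * (\<integral>y. cis (\<xi> \<bullet> y) * \<phi> y \<partial>lborel) \<partial>lborel) = ?c * (\<integral>y. fourier m (x - y) * \<phi> y \<partial>lborel)"
    by simp
  then show "fourier (\<lambda>\<xi>. m \<xi> * inv_fourier \<phi> \<xi>) x = conv (fourier_kernel m) \<phi> x"
    unfolding fourier_def[of "\<lambda>\<xi>. m \<xi> * inv_fourier \<phi> \<xi>"] unfolding inv_fourier_def conv_def fourier_kernel_def
    by (simp add: inner_commute mult_ac)
qed

section \<open>Littlewood-Paley pieces and duality\<close>

lemma LP_cutoff_schwartz: "LP_cutoff \<beta>0 \<Longrightarrow> \<beta>0 \<in> schwartz"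
  unfolding LP_cutoff_def using compact_support_schwartz[of \<beta>0 "7/4"] by blast

lemma LP_beta_schwartz:
  assumes "LP_cutoff \<beta>0" shows "LP_beta \<beta>0 k \<in> schwartz"
proof (cases "k = 0")
  case True
  then have "LP_beta \<beta>0 k = \<beta>0" by (simp add: LP_beta_def fun_eq_iff)
  then show ?thesis using LP_cutoff_schwartz[OF assms] by simp
next
  case False
  then have "LP_beta \<beta>0 k = (\<lambda>\<xi>. \<beta>0 ((2 powr (- real k)) *\<^sub>R \<xi>) - \<beta>0 ((2 powr (1 - real k)) *\<^sub>R \<xi>))"
    by (simp add: LP_beta_def fun_eq_iff)
  then show ?thesis by (simp add: schwartz_diff schwartz_dilate LP_cutoff_schwartz[OF assms])
qed

lemma schwartz_mult_schwartz: "f \<in> schwartz \<Longrightarrow> g \<in> schwartz \<Longrightarrow> (\<lambda>x. f x * g x) \<in> schwartz"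
  by (intro schwartz_mult schwartz_multiplier)

lemma LP_piece_apply:
  assumes \<beta>: "LP_cutoff \<beta>0" and \<phi>: "\<phi> \<in> schwartz"
  shows "LP_piece \<beta>0 k f \<phi> = f (conv (fourier_kernel (LP_beta \<beta>0 k)) \<phi>)"
proof -
  have "(\<lambda>\<xi>. LP_beta \<beta>0 k \<xi> * inv_fourier \<phi> \<xi>) \<in> schwartz"
    by (intro schwartz_mult_schwartz LP_beta_schwartz[OF \<beta>] schwartz_inv_fourier[OF \<phi>])
  then have "LP_piece \<beta>0 k f \<phi> = f (fourier (\<lambda>\<xi>. LP_beta \<beta>0 k \<xi> * inv_fourier \<phi> \<xi>))"
    using \<phi> schwartz_inv_fourier[OF \<phi>]
    by (simp add: LP_piece_def distr_inv_fourier_def distr_mult_def distr_fourier_def)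
  then show ?thesis
    by (simp add: fourier_mult_inv_fourier schwartz_integrable LP_beta_schwartz[OF \<beta>] \<phi>)
qed

text \<open>The dilated cutoff is 1 for \<open>|\<xi>| \<le> 3 * 2^k\<close>, whereas
  \<open>LP_beta\<close> at level \<open>k\<close> is zero already for
  \<open>|\<xi>| \<ge> 7/4 * 2^k\<close>.\<close>

lemma LP_beta_eq_mult:
  assumes \<beta>: "LP_cutoff \<beta>0"
  shows "LP_beta \<beta>0 k \<xi> * \<beta>0 ((2 powr (- real k - 1)) *\<^sub>R \<xi>) = LP_beta \<beta>0 k \<xi>"
proof (cases "norm \<xi> \<le> 3 * 2 powr real k")
  case True
  have "norm ((2 powr (- real k - 1)) *\<^sub>R \<xi>) = norm \<xi> / (2 * 2 powr real k)"
    by (simp add: powr_diff powr_minus field_simps)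
  also have "\<dots> \<le> 3 / 2" using True by (simp add: field_simps)
  finally show ?thesis using \<beta> by (simp add: LP_cutoff_def)
next
  case False
  have "norm ((2 powr (- real k)) *\<^sub>R \<xi>) = norm \<xi> / 2 powr real k"
    by (simp add: powr_minus field_simps)
  moreover have "\<dots> \<ge> 7 / 4"
  proof -
    have "0 < 2 powr real k" by simp
    then have "7 / 4 * 2 powr real k \<le> norm \<xi>" using False by linarith
    then show ?thesis by (simp add: field_simps)
  qed
  moreover have "norm ((2 powr (1 - real k)) *\<^sub>R \<xi>) = 2 * (norm \<xi> / 2 powr real k)"
    by (simp add: powr_diff)
  ultimately have "\<beta>0 ((2 powr (- real k)) *\<^sub>R \<xi>) = 0" "\<beta>0 ((2 powr (1 - real k)) *\<^sub>R \<xi>) = 0"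
    using \<beta> unfolding LP_cutoff_def by auto
  then have "LP_beta \<beta>0 k \<xi> = 0" by (auto simp: LP_beta_def)
  then show ?thesis by simp
qed

text \<open>The multiplier lives on a full ball rather than on a thickened annulus, so level 0 is
  not special and all kernels are dilates of one Schwartz function. This makes the constants uniform
  in \<open>k\<close>.\<close>

definition LP_kernel :: "('a::euclidean_space \<Rightarrow> complex) \<Rightarrow> nat \<Rightarrow> 'a \<Rightarrow> complex" where
  "LP_kernel \<beta>0 k = fourier_kernel (\<lambda>\<xi>. \<beta>0 ((2 powr (- real k - 1)) *\<^sub>R \<xi>))"

lemma LP_kernel_schwartz: "LP_cutoff \<beta>0 \<Longrightarrow> LP_kernel \<beta>0 k \<in> schwartz"
  unfolding LP_kernel_def by (intro schwartz_fourier_kernel schwartz_dilate LP_cutoff_schwartz) auto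

text \<open>Convolution with \<open>LP_kernel\<close> multiplies the inverse transform of \<phi> by
  the wider cutoff, and that cutoff is absorbed by \<open>LP_beta\<close>. The identity lives on
  test functions because the piece is still a functional here.\<close>

lemma LP_piece_reproduce:
  assumes \<beta>: "LP_cutoff \<beta>0" and \<phi>: "\<phi> \<in> schwartz"
  shows "LP_piece \<beta>0 k f (conv (LP_kernel \<beta>0 k) \<phi>) = LP_piece \<beta>0 k f \<phi>"
proof -
  let ?m = "\<lambda>\<xi>. \<beta>0 ((2 powr (- real k - 1)) *\<^sub>R \<xi>)"
  have m: "?m \<in> schwartz" by (intro schwartz_dilate LP_cutoff_schwartz \<beta>) auto
  have s: "conv (LP_kernel \<beta>0 k) \<phi> \<in> schwartz"
    by (intro schwartz_conv LP_kernel_schwartz \<beta> schwartz_finite_moments \<phi>)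
  have e: "conv (LP_kernel \<beta>0 k) \<phi> = fourier (\<lambda>\<xi>. ?m \<xi> * inv_fourier \<phi> \<xi>)"
    unfolding LP_kernel_def by (simp add: fourier_mult_inv_fourier schwartz_integrable m \<phi>)
  have "inv_fourier (conv (LP_kernel \<beta>0 k) \<phi>) = (\<lambda>\<xi>. ?m \<xi> * inv_fourier \<phi> \<xi>)"
    unfolding e by (intro inv_fourier_fourier schwartz_mult_schwartz m schwartz_inv_fourier \<phi>)
  then have "(\<lambda>\<xi>. LP_beta \<beta>0 k \<xi> * inv_fourier (conv (LP_kernel \<beta>0 k) \<phi>) \<xi>) = (\<lambda>\<xi>. LP_beta \<beta>0 k \<xi> * inv_fourier \<phi> \<xi>)"
    by (simp only: mult.assoc[symmetric] LP_beta_eq_mult[OF \<beta>])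
  then have "conv (fourier_kernel (LP_beta \<beta>0 k)) (conv (LP_kernel \<beta>0 k) \<phi>) = conv (fourier_kernel (LP_beta \<beta>0 k)) \<phi>"
    by (simp add: fourier_mult_inv_fourier[symmetric] schwartz_integrable LP_beta_schwartz[OF \<beta>] \<phi> s)
  then show ?thesis by (simp add: LP_piece_apply[OF \<beta>] \<phi> s)
qed

text \<open>Convolution puts all derivatives on a fixed kernel, so a seminorm of order
  \<open>N\<close> of the convolution costs only a weighted integral of \<phi>. Continuity of
  \<open>f\<close> thereby turns into a bound on pairings that is free of derivatives, as
  \<open>dual_bound\<close> requires.\<close>

lemma LP_piece_growth:
  fixes f :: "'a::euclidean_space distr"
  assumes \<beta>: "LP_cutoff \<beta>0" and f: "f \<in> tempered"
  shows "\<exists>C N. C \<ge> 0 \<and> (\<forall>\<phi>\<in>schwartz. norm (LP_piece \<beta>0 k f \<phi>) \<le> (\<integral>y. norm (\<phi> y) * (C * (1 + norm y) ^ N) \<partial>lborel))"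
proof -
  obtain C N where C: "\<And>\<phi>. \<phi> \<in> schwartz \<Longrightarrow> norm (f \<phi>) \<le> C * schwartz_seminorm N \<phi>"
    using f unfolding tempered_def by blast
  define \<psi> where "\<psi> = fourier_kernel (LP_beta \<beta>0 k)"
  have \<psi>: "\<psi> \<in> schwartz" unfolding \<psi>_def by (intro schwartz_fourier_kernel LP_beta_schwartz \<beta>)
  have "norm (LP_piece \<beta>0 k f \<phi>) \<le> (\<integral>y. norm (\<phi> y) * ((\<bar>C\<bar> * schwartz_seminorm N \<psi>) * (1 + norm y) ^ N) \<partial>lborel)"
    if \<phi>: "\<phi> \<in> schwartz" for \<phi>
  proof -
    have s: "conv \<psi> \<phi> \<in> schwartz" by (intro schwartz_conv \<psi> schwartz_finite_moments \<phi>)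
    have "norm (f (conv \<psi> \<phi>)) \<le> \<bar>C\<bar> * schwartz_seminorm N (conv \<psi> \<phi>)"
      by (rule order_trans[OF C[OF s]]) (intro mult_right_mono schwartz_seminorm_nonneg s, simp)
    also have "\<dots> \<le> \<bar>C\<bar> * (schwartz_seminorm N \<psi> * (\<integral>y. (1 + norm y) ^ N * norm (\<phi> y) \<partial>lborel))"
      by (intro mult_left_mono schwartz_seminorm_conv_le \<psi> schwartz_finite_moments \<phi>) auto
    also have "\<dots> = (\<integral>y. (\<bar>C\<bar> * schwartz_seminorm N \<psi>) * ((1 + norm y) ^ N * norm (\<phi> y)) \<partial>lborel)"
      by simp
    finally show ?thesis by (simp add: LP_piece_apply[OF \<beta> \<phi>] \<psi>_def mult_ac)
  qed
  then show ?thesis using schwartz_seminorm_nonneg[OF \<psi>] by (intro exI[of _ "\<bar>C\<bar> * schwartz_seminorm N \<psi>"] exI[of _ N]) auto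
qed

lemma fourier_dilate:
  fixes f :: "'a::euclidean_space \<Rightarrow> complex"
  assumes [measurable]: "f \<in> borel_measurable borel" and c: "c \<noteq> 0"
  shows "fourier (\<lambda>\<xi>. f (c *\<^sub>R \<xi>)) x = of_real (inverse (\<bar>c\<bar> ^ DIM('a))) * fourier f (inverse c *\<^sub>R x)"
proof -
  have "fourier f (inverse c *\<^sub>R x) = \<bar>c\<bar> ^ DIM('a) *\<^sub>R (\<integral>\<xi>. cis (- ((0 + c *\<^sub>R \<xi>) \<bullet> (inverse c *\<^sub>R x))) * f (0 + c *\<^sub>R \<xi>) \<partial>lborel)"
    unfolding fourier_def by (rule lborel_integral_affine[OF _ c]) simp
  also have "\<dots> = of_real (\<bar>c\<bar> ^ DIM('a)) * fourier (\<lambda>\<xi>. f (c *\<^sub>R \<xi>)) x"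
    using c by (simp add: fourier_def scaleR_conv_of_real mult.assoc[symmetric, of "inverse c" c])
  finally show ?thesis using c by simp
qed

lemma LP_kernel_eq:
  fixes \<beta>0 :: "'a::euclidean_space \<Rightarrow> complex"
  assumes \<beta>: "LP_cutoff \<beta>0"
  shows "LP_kernel \<beta>0 k x = of_real ((2 ^ (k + 1)) ^ DIM('a)) * fourier_kernel \<beta>0 (2 ^ (k + 1) *\<^sub>R x)"
proof -
  define c where "c = (2::real) ^ (k + 1)"
  have c: "c > 0" by (simp add: c_def)
  have p: "2 powr (- real k - 1) = inverse c"
    by (simp add: powr_diff powr_minus powr_realpow field_simps c_def)
  show ?thesis
    unfolding LP_kernel_def fourier_kernel_def p c_def[symmetric] using c
    by (subst fourier_dilate[OF schwartz_measurable[OF LP_cutoff_schwartz[OF \<beta>]]]) (simp_all add: power_inverse)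
qed

section \<open>Smooth approximation of indicators of compact sets\<close>

lemma of_real_norm_eqI: "z = complex_of_real r \<Longrightarrow> 0 \<le> r \<Longrightarrow> z = of_real (norm z)"
  by simp

text \<open>The bump is the normalised squared modulus of the cutoff: squaring removes the phase
  that \<open>\<beta>0\<close> may have between the radii \<open>3/2\<close> and \<open>7/4\<close>,
  and the value 1 on the unit ball makes the integral positive. Nonnegativity of a complex value is
  encoded as \<open>\<eta> x = of_real (norm (\<eta> x))\<close>.\<close>

lemma bump_exists:
  fixes \<beta>0 :: "'a::euclidean_space \<Rightarrow> complex"
  assumes \<beta>: "LP_cutoff \<beta>0"
  obtains \<eta> :: "'a \<Rightarrow> complex" where "\<eta> \<in> schwartz" "\<And>x. \<eta> x = of_real (norm (\<eta> x))"
    "\<And>x. norm x \<ge> 2 \<Longrightarrow> \<eta> x = 0" "(\<integral>x. \<eta> x \<partial>lborel) = 1"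
proof -
  have s: "\<beta>0 \<in> schwartz" by (rule LP_cutoff_schwartz[OF \<beta>])
  define h where "h x = \<beta>0 x * cnj (\<beta>0 x)" for x
  have h: "h \<in> schwartz" unfolding h_def[abs_def] by (intro schwartz_mult_schwartz schwartz_cnj s)
  have hr: "h x = of_real ((norm (\<beta>0 x))\<^sup>2)" for x by (simp add: h_def complex_norm_square[symmetric])
  have ih: "integrable lborel h" by (rule schwartz_integrable[OF h])
  then have i: "integrable lborel (\<lambda>x. (norm (\<beta>0 x))\<^sup>2)"
    using integrable_Re[of lborel h] by (simp add: hr[abs_def])
  have "0 < measure lborel (cball (0::'a) 1)"
    using content_cball_pos[of 1 "0::'a"] by simp
  also have "\<dots> = (\<integral>x. indicator (cball (0::'a) 1) x \<partial>lborel)" by simp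
  also have "\<dots> \<le> (\<integral>x. (norm (\<beta>0 x))\<^sup>2 \<partial>lborel)"
  proof (intro integral_mono i)
    fix x :: 'a show "indicator (cball 0 1) x \<le> (norm (\<beta>0 x))\<^sup>2"
      using \<beta> by (auto simp: indicator_def LP_cutoff_def)
  qed (simp add: emeasure_cball)
  finally have pos: "0 < (\<integral>x. (norm (\<beta>0 x))\<^sup>2 \<partial>lborel)" (is "0 < ?I") .
  have "(\<integral>x. h x \<partial>lborel) = of_real ?I" unfolding hr by (rule integral_complex_of_real)
  have "of_real (1 / ?I) * h x = of_real (norm (of_real (1 / ?I) * h x))" for x
    using pos by (intro of_real_norm_eqI[of _ "1 / ?I * (norm (\<beta>0 x))\<^sup>2"]) (auto simp: hr)
  moreover have "of_real (1 / ?I) * h x = 0" if "norm x \<ge> 2" for x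
    using \<beta> that by (simp add: h_def LP_cutoff_def)
  moreover have "(\<integral>x. of_real (1 / ?I) * h x \<partial>lborel) = 1"
    using pos \<open>(\<integral>x. h x \<partial>lborel) = of_real ?I\<close> by simp
  ultimately show ?thesis
    by (intro that[of "\<lambda>x. of_real (1 / ?I) * h x"] schwartz_cmult h)
qed

lemma compact_thickening:
  fixes K :: "'a::euclidean_space set"
  assumes K: "compact K" "K \<noteq> {}"
  shows "compact {y. infdist y K \<le> r}"
proof -
  obtain R where R: "\<And>x. x \<in> K \<Longrightarrow> norm x \<le> R" using compact_imp_bounded[OF K(1)] bounded_iff by metis
  have "bounded {y. infdist y K \<le> r}"
    unfolding bounded_iff
  proof (intro exI ballI)
    fix y assume "y \<in> {y. infdist y K \<le> r}"
    moreover obtain x where "x \<in> K" "infdist y K = dist y x"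
      using infdist_attains_inf[OF compact_imp_closed[OF K(1)] K(2)] by blast
    ultimately show "norm y \<le> r + R" using R[of x] norm_triangle_ineq[of "y - x" x] by (auto simp: dist_norm)
  qed
  moreover have "closed {y. infdist y K \<le> r}" by (intro closed_Collect_le continuous_intros)
  ultimately show ?thesis by (simp add: compact_eq_bounded_closed)
qed

lemma finite_moments_indicator:
  assumes "compact (K :: 'a::euclidean_space set)" shows "finite_moments (\<lambda>y. of_bool (y \<in> K))"
  unfolding finite_moments_def
proof (intro conjI allI)
  have K: "K \<in> sets borel" using assms by (simp add: borel_compact)
  have [measurable]: "Measurable.pred borel (\<lambda>y. y \<in> K)" using K by simp
  show m: "(\<lambda>y. of_bool (y \<in> K) :: complex) \<in> borel_measurable borel"
    unfolding of_bool_def by measurable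
  obtain R where R: "\<And>x. x \<in> K \<Longrightarrow> norm x \<le> R" using assms compact_imp_bounded bounded_iff by metis
  fix N
  have "integrable lborel (\<lambda>y. (1 + \<bar>R\<bar>) ^ N * indicator K y)"
    using K emeasure_compact_finite[OF assms] by (auto intro!: integrable_real_indicator)
  then show "integrable lborel (\<lambda>y. (1 + norm y) ^ N * norm (of_bool (y \<in> K) :: complex))"
    by (rule Bochner_Integration.integrable_bound)
       (use m R in \<open>auto simp: indicator_def abs_mult intro!: AE_I2 power_mono order_trans[OF R]\<close>)
qed

text \<open>The closed neighbourhood of \<open>K\<close> of radius \<open>2 / a n\<close> is
  mollified at the same scale. The result is exactly 1 on \<open>K\<close> and 0 from distance
  \<open>4 / a n\<close> on; as \<open>K\<close> is closed, every point outside is eventually that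
  far away.\<close>

lemma smooth_indicator_approx:
  fixes \<beta>0 :: "'a::euclidean_space \<Rightarrow> complex"
  assumes \<beta>: "LP_cutoff \<beta>0" and K: "compact K" "K \<noteq> {}"
  obtains \<phi> :: "nat \<Rightarrow> 'a \<Rightarrow> complex" and R where "R > 0" "\<And>n. \<phi> n \<in> schwartz" "\<And>n x. norm (\<phi> n x) \<le> 1"
    "\<And>n x. norm x > R \<Longrightarrow> \<phi> n x = 0" "\<And>x. (\<lambda>n. \<phi> n x) \<longlonglongrightarrow> of_bool (x \<in> K)"
proof -
  obtain \<eta> :: "'a \<Rightarrow> complex" where \<eta>: "\<eta> \<in> schwartz" "\<And>x. \<eta> x = of_real (norm (\<eta> x))"
    "\<And>x. norm x \<ge> 2 \<Longrightarrow> \<eta> x = 0" "(\<integral>x. \<eta> x \<partial>lborel) = 1" using bump_exists[OF \<beta>] by metis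
  define a where "a n = real (Suc n)" for n
  have a: "a n > 0" "a n \<ge> 1" for n by (auto simp: a_def)
  define e where "e n x = of_real (a n ^ DIM('a)) * \<eta> (a n *\<^sub>R x)" for n x
  have es: "e n \<in> schwartz" for n
    unfolding e_def[abs_def] using a[of n] by (intro schwartz_cmult schwartz_dilate \<eta>) auto
  have [measurable]: "\<eta> \<in> borel_measurable borel" "e n \<in> borel_measurable borel" for n
    by (intro schwartz_measurable \<eta> es)+
  have er: "e n x = of_real (norm (e n x))" for n x
    by (rule of_real_norm_eqI[of _ "a n ^ DIM('a) * norm (\<eta> (a n *\<^sub>R x))"])
       (use a[of n] \<eta>(2)[of "a n *\<^sub>R x"] in \<open>auto simp: e_def\<close>)
  have e0: "e n x = 0" if "norm x \<ge> 2 / a n" for n x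
    using that a[of n] \<eta>(3)[of "a n *\<^sub>R x"] by (simp add: e_def field_simps)
  have e1: "(\<integral>y. e n (x - y) \<partial>lborel) = 1" for n x
  proof -
    have "(\<integral>y. e n y \<partial>lborel) = \<bar>-1\<bar> ^ DIM('a) *\<^sub>R (\<integral>y. e n (x + (-1) *\<^sub>R y) \<partial>lborel)"
      by (rule lborel_integral_affine) auto
    moreover have "(\<integral>x. \<eta> x \<partial>lborel) = \<bar>a n\<bar> ^ DIM('a) *\<^sub>R (\<integral>y. \<eta> (0 + a n *\<^sub>R y) \<partial>lborel)"
      by (rule lborel_integral_affine) (use a[of n] in auto)
    ultimately show ?thesis using \<eta>(4) a[of n] by (simp add: e_def scaleR_conv_of_real)
  qed
  have i1: "integrable lborel (\<lambda>y. e n (x - y))" for n x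
    using lborel_integrable_affine[of "e n" "-1" x] schwartz_integrable[OF es[of n]] by simp
  have en1: "(\<integral>y. norm (e n (x - y)) \<partial>lborel) = 1" for n x
  proof -
    have "complex_of_real (\<integral>y. norm (e n (x - y)) \<partial>lborel) = (\<integral>y. e n (x - y) \<partial>lborel)"
      unfolding integral_complex_of_real[symmetric] er[symmetric] ..
    then show ?thesis unfolding e1 by (metis of_real_eq_1_iff)
  qed
  define L where "L n = {y. infdist y K \<le> 2 / a n}" for n
  have L: "compact (L n)" for n unfolding L_def by (rule compact_thickening[OF K])
  have [measurable]: "L n \<in> sets borel" for n using L by (simp add: borel_compact)
  define \<phi> where "\<phi> n = conv (e n) (\<lambda>y. of_bool (y \<in> L n))" for n
  have s: "\<phi> n \<in> schwartz" for n unfolding \<phi>_def by (intro schwartz_conv es finite_moments_indicator L)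
  have le1: "norm (\<phi> n x) \<le> 1" for n x
  proof -
    have "norm (\<phi> n x) \<le> (\<integral>y. norm (e n (x - y) * of_bool (y \<in> L n)) \<partial>lborel)"
      unfolding \<phi>_def conv_def by (rule integral_norm_bound)
    also have "\<dots> \<le> (\<integral>y. norm (e n (x - y)) \<partial>lborel)"
      by (intro integral_mono_AE' integrable_norm i1) (auto simp: norm_mult)
    finally show ?thesis by (simp add: en1)
  qed
  have out: "\<phi> n x = 0" if "infdist x K \<ge> 4 / a n" for n x
  proof -
    have "e n (x - y) * of_bool (y \<in> L n) = 0" for y
    proof (cases "y \<in> L n")
      case True
      have "infdist x K \<le> infdist y K + dist x y" by (rule infdist_triangle)
      then have "2 / a n \<le> norm (x - y)" using that True by (simp add: L_def dist_norm)
      then show ?thesis by (simp add: e0)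
    qed simp
    then have "\<phi> n x = (\<integral>y. 0 \<partial>(lborel :: 'a measure))"
      unfolding \<phi>_def conv_def by (intro Bochner_Integration.integral_cong refl)
    then show ?thesis by simp
  qed
  have ins: "\<phi> n x = 1" if "x \<in> K" for n x
  proof -
    have "e n (x - y) * of_bool (y \<in> L n) = e n (x - y)" for y
    proof (cases "y \<in> L n")
      case False
      have "infdist y K \<le> dist y x" by (rule infdist_le[OF that])
      then have "2 / a n \<le> norm (x - y)" using False by (simp add: L_def dist_norm norm_minus_commute)
      then show ?thesis by (simp add: e0)
    qed simp
    then show ?thesis unfolding \<phi>_def conv_def by (simp only: e1)
  qed
  obtain R where R: "\<And>y. infdist y K \<le> 4 \<Longrightarrow> norm y \<le> R"
    using compact_thickening[OF K, of 4] compact_imp_bounded bounded_iff by (metis (mono_tags, lifting) mem_Collect_eq)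
  show ?thesis
  proof (rule that[of "max R 1" \<phi>])
    show "\<phi> n x = 0" if "norm x > max R 1" for n x
    proof (rule out)
      have "4 / a n \<le> 4" using a[of n] by (simp add: field_simps)
      then show "4 / a n \<le> infdist x K" using R[of x] that by force
    qed
    show "(\<lambda>n. \<phi> n x) \<longlonglongrightarrow> of_bool (x \<in> K)" for x
    proof (cases "x \<in> K")
      case False
      then have "infdist x K > 0"
        using in_closed_iff_infdist_zero[OF compact_imp_closed[OF K(1)] K(2)] infdist_nonneg[of x K] by force
      moreover have "(\<lambda>n. 4 / a n) \<longlonglongrightarrow> 0"
        unfolding a_def by (rule LIMSEQ_Suc) (rule lim_const_over_n)
      ultimately have "\<forall>\<^sub>F n in sequentially. 4 / a n < infdist x K" by (rule order_tendstoD(2)[rotated])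
      then have "\<forall>\<^sub>F n in sequentially. \<phi> n x = of_bool (x \<in> K)"
        by eventually_elim (use False out in auto)
      then show ?thesis by (rule tendsto_eventually)
    qed (simp add: ins)
  qed (use s le1 in auto)
qed

section \<open>From pairings to pointwise bounds\<close>

lemma borel_measurable_lebesgueI: "f \<in> borel_measurable borel \<Longrightarrow> f \<in> borel_measurable lebesgue"
  by (intro measurable_completion) simp

text \<open>The Schwartz functions of \<open>smooth_indicator_approx\<close> converge to the
  indicator of \<open>K\<close>, are bounded by 1 and vanish outside a common ball, so both sides of
  \<open>bound\<close> pass to the limit.\<close>

lemma dual_bound_compact:
  fixes g :: "'a::euclidean_space \<Rightarrow> complex"
  assumes \<beta>: "LP_cutoff (\<beta>0 :: 'a \<Rightarrow> complex)"
    and gm: "g \<in> borel_measurable lebesgue"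
    and gi: "\<And>\<phi>. \<phi> \<in> schwartz \<Longrightarrow> integrable lebesgue (\<lambda>x. g x * \<phi> x)"
    and W: "continuous_on UNIV W" "\<And>x. W x \<ge> 0"
    and bound: "\<And>\<phi>. \<phi> \<in> schwartz \<Longrightarrow> norm (\<integral>x. g x * \<phi> x \<partial>lebesgue) \<le> (\<integral>x. norm (\<phi> x) * W x \<partial>lborel)"
    and K: "compact K"
  shows "integrable lebesgue (\<lambda>x. g x * of_bool (x \<in> K))"
    and "integrable lborel (\<lambda>x. of_bool (x \<in> K) * W x)"
    and "norm (\<integral>x. g x * of_bool (x \<in> K) \<partial>lebesgue) \<le> (\<integral>x. of_bool (x \<in> K) * W x \<partial>lborel)"
proof -
  have "integrable lebesgue (\<lambda>x. g x * of_bool (x \<in> K)) \<and> integrable lborel (\<lambda>x. of_bool (x \<in> K) * W x) \<and>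
    norm (\<integral>x. g x * of_bool (x \<in> K) \<partial>lebesgue) \<le> (\<integral>x. of_bool (x \<in> K) * W x \<partial>lborel)"
  proof (cases "K = {}")
    case False
    obtain \<phi> :: "nat \<Rightarrow> 'a \<Rightarrow> complex" and R where \<phi>: "R > 0" "\<And>n. \<phi> n \<in> schwartz" "\<And>n x. norm (\<phi> n x) \<le> 1"
      "\<And>n x. norm x > R \<Longrightarrow> \<phi> n x = 0" "\<And>x. (\<lambda>n. \<phi> n x) \<longlonglongrightarrow> of_bool (x \<in> K)"
      using smooth_indicator_approx[OF \<beta> K False] by metis
    have [measurable]: "\<phi> n \<in> borel_measurable borel" for n by (rule schwartz_measurable[OF \<phi>(2)])
    have [measurable]: "W \<in> borel_measurable borel" using W(1) by (simp add: borel_measurable_continuous_onI)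
    have Kb: "K \<in> sets borel" using K by (simp add: borel_compact)
    have Kp[measurable]: "Measurable.pred borel (\<lambda>y. y \<in> K)" using Kb by simp
    have Kl: "(\<lambda>x. of_bool (x \<in> K) :: complex) \<in> borel_measurable lebesgue"
      by (rule borel_measurable_lebesgueI) (simp add: of_bool_def)
    have [measurable]: "(\<lambda>x. of_bool (x \<in> K) :: real) \<in> borel_measurable borel" by (simp add: of_bool_def)
    \<comment> \<open>Equal to 1 on the ball carrying all \<open>\<phi> n\<close>, so that
      \<open>|g \<theta>|\<close> is an integrable majorant. Integrability of \<open>g\<close> near
      \<open>K\<close> is known only through such products.\<close>
    define \<theta> where "\<theta> x = \<beta>0 ((1 / R) *\<^sub>R x)" for x
    have \<theta>: "\<theta> \<in> schwartz" unfolding \<theta>_def[abs_def] using \<phi>(1) by (intro schwartz_dilate LP_cutoff_schwartz[OF \<beta>]) auto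
    have \<theta>1: "\<theta> x = 1" if "norm x \<le> R" for x
    proof -
      have "norm ((1 / R) *\<^sub>R x) \<le> 3 / 2" using that \<phi>(1) by (simp add: field_simps)
      then show ?thesis using \<beta> unfolding \<theta>_def LP_cutoff_def by blast
    qed
    have lim1: "(\<lambda>n. \<integral>x. g x * \<phi> n x \<partial>lebesgue) \<longlonglongrightarrow> (\<integral>x. g x * of_bool (x \<in> K) \<partial>lebesgue)"
      and i1: "integrable lebesgue (\<lambda>x. g x * of_bool (x \<in> K))"
    proof -
      have m: "(\<lambda>x. g x * of_bool (x \<in> K)) \<in> borel_measurable lebesgue" using gm Kl by (rule borel_measurable_times)
      have mn: "(\<lambda>x. g x * \<phi> n x) \<in> borel_measurable lebesgue" for n
        using gi[OF \<phi>(2)] by auto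
      have i: "integrable lebesgue (\<lambda>x. norm (g x * \<theta> x))" using gi[OF \<theta>] by auto
      have l: "AE x in lebesgue. (\<lambda>n. g x * \<phi> n x) \<longlonglongrightarrow> g x * of_bool (x \<in> K)"
        by (intro AE_I2 tendsto_intros \<phi>)
      have b: "AE x in lebesgue. norm (g x * \<phi> n x) \<le> norm (g x * \<theta> x)" for n
      proof (rule AE_I2)
        fix x show "norm (g x * \<phi> n x) \<le> norm (g x * \<theta> x)"
          using \<phi>(3)[of n x] \<phi>(4)[of x n] \<theta>1[of x] by (cases "norm x \<le> R") (auto simp: norm_mult mult_left_le)
      qed
      show "(\<lambda>n. \<integral>x. g x * \<phi> n x \<partial>lebesgue) \<longlonglongrightarrow> (\<integral>x. g x * of_bool (x \<in> K) \<partial>lebesgue)"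
        by (rule integral_dominated_convergence[OF m mn i l b])
      show "integrable lebesgue (\<lambda>x. g x * of_bool (x \<in> K))"
        by (rule integrable_dominated_convergence[OF m mn i l b])
    qed
    have lim2: "(\<lambda>n. \<integral>x. norm (\<phi> n x) * W x \<partial>lborel) \<longlonglongrightarrow> (\<integral>x. of_bool (x \<in> K) * W x \<partial>lborel)"
      and i2: "integrable lborel (\<lambda>x. of_bool (x \<in> K) * W x)"
    proof -
      have "compact (W ` cball 0 R)" using W(1) by (intro compact_continuous_image) (auto intro: continuous_on_subset)
      then have "bounded (W ` cball 0 R)" by (rule compact_imp_bounded)
      then obtain B where "\<forall>y\<in>W ` cball 0 R. norm y \<le> B" unfolding bounded_iff by blast
      then have B: "W x \<le> B" if "norm x \<le> R" for x using that by (force dest: abs_le_D1)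
      have m: "(\<lambda>x. of_bool (x \<in> K) * W x) \<in> borel_measurable lborel" by simp
      have mn: "(\<lambda>x. norm (\<phi> n x) * W x) \<in> borel_measurable lborel" for n by simp
      have i: "integrable lborel (\<lambda>x. B * indicator (cball (0::'a) R) x)"
        by (intro integrable_mult_right integrable_real_indicator) (auto simp: emeasure_compact_finite[OF compact_cball, unfolded infinity_ennreal_def])
      have l: "AE x in lborel. (\<lambda>n. norm (\<phi> n x) * W x) \<longlonglongrightarrow> of_bool (x \<in> K) * W x"
      proof (rule AE_I2)
        fix x
        have "(\<lambda>n. norm (\<phi> n x)) \<longlonglongrightarrow> norm (of_bool (x \<in> K) :: complex)" by (intro tendsto_intros \<phi>)
        then have "(\<lambda>n. norm (\<phi> n x)) \<longlonglongrightarrow> of_bool (x \<in> K)" by (cases "x \<in> K") auto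
        then show "(\<lambda>n. norm (\<phi> n x) * W x) \<longlonglongrightarrow> of_bool (x \<in> K) * W x" by (intro tendsto_intros)
      qed
      have b: "AE x in lborel. norm (norm (\<phi> n x) * W x) \<le> B * indicator (cball (0::'a) R) x" for n
      proof (rule AE_I2)
        fix x show "norm (norm (\<phi> n x) * W x) \<le> B * indicator (cball 0 R) x"
        proof (cases "norm x \<le> R")
          case True
          have "norm (\<phi> n x) * W x \<le> 1 * B" using True W(2)[of x] \<phi>(3)[of n x] B[of x] by (intro mult_mono) auto
          then show ?thesis using True W(2)[of x] by (simp add: abs_mult)
        qed (use \<phi>(4)[of x n] in auto)
      qed
      show "(\<lambda>n. \<integral>x. norm (\<phi> n x) * W x \<partial>lborel) \<longlonglongrightarrow> (\<integral>x. of_bool (x \<in> K) * W x \<partial>lborel)"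
        by (rule integral_dominated_convergence[OF m mn i l b])
      show "integrable lborel (\<lambda>x. of_bool (x \<in> K) * W x)"
        by (rule integrable_dominated_convergence[OF m mn i l b])
    qed
    have "norm (\<integral>x. g x * of_bool (x \<in> K) \<partial>lebesgue) \<le> (\<integral>x. of_bool (x \<in> K) * W x \<partial>lborel)"
      by (rule LIMSEQ_le[OF tendsto_norm[OF lim1] lim2]) (use bound[OF \<phi>(2)] in blast)
    then show ?thesis using i1 i2 by blast
  qed simp
  then show "integrable lebesgue (\<lambda>x. g x * of_bool (x \<in> K))"
    and "integrable lborel (\<lambda>x. of_bool (x \<in> K) * W x)"
    and "norm (\<integral>x. g x * of_bool (x \<in> K) \<partial>lebesgue) \<le> (\<integral>x. of_bool (x \<in> K) * W x \<partial>lborel)" by auto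
qed

text \<open>Closed sets exhaust \<open>E\<close> from inside up to measure \<open>e\<close>, and a
  closed set is the union of its compact intersections with balls.\<close>

lemma null_set_of_compact_subsets:
  fixes E :: "'a::euclidean_space set"
  assumes E: "E \<in> sets lebesgue" and K: "\<And>K. compact K \<Longrightarrow> K \<subseteq> E \<Longrightarrow> emeasure lebesgue K = 0"
  shows "emeasure lebesgue E = 0"
proof -
  have "emeasure lebesgue E \<le> ennreal e" if e: "e > 0" for e
  proof -
    obtain T where T: "closed T" "T \<subseteq> E" "E - T \<in> lmeasurable" "emeasure lebesgue (E - T) < ennreal e"
      using sets_lebesgue_inner_closed[OF E e] by metis
    have Ts: "T \<in> sets lebesgue" using T(1) by (simp add: borel_closed)
    have "T = (\<Union>n. T \<inter> cball 0 (real n))" using real_arch_simple by auto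
    moreover have "emeasure lebesgue (\<Union>n. T \<inter> cball 0 (real n)) = 0"
    proof (rule emeasure_UN_eq_0)
      fix n
      show "emeasure lebesgue (T \<inter> cball 0 (real n)) = 0"
        by (rule K) (use T in \<open>auto intro: closed_Int_compact\<close>)
    qed (use Ts in auto)
    ultimately have T0: "emeasure lebesgue T = 0" by simp
    have "emeasure lebesgue E = emeasure lebesgue (T \<union> (E - T))" using T(2) by (simp add: Un_absorb1)
    also have "\<dots> \<le> emeasure lebesgue T + emeasure lebesgue (E - T)"
      using Ts E by (intro emeasure_subadditive) auto
    finally show ?thesis using T(4) T0 by simp
  qed
  then show ?thesis by (metis ennreal_le_epsilon add_0 bot.extremum_uniqueI bot_ennreal)
qed

text \<open>
  This takes the place of the pointwise identity \<open>g = \<psi> * g\<close>, which is only available after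
  pairing with Schwartz functions.
\<close>

lemma dual_bound:
  fixes g :: "'a::euclidean_space \<Rightarrow> complex"
  assumes \<beta>: "LP_cutoff (\<beta>0 :: 'a \<Rightarrow> complex)"
    and gm: "g \<in> borel_measurable lebesgue"
    and gi: "\<And>\<phi>. \<phi> \<in> schwartz \<Longrightarrow> integrable lebesgue (\<lambda>x. g x * \<phi> x)"
    and W: "continuous_on UNIV W" "\<And>x. W x \<ge> 0"
    and bound: "\<And>\<phi>. \<phi> \<in> schwartz \<Longrightarrow> norm (\<integral>x. g x * \<phi> x \<partial>lebesgue) \<le> (\<integral>x. norm (\<phi> x) * W x \<partial>lborel)"
  shows "AE x in lebesgue. norm (g x) \<le> W x"
proof -
  have Wb: "W \<in> borel_measurable borel" using W(1) by (simp add: borel_measurable_continuous_onI)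
  have Wm: "W \<in> borel_measurable lebesgue" using W(1) by (intro borel_measurable_lebesgueI borel_measurable_continuous_onI)
  \<comment> \<open>The modulus is the supremum of \<open>Re (cis r * g x)\<close> over the phases
    \<open>r\<close>. For a fixed phase the excess over \<open>W\<close> is positive on the
    exceptional set, so integrating it over a compact part of that set and comparing with the dual
    bound forces the part to be null.\<close>
  have "AE x in lebesgue. Re (cis r * g x) \<le> W x" for r
  proof -
    let ?E = "{x. Re (cis r * g x) > W x}"
    have cg: "(\<lambda>x. Re (cis r * g x)) \<in> borel_measurable lebesgue" using gm by simp
    have E: "?E \<in> sets lebesgue" using borel_measurable_less[OF Wm cg] by simp
    have "emeasure lebesgue ?E = 0"
    proof (rule null_set_of_compact_subsets[OF E])
      fix K assume K: "compact K" "K \<subseteq> ?E"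
      note d = dual_bound_compact[OF \<beta> gm gi W bound K(1)]
      have Ks: "K \<in> sets lebesgue" using K(1) by (simp add: borel_compact)
      have i2: "integrable lebesgue (\<lambda>x. of_bool (x \<in> K) * W x)"
        using d(2) integrable_completion[OF borel_measurable_integrable[OF d(2)]] by simp
      let ?F = "\<lambda>x. Re (cis r * (g x * of_bool (x \<in> K))) - of_bool (x \<in> K) * W x"
      have i0: "integrable lebesgue (\<lambda>x. cis r * (g x * of_bool (x \<in> K)))"
        by (rule integrable_mult_right) (rule d(1))
      have i1: "integrable lebesgue (\<lambda>x. Re (cis r * (g x * of_bool (x \<in> K))))"
        by (rule integrable_Re[OF i0])
      have i3: "integrable lebesgue ?F" by (rule Bochner_Integration.integrable_diff[OF i1 i2])
      have "(\<integral>x. ?F x \<partial>lebesgue) = Re (cis r * (\<integral>x. g x * of_bool (x \<in> K) \<partial>lebesgue)) - (\<integral>x. of_bool (x \<in> K) * W x \<partial>lebesgue)"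
        by (simp only: Bochner_Integration.integral_diff[OF i1 i2] integral_Re[OF i0] integral_mult_right_zero)
      also have "(\<integral>x. of_bool (x \<in> K) * W x \<partial>lebesgue) = (\<integral>x. of_bool (x \<in> K) * W x \<partial>lborel)"
        by (rule integral_completion[OF borel_measurable_integrable[OF d(2)]])
      also have "Re (cis r * (\<integral>x. g x * of_bool (x \<in> K) \<partial>lebesgue)) \<le> norm (\<integral>x. g x * of_bool (x \<in> K) \<partial>lebesgue)"
        by (rule order_trans[OF complex_Re_le_cmod]) (simp add: norm_mult)
      finally have le: "(\<integral>x. ?F x \<partial>lebesgue) \<le> 0" using d(3) by simp
      have F0: "0 \<le> ?F x" for x using K(2) by (cases "x \<in> K") (auto simp: less_imp_le)
      then have "(\<integral>x. ?F x \<partial>lebesgue) = 0" using le by (intro antisym integral_nonneg_AE AE_I2) auto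
      then have "AE x in lebesgue. ?F x = 0"
        using integral_nonneg_eq_0_iff_AE[OF i3 AE_I2] F0 by blast
      then have "AE x in lebesgue. x \<notin> K"
        by eventually_elim (use K(2) in auto)
      then show "emeasure lebesgue K = 0"
        using AE_iff_measurable[OF Ks, of "\<lambda>x. x \<notin> K"] by auto
    qed
    then show ?thesis using AE_iff_measurable[OF E, of "\<lambda>x. Re (cis r * g x) \<le> W x"] by (auto simp: not_le)
  qed
  \<comment> \<open>Countably many phases keep the exceptional set null; continuity in
    \<open>r\<close> passes from rational phases to the optimal one,
    \<open>- Arg (g x)\<close>.\<close>
  then have "AE x in lebesgue. \<forall>r\<in>\<rat>. Re (cis r * g x) \<le> W x"
    by (intro AE_ball_countable[THEN iffD2] countable_rat) blast
  then show ?thesis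
  proof eventually_elim
    case (elim x)
    show ?case
    proof (rule ccontr)
      assume less: "\<not> norm (g x) \<le> W x"
      have "isCont (\<lambda>r. Re (cis r * g x)) (- Arg (g x))" unfolding isCont_def cis_conv_exp by (intro tendsto_intros)
      moreover have "Re (cis (- Arg (g x)) * g x) > W x"
      proof -
        have "cis (- Arg (g x)) * g x = of_real (norm (g x)) * (cis (- Arg (g x)) * cis (Arg (g x)))"
          by (metis mult.left_commute rcis_cmod_Arg rcis_def)
        then show ?thesis using less by (simp add: cis_mult)
      qed
      ultimately have "\<forall>\<^sub>F r in at (- Arg (g x)). Re (cis r * g x) > W x"
        unfolding isCont_def by (rule order_tendstoD(1))
      then obtain d where d: "d > 0" "\<And>r. r \<noteq> - Arg (g x) \<Longrightarrow> dist r (- Arg (g x)) < d \<Longrightarrow> Re (cis r * g x) > W x"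
        unfolding eventually_at by auto
      obtain r where "r \<in> \<rat>" "- Arg (g x) < r" "r < - Arg (g x) + d"
        using Rats_dense_in_real[of "- Arg (g x)" "- Arg (g x) + d"] d(1) by auto
      then show False using d(2)[of r] elim by (force simp: dist_real_def)
    qed
  qed
qed

section \<open>Lorentz quasi-norms\<close>

lemma epowr_top [simp]: "epowr \<infinity> a = \<infinity>" "epowr top a = top"
  by (simp_all add: epowr_def)

lemma epowr_ennreal: "0 \<le> x \<Longrightarrow> epowr (ennreal x) a = ennreal (x powr a)"
  by (simp add: epowr_def)

lemma epowr_0 [simp]: "epowr 0 a = 0"
  by (simp add: epowr_def)

lemma epowr_mono: "x \<le> y \<Longrightarrow> 0 \<le> a \<Longrightarrow> epowr x a \<le> epowr y a"
  by (cases x; cases y) (auto simp: epowr_ennreal top_unique powr_mono2 intro!: ennreal_leI)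

lemma epowr_less_top_iff: "epowr x a < \<infinity> \<longleftrightarrow> x < \<infinity>"
  by (cases x) (auto simp: epowr_ennreal)

lemma epowr_mult: "0 < a \<Longrightarrow> epowr (x * y) a = epowr x a * epowr y a"
proof (cases x; cases y)
  fix r s assume "x = ennreal r" "0 \<le> r" "y = ennreal s" "0 \<le> s"
  then show "epowr (x * y) a = epowr x a * epowr y a"
    by (simp add: epowr_ennreal ennreal_mult[symmetric] powr_mult)
qed (auto simp: ennreal_mult_top ennreal_top_mult epowr_ennreal)

lemma epowr_epowr: "epowr (epowr x a) b = epowr x (a * b)"
  by (cases x) (auto simp: epowr_ennreal powr_powr)

lemma epowr_1 [simp]: "epowr x 1 = x"
  by (cases x) (auto simp: epowr_ennreal)

lemma epowr_add: "0 < a \<Longrightarrow> 0 < b \<Longrightarrow> epowr x (a + b) = epowr x a * epowr x b"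
  by (cases x) (auto simp: epowr_ennreal powr_add ennreal_mult ennreal_top_mult)

lemma epowr_inverse: "0 < a \<Longrightarrow> epowr (epowr x a) (1 / a) = x"
  by (simp add: epowr_epowr)

lemma epowr_measurable [measurable (raw)]:
  assumes "f \<in> borel_measurable M" shows "(\<lambda>x. epowr (f x) a) \<in> borel_measurable M"
proof -
  have "(\<lambda>y. epowr y a) \<in> borel_measurable borel"
    unfolding epowr_def
  proof (rule measurable_If)
    have "(\<lambda>y. enn2real y powr a) \<in> borel_measurable borel"
      by (intro powr_real_measurable borel_measurable_const) simp
    then show "(\<lambda>y. ennreal (enn2real y powr a)) \<in> borel_measurable borel" by simp
  qed simp_all
  from measurable_compose[OF assms this] show ?thesis .
qed

text \<open>Separated from the rearrangement so that majorants such as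
  \<open>min (t powr (- 1 / p0)) c\<close> can be inserted and rescaled in \<open>t\<close>
  directly.\<close>

definition lorentz_functional :: "real \<Rightarrow> ennreal \<Rightarrow> (real \<Rightarrow> ennreal) \<Rightarrow> ennreal" where
  "lorentz_functional p r h =
     (if r = \<infinity> then (SUP t\<in>{0<..}. ennreal (t powr (1 / p)) * h t)
      else epowr
        (ennreal (enn2real r / p) *
          (\<integral>\<^sup>+t\<in>{0<..}. epowr (ennreal (t powr (1 / p)) * h t) (enn2real r) * ennreal (1 / t) \<partial>lborel))
        (1 / enn2real r))"

lemma lorentz_qnorm_eq: "lorentz_qnorm p r f = lorentz_functional p r (rearrangement f)"
  by (simp add: lorentz_qnorm_def lorentz_functional_def)

lemma lorentz_functional_mono:
  assumes "\<And>t. 0 < t \<Longrightarrow> h t \<le> k t"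
  shows "lorentz_functional p r h \<le> lorentz_functional p r k"
proof (cases "r = \<infinity>")
  case True
  have "(SUP t\<in>{0<..}. ennreal (t powr (1 / p)) * h t) \<le> (SUP t\<in>{0<..}. ennreal (t powr (1 / p)) * k t)"
    by (rule SUP_subset_mono) (auto intro!: mult_left_mono assms)
  then show ?thesis using True by (simp add: lorentz_functional_def)
next
  case False
  have "epowr (ennreal (t powr (1 / p)) * h t) (enn2real r) * ennreal (1 / t) * indicator {0<..} t
      \<le> epowr (ennreal (t powr (1 / p)) * k t) (enn2real r) * ennreal (1 / t) * indicator {0<..} t" for t
    by (cases "0 < t") (auto intro!: epowr_mono mult_left_mono mult_right_mono assms)
  then show ?thesis
    using False unfolding lorentz_functional_def
    by (auto intro!: epowr_mono mult_left_mono nn_integral_mono)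
qed

lemma lorentz_functional_cmult:
  assumes [measurable]: "h \<in> borel_measurable borel" and r: "0 < r"
  shows "lorentz_functional p r (\<lambda>t. c * h t) = c * lorentz_functional p r h"
proof (cases "r = \<infinity>")
  case True
  then show ?thesis unfolding lorentz_functional_def
    by (simp add: SUP_mult_left_ennreal[symmetric] mult.left_commute)
next
  case False
  let ?r = "enn2real r"
  have r': "0 < ?r" using r False by (simp add: enn2real_positive_iff less_top)
  have "(\<integral>\<^sup>+t\<in>{0<..}. epowr (ennreal (t powr (1 / p)) * (c * h t)) ?r * ennreal (1 / t) \<partial>lborel)
      = (\<integral>\<^sup>+t. epowr c ?r * (epowr (ennreal (t powr (1 / p)) * h t) ?r * ennreal (1 / t) * indicator {0<..} t) \<partial>lborel)"
    by (intro nn_integral_cong) (simp add: epowr_mult[OF r'] mult_ac)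
  also have "\<dots> = epowr c ?r * (\<integral>\<^sup>+t\<in>{0<..}. epowr (ennreal (t powr (1 / p)) * h t) ?r * ennreal (1 / t) \<partial>lborel)"
    by (rule nn_integral_cmult) measurable
  finally show ?thesis
    using False r' unfolding lorentz_functional_def
    by (simp add: mult.left_commute[of _ "epowr c _"] epowr_mult epowr_epowr)
qed

text \<open>The measure \<open>dt / t\<close> is invariant under dilation, so only the factor
  \<open>t powr (1 / p)\<close> responds to the substitution.\<close>

lemma lorentz_functional_dilate:
  assumes [measurable]: "h \<in> borel_measurable borel" and r: "0 < r" and k: "0 < k"
  shows "lorentz_functional p r (\<lambda>t. h (k * t)) = ennreal (k powr (- 1 / p)) * lorentz_functional p r h"
proof (cases "r = \<infinity>")
  case True
  have img: "(\<lambda>t. k * t) ` {0<..} = {0<..}"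
  proof (intro equalityI subsetI)
    fix t :: real assume "t \<in> {0<..}"
    then show "t \<in> (\<lambda>t. k * t) ` {0<..}" using k by (intro image_eqI[of _ _ "t / k"]) auto
  qed (use k in auto)
  have "ennreal (k powr (- 1 / p)) * (SUP t\<in>{0<..}. ennreal (t powr (1 / p)) * h t) = (SUP t\<in>{0<..}. ennreal (k powr (- 1 / p)) * (ennreal (t powr (1 / p)) * h t))"
    by (rule SUP_mult_left_ennreal)
  also have "\<dots> = (SUP t\<in>(\<lambda>t. k * t) ` {0<..}. ennreal (k powr (- 1 / p)) * (ennreal (t powr (1 / p)) * h t))"
    unfolding img ..
  also have "\<dots> = (SUP t\<in>{0<..}. ennreal (t powr (1 / p)) * h (k * t))"
    unfolding image_image
  proof (intro SUP_cong refl)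
    fix t :: real assume "t \<in> {0<..}"
    then have "k powr (- 1 / p) * (k * t) powr (1 / p) = t powr (1 / p)"
      using k by (simp add: powr_mult powr_minus)
    then show "ennreal (k powr (- 1 / p)) * (ennreal ((k * t) powr (1 / p)) * h (k * t)) = ennreal (t powr (1 / p)) * h (k * t)"
      by (simp add: mult.assoc[symmetric] ennreal_mult[symmetric])
  qed
  finally show ?thesis using True by (simp add: lorentz_functional_def)
next
  case False
  let ?r = "enn2real r"
  have r': "0 < ?r" using r False by (simp add: enn2real_positive_iff less_top)
  let ?G = "\<lambda>h t. epowr (ennreal (t powr (1 / p)) * h t) ?r * ennreal (1 / t) * indicator {0<..} t"
  have "(\<integral>\<^sup>+t. ?G h t \<partial>lborel) = \<bar>k\<bar> * (\<integral>\<^sup>+t. ?G h (0 + k * t) \<partial>lborel)"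
    by (rule nn_integral_real_affine) (use k in auto)
  also have "\<dots> = (\<integral>\<^sup>+t. \<bar>k\<bar> * ?G h (0 + k * t) \<partial>lborel)"
    by (rule nn_integral_cmult[symmetric]) measurable
  also have "\<dots> = (\<integral>\<^sup>+t. ennreal (k powr (?r / p)) * ?G (\<lambda>t. h (k * t)) t \<partial>lborel)"
  proof (intro nn_integral_cong)
    fix t :: real
    show "ennreal \<bar>k\<bar> * ?G h (0 + k * t) = ennreal (k powr (?r / p)) * ?G (\<lambda>t. h (k * t)) t"
    proof (cases "t > 0")
      case True
      have "(k * t) powr (1 / p) = k powr (1 / p) * t powr (1 / p)" using k True by (simp add: powr_mult)
      then have "epowr (ennreal ((k * t) powr (1 / p)) * h (k * t)) ?r = ennreal (k powr (?r / p)) * epowr (ennreal (t powr (1 / p)) * h (k * t)) ?r"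
        by (simp add: ennreal_mult mult.assoc epowr_mult[OF r'] epowr_ennreal powr_powr)
      moreover have "ennreal \<bar>k\<bar> * ennreal (1 / (k * t)) = ennreal (1 / t)"
        using k True by (simp add: ennreal_mult[symmetric])
      ultimately show ?thesis using True k by (simp add: mult.left_commute mult.assoc indicator_def) (metis mult.left_commute)
    qed (use k in \<open>auto simp: indicator_def zero_less_mult_iff\<close>)
  qed
  also have "\<dots> = ennreal (k powr (?r / p)) * (\<integral>\<^sup>+t. ?G (\<lambda>t. h (k * t)) t \<partial>lborel)"
    by (rule nn_integral_cmult) measurable
  finally have "ennreal (k powr (- (?r / p))) * (\<integral>\<^sup>+t. ?G h t \<partial>lborel) = ennreal (k powr (- (?r / p))) * (ennreal (k powr (?r / p)) * (\<integral>\<^sup>+t. ?G (\<lambda>t. h (k * t)) t \<partial>lborel))"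
    by simp
  also have "\<dots> = (\<integral>\<^sup>+t. ?G (\<lambda>t. h (k * t)) t \<partial>lborel)"
    using k by (simp add: mult.assoc[symmetric] ennreal_mult[symmetric] powr_add[symmetric])
  finally have eq: "(\<integral>\<^sup>+t. ?G (\<lambda>t. h (k * t)) t \<partial>lborel) = ennreal (k powr (- (?r / p))) * (\<integral>\<^sup>+t. ?G h t \<partial>lborel)" ..
  have "lorentz_functional p r (\<lambda>t. h (k * t)) = epowr (ennreal (?r / p) * (\<integral>\<^sup>+t. ?G (\<lambda>t. h (k * t)) t \<partial>lborel)) (1 / ?r)"
    using False by (simp add: lorentz_functional_def)
  also have "\<dots> = epowr (ennreal (k powr (- (?r / p)))) (1 / ?r) * epowr (ennreal (?r / p) * (\<integral>\<^sup>+t. ?G h t \<partial>lborel)) (1 / ?r)"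
    unfolding eq using r' by (simp add: mult.left_commute[of _ "ennreal (k powr _)"] epowr_mult[of "1 / ?r"])
  also have "epowr (ennreal (k powr (- (?r / p)))) (1 / ?r) = ennreal (k powr (- 1 / p))"
    using r' by (simp add: epowr_ennreal powr_powr)
  finally show ?thesis using False by (simp add: lorentz_functional_def)
qed

text \<open>For nonincreasing \<open>h\<close> the value at \<open>t\<close> is at most each of the
  values on \<open>[t/2, t]\<close>, an interval whose \<open>dt / t\<close> measure does not depend
  on \<open>t\<close>. The integral over this interval alone controls the term of the supremum at
  \<open>t\<close>.\<close>

lemma lorentz_weak_le:
  assumes p: "0 < p" and r: "0 < r"
  shows "\<exists>C. \<forall>h. antimono_on {0<..} h \<longrightarrow> h \<in> borel_measurable borel \<longrightarrow> lorentz_functional p \<infinity> h \<le> ennreal C * lorentz_functional p r h"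
proof (cases "r = \<infinity>")
  case True
  then show ?thesis by (intro exI[of _ 1]) simp
next
  case False
  let ?r = "enn2real r"
  have r': "0 < ?r" using r False by (simp add: enn2real_positive_iff less_top)
  \<comment> \<open>On \<open>[t/2, t]\<close> the integrand is at least
    \<open>2^(-r/p) (t^(1/p) h(t))^r / t\<close>; the length \<open>t/2\<close> and the prefactor
    \<open>r/p\<close> supply the rest of the constant.\<close>
  define c where "c = ?r / (2 * p) * 2 powr (- (?r / p))"
  have c: "c > 0" using r' p by (simp add: c_def)
  have "lorentz_functional p \<infinity> h \<le> ennreal (c powr (- (1 / ?r))) * lorentz_functional p r h"
    if h: "antimono_on {0<..} h" and [measurable]: "h \<in> borel_measurable borel" for h
  proof -
    let ?I = "\<integral>\<^sup>+t\<in>{0<..}. epowr (ennreal (t powr (1 / p)) * h t) ?r * ennreal (1 / t) \<partial>lborel"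
    have "ennreal (t powr (1 / p)) * h t \<le> ennreal (c powr (- (1 / ?r))) * lorentz_functional p r h" if t: "0 < t" for t
    proof -
      let ?x = "ennreal (t powr (1 / p)) * h t"
      have "ennreal c * epowr ?x ?r = ennreal (?r / p) * (ennreal (2 powr (- (?r / p))) * epowr ?x ?r * ennreal (1 / t) * emeasure lborel {t/2..t})"
      proof -
        have "ennreal (1 / t) * emeasure lborel {t/2..t} = ennreal (1 / 2)"
          using t by (simp add: ennreal_mult[symmetric])
        then have "ennreal (?r / p) * (ennreal (2 powr (- (?r / p))) * epowr ?x ?r * ennreal (1 / t) * emeasure lborel {t/2..t}) = ennreal (?r / p) * (ennreal (2 powr (- (?r / p))) * epowr ?x ?r * ennreal (1 / 2))"
          by (simp only: mult.assoc)
        also have "\<dots> = (ennreal (?r / p) * ennreal (2 powr (- (?r / p))) * ennreal (1 / 2)) * epowr ?x ?r" by (simp only: mult_ac)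
        also have "ennreal (?r / p) * ennreal (2 powr (- (?r / p))) * ennreal (1 / 2) = ennreal c"
          using r' p by (simp add: c_def ennreal_mult[symmetric] del: ennreal_half)
        finally show ?thesis ..
      qed
      also have "\<dots> = ennreal (?r / p) * (\<integral>\<^sup>+s. ennreal (2 powr (- (?r / p))) * epowr ?x ?r * ennreal (1 / t) * indicator {t/2..t} s \<partial>lborel)"
        by (simp add: nn_integral_cmult_indicator)
      also have "\<dots> \<le> ennreal (?r / p) * ?I"
      proof (intro mult_left_mono nn_integral_mono)
        fix s :: real
        show "ennreal (2 powr (- (?r / p))) * epowr ?x ?r * ennreal (1 / t) * indicator {t/2..t} s \<le> epowr (ennreal (s powr (1 / p)) * h s) ?r * ennreal (1 / s) * indicator {0<..} s"
        proof (cases "s \<in> {t/2..t}")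
          case True
          then have s: "0 < s" "t / 2 \<le> s" "s \<le> t" using t by auto
          have "(t / 2) powr (1 / p) \<le> s powr (1 / p)" using s t p by (intro powr_mono2) auto
          then have "ennreal ((t / 2) powr (1 / p)) * h t \<le> ennreal (s powr (1 / p)) * h s"
            using s t by (intro mult_mono ennreal_leI monotone_onD[OF h]) auto
          then have "epowr (ennreal ((t / 2) powr (1 / p)) * h t) ?r \<le> epowr (ennreal (s powr (1 / p)) * h s) ?r"
            using r' by (intro epowr_mono) auto
          moreover have "epowr (ennreal ((t / 2) powr (1 / p)) * h t) ?r = ennreal (2 powr (- (?r / p))) * epowr ?x ?r"
          proof -
            have "(t / 2) powr (1 / p) = 2 powr (- (1 / p)) * t powr (1 / p)" using t by (simp add: powr_divide powr_minus field_simps)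
            then have "ennreal ((t / 2) powr (1 / p)) * h t = ennreal (2 powr (- (1 / p))) * ?x"
              by (simp add: ennreal_mult mult.assoc)
            then show ?thesis by (simp add: epowr_mult[OF r'] epowr_ennreal powr_powr)
          qed
          moreover have "ennreal (1 / t) \<le> ennreal (1 / s)" using s t by (intro ennreal_leI) (simp add: frac_le)
          ultimately have "ennreal (2 powr (- (?r / p))) * epowr ?x ?r * ennreal (1 / t) \<le> epowr (ennreal (s powr (1 / p)) * h s) ?r * ennreal (1 / s)"
            by (metis mult_mono zero_le)
          then show ?thesis using True s by simp
        qed simp
      qed simp
      finally have "epowr (ennreal c * epowr ?x ?r) (1 / ?r) \<le> epowr (ennreal (?r / p) * ?I) (1 / ?r)"
        using r' by (intro epowr_mono) auto
      moreover have "epowr (ennreal c * epowr ?x ?r) (1 / ?r) = ennreal (c powr (1 / ?r)) * ?x"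
        using r' c by (simp add: epowr_mult[of "1 / ?r"] epowr_inverse epowr_ennreal)
      moreover have "epowr (ennreal (?r / p) * ?I) (1 / ?r) = lorentz_functional p r h"
        using False by (simp add: lorentz_functional_def)
      ultimately have "ennreal (c powr (1 / ?r)) * ?x \<le> lorentz_functional p r h" by simp
      then have "ennreal (c powr (- (1 / ?r))) * (ennreal (c powr (1 / ?r)) * ?x) \<le> ennreal (c powr (- (1 / ?r))) * lorentz_functional p r h"
        by (intro mult_left_mono) auto
      then show ?thesis
        using c by (simp add: mult.assoc[symmetric] ennreal_mult[symmetric] powr_add[symmetric])
    qed
    then show ?thesis unfolding lorentz_functional_def[of p \<infinity>] if_P[OF refl] by (intro SUP_least) auto
  qed
  then show ?thesis by blast
qed

text \<open>With \<open>u(t) = t^(1/p) h(t)\<close>, split \<open>u^r1 = u^(r1 - r0) u^r0\<close>;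
  the first factor is bounded by the weak quasi-norm, which \<open>lorentz_weak_le\<close> controls
  by the quasi-norm with exponent \<open>r0\<close>.\<close>

lemma lorentz_second_exponent_le:
  assumes p: "0 < p" and r0: "0 < r0" and r01: "r0 \<le> r1"
  shows "\<exists>C. \<forall>h. antimono_on {0<..} h \<longrightarrow> h \<in> borel_measurable borel \<longrightarrow> lorentz_functional p r1 h \<le> ennreal C * lorentz_functional p r0 h"
proof -
  obtain C where C: "\<And>h. antimono_on {0<..} h \<Longrightarrow> h \<in> borel_measurable borel \<Longrightarrow> lorentz_functional p \<infinity> h \<le> ennreal C * lorentz_functional p r0 h"
    using lorentz_weak_le[OF p r0] by blast
  show ?thesis
  proof (cases "r1 = \<infinity> \<or> r1 = r0")
    case True
    then show ?thesis using C by (metis ennreal_1 mult_1 order_refl)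
  next
    case False
    let ?r0 = "enn2real r0" and ?r1 = "enn2real r1"
    have fin: "r0 \<noteq> \<infinity>" "r1 \<noteq> \<infinity>" using False r01 by (auto simp: top_unique)
    have lt: "0 < ?r0" "?r0 < ?r1"
      using fin r0 r01 False by (cases r0; cases r1; simp)+
    have "lorentz_functional p r1 h \<le> ennreal ((?r1 / ?r0 * \<bar>C\<bar> powr (?r1 - ?r0)) powr (1 / ?r1)) * lorentz_functional p r0 h"
      if h: "antimono_on {0<..} h" and [measurable]: "h \<in> borel_measurable borel" for h
    proof -
      let ?A = "lorentz_functional p r0 h"
      define u where "u t = ennreal (t powr (1 / p)) * h t" for t
      have [measurable]: "u \<in> borel_measurable borel" unfolding u_def[abs_def] by measurable
      let ?I0 = "\<integral>\<^sup>+t\<in>{0<..}. epowr (u t) ?r0 * ennreal (1 / t) \<partial>lborel"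
      let ?I1 = "\<integral>\<^sup>+t\<in>{0<..}. epowr (u t) ?r1 * ennreal (1 / t) \<partial>lborel"
      have ut: "u t \<le> ennreal \<bar>C\<bar> * ?A" if "0 < t" for t
      proof -
        have "u t \<le> lorentz_functional p \<infinity> h"
          unfolding lorentz_functional_def u_def using that by (auto intro!: SUP_upper)
        also have "\<dots> \<le> ennreal C * ?A" by (rule C[OF h]) simp
        also have "\<dots> \<le> ennreal \<bar>C\<bar> * ?A" by (intro mult_right_mono ennreal_leI) auto
        finally show ?thesis .
      qed
      have A: "?A = epowr (ennreal (?r0 / p) * ?I0) (1 / ?r0)"
        using fin by (simp add: lorentz_functional_def u_def)
      have I0: "ennreal (?r0 / p) * ?I0 = epowr ?A ?r0" unfolding A using lt by (simp add: epowr_epowr)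
      have "?I1 \<le> (\<integral>\<^sup>+t. epowr (ennreal \<bar>C\<bar> * ?A) (?r1 - ?r0) * (epowr (u t) ?r0 * ennreal (1 / t) * indicator {0<..} t) \<partial>lborel)"
      proof (intro nn_integral_mono)
        fix t :: real
        show "epowr (u t) ?r1 * ennreal (1 / t) * indicator {0<..} t \<le> epowr (ennreal \<bar>C\<bar> * ?A) (?r1 - ?r0) * (epowr (u t) ?r0 * ennreal (1 / t) * indicator {0<..} t)"
        proof (cases "0 < t")
          case True
          have "epowr (u t) ?r1 = epowr (u t) (?r1 - ?r0) * epowr (u t) ?r0"
            using epowr_add[of "?r1 - ?r0" ?r0 "u t"] lt by simp
          also have "\<dots> \<le> epowr (ennreal \<bar>C\<bar> * ?A) (?r1 - ?r0) * epowr (u t) ?r0"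
            using lt True by (intro mult_right_mono epowr_mono ut) auto
          finally show ?thesis using True by (simp add: mult.assoc[symmetric] mult_right_mono)
        qed simp
      qed
      also have "\<dots> = epowr (ennreal \<bar>C\<bar> * ?A) (?r1 - ?r0) * ?I0"
        by (rule nn_integral_cmult) measurable
      finally have "ennreal (?r1 / p) * ?I1 \<le> ennreal (?r1 / p) * (epowr (ennreal \<bar>C\<bar> * ?A) (?r1 - ?r0) * ?I0)"
        by (intro mult_left_mono) auto
      also have "\<dots> = ennreal (?r1 / ?r0) * epowr (ennreal \<bar>C\<bar> * ?A) (?r1 - ?r0) * epowr ?A ?r0"
      proof -
        have "ennreal (?r1 / p) = ennreal (?r1 / ?r0) * ennreal (?r0 / p)"
          using lt p by (simp add: ennreal_mult[symmetric])
        then show ?thesis by (simp only: I0[symmetric] mult_ac)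
      qed
      also have "\<dots> = ennreal (?r1 / ?r0 * \<bar>C\<bar> powr (?r1 - ?r0)) * (epowr ?A (?r1 - ?r0) * epowr ?A ?r0)"
      proof -
        have "epowr (ennreal \<bar>C\<bar> * ?A) (?r1 - ?r0) = ennreal (\<bar>C\<bar> powr (?r1 - ?r0)) * epowr ?A (?r1 - ?r0)"
          using lt by (simp add: epowr_mult epowr_ennreal)
        moreover have "ennreal (?r1 / ?r0 * \<bar>C\<bar> powr (?r1 - ?r0)) = ennreal (?r1 / ?r0) * ennreal (\<bar>C\<bar> powr (?r1 - ?r0))"
          using lt by (intro ennreal_mult) auto
        ultimately show ?thesis by (simp only: mult_ac)
      qed
      also have "epowr ?A (?r1 - ?r0) * epowr ?A ?r0 = epowr ?A ?r1"
        using epowr_add[of "?r1 - ?r0" ?r0 ?A] lt by simp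
      finally have "epowr (ennreal (?r1 / p) * ?I1) (1 / ?r1) \<le> epowr (ennreal (?r1 / ?r0 * \<bar>C\<bar> powr (?r1 - ?r0)) * epowr ?A ?r1) (1 / ?r1)"
        using lt by (intro epowr_mono) auto
      also have "\<dots> = ennreal ((?r1 / ?r0 * \<bar>C\<bar> powr (?r1 - ?r0)) powr (1 / ?r1)) * ?A"
        using lt by (simp add: epowr_mult epowr_inverse epowr_ennreal)
      finally show ?thesis using fin by (simp add: lorentz_functional_def[of p r1] u_def)
    qed
    then show ?thesis by blast
  qed
qed

section \<open>Truncated powers in the Lorentz functional\<close>

lemma nn_integral_powr_near_0:
  assumes "a > -1" "0 \<le> c"
  shows "(\<integral>\<^sup>+t. indicator {0..c} t * ennreal (t powr a) \<partial>lborel) = ennreal (c powr (a + 1) / (a + 1))"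
proof -
  have "(\<integral>\<^sup>+t. ennreal (indicator {0..c} t * t powr a) \<partial>lborel) = ennreal (c powr (a + 1) / (a + 1))"
    by (rule nn_integral_has_integral_lebesgue[OF _ has_integral_powr_from_0[OF assms]]) simp
  then show ?thesis by (simp add: ennreal_mult ennreal_indicator)
qed

lemma nn_integral_powr_near_infinity:
  assumes "e < -1" "0 < c"
  shows "(\<integral>\<^sup>+t. indicator {c..} t * ennreal (t powr e) \<partial>lborel) = ennreal (- (c powr (e + 1)) / (e + 1))"
proof -
  have "(\<integral>\<^sup>+t. ennreal (indicator {c..} t * t powr e) \<partial>lborel) = ennreal (- (c powr (e + 1)) / (e + 1))"
    by (rule nn_integral_has_integral_lebesgue[OF _ has_integral_powr_to_inf[OF assms]]) simp
  then show ?thesis by (simp add: ennreal_mult ennreal_indicator)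
qed

lemma ennreal_powr_minus_one: "ennreal (t powr a) * ennreal (t powr (- 1)) = ennreal (t powr (a - 1))"
  by (metis add_uminus_conv_diff ennreal_mult' powr_add powr_ge_zero)

text \<open>Near zero the cap \<open>c\<close> leaves the power \<open>t^(r/p1 - 1)\<close>; near
  infinity the other bound leaves \<open>t^(r/p1 - r/p0 - 1)\<close>, which is integrable because
  \<open>p0 < p1\<close>. The case \<open>r = \<infinity>\<close> is reduced to
  \<open>r = 1\<close>.\<close>

lemma lorentz_functional_min_finite:
  assumes p: "0 < p0" "p0 < p1" and r: "0 < r" and c: "0 \<le> c"
  shows "lorentz_functional p1 r (\<lambda>t. ennreal (min (t powr (- 1 / p0)) c)) < \<infinity>"
proof -
  let ?h = "\<lambda>t. ennreal (min (t powr (- 1 / p0)) c)"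
  have fin: "lorentz_functional p1 r ?h < \<infinity>" if r: "0 < r" "r \<noteq> \<infinity>" for r
  proof -
    let ?r = "enn2real r"
    have r': "0 < ?r" using r by (simp add: enn2real_positive_iff less_top)
    have b: "?r / p1 - ?r / p0 < 0" using p r' by (simp add: frac_less2)
    let ?f1 = "\<lambda>t. ennreal (c powr ?r) * (indicator {0..1} t * ennreal (t powr (?r / p1 - 1)))"
    let ?f2 = "\<lambda>t. indicator {1..} t * ennreal (t powr (?r / p1 - ?r / p0 - 1))"
    have "(\<integral>\<^sup>+t\<in>{0<..}. epowr (ennreal (t powr (1 / p1)) * ?h t) ?r * ennreal (1 / t) \<partial>lborel) \<le> (\<integral>\<^sup>+t. ?f1 t + ?f2 t \<partial>lborel)"
    proof (intro nn_integral_mono)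
      fix t :: real
      show "epowr (ennreal (t powr (1 / p1)) * ?h t) ?r * ennreal (1 / t) * indicator {0<..} t \<le> ?f1 t + ?f2 t"
      proof (cases "0 < t")
        case t: True
        have ti: "1 / t = t powr (- 1)" using t by (simp add: powr_minus field_simps)
        show ?thesis
        proof (cases "t \<le> 1")
          case True
          have "epowr (ennreal (t powr (1 / p1)) * ?h t) ?r \<le> epowr (ennreal (t powr (1 / p1)) * ennreal c) ?r"
            using r' by (intro epowr_mono mult_left_mono ennreal_leI) auto
          also have "\<dots> = ennreal (c powr ?r) * ennreal (t powr (?r / p1))"
            using r' c by (simp add: epowr_mult epowr_ennreal powr_powr mult.commute)
          finally have "epowr (ennreal (t powr (1 / p1)) * ?h t) ?r * ennreal (1 / t) \<le> ennreal (c powr ?r) * (ennreal (t powr (?r / p1)) * ennreal (t powr (- 1)))"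
            unfolding ti by (metis mult.assoc mult_right_mono zero_le)
          also have "ennreal (t powr (?r / p1)) * ennreal (t powr (- 1)) = ennreal (t powr (?r / p1 - 1))"
            by (rule ennreal_powr_minus_one)
          finally show ?thesis using True t by (simp add: add_increasing2)
        next
          case False
          have "epowr (ennreal (t powr (1 / p1)) * ?h t) ?r \<le> epowr (ennreal (t powr (1 / p1)) * ennreal (t powr (- 1 / p0))) ?r"
            using r' by (intro epowr_mono mult_left_mono ennreal_leI) auto
          also have "\<dots> = ennreal (t powr (?r / p1 - ?r / p0))"
            using r' by (simp add: epowr_mult epowr_ennreal powr_powr ennreal_mult[symmetric] powr_add[symmetric] left_diff_distrib)
          finally have "epowr (ennreal (t powr (1 / p1)) * ?h t) ?r * ennreal (1 / t) \<le> ennreal (t powr (?r / p1 - ?r / p0)) * ennreal (t powr (- 1))"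
            unfolding ti by (intro mult_right_mono) auto
          also have "\<dots> = ennreal (t powr (?r / p1 - ?r / p0 - 1))"
            by (rule ennreal_powr_minus_one)
          finally show ?thesis using False t by (simp add: add_increasing)
        qed
      qed simp
    qed
    also have "\<dots> = ennreal (c powr ?r) * (\<integral>\<^sup>+t. indicator {0..1} t * ennreal (t powr (?r / p1 - 1)) \<partial>lborel) + (\<integral>\<^sup>+t. ?f2 t \<partial>lborel)"
      by (subst nn_integral_add) (auto simp: nn_integral_cmult)
    also have "\<dots> < \<infinity>"
      using b r' p by (subst nn_integral_powr_near_0, simp, simp, subst nn_integral_powr_near_infinity)
        (auto simp: ennreal_mult_less_top)
    finally show ?thesis
      using r by (simp add: lorentz_functional_def epowr_less_top_iff[simplified] ennreal_mult_less_top)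
  qed
  show ?thesis
  proof (cases "r = \<infinity>")
    case True
    have "antimono_on {0<..} ?h"
      unfolding monotone_on_def using p by (auto intro!: ennreal_leI min.mono powr_mono2')
    moreover have "?h \<in> borel_measurable borel" by measurable
    moreover obtain C where "\<And>h. antimono_on {0<..} h \<Longrightarrow> h \<in> borel_measurable borel \<Longrightarrow> lorentz_functional p1 \<infinity> h \<le> ennreal C * lorentz_functional p1 1 h"
      using lorentz_second_exponent_le[of p1 1 \<infinity>] p by auto
    ultimately have "lorentz_functional p1 \<infinity> ?h \<le> ennreal C * lorentz_functional p1 1 ?h" by blast
    also have "\<dots> < \<infinity>" using fin[of 1] by (simp add: ennreal_mult_less_top)
    finally show ?thesis using True by simp
  qed (use fin r in auto)
qed

text \<open>Rescaling \<open>t\<close> by \<open>L\<close> reduces every \<open>L\<close> to the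
  fixed profile \<open>min (t powr (- 1 / p0)) c\<close>, so the constant depends on neither
  \<open>A\<close> nor \<open>L\<close>. For the pieces, \<open>L\<close> will be
  \<open>2^(k d)\<close>.\<close>

lemma lorentz_functional_interpolation:
  assumes p: "0 < p0" "p0 < p1" and r: "0 < r" and c: "0 \<le> c"
  shows "\<exists>C\<ge>0. \<forall>A\<ge>0. \<forall>L>0. lorentz_functional p1 r (\<lambda>t. ennreal (A * min (t powr (- 1 / p0)) (c * L powr (1 / p0)))) \<le> ennreal (C * A * L powr (1 / p0 - 1 / p1))"
proof -
  let ?h = "\<lambda>t. ennreal (min (t powr (- 1 / p0)) c)"
  define C where "C = enn2real (lorentz_functional p1 r ?h)"
  have C: "lorentz_functional p1 r ?h = ennreal C"
    unfolding C_def using lorentz_functional_min_finite[OF assms] by simp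
  have "lorentz_functional p1 r (\<lambda>t. ennreal (A * min (t powr (- 1 / p0)) (c * L powr (1 / p0)))) \<le> ennreal (C * A * L powr (1 / p0 - 1 / p1))"
    if A: "A \<ge> 0" and L: "L > 0" for A L
  proof -
    have "lorentz_functional p1 r (\<lambda>t. ennreal (A * min (t powr (- 1 / p0)) (c * L powr (1 / p0)))) \<le> lorentz_functional p1 r (\<lambda>t. ennreal (A * L powr (1 / p0)) * ?h (L * t))"
    proof (rule lorentz_functional_mono)
      fix t :: real assume t: "0 < t"
      have "t powr (- 1 / p0) = L powr (1 / p0) * (L * t) powr (- 1 / p0)"
        using L t by (simp add: powr_mult powr_minus)
      then have "min (t powr (- 1 / p0)) (c * L powr (1 / p0)) = L powr (1 / p0) * min ((L * t) powr (- 1 / p0)) c"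
        by (simp add: min_mult_distrib_left mult.commute)
      then show "ennreal (A * min (t powr (- 1 / p0)) (c * L powr (1 / p0))) \<le> ennreal (A * L powr (1 / p0)) * ?h (L * t)"
        using A c by (simp add: ennreal_mult[symmetric] mult.assoc)
    qed
    also have "\<dots> = ennreal (A * L powr (1 / p0)) * lorentz_functional p1 r (\<lambda>t. ?h (L * t))"
      by (rule lorentz_functional_cmult[OF _ r]) measurable
    also have "lorentz_functional p1 r (\<lambda>t. ?h (L * t)) = ennreal (L powr (- 1 / p1)) * lorentz_functional p1 r ?h"
      by (rule lorentz_functional_dilate[OF _ r L]) measurable
    also have "ennreal (A * L powr (1 / p0)) * (ennreal (L powr (- 1 / p1)) * lorentz_functional p1 r ?h) = ennreal (C * A * L powr (1 / p0 - 1 / p1))"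
      unfolding C using A by (simp add: ennreal_mult[symmetric] powr_diff powr_minus C_def field_simps)
    finally show ?thesis .
  qed
  then show ?thesis by (intro exI[of _ C]) (auto simp: C_def)
qed

section \<open>Estimates for rearrangements\<close>

lemma rearrangement_le: "0 \<le> \<alpha> \<Longrightarrow> emeasure lebesgue {x. norm (f x) > \<alpha>} \<le> ennreal t \<Longrightarrow> rearrangement f t \<le> ennreal \<alpha>"
  unfolding rearrangement_def by (rule INF_lower) simp

lemma level_set_lebesgue:
  "f \<in> borel_measurable lebesgue \<Longrightarrow> {x. norm (f x) > \<alpha>} \<in> sets lebesgue"
  for f :: "'a::euclidean_space \<Rightarrow> complex"
proof -
  assume "f \<in> borel_measurable lebesgue"
  then have "(\<lambda>x. norm (f x)) \<in> borel_measurable lebesgue" by simp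
  then show ?thesis using borel_measurable_less[of "\<lambda>_. \<alpha>" lebesgue "\<lambda>x. norm (f x)"] by simp
qed

text \<open>Any \<alpha> below \<open>c\<close> has a level set containing \<open>A\<close>, hence
  of measure above \<open>t\<close>, and so does not compete in the infimum.\<close>

lemma rearrangement_ge:
  fixes f :: "'a::euclidean_space \<Rightarrow> complex"
  assumes f: "f \<in> borel_measurable lebesgue" and A: "emeasure lebesgue A > ennreal t" "\<And>x. x \<in> A \<Longrightarrow> norm (f x) \<ge> c"
  shows "ennreal c \<le> rearrangement f t"
  unfolding rearrangement_def
proof (rule INF_greatest)
  fix \<alpha> assume \<alpha>: "\<alpha> \<in> {\<alpha>. 0 \<le> \<alpha> \<and> emeasure lebesgue {x. \<alpha> < cmod (f x)} \<le> ennreal t}"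
  show "ennreal c \<le> ennreal \<alpha>"
  proof (rule ccontr)
    assume "\<not> ennreal c \<le> ennreal \<alpha>"
    then have "\<alpha> < c" using ennreal_leI not_le by blast
    then have "A \<subseteq> {x. \<alpha> < norm (f x)}" using A(2) by force
    then have "emeasure lebesgue A \<le> emeasure lebesgue {x. \<alpha> < norm (f x)}"
      using level_set_lebesgue[OF f] by (rule emeasure_mono)
    then show False using \<alpha> A(1) by auto
  qed
qed

lemma rearrangement_antimono: "s \<le> t \<Longrightarrow> rearrangement f t \<le> rearrangement f s"
  unfolding rearrangement_def by (rule INF_superset_mono) (auto intro: order_trans ennreal_leI)

lemma rearrangement_antimono_on: "antimono_on {0<..} (rearrangement f)"
  by (simp add: monotone_on_def rearrangement_antimono)

lemma rearrangement_measurable [measurable]: "rearrangement f \<in> borel_measurable borel"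
proof (rule borel_measurableI_greater)
  fix y
  have "is_interval {t. y < rearrangement f t}"
    unfolding is_interval_1 using rearrangement_antimono[of _ _ f] by (auto intro: less_le_trans)
  then show "{x \<in> space borel. y < rearrangement f x} \<in> sets borel"
    using real_interval_borel_measurable by simp
qed

lemma rearrangement_cong_AE:
  fixes f g :: "'a::euclidean_space \<Rightarrow> complex"
  assumes "f \<in> borel_measurable lebesgue" "g \<in> borel_measurable lebesgue" "AE x in lebesgue. f x = g x"
  shows "rearrangement f = rearrangement g"
proof -
  have "emeasure lebesgue {x. \<alpha> < norm (f x)} = emeasure lebesgue {x. \<alpha> < norm (g x)}" for \<alpha>
    using assms by (intro emeasure_eq_AE level_set_lebesgue) (auto elim!: eventually_mono)
  then show ?thesis by (simp add: rearrangement_def fun_eq_iff)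
qed

lemma rearrangement_dilate:
  fixes f :: "'a::euclidean_space \<Rightarrow> complex"
  assumes c: "c > 0"
  shows "rearrangement (\<lambda>x. f (c *\<^sub>R x)) t = rearrangement f (c ^ DIM('a) * t)"
proof -
  have "emeasure lebesgue {x. \<alpha> < norm (f (c *\<^sub>R x))} \<le> ennreal t \<longleftrightarrow> emeasure lebesgue {x. \<alpha> < norm (f x)} \<le> ennreal (c ^ DIM('a) * t)" for \<alpha>
  proof -
    let ?S = "{x. \<alpha> < norm (f (c *\<^sub>R x))}"
    have "{x. \<alpha> < norm (f x)} = (\<lambda>x. c *\<^sub>R x + 0) ` ?S"
    proof (intro equalityI subsetI)
      fix x assume "x \<in> {x. \<alpha> < norm (f x)}"
      then show "x \<in> (\<lambda>x. c *\<^sub>R x + 0) ` ?S" using c by (intro image_eqI[of _ _ "inverse c *\<^sub>R x"]) auto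
    qed auto
    then have "emeasure lebesgue {x. \<alpha> < norm (f x)} = ennreal (c ^ DIM('a)) * emeasure lebesgue ?S"
      using emeasure_lebesgue_affine[of c "0::'a" ?S] c by (simp add: ennreal_power)
    moreover have "ennreal (c ^ DIM('a) * t) = ennreal (c ^ DIM('a)) * ennreal t"
      using c by (simp add: ennreal_mult')
    ultimately show ?thesis using c by (simp add: ennreal_mult_le_mult_iff)
  qed
  then show ?thesis by (simp add: rearrangement_def)
qed

text \<open>Passes from the rearrangement to the distribution function. If the level set were too
  large, some \<open>t\<close> would lie strictly between the claimed bound and its measure; the
  rearrangement at \<open>t\<close> would be at least \<alpha>, against the weak bound.\<close>

lemma weak_type_level_set:
  fixes f :: "'a::euclidean_space \<Rightarrow> complex"
  assumes f: "f \<in> borel_measurable lebesgue" and p: "p > 0" and A: "A \<ge> 0" and \<alpha>: "\<alpha> > 0"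
    and w: "\<And>t. t > 0 \<Longrightarrow> ennreal (t powr (1 / p)) * rearrangement f t \<le> ennreal A"
  shows "emeasure lebesgue {x. norm (f x) > \<alpha>} \<le> ennreal ((A / \<alpha>) powr p)"
proof (rule ccontr)
  assume "\<not> ?thesis"
  then obtain z where z: "ennreal ((A / \<alpha>) powr p) < z" "z < emeasure lebesgue {x. norm (f x) > \<alpha>}"
    using dense by (metis not_le)
  then obtain t where t: "z = ennreal t" "t \<ge> 0" by (cases z) (auto simp: top_unique)
  have At: "(A / \<alpha>) powr p < t" using z(1) t by (simp add: ennreal_less_iff)
  then have t0: "t > 0" by (meson le_less_trans powr_ge_zero)
  have "ennreal \<alpha> \<le> rearrangement f t"
    using z(2) t by (intro rearrangement_ge[OF f, of _ "{x. norm (f x) > \<alpha>}"]) auto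
  then have "ennreal (t powr (1 / p)) * ennreal \<alpha> \<le> ennreal A"
    using w[OF t0] by (meson mult_left_mono order_trans zero_le)
  then have "t powr (1 / p) * \<alpha> \<le> A" using A \<alpha> by (simp add: ennreal_mult[symmetric])
  then have "t powr (1 / p) \<le> A / \<alpha>" using \<alpha> by (simp add: field_simps)
  then have "(t powr (1 / p)) powr p \<le> (A / \<alpha>) powr p" using p by (intro powr_mono2) auto
  then show False using At t0 p by (simp add: powr_powr)
qed

text \<open>
  The set where \<open>|f|\<close> exceeds the bound lies in the ball of measure \<open>t\<close>.
\<close>

lemma rearrangement_decay:
  fixes f :: "'a::euclidean_space \<Rightarrow> complex"
  assumes A: "A \<ge> 0" and \<theta>: "\<theta> > 0" and t: "t > 0" and b: "\<And>x. x \<noteq> 0 \<Longrightarrow> norm (f x) \<le> A * norm x powr (- \<theta>)"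
  shows "rearrangement f t \<le> ennreal (A * (unit_ball_vol (real DIM('a)) / t) powr (\<theta> / real DIM('a)))"
proof (rule rearrangement_le)
  let ?d = "real DIM('a)"
  define v where "v = unit_ball_vol ?d"
  have v: "v > 0" by (simp add: v_def)
  define \<rho> where "\<rho> = (t / v) powr (1 / ?d)"
  have \<rho>: "\<rho> > 0" using t v by (simp add: \<rho>_def)
  have \<rho>d: "\<rho> ^ DIM('a) = t / v"
    using t v \<rho> by (simp add: powr_realpow[symmetric] \<rho>_def powr_powr)
  have e: "(v / t) powr (\<theta> / ?d) = \<rho> powr (- \<theta>)"
    using t v by (simp add: \<rho>_def powr_powr powr_minus_divide powr_divide)
  have "{x. norm (f x) > A * (v / t) powr (\<theta> / ?d)} \<subseteq> ball 0 \<rho>"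
  proof
    fix x assume x: "x \<in> {x. norm (f x) > A * (v / t) powr (\<theta> / ?d)}"
    show "x \<in> ball 0 \<rho>"
    proof (rule ccontr)
      assume "x \<notin> ball 0 \<rho>"
      then have "\<rho> \<le> norm x" by simp
      then have "norm x powr (- \<theta>) \<le> \<rho> powr (- \<theta>)" using \<rho> \<theta> by (intro powr_mono2') auto
      moreover have "x \<noteq> 0" using \<open>\<rho> \<le> norm x\<close> \<rho> by auto
      ultimately have "norm (f x) \<le> A * \<rho> powr (- \<theta>)" using b[of x] A by (meson mult_left_mono order_trans)
      then show False using x by (simp add: e)
    qed
  qed
  then have "emeasure lebesgue {x. norm (f x) > A * (v / t) powr (\<theta> / ?d)} \<le> emeasure lebesgue (ball (0::'a) \<rho>)"
    by (rule emeasure_mono) simp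
  also have "\<dots> = ennreal (v * \<rho> ^ DIM('a))" using \<rho> by (simp add: emeasure_ball v_def)
  also have "\<dots> = ennreal t" using v by (simp add: \<rho>d)
  finally show "emeasure lebesgue {x. norm (f x) > A * (unit_ball_vol ?d / t) powr (\<theta> / ?d)} \<le> ennreal t"
    unfolding v_def .
qed (use A in auto)

lemma rearrangement_bounded:
  fixes f :: "'a::euclidean_space \<Rightarrow> complex"
  assumes f: "f \<in> borel_measurable lebesgue" and B: "B \<ge> 0" "AE x in lebesgue. norm (f x) \<le> B"
  shows "rearrangement f t \<le> ennreal B"
proof (rule rearrangement_le[OF B(1)])
  have "emeasure lebesgue {x. norm (f x) > B} = 0"
    using AE_iff_measurable[OF level_set_lebesgue[OF f, of B], of "\<lambda>x. norm (f x) \<le> B"] B(2) by (auto simp: not_le)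
  then show "emeasure lebesgue {x. norm (f x) > B} \<le> ennreal t" by simp
qed

section \<open>The Nikolskii inequality\<close>

text \<open>Submultiplicativity with constant 1 for every \<delta>, so that varying \<delta> causes
  no loss.\<close>

lemma one_plus_scaled_norm_le:
  assumes "0 \<le> \<delta>"
  shows "1 + \<delta> * norm (x::'a::real_normed_vector) \<le> (1 + \<delta> * norm (x - y)) * (1 + \<delta> * norm y)"
proof -
  have "\<delta> * norm x \<le> \<delta> * norm (x - y) + \<delta> * norm y"
    using mult_left_mono[OF norm_triangle_ineq[of "x - y" y] assms] by (simp add: distrib_left)
  moreover have "0 \<le> (\<delta> * norm (x - y)) * (\<delta> * norm y)" using assms by simp
  moreover have "(1 + \<delta> * norm (x - y)) * (1 + \<delta> * norm y) = 1 + \<delta> * norm y + \<delta> * norm (x - y) + (\<delta> * norm (x - y)) * (\<delta> * norm y)"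
    by (simp add: algebra_simps)
  ultimately show ?thesis by linarith
qed

text \<open>
  Splitting at height \<open>\<alpha>\<close>: the part above \<open>\<alpha>\<close> lives on a set so small that it contributes at most
  half of the supremum \<open>M\<close>.
\<close>

lemma weighted_kernel_integral_le:
  fixes g' :: "'a::euclidean_space \<Rightarrow> ennreal" and T :: "'a \<Rightarrow> real"
  assumes [measurable]: "g' \<in> borel_measurable borel" "T \<in> borel_measurable borel"
    and T: "\<And>z. 0 \<le> T z" "\<And>z. T z \<le> Q" "(\<integral>\<^sup>+z. ennreal (T z) \<partial>lborel) \<le> ennreal I"
    and Q: "Q > 0" and \<alpha>: "\<alpha> \<ge> 0" and M: "M \<ge> 0" and I: "I \<ge> 0"
    and gM: "AE x in lborel. g' x \<le> ennreal M"
    and level: "emeasure lborel {x. ennreal \<alpha> < g' x} \<le> ennreal (1 / (2 * Q))"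
  shows "(\<integral>\<^sup>+x. g' x * ennreal (T (x - y)) \<partial>lborel) \<le> ennreal (M / 2 + \<alpha> * I)"
proof -
  let ?E = "{x. ennreal \<alpha> < g' x}"
  have [measurable]: "?E \<in> sets borel" by measurable
  have "(\<integral>\<^sup>+x. g' x * ennreal (T (x - y)) \<partial>lborel)
      \<le> (\<integral>\<^sup>+x. ennreal \<alpha> * ennreal (T (x - y)) + ennreal (M * Q) * indicator ?E x \<partial>lborel)"
    using gM
  proof (intro nn_integral_mono_AE, eventually_elim)
    case (elim x)
    show ?case
    proof (cases "x \<in> ?E")
      case True
      have "g' x * ennreal (T (x - y)) \<le> ennreal M * ennreal Q"
        using elim T by (intro mult_mono ennreal_leI) auto
      then show ?thesis using True M Q by (simp add: ennreal_mult add_increasing)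
    next
      case False
      then show ?thesis by (simp add: not_less mult_right_mono)
    qed
  qed
  also have "\<dots> = ennreal \<alpha> * (\<integral>\<^sup>+x. ennreal (T (x - y)) \<partial>lborel) + ennreal (M * Q) * emeasure lborel ?E"
    by (subst nn_integral_add) (auto simp: nn_integral_cmult nn_integral_cmult_indicator)
  also have "(\<integral>\<^sup>+x. ennreal (T (x - y)) \<partial>lborel) = (\<integral>\<^sup>+z. ennreal (T z) \<partial>lborel)"
    using lborel_nn_integral_affine[of "\<lambda>z. ennreal (T z)" 1 "- y"] by simp
  also have "ennreal \<alpha> * (\<integral>\<^sup>+z. ennreal (T z) \<partial>lborel) + ennreal (M * Q) * emeasure lborel ?E
      \<le> ennreal \<alpha> * ennreal I + ennreal (M * Q) * ennreal (1 / (2 * Q))"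
    by (intro add_mono mult_left_mono T level) auto
  also have "\<dots> = ennreal (M / 2 + \<alpha> * I)"
    using \<alpha> I M Q by (simp add: ennreal_mult[symmetric] ennreal_plus[symmetric] del: ennreal_plus)
  finally show ?thesis .
qed

text \<open>The pairing with \<phi> is rewritten by \<open>rep\<close>, the weight at
  \<open>x\<close> is split into weights at \<open>x - y\<close> and \<open>y\<close>, and Tonelli's
  theorem isolates the integral estimated in \<open>weighted_kernel_integral_le\<close>. What
  remains is a pairing of \<open>|\<phi>|\<close> with a multiple of the weight, from which
  \<open>dual_bound\<close> returns a pointwise estimate of the original form with a new
  constant.\<close>

lemma weighted_bound_improve:
  fixes g \<psi> :: "'a::euclidean_space \<Rightarrow> complex"
  assumes \<beta>: "LP_cutoff (\<beta>0 :: 'a \<Rightarrow> complex)"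
    and gm: "g \<in> borel_measurable lebesgue"
    and gi: "\<And>\<phi>. \<phi> \<in> schwartz \<Longrightarrow> integrable lebesgue (\<lambda>x. g x * \<phi> x)"
    and \<psi>: "\<psi> \<in> schwartz"
    and rep: "\<And>\<phi>. \<phi> \<in> schwartz \<Longrightarrow> (\<integral>x. g x * \<phi> x \<partial>lebesgue) = (\<integral>x. g x * conv \<psi> \<phi> x \<partial>lebesgue)"
    and \<delta>: "\<delta> > 0" and Q: "Q > 0" and \<alpha>: "\<alpha> \<ge> 0" and M: "M \<ge> 0" and I: "I \<ge> 0"
    and TQ: "\<And>z. (1 + \<delta> * norm z) ^ N * norm (\<psi> z) \<le> Q"
    and TI: "(\<integral>\<^sup>+z. ennreal ((1 + \<delta> * norm z) ^ N * norm (\<psi> z)) \<partial>lborel) \<le> ennreal I"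
    and level: "emeasure lebesgue {x. norm (g x) > \<alpha>} \<le> ennreal (1 / (2 * Q))"
    and gM: "AE x in lebesgue. norm (g x) \<le> M * (1 + \<delta> * norm x) ^ N"
  shows "AE x in lebesgue. norm (g x) \<le> (M / 2 + \<alpha> * I) * (1 + \<delta> * norm x) ^ N"
proof -
  define w where "w x = (1 + \<delta> * norm x) ^ N" for x :: 'a
  define T where "T z = w z * norm (\<psi> z)" for z
  have w1: "w x \<ge> 1" for x unfolding w_def using \<delta> by (intro one_le_power) auto
  have w0: "w x > 0" for x using w1[of x] by simp
  have wc: "continuous_on UNIV w" unfolding w_def[abs_def] by (intro continuous_intros)
  have [measurable]: "w \<in> borel_measurable borel" using wc by (simp add: borel_measurable_continuous_onI)
  have [measurable]: "\<psi> \<in> borel_measurable borel" by (rule schwartz_measurable[OF \<psi>])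
  have [measurable]: "T \<in> borel_measurable borel" unfolding T_def[abs_def] by measurable
  \<comment> \<open>Tonelli's theorem is applied on \<open>lborel\<close>, while \<open>g\<close> is
    only Lebesgue measurable; hence the passage to a Borel version \<open>h\<close> of
    \<open>|g| / w\<close>.\<close>
  have "(\<lambda>x. ennreal (norm (g x) / w x)) \<in> borel_measurable lebesgue"
    using gm borel_measurable_lebesgueI[of w] by simp
  then obtain h where h[measurable]: "h \<in> borel_measurable lborel" and hg: "AE x in lborel. ennreal (norm (g x) / w x) = h x"
    using completion_ex_borel_measurable by blast
  have hg': "AE x in lebesgue. ennreal (norm (g x) / w x) = h x" using hg by (rule AE_completion)
  have [measurable]: "h \<in> borel_measurable borel" using h by simp
  have wle: "w x \<le> w (x - y) * w y" for x y
    unfolding w_def power_mult_distrib[symmetric] using \<delta>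
    by (intro power_mono one_plus_scaled_norm_le) auto
  have b0: "0 \<le> M / 2 + \<alpha> * I" using M \<alpha> I by simp
  have hM: "AE x in lborel. h x \<le> ennreal M"
  proof -
    have "AE x in lebesgue. h x \<le> ennreal M"
      using hg' gM
    proof eventually_elim
      case (elim x)
      have "norm (g x) / w x \<le> M" using elim(2) w0[of x] by (simp add: w_def divide_le_eq)
      then show ?case using elim(1) by (metis ennreal_leI)
    qed
    then show ?thesis by (simp add: AE_completion_iff)
  qed
  \<comment> \<open>As \<open>w \<ge> 1\<close>, division by the weight can only shrink the level
    set, up to the null set where \<open>h\<close> differs from \<open>|g| / w\<close>.\<close>
  have lev: "emeasure lborel {x. ennreal \<alpha> < h x} \<le> ennreal (1 / (2 * Q))"
  proof -
    have s: "{x. ennreal \<alpha> < h x} \<in> sets borel" by measurable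
    have "emeasure lborel {x. ennreal \<alpha> < h x} = emeasure lebesgue {x. ennreal \<alpha> < h x}" using s by simp
    also have "\<dots> \<le> emeasure lebesgue {x. norm (g x) > \<alpha>}"
    proof (rule emeasure_mono_AE)
      show "AE x in lebesgue. x \<in> {x. ennreal \<alpha> < h x} \<longrightarrow> x \<in> {x. norm (g x) > \<alpha>}"
        using hg'
      proof eventually_elim
        case (elim x)
        show ?case
        proof
          assume "x \<in> {x. ennreal \<alpha> < h x}"
          then have "ennreal \<alpha> < ennreal (norm (g x) / w x)" using elim by simp
          then have "\<alpha> < norm (g x) / w x" using \<alpha> by (simp add: ennreal_less_iff)
          also have "\<dots> \<le> norm (g x)" using w1[of x] by (simp add: divide_le_eq mult_le_cancel_left1)
          finally show "x \<in> {x. norm (g x) > \<alpha>}" by simp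
        qed
      qed
    qed (rule level_set_lebesgue[OF gm])
    finally show ?thesis using level by simp
  qed
  have inner: "(\<integral>\<^sup>+x. h x * ennreal (T (x - y)) \<partial>lborel) \<le> ennreal (M / 2 + \<alpha> * I)" for y
    by (rule weighted_kernel_integral_le[OF _ _ _ _ _ Q \<alpha> M I hM lev])
       (use TQ TI w0 in \<open>auto simp: T_def w_def less_imp_le\<close>)
  have "AE x in lebesgue. norm (g x) \<le> (M / 2 + \<alpha> * I) * w x"
  proof (rule dual_bound[OF \<beta> gm gi])
    show "continuous_on UNIV (\<lambda>x. (M / 2 + \<alpha> * I) * w x)" by (intro continuous_intros wc)
    show "0 \<le> (M / 2 + \<alpha> * I) * w x" for x using b0 w0[of x] by simp
    fix \<phi> :: "'a \<Rightarrow> complex" assume \<phi>: "\<phi> \<in> schwartz"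
    have [measurable]: "\<phi> \<in> borel_measurable borel" by (rule schwartz_measurable[OF \<phi>])
    have c: "conv \<psi> \<phi> \<in> schwartz" by (intro schwartz_conv \<psi> schwartz_finite_moments \<phi>)
    have iw: "integrable lborel (\<lambda>y. norm (\<phi> y) * ((M / 2 + \<alpha> * I) * w y))"
    proof (rule Bochner_Integration.integrable_bound)
      show "integrable lborel (\<lambda>y. ((M / 2 + \<alpha> * I) * max 1 \<delta> ^ N) * ((1 + norm y) ^ N * norm (\<phi> y)))"
        by (intro integrable_mult_right rapid_integrable_weight schwartz_rapid \<phi>) simp
      have "w y \<le> max 1 \<delta> ^ N * (1 + norm y) ^ N" for y
        unfolding w_def power_mult_distrib[symmetric] using \<delta>
        by (intro power_mono) (auto simp: distrib_left intro!: add_mono mult_right_mono)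
      then have "norm (\<phi> y) * ((M / 2 + \<alpha> * I) * w y) \<le> norm (\<phi> y) * ((M / 2 + \<alpha> * I) * (max 1 \<delta> ^ N * (1 + norm y) ^ N))" for y
        using b0 by (intro mult_left_mono) auto
      moreover have "0 \<le> norm (\<phi> y) * ((M / 2 + \<alpha> * I) * w y)" for y using b0 w0[of y] by simp
      ultimately show "AE y in lborel. norm (norm (\<phi> y) * ((M / 2 + \<alpha> * I) * w y)) \<le> norm (((M / 2 + \<alpha> * I) * max 1 \<delta> ^ N) * ((1 + norm y) ^ N * norm (\<phi> y)))"
        by (intro AE_I2) (simp add: mult_ac order_trans[OF _ abs_ge_self])
    qed measurable
    have "ennreal (norm (\<integral>x. g x * \<phi> x \<partial>lebesgue)) = ennreal (norm (\<integral>x. g x * conv \<psi> \<phi> x \<partial>lebesgue))"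
      by (simp only: rep[OF \<phi>])
    also have "\<dots> \<le> (\<integral>\<^sup>+x. ennreal (norm (g x * conv \<psi> \<phi> x)) \<partial>lebesgue)"
      by (rule integral_norm_bound_ennreal[OF gi[OF c]])
    also have "\<dots> \<le> (\<integral>\<^sup>+x. h x * (\<integral>\<^sup>+y. ennreal (T (x - y)) * ennreal (w y * norm (\<phi> y)) \<partial>lborel) \<partial>lebesgue)"
    proof (rule nn_integral_mono_AE)
      show "AE x in lebesgue. ennreal (norm (g x * conv \<psi> \<phi> x)) \<le> h x * (\<integral>\<^sup>+y. ennreal (T (x - y)) * ennreal (w y * norm (\<phi> y)) \<partial>lborel)"
        using hg'
      proof eventually_elim
        case (elim x)
        have ci: "integrable lborel (\<lambda>y. \<psi> (x - y) * \<phi> y)"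
        proof -
          obtain B where B: "\<And>x. norm (\<psi> x) \<le> B"
            using rapid_bound[OF schwartz_rapid[OF \<psi>], of 0] by (metis mult_1 power_0)
          show ?thesis
            by (rule Bochner_Integration.integrable_bound[OF integrable_mult_right[OF integrable_norm[OF schwartz_integrable[OF \<phi>]], of B]])
               (auto intro!: AE_I2 order_trans[OF mult_right_mono[OF B] abs_ge_self] simp: norm_mult)
        qed
        have "ennreal (norm (conv \<psi> \<phi> x)) \<le> (\<integral>\<^sup>+y. ennreal (norm (\<psi> (x - y) * \<phi> y)) \<partial>lborel)"
          unfolding conv_def by (rule integral_norm_bound_ennreal[OF ci])
        then have "ennreal (norm (g x * conv \<psi> \<phi> x)) \<le> ennreal (norm (g x)) * (\<integral>\<^sup>+y. ennreal (norm (\<psi> (x - y) * \<phi> y)) \<partial>lborel)"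
          by (simp add: norm_mult ennreal_mult mult_left_mono)
        also have "ennreal (norm (g x)) = h x * ennreal (w x)"
          unfolding elim[symmetric] using w0[of x] by (simp add: ennreal_mult[symmetric])
        also have "h x * ennreal (w x) * (\<integral>\<^sup>+y. ennreal (norm (\<psi> (x - y) * \<phi> y)) \<partial>lborel) = h x * (\<integral>\<^sup>+y. ennreal (w x) * ennreal (norm (\<psi> (x - y) * \<phi> y)) \<partial>lborel)"
          by (simp add: nn_integral_cmult mult.assoc)
        also have "\<dots> \<le> h x * (\<integral>\<^sup>+y. ennreal (T (x - y)) * ennreal (w y * norm (\<phi> y)) \<partial>lborel)"
        proof (intro mult_left_mono nn_integral_mono)
          fix y
          have "w x * norm (\<psi> (x - y) * \<phi> y) \<le> (w (x - y) * w y) * norm (\<psi> (x - y) * \<phi> y)"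
            by (intro mult_right_mono wle) auto
          then have "ennreal (w x * norm (\<psi> (x - y) * \<phi> y)) \<le> ennreal (T (x - y) * (w y * norm (\<phi> y)))"
            by (intro ennreal_leI) (simp add: T_def norm_mult mult_ac)
          moreover have "0 \<le> T (x - y)" using w0[of "x - y"] by (simp add: T_def)
          ultimately show "ennreal (w x) * ennreal (norm (\<psi> (x - y) * \<phi> y)) \<le> ennreal (T (x - y)) * ennreal (w y * norm (\<phi> y))"
            using w0[of x] w0[of y] by (simp add: ennreal_mult[symmetric])
        qed simp
        finally show ?case .
      qed
    qed
    also have "\<dots> = (\<integral>\<^sup>+x. (\<integral>\<^sup>+y. h x * (ennreal (T (x - y)) * ennreal (w y * norm (\<phi> y))) \<partial>lborel) \<partial>lborel)"
      by (simp add: nn_integral_completion nn_integral_cmult)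
    also have "\<dots> = (\<integral>\<^sup>+y. (\<integral>\<^sup>+x. h x * (ennreal (T (x - y)) * ennreal (w y * norm (\<phi> y))) \<partial>lborel) \<partial>lborel)"
      by (rule lborel_pair.Fubini'[symmetric]) simp
    also have "\<dots> = (\<integral>\<^sup>+y. (\<integral>\<^sup>+x. h x * ennreal (T (x - y)) \<partial>lborel) * ennreal (w y * norm (\<phi> y)) \<partial>lborel)"
      by (intro nn_integral_cong) (simp add: nn_integral_multc[symmetric] mult.assoc)
    also have "\<dots> \<le> (\<integral>\<^sup>+y. ennreal (M / 2 + \<alpha> * I) * ennreal (w y * norm (\<phi> y)) \<partial>lborel)"
      by (intro nn_integral_mono mult_right_mono inner) simp
    also have "\<dots> = (\<integral>\<^sup>+y. ennreal (norm (\<phi> y) * ((M / 2 + \<alpha> * I) * w y)) \<partial>lborel)"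
      using b0 w0 by (intro nn_integral_cong) (simp add: ennreal_mult[symmetric] less_imp_le mult_ac)
    also have "\<dots> = ennreal (\<integral>y. norm (\<phi> y) * ((M / 2 + \<alpha> * I) * w y) \<partial>lborel)"
      by (rule nn_integral_eq_integral[OF iw]) (use b0 w0 in \<open>auto simp: less_imp_le\<close>)
    finally show "norm (\<integral>x. g x * \<phi> x \<partial>lebesgue) \<le> (\<integral>x. norm (\<phi> x) * ((M / 2 + \<alpha> * I) * w x) \<partial>lborel)"
      by (subst (asm) ennreal_le_iff) (use b0 w0 in \<open>auto intro!: integral_nonneg_AE simp: less_imp_le\<close>)
  qed
  then show ?thesis by (simp add: w_def)
qed

text \<open>Convexity in \<delta>: on \<open>[0, 1]\<close> the power lies below the chord between
  \<delta> = 0 and \<delta> = 1. The extra size of a weighted kernel is thus at most \<delta> times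
  a fixed quantity.\<close>

lemma power_one_plus_scaled_le:
  assumes "0 \<le> \<delta>" "\<delta> \<le> 1" "0 \<le> (z::real)"
  shows "(1 + \<delta> * z) ^ N \<le> 1 + \<delta> * ((1 + z) ^ N - 1)"
proof (induction N)
  case (Suc N)
  define P where "P = (1 + z) ^ N"
  have P: "P \<ge> 1" using assms by (simp add: P_def one_le_power)
  have "(1 + \<delta> * z) ^ Suc N \<le> (1 + \<delta> * z) * (1 + \<delta> * (P - 1))"
    using Suc assms by (simp add: mult_left_mono P_def)
  also have "\<dots> = 1 + \<delta> * (P - 1) + \<delta> * z + \<delta> * (\<delta> * (z * (P - 1)))" by (simp add: algebra_simps)
  also have "\<delta> * (\<delta> * (z * (P - 1))) \<le> \<delta> * (1 * (z * (P - 1)))"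
    using assms P by (intro mult_left_mono mult_right_mono) auto
  also have "1 + \<delta> * (P - 1) + \<delta> * z + \<delta> * (1 * (z * (P - 1))) = 1 + \<delta> * ((1 + z) ^ Suc N - 1)"
    by (simp add: P_def algebra_simps)
  finally show ?case by simp
qed simp

text \<open>
  Iterating \<open>M \<mapsto> M / 2 + \<alpha> I\<close> removes the a priori constant; \<open>\<delta> \<rightarrow> 0\<close> then removes the weight.
\<close>

lemma bound_of_growth:
  fixes g \<psi> :: "'a::euclidean_space \<Rightarrow> complex"
  assumes \<beta>: "LP_cutoff (\<beta>0 :: 'a \<Rightarrow> complex)"
    and gm: "g \<in> borel_measurable lebesgue"
    and gi: "\<And>\<phi>. \<phi> \<in> schwartz \<Longrightarrow> integrable lebesgue (\<lambda>x. g x * \<phi> x)"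
    and \<psi>: "\<psi> \<in> schwartz"
    and rep: "\<And>\<phi>. \<phi> \<in> schwartz \<Longrightarrow> (\<integral>x. g x * \<phi> x \<partial>lebesgue) = (\<integral>x. g x * conv \<psi> \<phi> x \<partial>lebesgue)"
    and P: "P > 0" "\<And>z. norm (\<psi> z) \<le> P" and I: "(\<integral>z. norm (\<psi> z) \<partial>lborel) \<le> I" and \<alpha>: "\<alpha> \<ge> 0"
    and level: "emeasure lebesgue {x. norm (g x) > \<alpha>} \<le> ennreal (1 / (4 * P))"
    and C: "C \<ge> 0" and growth: "AE x in lebesgue. norm (g x) \<le> C * (1 + norm x) ^ N"
  shows "AE x in lebesgue. norm (g x) \<le> 2 * \<alpha> * (I + 1)"
proof -
  have [measurable]: "\<psi> \<in> borel_measurable borel" by (rule schwartz_measurable[OF \<psi>])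
  have i\<psi>: "integrable lborel \<psi>" by (rule schwartz_integrable[OF \<psi>])
  have I0: "I \<ge> 0" using I by (rule order_trans[rotated]) (simp add: integral_nonneg_AE)
  obtain K where K: "K > 0" "\<And>z. (1 + norm z) ^ N * norm (\<psi> z) \<le> K"
    using rapid_bound[OF schwartz_rapid[OF \<psi>]] by metis
  define J where "J = (\<integral>z. (1 + norm z) ^ N * norm (\<psi> z) \<partial>lborel)"
  have iJ: "integrable lborel (\<lambda>z. (1 + norm z) ^ N * norm (\<psi> z))"
    by (intro rapid_integrable_weight schwartz_rapid \<psi>) simp
  have J0: "J \<ge> 0" unfolding J_def by (intro integral_nonneg_AE) simp
  \<comment> \<open>Below this threshold the weight adds at most \<open>P\<close> to the supremum of
    \<psi> and at most 1 to its integral. The weighted kernel then has the bounds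
    \<open>Q = 2 * P\<close> and \<open>I + 1\<close>, and \<open>1 / (4 * P)\<close> in
    \<open>level\<close> is \<open>1 / (2 * Q)\<close>.\<close>
  define \<delta>0 where "\<delta>0 = min 1 (min (P / K) (1 / (J + 1)))"
  have \<delta>0: "\<delta>0 > 0" using P K J0 by (simp add: \<delta>0_def)
  have main: "AE x in lebesgue. norm (g x) \<le> 2 * \<alpha> * (I + 1) * (1 + \<delta> * norm x) ^ N" if \<delta>: "0 < \<delta>" "\<delta> \<le> \<delta>0" for \<delta>
  proof -
    have d1: "\<delta> \<le> 1" and dK: "\<delta> * K \<le> P" and dJ: "\<delta> * J \<le> 1"
    proof -
      have "\<delta> \<le> P / K" "\<delta> \<le> 1 / (J + 1)" using \<delta> by (auto simp: \<delta>0_def)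
      then show "\<delta> * K \<le> P" "\<delta> * J \<le> 1" using K J0 \<delta> by (auto simp: field_simps)
      show "\<delta> \<le> 1" using \<delta> by (auto simp: \<delta>0_def)
    qed
    have T: "(1 + \<delta> * norm z) ^ N * norm (\<psi> z) \<le> norm (\<psi> z) + \<delta> * ((1 + norm z) ^ N * norm (\<psi> z))" for z
    proof -
      have "(1 + \<delta> * norm z) ^ N \<le> 1 + \<delta> * (1 + norm z) ^ N"
        using power_one_plus_scaled_le[of \<delta> "norm z" N] \<delta> d1 by (simp add: right_diff_distrib)
      then have "(1 + \<delta> * norm z) ^ N * norm (\<psi> z) \<le> (1 + \<delta> * (1 + norm z) ^ N) * norm (\<psi> z)"
        by (intro mult_right_mono) auto
      then show ?thesis by (simp add: distrib_right mult.assoc)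
    qed
    have TQ: "(1 + \<delta> * norm z) ^ N * norm (\<psi> z) \<le> 2 * P" for z
    proof -
      have "\<delta> * ((1 + norm z) ^ N * norm (\<psi> z)) \<le> \<delta> * K" using \<delta> by (intro mult_left_mono K) auto
      then show ?thesis using T[of z] P(2)[of z] dK by linarith
    qed
    have TI: "(\<integral>\<^sup>+z. ennreal ((1 + \<delta> * norm z) ^ N * norm (\<psi> z)) \<partial>lborel) \<le> ennreal (I + 1)"
    proof -
      have "(\<integral>\<^sup>+z. ennreal ((1 + \<delta> * norm z) ^ N * norm (\<psi> z)) \<partial>lborel) \<le> (\<integral>\<^sup>+z. ennreal (norm (\<psi> z) + \<delta> * ((1 + norm z) ^ N * norm (\<psi> z))) \<partial>lborel)"
        by (intro nn_integral_mono ennreal_leI T)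
      also have "\<dots> = ennreal (\<integral>z. norm (\<psi> z) + \<delta> * ((1 + norm z) ^ N * norm (\<psi> z)) \<partial>lborel)"
        using \<delta> i\<psi> iJ by (intro nn_integral_eq_integral) auto
      also have "(\<integral>z. norm (\<psi> z) + \<delta> * ((1 + norm z) ^ N * norm (\<psi> z)) \<partial>lborel) = (\<integral>z. norm (\<psi> z) \<partial>lborel) + \<delta> * J"
        unfolding J_def using i\<psi> iJ by simp
      also have "ennreal ((\<integral>z. norm (\<psi> z) \<partial>lborel) + \<delta> * J) \<le> ennreal (I + 1)"
        using I dJ by (intro ennreal_leI) simp
      finally show ?thesis .
    qed
    have lev: "emeasure lebesgue {x. norm (g x) > \<alpha>} \<le> ennreal (1 / (2 * (2 * P)))" using level by simp
    define c where "c = C / \<delta> ^ N"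
    have c: "c \<ge> 0" using C \<delta> by (simp add: c_def)
    \<comment> \<open>The solution of the recursion
      \<open>M (Suc j) = M j / 2 + \<alpha> * (I + 1)\<close>, with fixed point
      \<open>2 * \<alpha> * (I + 1)\<close>. The initial excess \<open>c = C / \<delta>^N\<close>
      comes from \<open>(1 + |x|)^N \<le> \<delta>^(-N) (1 + \<delta> |x|)^N\<close>.\<close>
    define M where "M j = 2 * \<alpha> * (I + 1) + c / 2 ^ j" for j :: nat
    have M0: "M j \<ge> 0" for j using \<alpha> I0 c by (simp add: M_def)
    have "AE x in lebesgue. norm (g x) \<le> M j * (1 + \<delta> * norm x) ^ N" for j
    proof (induction j)
      case 0
      show ?case
        using growth
      proof eventually_elim
        case (elim x)
        have "(\<delta> * (1 + norm x)) ^ N \<le> (1 + \<delta> * norm x) ^ N"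
          using \<delta> d1 by (intro power_mono) (auto simp: distrib_left)
        then have "(1 + norm x) ^ N \<le> (1 + \<delta> * norm x) ^ N / \<delta> ^ N"
          unfolding power_mult_distrib using \<delta> by (simp add: pos_le_divide_eq mult.commute)
        then have "C * (1 + norm x) ^ N \<le> C * ((1 + \<delta> * norm x) ^ N / \<delta> ^ N)" using C by (rule mult_left_mono)
        also have "\<dots> = c * (1 + \<delta> * norm x) ^ N" by (simp add: c_def)
        also have "\<dots> \<le> M 0 * (1 + \<delta> * norm x) ^ N" using \<alpha> I0 \<delta> by (intro mult_right_mono) (auto simp: M_def)
        finally show ?case using elim by simp
      qed
    next
      case (Suc j)
      have "M (Suc j) = M j / 2 + \<alpha> * (I + 1)" by (simp add: M_def add_divide_distrib)
      moreover have "AE x in lebesgue. norm (g x) \<le> (M j / 2 + \<alpha> * (I + 1)) * (1 + \<delta> * norm x) ^ N"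
        by (rule weighted_bound_improve[OF \<beta> gm gi \<psi> rep \<delta>(1) _ \<alpha> M0 _ TQ TI lev Suc])
           (use P I0 in auto)
      ultimately show ?case by simp
    qed
    then have "AE x in lebesgue. \<forall>j. norm (g x) \<le> M j * (1 + \<delta> * norm x) ^ N" by (simp add: AE_all_countable)
    then show ?thesis
    proof eventually_elim
      case (elim x)
      have "(\<lambda>j. c / 2 ^ j) \<longlonglongrightarrow> 0" by (rule LIMSEQ_divide_realpow_zero) simp
      then have "(\<lambda>j. M j * (1 + \<delta> * norm x) ^ N) \<longlonglongrightarrow> (2 * \<alpha> * (I + 1) + 0) * (1 + \<delta> * norm x) ^ N"
        unfolding M_def by (intro tendsto_intros)
      then show ?case using elim by (intro LIMSEQ_le_const[where X="\<lambda>j. M j * (1 + \<delta> * norm x) ^ N"]) auto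
    qed
  qed
  define d where "d n = \<delta>0 / real (Suc n)" for n
  have d: "0 < d n" "d n \<le> \<delta>0" for n using \<delta>0 by (auto simp: d_def field_simps)
  have d0: "d \<longlonglongrightarrow> 0" unfolding d_def by (rule LIMSEQ_Suc[OF lim_const_over_n])
  have "AE x in lebesgue. \<forall>n. norm (g x) \<le> 2 * \<alpha> * (I + 1) * (1 + d n * norm x) ^ N"
    unfolding AE_all_countable using main d by blast
  then show ?thesis
  proof eventually_elim
    case (elim x)
    have "(\<lambda>n. 2 * \<alpha> * (I + 1) * (1 + d n * norm x) ^ N) \<longlonglongrightarrow> 2 * \<alpha> * (I + 1) * (1 + 0 * norm x) ^ N"
      by (intro tendsto_intros d0)
    then show ?case using elim by (intro LIMSEQ_le_const[where X="\<lambda>n. 2 * \<alpha> * (I + 1) * (1 + d n * norm x) ^ N"]) auto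
  qed
qed

section \<open>The Nikolskii inequality and its Lorentz form for the pieces\<close>

lemma represents_integral:
  assumes "represents g u" "\<phi> \<in> schwartz"
  shows "integrable lebesgue (\<lambda>x. g x * \<phi> x)" "u \<phi> = (\<integral>x. g x * \<phi> x \<partial>lebesgue)"
  using assms by (auto simp: represents_def)

lemma Nikolskii:
  fixes \<beta>0 :: "'a::euclidean_space \<Rightarrow> complex"
  assumes \<beta>: "LP_cutoff \<beta>0" and p: "p > 0"
  shows "\<exists>C\<ge>0. \<forall>f\<in>tempered. \<forall>k g A. represents g (LP_piece \<beta>0 k f) \<longrightarrow> A > 0 \<longrightarrow>
    (\<forall>t>0. ennreal (t powr (1 / p)) * rearrangement g t \<le> ennreal A) \<longrightarrow>
    (AE x in lebesgue. norm (g x) \<le> C * ((2 ^ k) ^ DIM('a)) powr (1 / p) * A)"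
proof -
  define \<Psi> where "\<Psi> = fourier_kernel \<beta>0"
  have \<Psi>: "\<Psi> \<in> schwartz" unfolding \<Psi>_def by (intro schwartz_fourier_kernel LP_cutoff_schwartz \<beta>)
  have [measurable]: "\<Psi> \<in> borel_measurable borel" by (rule schwartz_measurable[OF \<Psi>])
  define I where "I = (\<integral>z. norm (\<Psi> z) \<partial>lborel)"
  have I0: "I \<ge> 0" unfolding I_def by (intro integral_nonneg_AE) simp
  obtain S where S: "S > 0" "\<And>z. norm (\<Psi> z) \<le> S"
    using rapid_bound[OF schwartz_rapid[OF \<Psi>], of 0] by (metis mult_1 power_0)
  \<comment> \<open>Obtained from \<open>2 * \<alpha> * (I + 1)\<close> by splitting
    \<open>4 P = (4 * 2^d S) * 2^(k d)\<close>, where only the second factor depends on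
    \<open>k\<close>.\<close>
  define C where "C = 2 * (4 * 2 ^ DIM('a) * S) powr (1 / p) * (I + 1)"
  have "AE x in lebesgue. norm (g x) \<le> C * ((2 ^ k) ^ DIM('a)) powr (1 / p) * A"
    if f: "f \<in> tempered" and g: "represents g (LP_piece \<beta>0 k f)" and A: "A > 0"
      and w: "\<And>t. t > 0 \<Longrightarrow> ennreal (t powr (1 / p)) * rearrangement g t \<le> ennreal A" for f k g A
  proof -
    define s where "s = (2::real) ^ (k + 1)"
    have s: "s > 0" by (simp add: s_def)
    define P where "P = s ^ DIM('a) * S"
    have P: "P > 0" using s S by (simp add: P_def)
    \<comment> \<open>The height at which the weak bound yields a level set of measure at most
      \<open>1 / (4 * P)\<close>, as \<open>bound_of_growth\<close> demands.\<close>
    define \<alpha> where "\<alpha> = A * (4 * P) powr (1 / p)"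
    have \<alpha>: "\<alpha> > 0" using A P by (simp add: \<alpha>_def)
    have gm: "g \<in> borel_measurable lebesgue" using g by (simp add: represents_def)
    note gi = represents_integral[OF g]
    have \<psi>: "LP_kernel \<beta>0 k \<in> schwartz" by (rule LP_kernel_schwartz[OF \<beta>])
    have k: "LP_kernel \<beta>0 k x = of_real (s ^ DIM('a)) * \<Psi> (s *\<^sub>R x)" for x
      unfolding LP_kernel_eq[OF \<beta>] s_def \<Psi>_def ..
    have kn: "norm (LP_kernel \<beta>0 k x) = s ^ DIM('a) * norm (\<Psi> (s *\<^sub>R x))" for x
      using s unfolding k norm_mult norm_of_real by simp
    obtain C0 N where C0: "C0 \<ge> 0" "\<And>\<phi>. \<phi> \<in> schwartz \<Longrightarrow> norm (LP_piece \<beta>0 k f \<phi>) \<le> (\<integral>y. norm (\<phi> y) * (C0 * (1 + norm y) ^ N) \<partial>lborel)"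
      using LP_piece_growth[OF \<beta> f, of k] by blast
    have growth: "AE x in lebesgue. norm (g x) \<le> C0 * (1 + norm x) ^ N"
      by (rule dual_bound[OF \<beta> gm gi(1)]) (use C0 gi(2) in \<open>auto intro!: continuous_intros\<close>)
    have "AE x in lebesgue. norm (g x) \<le> 2 * \<alpha> * (I + 1)"
    proof (rule bound_of_growth[OF \<beta> gm gi(1) \<psi> _ P _ _ _ _ C0(1) growth])
      fix \<phi> :: "'a \<Rightarrow> complex" assume \<phi>: "\<phi> \<in> schwartz"
      have "conv (LP_kernel \<beta>0 k) \<phi> \<in> schwartz" by (intro schwartz_conv \<psi> schwartz_finite_moments \<phi>)
      then show "(\<integral>x. g x * \<phi> x \<partial>lebesgue) = (\<integral>x. g x * conv (LP_kernel \<beta>0 k) \<phi> x \<partial>lebesgue)"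
        using LP_piece_reproduce[OF \<beta> \<phi>, of k f] gi(2) \<phi> by simp
    next
      show "norm (LP_kernel \<beta>0 k z) \<le> P" for z
        unfolding kn P_def using s S by (intro mult_left_mono) auto
      have "I = \<bar>s\<bar> ^ DIM('a) *\<^sub>R (\<integral>z. norm (\<Psi> (0 + s *\<^sub>R z)) \<partial>lborel)"
        unfolding I_def by (rule lborel_integral_affine) (use s in auto)
      then show "(\<integral>z. norm (LP_kernel \<beta>0 k z) \<partial>lborel) \<le> I"
        unfolding kn using s by simp
      have "(A / \<alpha>) powr p = 1 / (4 * P)"
        using A P p by (simp add: \<alpha>_def powr_divide powr_powr powr_minus_divide[symmetric])
      then show "emeasure lebesgue {x. norm (g x) > \<alpha>} \<le> ennreal (1 / (4 * P))"
        using weak_type_level_set[OF gm p less_imp_le[OF A] \<alpha> w] by simp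
    qed (use \<alpha> in auto)
    moreover have "2 * \<alpha> * (I + 1) = C * ((2 ^ k) ^ DIM('a)) powr (1 / p) * A"
    proof -
      have "4 * P = (4 * 2 ^ DIM('a) * S) * (2 ^ k) ^ DIM('a)"
        by (simp add: P_def s_def power_mult_distrib)
      then have "(4 * P) powr (1 / p) = (4 * 2 ^ DIM('a) * S) powr (1 / p) * ((2 ^ k) ^ DIM('a)) powr (1 / p)"
        using S by (simp add: powr_mult)
      then show ?thesis by (simp add: \<alpha>_def C_def)
    qed
    ultimately show ?thesis by simp
  qed
  moreover have "C \<ge> 0" using I0 by (simp add: C_def)
  ultimately show ?thesis by blast
qed

text \<open>Estimates proved for all finite bounds \<open>A\<close> become one inequality between
  extended reals. With \<open>C + 1\<close> the factor is positive, so for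
  \<open>x = \<infinity>\<close> the right-hand side is infinite even if \<open>C = 0\<close>; for
  \<open>x = 0\<close> the bounds \<open>A\<close> tend to 0.\<close>

lemma ennreal_le_cmult_of_le:
  assumes C: "0 \<le> C" and le: "\<And>A. A > 0 \<Longrightarrow> x \<le> ennreal A \<Longrightarrow> y \<le> ennreal (C * A)"
  shows "y \<le> ennreal (C + 1) * x"
proof (cases x)
  case (real r)
  show ?thesis
  proof (cases "r = 0")
    case True
    have ye: "y \<le> ennreal e" if "e > 0" for e
    proof -
      have "y \<le> ennreal (C * (e / (C + 1)))" using True real that C by (intro le) auto
      also have "\<dots> \<le> ennreal e" using that C by (intro ennreal_leI) (simp add: field_simps)
      finally show ?thesis .
    qed
    have "y \<le> 0" by (rule ennreal_le_epsilon) (use ye in simp)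
    then show ?thesis by simp
  next
    case False
    then have "y \<le> ennreal (C * r)" using real by (intro le) auto
    also have "\<dots> \<le> ennreal ((C + 1) * r)" using real by (intro ennreal_leI) (simp add: distrib_right)
    finally show ?thesis using real C by (simp add: ennreal_mult)
  qed
qed (use C in \<open>auto simp: ennreal_mult_top\<close>)

text \<open>Dividing by \<open>c\<close> first allows the infimum on the right to be tested one
  element at a time.\<close>

lemma ennreal_INF_le_cmult:
  assumes c: "0 < c" and le: "\<And>g. g \<in> G \<Longrightarrow> F g \<le> ennreal c * H g"
  shows "(INF g\<in>G. F g) \<le> ennreal c * (INF g\<in>G. H g)"
proof -
  have "ennreal (1 / c) * (INF g\<in>G. F g) \<le> (INF g\<in>G. H g)"
  proof (rule INF_greatest)
    fix g assume g: "g \<in> G"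
    have "ennreal (1 / c) * (INF g\<in>G. F g) \<le> ennreal (1 / c) * (ennreal c * H g)"
      using le[OF g] g by (intro mult_left_mono) (auto intro: INF_lower2)
    also have "\<dots> = H g" using c by (simp add: mult.assoc[symmetric] ennreal_mult[symmetric])
    finally show "ennreal (1 / c) * (INF g\<in>G. F g) \<le> H g" .
  qed
  then have "ennreal c * (ennreal (1 / c) * (INF g\<in>G. F g)) \<le> ennreal c * (INF g\<in>G. H g)" by (intro mult_left_mono) auto
  then show ?thesis using c by (simp add: mult.assoc[symmetric] ennreal_mult[symmetric])
qed

lemma LP_piece_lorentz_embed:
  fixes \<beta>0 :: "'a::euclidean_space \<Rightarrow> complex"
  assumes \<beta>: "LP_cutoff \<beta>0" and p: "0 < p0" "p0 < p1" and r: "0 < r0" "0 < r1"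
  shows "\<exists>C>0. \<forall>f\<in>tempered. \<forall>k. distr_lorentz_qnorm p1 r1 (LP_piece \<beta>0 k f)
    \<le> ennreal (C * 2 powr (real k * (real DIM('a) / p0 - real DIM('a) / p1))) * distr_lorentz_qnorm p0 r0 (LP_piece \<beta>0 k f)"
proof -
  obtain C1 where C1: "C1 \<ge> 0" "\<And>f k g A. f \<in> tempered \<Longrightarrow> represents g (LP_piece \<beta>0 k f) \<Longrightarrow> A > 0 \<Longrightarrow>
    (\<And>t. t > 0 \<Longrightarrow> ennreal (t powr (1 / p0)) * rearrangement g t \<le> ennreal A) \<Longrightarrow>
    AE x in lebesgue. norm (g x) \<le> C1 * ((2 ^ k) ^ DIM('a)) powr (1 / p0) * A"
    using Nikolskii[OF \<beta> p(1)] by metis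
  obtain C2 where C2: "\<And>h. antimono_on {0<..} h \<Longrightarrow> h \<in> borel_measurable borel \<Longrightarrow> lorentz_functional p0 \<infinity> h \<le> ennreal C2 * lorentz_functional p0 r0 h"
    using lorentz_weak_le[OF p(1) r(1)] by blast
  obtain C3 where C3: "C3 \<ge> 0" "\<And>A L. A \<ge> 0 \<Longrightarrow> L > 0 \<Longrightarrow> lorentz_functional p1 r1 (\<lambda>t. ennreal (A * min (t powr (- 1 / p0)) (C1 * L powr (1 / p0)))) \<le> ennreal (C3 * A * L powr (1 / p0 - 1 / p1))"
    using lorentz_functional_interpolation[OF p r(2) C1(1)] by blast
  have main: "lorentz_qnorm p1 r1 g \<le> ennreal ((C3 + 1) * (\<bar>C2\<bar> + 1) * 2 powr (real k * (real DIM('a) / p0 - real DIM('a) / p1))) * lorentz_qnorm p0 r0 g"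
    if f: "f \<in> tempered" and g: "represents g (LP_piece \<beta>0 k f)" for f k g
  proof -
    define L where "L = ((2::real) ^ k) ^ DIM('a)"
    have L: "L > 0" by (simp add: L_def)
    define E where "E = L powr (1 / p0 - 1 / p1)"
    have E: "E > 0" using L by (simp add: E_def)
    have gm: "g \<in> borel_measurable lebesgue" using g by (simp add: represents_def)
    \<comment> \<open>Division by \<open>E\<close> removes the dependence on \<open>k\<close>, so
      that the constant passed to \<open>ennreal_le_cmult_of_le\<close>, and hence its increase by
      1, is uniform in \<open>k\<close>.\<close>
    have "lorentz_qnorm p1 r1 g / ennreal E \<le> ennreal (C3 + 1) * lorentz_functional p0 \<infinity> (rearrangement g)"
    proof (rule ennreal_le_cmult_of_le[OF C3(1)])
      fix A :: real assume A: "A > 0" "lorentz_functional p0 \<infinity> (rearrangement g) \<le> ennreal A"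
      have w: "ennreal (t powr (1 / p0)) * rearrangement g t \<le> ennreal A" if "t > 0" for t
        using A(2) that unfolding lorentz_functional_def if_P[OF refl] SUP_le_iff by auto
      have bd: "AE x in lebesgue. norm (g x) \<le> C1 * L powr (1 / p0) * A"
        unfolding L_def by (rule C1(2)[OF f g A(1) w])
      have "rearrangement g t \<le> ennreal (A * min (t powr (- 1 / p0)) (C1 * L powr (1 / p0)))" if t: "t > 0" for t
      proof -
        have "ennreal (t powr (- 1 / p0)) * (ennreal (t powr (1 / p0)) * rearrangement g t) \<le> ennreal (t powr (- 1 / p0)) * ennreal A"
          by (intro mult_left_mono w t) simp
        moreover have "ennreal (t powr (- 1 / p0)) * ennreal (t powr (1 / p0)) = 1"
          using t by (simp add: ennreal_mult[symmetric] powr_add[symmetric])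
        then have "ennreal (t powr (- 1 / p0)) * (ennreal (t powr (1 / p0)) * rearrangement g t) = rearrangement g t"
          unfolding mult.assoc[symmetric] by simp
        moreover have "ennreal (t powr (- 1 / p0)) * ennreal A = ennreal (A * t powr (- 1 / p0))"
          using A(1) by (simp add: ennreal_mult mult.commute)
        ultimately have "rearrangement g t \<le> ennreal (A * t powr (- 1 / p0))" by simp
        moreover have "rearrangement g t \<le> ennreal (A * (C1 * L powr (1 / p0)))"
          using rearrangement_bounded[OF gm _ bd, of t] C1(1) A(1) by (simp add: mult_ac)
        ultimately show ?thesis by (cases "t powr (- 1 / p0) \<le> C1 * L powr (1 / p0)") (auto simp: min_def)
      qed
      then have "lorentz_qnorm p1 r1 g \<le> lorentz_functional p1 r1 (\<lambda>t. ennreal (A * min (t powr (- 1 / p0)) (C1 * L powr (1 / p0))))"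
        unfolding lorentz_qnorm_eq by (rule lorentz_functional_mono)
      also have "\<dots> \<le> ennreal (C3 * A * E)" unfolding E_def using A L by (intro C3) auto
      finally have "lorentz_qnorm p1 r1 g / ennreal E \<le> ennreal (C3 * A * E) / ennreal E" by (rule divide_right_mono_ennreal)
      then show "lorentz_qnorm p1 r1 g / ennreal E \<le> ennreal (C3 * A)" using E C3 A by (simp add: divide_ennreal)
    qed
    also have "\<dots> \<le> ennreal (C3 + 1) * (ennreal (\<bar>C2\<bar> + 1) * lorentz_qnorm p0 r0 g)"
    proof (intro mult_left_mono)
      have "lorentz_functional p0 \<infinity> (rearrangement g) \<le> ennreal C2 * lorentz_qnorm p0 r0 g"
        unfolding lorentz_qnorm_eq by (rule C2[OF rearrangement_antimono_on rearrangement_measurable])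
      also have "\<dots> \<le> ennreal (\<bar>C2\<bar> + 1) * lorentz_qnorm p0 r0 g" by (intro mult_right_mono ennreal_leI) auto
      finally show "lorentz_functional p0 \<infinity> (rearrangement g) \<le> ennreal (\<bar>C2\<bar> + 1) * lorentz_qnorm p0 r0 g" .
    qed simp
    finally have "lorentz_qnorm p1 r1 g / ennreal E * ennreal E \<le> ennreal (C3 + 1) * (ennreal (\<bar>C2\<bar> + 1) * lorentz_qnorm p0 r0 g) * ennreal E"
      by (intro mult_right_mono) auto
    moreover have "lorentz_qnorm p1 r1 g / ennreal E * ennreal E = lorentz_qnorm p1 r1 g"
      using E by (simp add: divide_ennreal_def mult.assoc inverse_ennreal ennreal_mult[symmetric])
    moreover have "ennreal (C3 + 1) * (ennreal (\<bar>C2\<bar> + 1) * lorentz_qnorm p0 r0 g) * ennreal E = ennreal ((C3 + 1) * (\<bar>C2\<bar> + 1) * E) * lorentz_qnorm p0 r0 g"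
      using C3(1) E by (simp add: ennreal_mult mult_ac del: ennreal_plus)
    moreover have "E = 2 powr (real k * (real DIM('a) / p0 - real DIM('a) / p1))"
    proof -
      have "L = 2 powr (real k * real DIM('a))" unfolding L_def by (simp add: powr_realpow[symmetric] powr_powr)
      then show ?thesis by (simp add: E_def powr_powr right_diff_distrib)
    qed
    ultimately show ?thesis by simp
  qed
  have pos: "0 < (C3 + 1) * (\<bar>C2\<bar> + 1)" using C3(1) by (intro mult_pos_pos) auto
  show ?thesis
    unfolding distr_lorentz_qnorm_def
  proof (intro exI[of _ "(C3 + 1) * (\<bar>C2\<bar> + 1)"] conjI ballI allI ennreal_INF_le_cmult)
    show "0 < (C3 + 1) * (\<bar>C2\<bar> + 1)" by (rule pos)
    show "0 < (C3 + 1) * (\<bar>C2\<bar> + 1) * 2 powr (real k * (real DIM('a) / p0 - real DIM('a) / p1))" for k :: nat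
      by (intro mult_pos_pos[OF pos]) simp
  qed (use main in auto)
qed

lemma distr_lorentz_second_exponent_le:
  assumes p: "0 < p" and r: "0 < r0" "r0 \<le> r1"
  shows "\<exists>C>0. \<forall>u. distr_lorentz_qnorm p r1 u \<le> ennreal C * distr_lorentz_qnorm p r0 u"
proof -
  obtain C where C: "\<And>h. antimono_on {0<..} h \<Longrightarrow> h \<in> borel_measurable borel \<Longrightarrow> lorentz_functional p r1 h \<le> ennreal C * lorentz_functional p r0 h"
    using lorentz_second_exponent_le[OF assms] by blast
  have "lorentz_qnorm p r1 g \<le> ennreal (\<bar>C\<bar> + 1) * lorentz_qnorm p r0 g" for g :: "'a \<Rightarrow> complex"
  proof -
    have "lorentz_qnorm p r1 g \<le> ennreal C * lorentz_qnorm p r0 g"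
      unfolding lorentz_qnorm_eq by (rule C[OF rearrangement_antimono_on rearrangement_measurable])
    also have "\<dots> \<le> ennreal (\<bar>C\<bar> + 1) * lorentz_qnorm p r0 g" by (intro mult_right_mono ennreal_leI) auto
    finally show ?thesis .
  qed
  then show ?thesis
    unfolding distr_lorentz_qnorm_def
    by (intro exI[of _ "\<bar>C\<bar> + 1"] conjI allI ennreal_INF_le_cmult) auto
qed

section \<open>Sufficiency\<close>

definition seq_qnorm :: "ennreal \<Rightarrow> (nat \<Rightarrow> ennreal) \<Rightarrow> ennreal" where
  "seq_qnorm q c = (if q = \<infinity> then (SUP k. c k) else epowr (\<Sum>k. epowr (c k) (enn2real q)) (1 / enn2real q))"

lemma besov_lorentz_qnorm_eq:
  assumes "0 < q"
  shows "besov_lorentz_qnorm \<beta>0 s q p r f = seq_qnorm q (\<lambda>k. ennreal (2 powr (real k * s)) * distr_lorentz_qnorm p r (LP_piece \<beta>0 k f))"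
proof (cases "q = \<infinity>")
  case False
  then have "0 < enn2real q" using assms by (simp add: enn2real_positive_iff less_top)
  then show ?thesis
    using False by (simp add: besov_lorentz_qnorm_def seq_qnorm_def epowr_mult epowr_ennreal powr_powr)
qed (simp add: besov_lorentz_qnorm_def seq_qnorm_def)

lemma seq_qnorm_upper:
  assumes q: "0 < q" shows "c k \<le> seq_qnorm q c"
proof (cases "q = \<infinity>")
  case False
  then have q': "0 < enn2real q" using q by (simp add: enn2real_positive_iff less_top)
  have "epowr (c k) (enn2real q) \<le> (\<Sum>k. epowr (c k) (enn2real q))"
    using sum_le_suminf[of "\<lambda>k. epowr (c k) (enn2real q)" "{k}"] by (simp add: summableI)
  then have "epowr (epowr (c k) (enn2real q)) (1 / enn2real q) \<le> epowr (\<Sum>k. epowr (c k) (enn2real q)) (1 / enn2real q)"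
    using q' by (intro epowr_mono) auto
  then show ?thesis using False q' by (simp add: seq_qnorm_def epowr_inverse)
qed (auto simp: seq_qnorm_def intro: SUP_upper)

lemma seq_qnorm_mono:
  assumes "\<And>k. c k \<le> d k" shows "seq_qnorm q c \<le> seq_qnorm q d"
  unfolding seq_qnorm_def
  by (auto intro!: SUP_subset_mono epowr_mono suminf_le assms summableI)

lemma seq_qnorm_cmult:
  assumes q: "0 < q" shows "seq_qnorm q (\<lambda>k. a * c k) = a * seq_qnorm q c"
proof (cases "q = \<infinity>")
  case False
  then have q': "0 < enn2real q" using q by (simp add: enn2real_positive_iff less_top)
  then show ?thesis
    using False by (simp add: seq_qnorm_def epowr_mult ennreal_suminf_cmult epowr_inverse)
qed (simp add: seq_qnorm_def SUP_mult_left_ennreal)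

text \<open>The sequence analogue of \<open>lorentz_second_exponent_le\<close>: in
  \<open>c^r1 = c^(r1 - r0) c^r0\<close> the first factor is at most that power of the whole
  quasi-norm.\<close>

lemma seq_qnorm_antimono_exponent:
  assumes q: "0 < q0" "q0 \<le> q1" shows "seq_qnorm q1 c \<le> seq_qnorm q0 c"
proof (cases "q1 = \<infinity> \<or> q1 = q0")
  case True
  then show ?thesis
  proof
    assume "q1 = \<infinity>"
    moreover have "(SUP k. c k) \<le> seq_qnorm q0 c" by (intro SUP_least seq_qnorm_upper q)
    ultimately show ?thesis unfolding seq_qnorm_def[of q1] by simp
  qed simp
next
  case False
  let ?r0 = "enn2real q0" and ?r1 = "enn2real q1"
  have fin: "q0 \<noteq> \<infinity>" "q1 \<noteq> \<infinity>" using False q by (auto simp: top_unique)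
  have lt: "0 < ?r0" "?r0 < ?r1"
    using fin q False by (cases q0; cases q1; simp)+
  let ?A = "seq_qnorm q0 c"
  have A: "(\<Sum>k. epowr (c k) ?r0) = epowr ?A ?r0"
    using fin lt by (simp add: seq_qnorm_def epowr_epowr)
  have "epowr (c k) ?r1 \<le> epowr ?A (?r1 - ?r0) * epowr (c k) ?r0" for k
  proof -
    have "epowr (c k) ?r1 = epowr (c k) (?r1 - ?r0) * epowr (c k) ?r0"
      using epowr_add[of "?r1 - ?r0" ?r0 "c k"] lt by simp
    also have "\<dots> \<le> epowr ?A (?r1 - ?r0) * epowr (c k) ?r0"
      using lt by (intro mult_right_mono epowr_mono seq_qnorm_upper q) auto
    finally show ?thesis .
  qed
  then have "(\<Sum>k. epowr (c k) ?r1) \<le> (\<Sum>k. epowr ?A (?r1 - ?r0) * epowr (c k) ?r0)"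
    by (intro suminf_le summableI)
  also have "\<dots> = epowr ?A (?r1 - ?r0) * epowr ?A ?r0" by (simp add: ennreal_suminf_cmult A)
  also have "\<dots> = epowr ?A ?r1" using epowr_add[of "?r1 - ?r0" ?r0 ?A] lt by simp
  finally have "epowr (\<Sum>k. epowr (c k) ?r1) (1 / ?r1) \<le> epowr (epowr ?A ?r1) (1 / ?r1)"
    using lt by (intro epowr_mono) auto
  then show ?thesis using fin lt by (simp add: seq_qnorm_def[of q1] epowr_inverse)
qed

lemma seq_qnorm_geometric_finite:
  assumes q: "0 < q" and e: "0 < e" shows "seq_qnorm q (\<lambda>k. ennreal (2 powr (- (real k * e)))) < \<infinity>"
proof (cases "q = \<infinity>")
  case True
  have "(SUP k. ennreal (2 powr (- (real k * e)))) \<le> ennreal 1"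
  proof (intro SUP_least ennreal_leI)
    fix k show "2 powr (- (real k * e)) \<le> 1" using powr_mono[of "- (real k * e)" 0 2] e by simp
  qed
  then show ?thesis using True by (simp add: seq_qnorm_def order_le_less_trans)
next
  case False
  then have q': "0 < enn2real q" using q by (simp add: enn2real_positive_iff less_top)
  define x where "x = (2::real) powr (- (e * enn2real q))"
  have x: "0 < x" "x < 1" using e q' by (auto simp: x_def powr_less_one)
  have "epowr (ennreal (2 powr (- (real k * e)))) (enn2real q) = ennreal (x ^ k)" for k
    using x by (simp add: epowr_ennreal powr_powr powr_realpow[symmetric] x_def mult_ac)
  moreover have "(\<Sum>k. ennreal (x ^ k)) < \<infinity>"
  proof -
    have "(\<Sum>k. ennreal (x ^ k)) = ennreal (\<Sum>k. x ^ k)"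
    proof (rule suminf_ennreal2)
      show "summable (\<lambda>k. x ^ k)" using x by (intro summable_geometric) simp
    qed (use x in simp)
    then show ?thesis by simp
  qed
  ultimately show ?thesis using False by (simp add: seq_qnorm_def epowr_less_top_iff[simplified])
qed

text \<open>The excess of smoothness \<open>e = s0 - s1 - D\<close> decides. For
  \<open>e > 0\<close> every weighted piece is bounded by the source quasi-norm, and the remaining
  geometric sequence lies in every sequence space, whatever \<open>q0\<close> and \<open>q1\<close>
  are. For \<open>e = 0\<close> the inclusion of sequence spaces takes over, using
  \<open>q0 \<le> q1\<close>.\<close>

lemma besov_lorentz_embedI:
  fixes \<beta>0 :: "'a::euclidean_space \<Rightarrow> complex"
  assumes q: "0 < q0" "0 < q1"
    and C: "0 < C" "\<And>f k. f \<in> tempered \<Longrightarrow> distr_lorentz_qnorm p1 r1 (LP_piece \<beta>0 k f)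
      \<le> ennreal (C * 2 powr (real k * D)) * distr_lorentz_qnorm p0 r0 (LP_piece \<beta>0 k f)"
    and s: "s0 - s1 > D \<or> s0 - s1 = D \<and> q0 \<le> q1"
  shows "cont_embeds (besov_lorentz \<beta>0 s0 q0 p0 r0) (besov_lorentz_qnorm \<beta>0 s0 q0 p0 r0)
    (besov_lorentz \<beta>0 s1 q1 p1 r1) (besov_lorentz_qnorm \<beta>0 s1 q1 p1 r1)"
proof -
  define e where "e = s0 - s1 - D"
  obtain K where K: "0 \<le> K" "\<And>c. seq_qnorm q1 (\<lambda>k. ennreal (2 powr (- (real k * e))) * c k) \<le> ennreal K * seq_qnorm q0 c"
  proof (cases "e > 0")
    case True
    let ?G = "seq_qnorm q1 (\<lambda>k. ennreal (2 powr (- (real k * e))))"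
    have "seq_qnorm q1 (\<lambda>k. ennreal (2 powr (- (real k * e))) * c k) \<le> ?G * seq_qnorm q0 c" for c
    proof -
      have "seq_qnorm q1 (\<lambda>k. ennreal (2 powr (- (real k * e))) * c k) \<le> seq_qnorm q1 (\<lambda>k. seq_qnorm q0 c * ennreal (2 powr (- (real k * e))))"
        by (intro seq_qnorm_mono) (simp add: mult.commute mult_right_mono seq_qnorm_upper[OF q(1)])
      then show ?thesis by (simp add: seq_qnorm_cmult[OF q(2)] mult.commute)
    qed
    moreover have "?G = ennreal (enn2real ?G)" using seq_qnorm_geometric_finite[OF q(2) True] by simp
    ultimately show ?thesis using that[of "enn2real ?G"] by (metis enn2real_nonneg)
  next
    case False
    then have "e = 0" "q0 \<le> q1" using s by (auto simp: e_def)
    then show ?thesis using that[of 1] seq_qnorm_antimono_exponent[OF q(1)] by simp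
  qed
  have main: "besov_lorentz_qnorm \<beta>0 s1 q1 p1 r1 f \<le> ennreal (C * K) * besov_lorentz_qnorm \<beta>0 s0 q0 p0 r0 f"
    if f: "f \<in> tempered" for f
  proof -
    let ?c = "\<lambda>k. ennreal (2 powr (real k * s0)) * distr_lorentz_qnorm p0 r0 (LP_piece \<beta>0 k f)"
    have "besov_lorentz_qnorm \<beta>0 s1 q1 p1 r1 f \<le> seq_qnorm q1 (\<lambda>k. ennreal C * (ennreal (2 powr (- (real k * e))) * ?c k))"
      unfolding besov_lorentz_qnorm_eq[OF q(2)]
    proof (rule seq_qnorm_mono)
      fix k
      have "ennreal (2 powr (real k * s1)) * distr_lorentz_qnorm p1 r1 (LP_piece \<beta>0 k f)
        \<le> ennreal (2 powr (real k * s1)) * (ennreal (C * 2 powr (real k * D)) * distr_lorentz_qnorm p0 r0 (LP_piece \<beta>0 k f))"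
        by (intro mult_left_mono C f) auto
      also have "\<dots> = ennreal (C * (2 powr (- (real k * e)) * 2 powr (real k * s0))) * distr_lorentz_qnorm p0 r0 (LP_piece \<beta>0 k f)"
      proof -
        have "real k * s1 + real k * D = - (real k * e) + real k * s0" by (simp add: e_def algebra_simps)
        then have "2 powr (real k * s1) * 2 powr (real k * D) = 2 powr (- (real k * e)) * (2::real) powr (real k * s0)"
          unfolding powr_add[symmetric] by simp
        then have "2 powr (real k * s1) * (C * 2 powr (real k * D)) = C * (2 powr (- (real k * e)) * 2 powr (real k * s0))"
          by (simp add: mult.left_commute)
        then have "ennreal (2 powr (real k * s1)) * ennreal (C * 2 powr (real k * D)) = ennreal (C * (2 powr (- (real k * e)) * 2 powr (real k * s0)))"
          using C(1) by (subst ennreal_mult[symmetric]) auto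
        then show ?thesis by (simp only: mult.assoc[symmetric])
      qed
      also have "\<dots> = ennreal C * (ennreal (2 powr (- (real k * e))) * ?c k)"
        using C(1) by (simp add: ennreal_mult mult.assoc)
      finally show "ennreal (2 powr (real k * s1)) * distr_lorentz_qnorm p1 r1 (LP_piece \<beta>0 k f) \<le> ennreal C * (ennreal (2 powr (- (real k * e))) * ?c k)" .
    qed
    also have "\<dots> = ennreal C * seq_qnorm q1 (\<lambda>k. ennreal (2 powr (- (real k * e))) * ?c k)"
      by (rule seq_qnorm_cmult[OF q(2)])
    also have "\<dots> \<le> ennreal C * (ennreal K * seq_qnorm q0 ?c)" by (intro mult_left_mono K) auto
    also have "\<dots> = ennreal (C * K) * besov_lorentz_qnorm \<beta>0 s0 q0 p0 r0 f"
      unfolding besov_lorentz_qnorm_eq[OF q(1)] using C(1) K(1) by (simp add: ennreal_mult mult.assoc)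
    finally show ?thesis .
  qed
  show ?thesis
    unfolding cont_embeds_def
  proof (intro conjI exI[of _ "C * K"] ballI subsetI)
    fix f assume "f \<in> besov_lorentz \<beta>0 s0 q0 p0 r0"
    then have f: "f \<in> tempered" "besov_lorentz_qnorm \<beta>0 s0 q0 p0 r0 f < \<infinity>" by (auto simp: besov_lorentz_def)
    then have "ennreal (C * K) * besov_lorentz_qnorm \<beta>0 s0 q0 p0 r0 f < \<infinity>" by (simp add: ennreal_mult_less_top)
    then show "f \<in> besov_lorentz \<beta>0 s1 q1 p1 r1"
      using main[OF f(1)] f(1) by (auto simp: besov_lorentz_def intro: le_less_trans)
    show "besov_lorentz_qnorm \<beta>0 s1 q1 p1 r1 f \<le> ennreal (C * K) * besov_lorentz_qnorm \<beta>0 s0 q0 p0 r0 f"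
      by (rule main[OF f(1)])
  qed
qed

text \<open>The conditions are regrouped by the first exponents: for \<open>p0 < p1\<close> the
  bound on pieces has \<open>D = d/p0 - d/p1\<close>, while for equal exponents it is monotonicity
  in the second Lorentz exponent, with \<open>D = 0\<close>.\<close>

lemma besov_lorentz_embed_sufficient:
  fixes \<beta>0 :: "'a::euclidean_space \<Rightarrow> complex"
  assumes \<beta>: "LP_cutoff \<beta>0" and p: "0 < p0" "0 < p1" and q: "0 < q0" "0 < q1" and r: "0 < r0" "0 < r1"
    and c: "(p0 < p1 \<and> s0 - s1 > real DIM('a) / p0 - real DIM('a) / p1) \<or>
      (p0 < p1 \<and> s0 - s1 = real DIM('a) / p0 - real DIM('a) / p1 \<and> q0 \<le> q1) \<or>
      (p0 = p1 \<and> r0 \<le> r1 \<and> s0 > s1) \<or> (p0 = p1 \<and> r0 \<le> r1 \<and> s0 = s1 \<and> q0 \<le> q1)"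
  shows "cont_embeds (besov_lorentz \<beta>0 s0 q0 p0 r0) (besov_lorentz_qnorm \<beta>0 s0 q0 p0 r0)
    (besov_lorentz \<beta>0 s1 q1 p1 r1) (besov_lorentz_qnorm \<beta>0 s1 q1 p1 r1)"
proof (cases "p0 < p1")
  case True
  obtain C where "C > 0" "\<And>f k. f \<in> tempered \<Longrightarrow> distr_lorentz_qnorm p1 r1 (LP_piece \<beta>0 k f)
    \<le> ennreal (C * 2 powr (real k * (real DIM('a) / p0 - real DIM('a) / p1))) * distr_lorentz_qnorm p0 r0 (LP_piece \<beta>0 k f)"
    using LP_piece_lorentz_embed[OF \<beta> p(1) True r] by metis
  then show ?thesis by (rule besov_lorentz_embedI[OF q]) (use c True in auto)
next
  case False
  obtain C where "C > 0" "\<And>u. distr_lorentz_qnorm p1 r1 u \<le> ennreal C * distr_lorentz_qnorm p0 r0 (u :: 'a distr)"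
    using distr_lorentz_second_exponent_le[OF p(1) r(1), of r1] c False by blast
  then show ?thesis by (intro besov_lorentz_embedI[OF q, where C=C and D=0]) (use c False in auto)
qed

section \<open>Test functions\<close>

definition distr_of :: "('a::euclidean_space \<Rightarrow> complex) \<Rightarrow> 'a distr" where
  "distr_of F = (\<lambda>\<phi>\<in>schwartz. \<integral>x. F x * \<phi> x \<partial>lborel)"

lemma schwartz_product_integrable:
  "F \<in> schwartz \<Longrightarrow> \<phi> \<in> schwartz \<Longrightarrow> integrable lborel (\<lambda>x. F x * \<phi> x)"
  by (intro schwartz_integrable schwartz_mult_schwartz)

lemma distr_of_tempered:
  assumes F: "F \<in> schwartz" shows "distr_of F \<in> tempered"
  unfolding tempered_def
proof (intro CollectI conjI ballI allI)
  show "distr_of F \<in> extensional schwartz" by (simp add: distr_of_def)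
  show "distr_of F (\<lambda>x. \<phi> x + \<psi> x) = distr_of F \<phi> + distr_of F \<psi>" if "\<phi> \<in> schwartz" "\<psi> \<in> schwartz" for \<phi> \<psi>
    using that by (simp add: distr_of_def schwartz_add distrib_left schwartz_product_integrable[OF F])
  show "distr_of F (\<lambda>x. c * \<phi> x) = c * distr_of F \<phi>" if "\<phi> \<in> schwartz" for c \<phi>
    using that by (simp add: distr_of_def schwartz_cmult mult.left_commute[of _ c])
  have "norm (distr_of F \<phi>) \<le> (\<integral>x. norm (F x) \<partial>lborel) * schwartz_seminorm 0 \<phi>" if \<phi>: "\<phi> \<in> schwartz" for \<phi>
  proof -
    have le: "norm (\<phi> x) \<le> schwartz_seminorm 0 \<phi>" for x
      using schwartz_seminorm_upper[OF \<phi>, of "[]" 0 x] by simp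
    have "norm (distr_of F \<phi>) \<le> (\<integral>x. norm (F x * \<phi> x) \<partial>lborel)"
      using \<phi> by (simp add: distr_of_def)
    also have "\<dots> \<le> (\<integral>x. norm (F x) * schwartz_seminorm 0 \<phi> \<partial>lborel)"
    proof (rule integral_mono)
      show "integrable lborel (\<lambda>x. norm (F x * \<phi> x))"
        by (intro integrable_norm schwartz_product_integrable F \<phi>)
      show "integrable lborel (\<lambda>x. norm (F x) * schwartz_seminorm 0 \<phi>)"
        by (intro integrable_mult_left integrable_norm schwartz_integrable F)
    qed (simp add: norm_mult le mult_left_mono)
    finally show ?thesis by simp
  qed
  then show "\<exists>C N. \<forall>\<phi>\<in>schwartz. norm (distr_of F \<phi>) \<le> C * schwartz_seminorm N \<phi>" by blast
qed

text \<open>For a Schwartz function the frequency localisation can be done classically. The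
  multiplication formulas for the Fourier transform and for its inverse transfer the operators from
  the test function back to \<open>F\<close>.\<close>

lemma LP_piece_distr_of_represents:
  assumes \<beta>: "LP_cutoff \<beta>0" and F: "F \<in> schwartz"
  shows "represents (inv_fourier (\<lambda>\<xi>. LP_beta \<beta>0 k \<xi> * fourier F \<xi>)) (LP_piece \<beta>0 k (distr_of F))"
proof -
  let ?G = "inv_fourier (\<lambda>\<xi>. LP_beta \<beta>0 k \<xi> * fourier F \<xi>)"
  have bF: "(\<lambda>\<xi>. LP_beta \<beta>0 k \<xi> * fourier F \<xi>) \<in> schwartz"
    by (intro schwartz_mult_schwartz LP_beta_schwartz[OF \<beta>] schwartz_fourier F)
  have G: "?G \<in> schwartz" by (intro schwartz_inv_fourier bF)
  have "integrable lebesgue (\<lambda>x. ?G x * \<phi> x) \<and> LP_piece \<beta>0 k (distr_of F) \<phi> = (\<integral>x. ?G x * \<phi> x \<partial>lebesgue)"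
    if \<phi>: "\<phi> \<in> schwartz" for \<phi>
  proof
    have i: "integrable lborel (\<lambda>x. ?G x * \<phi> x)" by (rule schwartz_product_integrable[OF G \<phi>])
    then show "integrable lebesgue (\<lambda>x. ?G x * \<phi> x)"
      using integrable_completion[OF borel_measurable_integrable[OF i]] by simp
    have b\<phi>: "(\<lambda>\<xi>. LP_beta \<beta>0 k \<xi> * inv_fourier \<phi> \<xi>) \<in> schwartz"
      by (intro schwartz_mult_schwartz LP_beta_schwartz[OF \<beta>] schwartz_inv_fourier \<phi>)
    have "LP_piece \<beta>0 k (distr_of F) \<phi> = (\<integral>x. F x * fourier (\<lambda>\<xi>. LP_beta \<beta>0 k \<xi> * inv_fourier \<phi> \<xi>) x \<partial>lborel)"
      unfolding LP_piece_apply[OF \<beta> \<phi>]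
      using schwartz_fourier[OF b\<phi>] fourier_mult_inv_fourier[OF schwartz_integrable[OF LP_beta_schwartz[OF \<beta>]] schwartz_integrable[OF \<phi>], of k]
      by (simp add: distr_of_def)
    also have "\<dots> = (\<integral>\<xi>. fourier F \<xi> * (LP_beta \<beta>0 k \<xi> * inv_fourier \<phi> \<xi>) \<partial>lborel)"
      by (rule fourier_multiplication_formula) (intro schwartz_integrable F b\<phi>)+
    also have "\<dots> = (\<integral>\<xi>. (LP_beta \<beta>0 k \<xi> * fourier F \<xi>) * inv_fourier \<phi> \<xi> \<partial>lborel)"
      by (simp add: mult_ac)
    also have "\<dots> = (\<integral>x. ?G x * \<phi> x \<partial>lborel)"
      by (rule inv_fourier_multiplication_formula) (intro schwartz_integrable bF \<phi>)+
    also have "\<dots> = (\<integral>x. ?G x * \<phi> x \<partial>lebesgue)"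
      by (rule integral_completion[OF borel_measurable_integrable[OF i], symmetric])
    finally show "LP_piece \<beta>0 k (distr_of F) \<phi> = (\<integral>x. ?G x * \<phi> x \<partial>lebesgue)" .
  qed
  then show ?thesis
    unfolding represents_def using borel_measurable_lebesgueI[OF schwartz_measurable[OF G]] by blast
qed

text \<open>The difference of two representatives pairs to zero with every Schwartz function, so
  \<open>dual_bound\<close> applies with \<open>W = 0\<close>. This lets the infimum in
  \<open>distr_lorentz_qnorm\<close> be computed from any one representative.\<close>

lemma represents_unique:
  assumes \<beta>: "LP_cutoff (\<beta>0 :: 'a::euclidean_space \<Rightarrow> complex)"
    and g: "represents g u" "represents (g' :: 'a \<Rightarrow> complex) u"
  shows "AE x in lebesgue. g x = g' x"
proof -
  have m: "g \<in> borel_measurable lebesgue" "g' \<in> borel_measurable lebesgue"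
    using g by (auto simp: represents_def)
  have "AE x in lebesgue. norm (g x - g' x) \<le> 0"
  proof (rule dual_bound[OF \<beta>])
    show "(\<lambda>x. g x - g' x) \<in> borel_measurable lebesgue" using m by (rule borel_measurable_diff)
    fix \<phi> :: "'a \<Rightarrow> complex" assume \<phi>: "\<phi> \<in> schwartz"
    note r = represents_integral[OF g(1) \<phi>] represents_integral[OF g(2) \<phi>]
    show "integrable lebesgue (\<lambda>x. (g x - g' x) * \<phi> x)"
      unfolding left_diff_distrib using r by (intro Bochner_Integration.integrable_diff)
    have "(\<integral>x. (g x - g' x) * \<phi> x \<partial>lebesgue) = 0"
      unfolding left_diff_distrib Bochner_Integration.integral_diff[OF r(1,3)] using r by simp
    then show "norm (\<integral>x. (g x - g' x) * \<phi> x \<partial>lebesgue) \<le> (\<integral>x. norm (\<phi> x) * 0 \<partial>lborel)" by simp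
  qed auto
  then show ?thesis by simp
qed

lemma distr_lorentz_qnorm_represents:
  assumes \<beta>: "LP_cutoff (\<beta>0 :: 'a::euclidean_space \<Rightarrow> complex)" and g: "represents (g :: 'a \<Rightarrow> complex) u"
  shows "distr_lorentz_qnorm p r u = lorentz_qnorm p r g"
proof -
  have "lorentz_qnorm p r g' = lorentz_qnorm p r g" if g': "represents g' u" for g'
    unfolding lorentz_qnorm_eq
    using rearrangement_cong_AE[OF _ _ represents_unique[OF \<beta> g' g]] g g' by (simp add: represents_def)
  moreover have "{g. represents g u} \<noteq> {}" using g by blast
  ultimately show ?thesis unfolding distr_lorentz_qnorm_def by (intro INF_eq_const) auto
qed

section \<open>Besov quasi-norms of functions with prescribed spectrum\<close>

lemma besov_qnorm_distr_of:
  assumes \<beta>: "LP_cutoff \<beta>0" and F: "F \<in> schwartz" and q: "0 < q"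
  shows "besov_lorentz_qnorm \<beta>0 s q p r (distr_of F) =
    seq_qnorm q (\<lambda>k. ennreal (2 powr (real k * s)) * lorentz_qnorm p r (inv_fourier (\<lambda>\<xi>. LP_beta \<beta>0 k \<xi> * fourier F \<xi>)))"
  unfolding besov_lorentz_qnorm_eq[OF q]
  by (simp add: distr_lorentz_qnorm_represents[OF \<beta> LP_piece_distr_of_represents[OF \<beta> F]])

lemma inv_fourier_zero: "inv_fourier (\<lambda>\<xi>. 0) = (\<lambda>x. 0)"
  by (simp add: inv_fourier_def fun_eq_iff)

lemma lorentz_functional_zero: "0 < r \<Longrightarrow> lorentz_functional p r (\<lambda>t. 0) = 0"
  using lorentz_functional_cmult[of "\<lambda>t. 0" r p 0] by simp

lemma lorentz_qnorm_zero: "0 < r \<Longrightarrow> lorentz_qnorm p r (\<lambda>x. 0) = 0"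
proof -
  assume r: "0 < r"
  have "lorentz_functional p r (rearrangement (\<lambda>x::'a. 0)) \<le> lorentz_functional p r (\<lambda>t. 0)"
  proof (rule lorentz_functional_mono)
    fix t :: real show "rearrangement (\<lambda>x::'a. 0) t \<le> 0"
      using rearrangement_le[of 0 "\<lambda>x::'a. 0" t] by simp
  qed
  then show ?thesis unfolding lorentz_qnorm_eq lorentz_functional_zero[OF r] by simp
qed

lemma seq_qnorm_first:
  assumes q: "0 < q" and c: "\<And>k. k \<noteq> 0 \<Longrightarrow> c k = 0" shows "seq_qnorm q c = c 0"
proof (cases "q = \<infinity>")
  case True
  have "(SUP k. c k) = c 0"
  proof (rule antisym)
    show "(SUP k. c k) \<le> c 0"
    proof (rule SUP_least)
      fix k show "c k \<le> c 0" by (cases "k = 0") (simp_all add: c)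
    qed
  qed (simp add: SUP_upper)
  then show ?thesis using True by (simp add: seq_qnorm_def)
next
  case False
  then have q': "0 < enn2real q" using q by (simp add: enn2real_positive_iff less_top)
  have "(\<Sum>k. epowr (c k) (enn2real q)) = (\<Sum>k\<in>{0}. epowr (c k) (enn2real q))"
    by (rule suminf_finite) (auto simp: c)
  then show ?thesis using False q' by (simp add: seq_qnorm_def epowr_inverse)
qed

text \<open>For \<open>|\<xi>| \<le> 3/2\<close> the cutoff is 1, and for \<open>k \<ge> 1\<close>
  both dilated cutoffs in \<open>LP_beta\<close> are 1 and cancel. The only piece is
  \<open>F\<close> itself, at level 0 with weight 1, so \<open>s\<close> and \<open>q\<close> drop
  out.\<close>

lemma besov_qnorm_low_frequency:
  assumes \<beta>: "LP_cutoff \<beta>0" and F: "F \<in> schwartz" and supp: "\<And>\<xi>. norm \<xi> > 3 / 2 \<Longrightarrow> fourier F \<xi> = 0"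
    and q: "0 < q" and r: "0 < r"
  shows "besov_lorentz_qnorm \<beta>0 s q p r (distr_of F) = lorentz_qnorm p r F"
proof -
  let ?c = "\<lambda>k. ennreal (2 powr (real k * s)) * lorentz_qnorm p r (inv_fourier (\<lambda>\<xi>. LP_beta \<beta>0 k \<xi> * fourier F \<xi>))"
  have one: "\<beta>0 \<xi> = 1" if "norm \<xi> \<le> 3 / 2" for \<xi> using \<beta> that by (simp add: LP_cutoff_def)
  have "(\<lambda>\<xi>. LP_beta \<beta>0 0 \<xi> * fourier F \<xi>) = fourier F"
  proof
    fix \<xi> show "LP_beta \<beta>0 0 \<xi> * fourier F \<xi> = fourier F \<xi>"
      using supp[of \<xi>] one[of \<xi>] by (cases "norm \<xi> \<le> 3 / 2") (auto simp: LP_beta_def)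
  qed
  then have c0: "?c 0 = lorentz_qnorm p r F" by (simp add: inv_fourier_fourier[OF F])
  have "?c k = 0" if k: "k \<noteq> 0" for k
  proof -
    have "(\<lambda>\<xi>. LP_beta \<beta>0 k \<xi> * fourier F \<xi>) = (\<lambda>\<xi>. 0)"
    proof
      fix \<xi>
      show "LP_beta \<beta>0 k \<xi> * fourier F \<xi> = 0"
      proof (cases "norm \<xi> \<le> 3 / 2")
        case True
        have "2 powr (- real k) \<le> (1::real)" "2 powr (1 - real k) \<le> (1::real)"
          using k powr_mono[of "- real k" 0 "2::real"] powr_mono[of "1 - real k" 0 "2::real"] by auto
        then have "norm ((2 powr (- real k)) *\<^sub>R \<xi>) \<le> 3 / 2" "norm ((2 powr (1 - real k)) *\<^sub>R \<xi>) \<le> 3 / 2"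
          using True mult_mono[of "2 powr (- real k)" 1 "norm \<xi>" "3/2"] mult_mono[of "2 powr (1 - real k)" 1 "norm \<xi>" "3/2"] by auto
        then show ?thesis using k by (simp add: LP_beta_def one)
      qed (use supp in simp)
    qed
    then show ?thesis by (simp add: inv_fourier_zero lorentz_qnorm_zero[OF r])
  qed
  then have "seq_qnorm q ?c = ?c 0" by (rule seq_qnorm_first[OF q])
  then show ?thesis unfolding besov_qnorm_distr_of[OF \<beta> F q] c0 .
qed

text \<open>Since \<open>7/8 * 2^k = 7/4 * 2^(k - 1)\<close>, the cutoffs dilated by
  \<open>2^i\<close> vanish on the annulus for \<open>i < k\<close> and are 1 for
  \<open>i \<ge> k\<close>; among their differences only the one for \<open>j = k\<close>
  survives.\<close>

lemma LP_beta_on_annulus: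
  assumes \<beta>: "LP_cutoff \<beta>0" and k: "1 \<le> k" and \<xi>: "7 / 8 * 2 ^ k \<le> norm \<xi>" "norm \<xi> \<le> 3 / 2 * 2 ^ k"
  shows "LP_beta \<beta>0 j \<xi> = of_bool (j = k)"
proof -
  have a: "\<beta>0 ((2 powr (- real i)) *\<^sub>R \<xi>) = of_bool (k \<le> i)" for i :: nat
  proof -
    have n: "norm ((2 powr (- real i)) *\<^sub>R \<xi>) = norm \<xi> / 2 ^ i" by (simp add: powr_minus powr_realpow field_simps)
    show ?thesis
    proof (cases "k \<le> i")
      case True
      have "norm \<xi> \<le> 3 / 2 * 2 ^ i" using \<xi>(2) power_increasing[OF True, of "2::real"] by linarith
      then have "norm \<xi> / 2 ^ i \<le> 3 / 2" by (simp add: field_simps)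
      then show ?thesis using True \<beta> n by (simp add: LP_cutoff_def)
    next
      case False
      then have "2 ^ Suc i \<le> (2::real) ^ k" by (intro power_increasing) auto
      then have "7 / 4 * 2 ^ i \<le> norm \<xi>" using \<xi>(1) by simp
      then have "7 / 4 \<le> norm \<xi> / 2 ^ i" by (simp add: field_simps)
      then show ?thesis using False \<beta> n by (simp add: LP_cutoff_def)
    qed
  qed
  show ?thesis
  proof (cases j)
    case 0
    then show ?thesis using a[of 0] k by (simp add: LP_beta_def)
  next
    case (Suc i)
    have "1 - real j = - real i" using Suc by simp
    then show ?thesis using a[of j] a[of i] Suc by (auto simp: LP_beta_def)
  qed
qed

lemma fourier_sum:
  "(\<And>i. i \<in> I \<Longrightarrow> integrable lborel (f i)) \<Longrightarrow> fourier (\<lambda>x. \<Sum>i\<in>I. f i x) \<xi> = (\<Sum>i\<in>I. fourier (f i) \<xi>)"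
  unfolding fourier_def by (simp add: sum_distrib_left integrable_cis_minus_mult)

text \<open>The dilated spectra lie in annuli each selected by a single \<open>LP_beta\<close>, so
  the pieces of the sum are its summands and the Besov quasi-norm is a sequence quasi-norm with
  freely chosen coefficients.\<close>

lemma besov_qnorm_annulus_sum:
  fixes \<beta>0 :: "'a::euclidean_space \<Rightarrow> complex"
  assumes \<beta>: "LP_cutoff \<beta>0" and F: "F \<in> schwartz"
    and supp: "\<And>\<xi>. fourier F \<xi> \<noteq> 0 \<Longrightarrow> 7 / 8 \<le> norm \<xi> \<and> norm \<xi> \<le> 3 / 2"
    and I: "finite I" "0 \<notin> I" and q: "0 < q" and r: "0 < r"
  shows "(\<lambda>x. \<Sum>k\<in>I. of_real (a k) * F (2 ^ k *\<^sub>R x)) \<in> schwartz"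
    and "besov_lorentz_qnorm \<beta>0 s q p r (distr_of (\<lambda>x. \<Sum>k\<in>I. of_real (a k) * F (2 ^ k *\<^sub>R x))) =
      seq_qnorm q (\<lambda>k. if k \<in> I then ennreal (2 powr (real k * s)) * lorentz_qnorm p r (\<lambda>x. of_real (a k) * F (2 ^ k *\<^sub>R x)) else 0)"
proof -
  let ?f = "\<lambda>k x. of_real (a k) * F (2 ^ k *\<^sub>R x)"
  let ?S = "\<lambda>x. \<Sum>k\<in>I. ?f k x"
  have fS: "?f k \<in> schwartz" for k by (intro schwartz_cmult schwartz_dilate F) simp
  show S: "?S \<in> schwartz" by (intro schwartz_sum fS)
  have ff: "fourier (?f k) \<xi> \<noteq> 0 \<Longrightarrow> 7 / 8 * 2 ^ k \<le> norm \<xi> \<and> norm \<xi> \<le> 3 / 2 * 2 ^ k" for k \<xi>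
  proof -
    assume "fourier (?f k) \<xi> \<noteq> 0"
    then have "fourier F (inverse (2 ^ k) *\<^sub>R \<xi>) \<noteq> 0"
      using fourier_dilate[OF schwartz_measurable[OF F], of "2 ^ k" \<xi>] by (auto simp: fourier_cmult)
    then have "7 / 8 \<le> norm (inverse (2 ^ k) *\<^sub>R \<xi>) \<and> norm (inverse (2 ^ k) *\<^sub>R \<xi>) \<le> 3 / 2" by (rule supp)
    moreover have "norm (inverse (2 ^ k) *\<^sub>R \<xi>) = norm \<xi> / 2 ^ k" by (simp add: divide_inverse_commute)
    ultimately show ?thesis by (simp add: pos_le_divide_eq pos_divide_le_eq)
  qed
  have "inv_fourier (\<lambda>\<xi>. LP_beta \<beta>0 j \<xi> * fourier ?S \<xi>) = (if j \<in> I then ?f j else (\<lambda>x. 0))" for j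
  proof -
    have "(\<lambda>\<xi>. LP_beta \<beta>0 j \<xi> * fourier ?S \<xi>) = (if j \<in> I then fourier (?f j) else (\<lambda>\<xi>. 0))"
    proof
      fix \<xi>
      have "LP_beta \<beta>0 j \<xi> * fourier ?S \<xi> = (\<Sum>k\<in>I. LP_beta \<beta>0 j \<xi> * fourier (?f k) \<xi>)"
        by (subst fourier_sum) (auto intro: schwartz_integrable fS simp: sum_distrib_left)
      also have "\<dots> = (\<Sum>k\<in>I. if k = j then fourier (?f k) \<xi> else 0)"
      proof (rule sum.cong[OF refl])
        fix k assume "k \<in> I"
        then have "1 \<le> k" using I(2) by (metis One_nat_def Suc_leI neq0_conv)
        then show "LP_beta \<beta>0 j \<xi> * fourier (?f k) \<xi> = (if k = j then fourier (?f k) \<xi> else 0)"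
          using LP_beta_on_annulus[OF \<beta> _, of k \<xi> j] ff[of k \<xi>] by (cases "fourier (?f k) \<xi> = 0") auto
      qed
      also have "\<dots> = (if j \<in> I then fourier (?f j) \<xi> else 0)" using I(1) by simp
      finally show "LP_beta \<beta>0 j \<xi> * fourier ?S \<xi> = (if j \<in> I then fourier (?f j) else (\<lambda>\<xi>. 0)) \<xi>" by simp
    qed
    then show ?thesis by (simp add: inv_fourier_zero inv_fourier_fourier[OF fS])
  qed
  then show "besov_lorentz_qnorm \<beta>0 s q p r (distr_of ?S) =
    seq_qnorm q (\<lambda>k. if k \<in> I then ennreal (2 powr (real k * s)) * lorentz_qnorm p r (?f k) else 0)"
    unfolding besov_qnorm_distr_of[OF \<beta> S q] by (auto intro!: arg_cong[of _ _ "seq_qnorm q"] simp: lorentz_qnorm_zero[OF r])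
qed

section \<open>Scaling, finiteness and positivity of Lorentz quasi-norms\<close>

lemma rearrangement_cmult_le:
  assumes a: "a > 0" shows "rearrangement (\<lambda>x. of_real a * f x) t \<le> ennreal a * rearrangement f t"
proof -
  let ?R = "rearrangement (\<lambda>x. of_real a * f x) t"
  have "ennreal (1 / a) * ?R \<le> rearrangement f t"
    unfolding rearrangement_def[of f]
  proof (rule INF_greatest)
    fix \<alpha> assume "\<alpha> \<in> {\<alpha>. 0 \<le> \<alpha> \<and> emeasure lebesgue {x. \<alpha> < cmod (f x)} \<le> ennreal t}"
    then have \<alpha>: "0 \<le> \<alpha>" "emeasure lebesgue {x. \<alpha> < cmod (f x)} \<le> ennreal t" by auto
    have "{x. a * \<alpha> < norm (of_real a * f x)} = {x. \<alpha> < cmod (f x)}" using a by (simp add: norm_mult)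
    then have "?R \<le> ennreal (a * \<alpha>)" using a \<alpha> by (intro rearrangement_le) auto
    then have "ennreal (1 / a) * ?R \<le> ennreal (1 / a) * ennreal (a * \<alpha>)" by (intro mult_left_mono) auto
    also have "\<dots> = ennreal \<alpha>" using a \<alpha> by (simp add: ennreal_mult[symmetric])
    finally show "ennreal (1 / a) * ?R \<le> ennreal \<alpha>" .
  qed
  then have "ennreal a * (ennreal (1 / a) * ?R) \<le> ennreal a * rearrangement f t" by (intro mult_left_mono) auto
  then show ?thesis using a by (simp add: mult.assoc[symmetric] ennreal_mult[symmetric])
qed

lemma rearrangement_cmult:
  assumes a: "a > 0" shows "rearrangement (\<lambda>x. of_real a * f x) t = ennreal a * rearrangement f t"
proof (rule antisym[OF rearrangement_cmult_le[OF a]])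
  have "rearrangement f t \<le> ennreal (1 / a) * rearrangement (\<lambda>x. of_real a * f x) t"
    using rearrangement_cmult_le[of "1 / a" "\<lambda>x. of_real a * f x" t] a by (simp add: mult.assoc[symmetric] flip: of_real_mult)
  then have "ennreal a * rearrangement f t \<le> ennreal a * (ennreal (1 / a) * rearrangement (\<lambda>x. of_real a * f x) t)"
    by (intro mult_left_mono) auto
  then show "ennreal a * rearrangement f t \<le> rearrangement (\<lambda>x. of_real a * f x) t"
    using a by (simp add: mult.assoc[symmetric] ennreal_mult[symmetric])
qed

lemma lorentz_qnorm_dilate:
  fixes f :: "'a::euclidean_space \<Rightarrow> complex"
  assumes a: "a > 0" and c: "c > 0" and r: "0 < r"
  shows "lorentz_qnorm p r (\<lambda>x. of_real a * f (c *\<^sub>R x)) = ennreal (a * c powr (- real DIM('a) / p)) * lorentz_qnorm p r f"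
proof -
  have "rearrangement (\<lambda>x. of_real a * f (c *\<^sub>R x)) = (\<lambda>t. ennreal a * rearrangement f (c ^ DIM('a) * t))"
    by (simp add: rearrangement_cmult[OF a] rearrangement_dilate[OF c] fun_eq_iff)
  then have "lorentz_qnorm p r (\<lambda>x. of_real a * f (c *\<^sub>R x)) = ennreal a * lorentz_functional p r (\<lambda>t. rearrangement f (c ^ DIM('a) * t))"
    unfolding lorentz_qnorm_eq by (simp add: lorentz_functional_cmult[OF _ r])
  also have "lorentz_functional p r (\<lambda>t. rearrangement f (c ^ DIM('a) * t)) = ennreal ((c ^ DIM('a)) powr (- 1 / p)) * lorentz_qnorm p r f"
    unfolding lorentz_qnorm_eq by (rule lorentz_functional_dilate[OF _ r]) (use c in auto)
  also have "(c ^ DIM('a)) powr (- 1 / p) = c powr (- real DIM('a) / p)"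
    using c by (simp add: powr_realpow[symmetric] powr_powr)
  finally show ?thesis using a by (simp add: ennreal_mult mult.assoc)
qed

lemma rapid_decay:
  fixes F :: "'a::euclidean_space \<Rightarrow> complex"
  assumes F: "rapid F" and \<theta>: "0 \<le> \<theta>"
  obtains A where "A > 0" "\<And>x. norm (F x) \<le> A" "\<And>x. x \<noteq> 0 \<Longrightarrow> norm (F x) \<le> A * norm x powr (- \<theta>)"
proof -
  \<comment> \<open>Real exponents such as \<open>d/p\<close> are needed, while \<open>rapid\<close>
    offers integer powers; rounding up is harmless because \<open>1 + |x| \<ge> 1\<close>.\<close>
  define N where "N = nat \<lceil>\<theta>\<rceil>"
  obtain B where B: "B > 0" "\<And>x. (1 + norm x) ^ N * norm (F x) \<le> B" using rapid_bound[OF F] by metis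
  have b: "norm (F x) \<le> B" for x
    using B(2)[of x] mult_right_mono[OF one_le_one_plus_norm_power[of x N], of "norm (F x)"] by simp
  have "norm (F x) \<le> B * norm x powr (- \<theta>)" if x: "x \<noteq> 0" for x
  proof -
    have "norm x powr \<theta> \<le> (1 + norm x) powr \<theta>" using \<theta> by (intro powr_mono2) auto
    also have "\<dots> \<le> (1 + norm x) powr real N" unfolding N_def using \<theta> by (intro powr_mono) auto
    also have "\<dots> = (1 + norm x) ^ N" by (intro powr_realpow) (simp add: add_pos_nonneg)
    finally have "norm x powr \<theta> * norm (F x) \<le> (1 + norm x) ^ N * norm (F x)" by (intro mult_right_mono) auto
    then have "norm x powr \<theta> * norm (F x) \<le> B" using B(2)[of x] by linarith
    then show ?thesis using x by (simp add: powr_minus field_simps)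
  qed
  then show ?thesis using that[of B] B(1) b by blast
qed

lemma schwartz_lorentz_qnorm_finite:
  fixes F :: "'a::euclidean_space \<Rightarrow> complex"
  assumes F: "F \<in> schwartz" and p: "0 < p" and r: "0 < r"
  shows "lorentz_qnorm p r F < \<infinity>"
proof -
  \<comment> \<open>Decay of order \<open>d/p'\<close> with \<open>p' < p\<close> makes the
    rearrangement fall faster than \<open>t^(-1/p)\<close>; finiteness is then the interpolation
    estimate from \<open>p'\<close> to \<open>p\<close> with \<open>L = 1\<close>.\<close>
  define p' where "p' = p / 2"
  have p': "0 < p'" "p' < p" using p by (auto simp: p'_def)
  define v where "v = unit_ball_vol (real DIM('a))"
  have v: "v > 0" by (simp add: v_def)
  have Fm: "F \<in> borel_measurable lebesgue" by (intro borel_measurable_lebesgueI schwartz_measurable F)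
  obtain A where A: "A > 0" "\<And>x. norm (F x) \<le> A" "\<And>x. x \<noteq> 0 \<Longrightarrow> norm (F x) \<le> A * norm x powr (- (real DIM('a) / p'))"
    using rapid_decay[OF schwartz_rapid[OF F], of "real DIM('a) / p'"] p' by auto
  \<comment> \<open>Chosen so that the cap in the minimum, times the common factor
    \<open>A * v powr (1 / p')\<close>, is the supremum bound \<open>A\<close>.\<close>
  define c where "c = 1 / v powr (1 / p')"
  have "rearrangement F t \<le> ennreal ((A * v powr (1 / p')) * min (t powr (- 1 / p')) (c * 1 powr (1 / p')))" if t: "t > 0" for t
  proof -
    have "rearrangement F t \<le> ennreal (A * (v / t) powr ((real DIM('a) / p') / real DIM('a)))"
      unfolding v_def by (rule rearrangement_decay) (use A p' t in auto)
    also have "A * (v / t) powr ((real DIM('a) / p') / real DIM('a)) = (A * v powr (1 / p')) * t powr (- 1 / p')"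
      using t v by (simp add: powr_divide powr_minus field_simps)
    finally have 1: "rearrangement F t \<le> ennreal ((A * v powr (1 / p')) * t powr (- 1 / p'))" .
    have "rearrangement F t \<le> ennreal A" by (rule rearrangement_bounded[OF Fm]) (use A in auto)
    also have "A = (A * v powr (1 / p')) * (c * 1 powr (1 / p'))" using v by (simp add: c_def)
    finally have 2: "rearrangement F t \<le> ennreal ((A * v powr (1 / p')) * (c * 1 powr (1 / p')))" .
    show ?thesis using 1 2 by (cases "t powr (- 1 / p') \<le> c * 1 powr (1 / p')") (auto simp: min_def)
  qed
  then have "lorentz_qnorm p r F \<le> lorentz_functional p r (\<lambda>t. ennreal ((A * v powr (1 / p')) * min (t powr (- 1 / p')) (c * 1 powr (1 / p'))))"
    unfolding lorentz_qnorm_eq by (rule lorentz_functional_mono)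
  also obtain C where C: "\<And>A L. A \<ge> 0 \<Longrightarrow> L > 0 \<Longrightarrow> lorentz_functional p r (\<lambda>t. ennreal (A * min (t powr (- 1 / p')) (c * L powr (1 / p')))) \<le> ennreal (C * A * L powr (1 / p' - 1 / p))"
    using lorentz_functional_interpolation[OF p' r, of c] by (auto simp: c_def)
  then have "lorentz_functional p r (\<lambda>t. ennreal ((A * v powr (1 / p')) * min (t powr (- 1 / p')) (c * 1 powr (1 / p')))) \<le> ennreal (C * (A * v powr (1 / p')) * 1 powr (1 / p' - 1 / p))"
    using A(1) by (intro C) auto
  also have "\<dots> < \<infinity>" by simp
  finally show ?thesis .
qed

text \<open>On some ball \<open>|F|\<close> exceeds half of \<open>|F x|\<close>, which makes the
  rearrangement positive at half the measure of that ball. One such value makes the weak quasi-norm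
  positive, and \<open>lorentz_weak_le\<close> carries this over to every \<open>r\<close>.\<close>

lemma continuous_lorentz_qnorm_pos:
  fixes F :: "'a::euclidean_space \<Rightarrow> complex"
  assumes F: "continuous_on UNIV F" and x: "F x \<noteq> 0" and p: "0 < p" and r: "0 < r"
  shows "0 < lorentz_qnorm p r F"
proof -
  have Fm: "F \<in> borel_measurable lebesgue" by (intro borel_measurable_lebesgueI borel_measurable_continuous_onI F)
  define c where "c = norm (F x) / 2"
  have c: "c > 0" using x by (simp add: c_def)
  have "open {y. c < norm (F y)}" using F by (intro open_Collect_less continuous_intros)
  moreover have "x \<in> {y. c < norm (F y)}" using x by (simp add: c_def)
  ultimately obtain e where e: "e > 0" "ball x e \<subseteq> {y. c < norm (F y)}" by (meson openE)
  define V where "V = unit_ball_vol (real DIM('a)) * e ^ DIM('a)"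
  have V: "V > 0" using e by (simp add: V_def)
  have "ennreal c \<le> rearrangement F (V / 2)"
    by (rule rearrangement_ge[OF Fm, of _ "ball x e"]) (use e V in \<open>auto simp: emeasure_ball V_def[symmetric] ennreal_less_iff less_imp_le\<close>)
  then have "0 < rearrangement F (V / 2)" using c by (metis ennreal_less_zero_iff less_le_trans)
  then have "0 < ennreal ((V / 2) powr (1 / p)) * rearrangement F (V / 2)"
    using V by (simp add: ennreal_zero_less_mult_iff)
  also have "\<dots> \<le> lorentz_functional p \<infinity> (rearrangement F)"
    unfolding lorentz_functional_def if_P[OF refl] using V by (intro SUP_upper) auto
  finally have pos: "0 < lorentz_functional p \<infinity> (rearrangement F)" .
  obtain C where "lorentz_functional p \<infinity> (rearrangement F) \<le> ennreal C * lorentz_functional p r (rearrangement F)"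
    using lorentz_weak_le[OF p r] rearrangement_antimono_on rearrangement_measurable by blast
  then have "0 < ennreal C * lorentz_functional p r (rearrangement F)" using pos by (rule less_le_trans[rotated])
  then show ?thesis unfolding lorentz_qnorm_eq by (simp add: ennreal_zero_less_mult_iff)
qed

section \<open>Band-limited profiles\<close>

lemma annulus_function_exists:
  fixes \<beta>0 :: "'a::euclidean_space \<Rightarrow> complex"
  assumes \<beta>: "LP_cutoff \<beta>0"
  obtains F :: "'a \<Rightarrow> complex" and x where "F \<in> schwartz" "F x \<noteq> 0"
    "\<And>\<xi>. fourier F \<xi> \<noteq> 0 \<Longrightarrow> 7 / 8 \<le> norm \<xi> \<and> norm \<xi> \<le> 3 / 2"
proof -
  \<comment> \<open>The factor \<open>7/6\<close> moves the outer radius \<open>7/4\<close> of the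
    cutoff to \<open>3/2\<close>, and \<open>12/7\<close> moves its inner radius \<open>3/2\<close>
    to \<open>7/8\<close>. These are the radii of the annulus whose dilates occur in
    \<open>LP_beta_on_annulus\<close>.\<close>
  define H where "H \<xi> = \<beta>0 ((7 / 6) *\<^sub>R \<xi>) - \<beta>0 ((12 / 7) *\<^sub>R \<xi>)" for \<xi>
  have H: "H \<in> schwartz" unfolding H_def[abs_def] by (intro schwartz_diff schwartz_dilate LP_cutoff_schwartz \<beta>) auto
  have fH: "fourier (inv_fourier H) = H" by (rule fourier_inv_fourier[OF H])
  have supp: "7 / 8 \<le> norm \<xi> \<and> norm \<xi> \<le> 3 / 2" if "H \<xi> \<noteq> 0" for \<xi>
  proof (rule ccontr)
    assume n: "\<not> (7 / 8 \<le> norm \<xi> \<and> norm \<xi> \<le> 3 / 2)"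
    have "H \<xi> = 0"
    proof (cases "norm \<xi> < 7 / 8")
      case True
      then show ?thesis using \<beta> by (simp add: H_def LP_cutoff_def)
    next
      case False
      then show ?thesis using \<beta> n by (simp add: H_def LP_cutoff_def)
    qed
    then show False using that by simp
  qed
  obtain b :: 'a where b: "norm b = 1" using vector_choose_size[of 1] by auto
  \<comment> \<open>The radius \<open>11/10\<close> lies in the window where the first cutoff is
    still 1, up to \<open>9/7\<close>, and the second already 0, from \<open>49/48\<close>
    on.\<close>
  have "H ((11 / 10) *\<^sub>R b) = 1" using b \<beta> by (simp add: H_def LP_cutoff_def)
  have "\<exists>x. inv_fourier H x \<noteq> 0"
  proof (rule ccontr)
    assume "\<nexists>x. inv_fourier H x \<noteq> 0"
    then have "fourier (inv_fourier H) \<xi> = 0" for \<xi> by (simp add: fourier_def)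
    then show False using \<open>H ((11 / 10) *\<^sub>R b) = 1\<close> unfolding fH by simp
  qed
  then obtain x where "inv_fourier H x \<noteq> 0" ..
  then show ?thesis using that[of "inv_fourier H" x] schwartz_inv_fourier[OF H] supp unfolding fH by blast
qed

lemma fourier_cnj: "fourier (\<lambda>x. cnj (f x)) \<xi> = cnj (fourier f (- \<xi>))"
proof -
  have "(\<integral>x. cnj (cis (- (x \<bullet> (- \<xi>))) * f x) \<partial>lborel) = cnj (\<integral>x. cis (- (x \<bullet> (- \<xi>))) * f x \<partial>lborel)"
    by (rule Bochner_Integration.integral_cnj)
  then show ?thesis unfolding fourier_def by (simp add: cis_cnj)
qed

text \<open>
  The square \<open>|\<psi>|\<^sup>2\<close> of a band-limited function is band-limited, with spectrum in the difference set.
\<close>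

lemma positive_bandlimited_exists:
  fixes \<beta>0 :: "'a::euclidean_space \<Rightarrow> complex"
  assumes \<beta>: "LP_cutoff \<beta>0"
  obtains \<eta> :: "'a \<Rightarrow> complex" where "\<eta> \<in> schwartz" "\<And>x. \<eta> x = of_real (norm (\<eta> x))" "\<eta> 0 \<noteq> 0"
    "\<And>\<xi>. norm \<xi> \<ge> 1 \<Longrightarrow> fourier \<eta> \<xi> = 0"
proof -
  obtain b :: "'a \<Rightarrow> complex" where b: "b \<in> schwartz" "\<And>x. b x = of_real (norm (b x))"
    "\<And>x. norm x \<ge> 2 \<Longrightarrow> b x = 0" "(\<integral>x. b x \<partial>lborel) = 1" using bump_exists[OF \<beta>] by metis
  \<comment> \<open>As \<open>b\<close> vanishes for \<open>|x| \<ge> 2\<close>, the factor 4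
    confines \<open>h\<close> to radius \<open>1/2\<close>, and so the differences of points in its
    support to radius 1.\<close>
  define h where "h x = b (4 *\<^sub>R x)" for x
  have h: "h \<in> schwartz" unfolding h_def[abs_def] by (intro schwartz_dilate b) simp
  have h0: "h x = 0" if "norm x \<ge> 1 / 2" for x using that b(3)[of "4 *\<^sub>R x"] by (simp add: h_def)
  define \<psi> where "\<psi> = inv_fourier h"
  have \<psi>: "\<psi> \<in> schwartz" unfolding \<psi>_def by (rule schwartz_inv_fourier[OF h])
  have f\<psi>: "fourier \<psi> = h" unfolding \<psi>_def by (rule fourier_inv_fourier[OF h])
  define \<eta> where "\<eta> x = cnj (\<psi> x) * \<psi> x" for x
  have \<eta>: "\<eta> \<in> schwartz" unfolding \<eta>_def[abs_def] by (intro schwartz_mult_schwartz schwartz_cnj \<psi>)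
  have \<eta>r: "\<eta> x = of_real ((norm (\<psi> x))\<^sup>2)" for x
    by (simp add: \<eta>_def mult.commute[of "cnj _"] complex_norm_square[symmetric])
  have "\<psi> 0 \<noteq> 0"
  proof -
    have [measurable]: "b \<in> borel_measurable borel" by (rule schwartz_measurable[OF b(1)])
    have "(\<integral>x. b x \<partial>lborel) = \<bar>4\<bar> ^ DIM('a) *\<^sub>R (\<integral>x. b (0 + 4 *\<^sub>R x) \<partial>lborel)"
      by (rule lborel_integral_affine) auto
    then have "(\<integral>x. h x \<partial>lborel) \<noteq> 0" using b(4) by (auto simp: h_def)
    then show ?thesis by (simp add: \<psi>_def inv_fourier_def)
  qed
  then have "\<eta> 0 \<noteq> 0" by (simp add: \<eta>_def)
  moreover have "fourier \<eta> \<xi> = 0" if \<xi>: "norm \<xi> \<ge> 1" for \<xi>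
  proof -
    have "fourier \<eta> = conv (fourier_kernel (\<lambda>x. cnj (\<psi> x))) h"
      unfolding \<eta>_def[abs_def] \<psi>_def
      by (rule fourier_mult_inv_fourier) (intro schwartz_integrable schwartz_cnj schwartz_inv_fourier h)+
    moreover have zero: "fourier_kernel (\<lambda>x. cnj (\<psi> x)) (\<xi> - y) * h y = 0" for y
    proof (cases "norm y \<ge> 1 / 2")
      case False
      have "norm (- (\<xi> - y)) \<ge> 1 / 2" using False \<xi> norm_triangle_ineq2[of \<xi> y] by (simp add: norm_minus_commute)
      then have "h (- (\<xi> - y)) = 0" by (rule h0)
      then show ?thesis by (simp add: fourier_kernel_def fourier_cnj f\<psi>)
    qed (simp add: h0)
    ultimately have "fourier \<eta> \<xi> = (\<integral>y. fourier_kernel (\<lambda>x. cnj (\<psi> x)) (\<xi> - y) * h y \<partial>lborel)"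
      by (simp only: conv_def)
    then show ?thesis unfolding zero by simp
  qed
  moreover have "\<eta> x = of_real (norm (\<eta> x))" for x by (rule of_real_norm_eqI[OF \<eta>r]) simp
  ultimately show ?thesis using that[of \<eta>] \<eta> by blast
qed

section \<open>Dyadic sums\<close>

text \<open>Positivity of \<open>Y\<close> and finiteness of \<open>X\<close> leave only the two
  exponential rates to compare: dividing by \<open>2^(m b)\<close>, a larger rate on the left would
  make a power of \<open>2^(a - b)\<close> unbounded. All four necessary conditions end
  here.\<close>

lemma growth_rate_le:
  assumes le: "\<And>m::nat. 1 \<le> m \<Longrightarrow> ennreal (2 powr (real m * a)) * Y \<le> ennreal C * (ennreal (2 powr (real m * b)) * X)"
    and Y: "0 < Y" and X: "X < \<infinity>"
  shows "a \<le> b"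
proof (rule ccontr)
  assume "\<not> a \<le> b"
  then have ab: "a - b > 0" by simp
  define x where "x = (2::real) powr (a - b)"
  have x: "x > 1" using ab by (simp add: x_def)
  obtain X' where X': "X = ennreal X'" "X' \<ge> 0" using X by (cases X) auto
  have le': "ennreal (x ^ m) * Y \<le> ennreal (\<bar>C\<bar> * X')" if "1 \<le> m" for m
  proof -
    have "ennreal (2 powr (- (real m * b))) * (ennreal (2 powr (real m * a)) * Y) \<le> ennreal (2 powr (- (real m * b))) * (ennreal \<bar>C\<bar> * (ennreal (2 powr (real m * b)) * X))"
      by (intro mult_left_mono order_trans[OF le[OF that]] mult_right_mono ennreal_leI) auto
    also have "\<dots> = ennreal (2 powr (- (real m * b)) * (\<bar>C\<bar> * (2 powr (real m * b) * X')))"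
      using X' by (simp add: ennreal_mult)
    also have "2 powr (- (real m * b)) * (\<bar>C\<bar> * (2 powr (real m * b) * X')) = \<bar>C\<bar> * X'"
      by (simp add: powr_minus field_simps)
    finally have "ennreal (2 powr (- (real m * b)) * 2 powr (real m * a)) * Y \<le> ennreal (\<bar>C\<bar> * X')"
      by (simp add: ennreal_mult mult.assoc)
    moreover have "2 powr (- (real m * b)) * 2 powr (real m * a) = x ^ m"
      unfolding powr_add[symmetric] x_def by (simp add: powr_realpow[symmetric] powr_powr algebra_simps)
    ultimately show ?thesis by simp
  qed
  have "Y \<noteq> top"
  proof
    assume "Y = top"
    then have "ennreal (x ^ 1) * top \<le> ennreal (\<bar>C\<bar> * X')" using le'[of 1] by simp
    then show False using x by (simp add: ennreal_mult_top top_unique)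
  qed
  then obtain Y' where Y': "Y = ennreal Y'" "Y' > 0" using Y by (cases Y) auto
  \<comment> \<open>The index used below is \<open>Suc n\<close>, because \<open>le'\<close> is
    available from 1 on.\<close>
  obtain n where n: "\<bar>C\<bar> * X' / Y' < x ^ n" using real_arch_pow[OF x] by blast
  have "x ^ n \<le> x ^ Suc n" using x by (intro power_increasing) auto
  then have "x ^ n * Y' \<le> x ^ Suc n * Y'" using Y' by (intro mult_right_mono) auto
  moreover have "\<bar>C\<bar> * X' < x ^ n * Y'" using n Y' by (simp add: pos_divide_less_eq)
  ultimately have "\<bar>C\<bar> * X' < x ^ Suc n * Y'" by linarith
  moreover have "x ^ Suc n * Y' \<le> \<bar>C\<bar> * X'"
    using le'[of "Suc n"] Y' X' x by (simp add: ennreal_mult[symmetric])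
  ultimately show False by simp
qed

text \<open>\<open>1 / q\<close>, with \<open>1 / \<infinity> = 0\<close>.\<close>

definition recip_exponent :: "ennreal \<Rightarrow> real" where
  "recip_exponent q = (if q = \<infinity> then 0 else 1 / enn2real q)"

lemma recip_exponent_le_imp:
  assumes "0 < q0" "0 < q1" "recip_exponent q1 \<le> recip_exponent q0" shows "q0 \<le> q1"
proof (cases q1)
  case (real r1)
  then have r1: "r1 > 0" using assms(2) by simp
  show ?thesis
  proof (cases q0)
    case r0: (real r0)
    then have "r0 > 0" using assms(1) by simp
    then have "r0 \<le> r1" using assms(3) real r0 r1 by (simp add: recip_exponent_def field_simps)
    then show ?thesis using real r0 by (simp add: ennreal_leI)
  next
    case top
    then show ?thesis using assms(3) real r1 by (simp add: recip_exponent_def field_simps)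
  qed
qed simp

lemma seq_qnorm_const_on:
  assumes q: "0 < q" and I: "finite I" "I \<noteq> {}"
  shows "seq_qnorm q (\<lambda>k. if k \<in> I then x else 0) = ennreal (real (card I) powr recip_exponent q) * x"
proof (cases "q = \<infinity>")
  case True
  obtain i where i: "i \<in> I" using I by blast
  have "(SUP k. if k \<in> I then x else 0) = x"
  proof (rule antisym)
    show "x \<le> (SUP k. if k \<in> I then x else 0)" by (rule SUP_upper2[of i]) (use i in auto)
    show "(SUP k. if k \<in> I then x else 0) \<le> x" by (rule SUP_least) auto
  qed
  then show ?thesis using True I by (simp add: seq_qnorm_def recip_exponent_def)
next
  case False
  then have q': "0 < enn2real q" using q by (simp add: enn2real_positive_iff less_top)
  have "(\<Sum>k. epowr (if k \<in> I then x else 0) (enn2real q)) = (\<Sum>k\<in>I. epowr (if k \<in> I then x else 0) (enn2real q))"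
    by (rule suminf_finite) (use I in auto)
  also have "\<dots> = ennreal (real (card I)) * epowr x (enn2real q)"
    by (simp add: ennreal_of_nat_eq_real_of_nat)
  finally have "seq_qnorm q (\<lambda>k. if k \<in> I then x else 0) = epowr (ennreal (real (card I)) * epowr x (enn2real q)) (1 / enn2real q)"
    using False by (simp add: seq_qnorm_def)
  also have "\<dots> = ennreal (real (card I) powr (1 / enn2real q)) * x"
    using q' by (simp add: epowr_mult epowr_inverse epowr_ennreal)
  finally show ?thesis using False by (simp add: recip_exponent_def)
qed

lemma nn_integral_inverse:
  assumes "0 < a" "a \<le> b"
  shows "(\<integral>\<^sup>+t. indicator {a..b} t * ennreal (1 / t) \<partial>lborel) = ennreal (ln (b / a))"
proof -
  have "((\<lambda>t. 1 / t) has_integral (ln b - ln a)) {a..b}"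
    using assms by (intro fundamental_theorem_of_calculus)
      (auto simp flip: has_real_derivative_iff_has_vector_derivative intro!: derivative_eq_intros)
  then have "(\<integral>\<^sup>+t. ennreal (indicator {a..b} t * (1 / t)) \<partial>lborel) = ennreal (ln b - ln a)"
    by (intro nn_integral_has_integral_lebesgue) (use assms in auto)
  moreover have "ennreal (indicator {a..b} t * (1 / t)) = indicator {a..b} t * ennreal (1 / t)" for t
    by (simp add: indicator_def)
  ultimately show ?thesis using assms by (simp add: ln_div)
qed

text \<open>
  Along \<open>u\<^sub>j = \<lambda>\<^sup>-\<^sup>j u\<^sub>0\<close> the right-hand sides telescope, which bounds the two-sided geometric sum
  of \<open>min (u\<^sub>j) (1 / u\<^sub>j)\<close> independently of \<open>u\<^sub>0\<close>.
\<close>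

lemma min_le_telescope:
  assumes l: "(l::real) > 1" and u: "u > 0"
  shows "min u (1 / u) \<le> 2 * (l + 1) / (l - 1) * (l * u / (1 + l * u) - u / (1 + u))"
proof -
  have eq: "l * u / (1 + l * u) - u / (1 + u) = (l - 1) * u / ((1 + u) * (1 + l * u))"
  proof -
    have "1 + l * u \<noteq> 0" "1 + u \<noteq> 0" using l u by (auto simp: add_nonneg_eq_0_iff)
    then show ?thesis by (simp add: diff_frac_eq algebra_simps)
  qed
  have lu: "0 < 1 + l * u" using l u by (simp add: add_pos_pos)
  have "min u (1 / u) \<le> 2 * (l + 1) * u / ((1 + u) * (1 + l * u))"
  proof (cases "u \<le> 1")
    case True
    have "(1 + u) * (1 + l * u) \<le> 2 * (l + 1)"
      using True l u by (intro mult_mono) (auto simp: mult_left_le)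
    then have "u * ((1 + u) * (1 + l * u)) \<le> u * (2 * (l + 1))" using u by (intro mult_left_mono) auto
    then have "u \<le> 2 * (l + 1) * u / ((1 + u) * (1 + l * u))"
      using u lu by (simp add: pos_le_divide_eq mult_ac)
    then show ?thesis by simp
  next
    case False
    have "(1 + u) * (1 + l * u) \<le> (2 * u) * ((l + 1) * u)"
      using False l u by (intro mult_mono) (auto simp: distrib_right)
    then have "1 / u * ((1 + u) * (1 + l * u)) \<le> 1 / u * ((2 * u) * ((l + 1) * u))"
      using u by (intro mult_left_mono) auto
    then have "1 / u \<le> 2 * (l + 1) * u / ((1 + u) * (1 + l * u))"
      using u lu by (subst pos_le_divide_eq) (simp_all add: mult_ac)
    then show ?thesis by simp
  qed
  also have "\<dots> = 2 * (l + 1) / (l - 1) * ((l - 1) * u / ((1 + u) * (1 + l * u)))" using l by simp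
  finally show ?thesis unfolding eq .
qed

text \<open>For \<theta> = d/p the factor \<open>2^(-j \<theta>)\<close> compensates the dilation
  exactly, so all summands have the same \<open>L^{p,r}\<close> quasi-norm.\<close>

definition dyadic_sum :: "real \<Rightarrow> ('a::euclidean_space \<Rightarrow> complex) \<Rightarrow> nat \<Rightarrow> 'a \<Rightarrow> complex" where
  "dyadic_sum \<theta> \<eta> J x = (\<Sum>j\<le>J. of_real (2 powr (- (real j * \<theta>))) * \<eta> ((1 / 2) ^ j *\<^sub>R x))"

lemma dyadic_sum_schwartz: "\<eta> \<in> schwartz \<Longrightarrow> dyadic_sum \<theta> \<eta> J \<in> schwartz"
  unfolding dyadic_sum_def[abs_def] by (intro schwartz_sum schwartz_cmult schwartz_dilate) auto

lemma fourier_dilate_low_frequency: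
  fixes \<eta> :: "'a::euclidean_space \<Rightarrow> complex"
  assumes \<eta>: "\<eta> \<in> schwartz" "\<And>\<xi>. norm \<xi> \<ge> 1 \<Longrightarrow> fourier \<eta> \<xi> = 0" and \<xi>: "norm \<xi> > 3 / 2"
  shows "fourier (\<lambda>x. \<eta> ((1 / 2) ^ j *\<^sub>R x)) \<xi> = 0"
proof -
  have "1 * 1 \<le> 2 ^ j * norm \<xi>" using \<xi> by (intro mult_mono) (auto simp: one_le_power)
  then have "norm (inverse ((1 / 2) ^ j) *\<^sub>R \<xi>) \<ge> 1" by (simp add: power_divide)
  then have "fourier \<eta> (inverse ((1 / 2) ^ j) *\<^sub>R \<xi>) = 0" by (rule \<eta>)
  then show ?thesis
    using fourier_dilate[OF schwartz_measurable[OF \<eta>(1)], of "(1 / 2) ^ j" \<xi>] by simp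
qed

lemma dyadic_sum_low_frequency:
  assumes \<eta>: "\<eta> \<in> schwartz" "\<And>\<xi>. norm \<xi> \<ge> 1 \<Longrightarrow> fourier \<eta> \<xi> = 0" and \<xi>: "norm \<xi> > 3 / 2"
  shows "fourier (dyadic_sum \<theta> \<eta> J) \<xi> = 0"
  unfolding dyadic_sum_def[abs_def]
  by (subst fourier_sum)
     (auto intro!: schwartz_integrable schwartz_cmult schwartz_dilate \<eta>(1) simp: fourier_cmult fourier_dilate_low_frequency[OF \<eta> \<xi>])

lemma half_power_powr: "((1 / 2) ^ j) powr a = (2::real) powr (- (real j * a))"
proof -
  have "(1 / 2 :: real) ^ j = 2 powr (- real j)" by (simp add: powr_minus_divide powr_realpow power_one_over)
  then show ?thesis by (simp add: powr_powr)
qed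

text \<open>The three bounds serve three ranges of the rearrangement variable: below 1, from 1 to
  \<open>2^(J d)\<close>, and beyond. For the middle one, decay rates \<open>\<theta>/2\<close> and
  \<open>3/2 * \<theta>\<close> are placed symmetrically around the critical rate \<theta>. With
  \<open>u = (2^(-j) |x|)^(\<theta>/2)\<close> each summand is then at most a constant times
  \<open>|x|^(-\<theta>) min u (1/u)\<close>.\<close>

lemma dyadic_sum_decay:
  fixes \<eta> :: "'a::euclidean_space \<Rightarrow> complex"
  assumes \<eta>: "\<eta> \<in> schwartz" and \<theta>: "\<theta> > 0"
  obtains A where "A > 0" "\<And>J x. norm (dyadic_sum \<theta> \<eta> J x) \<le> A"
    "\<And>J x. x \<noteq> 0 \<Longrightarrow> norm (dyadic_sum \<theta> \<eta> J x) \<le> A * norm x powr (- \<theta>)"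
    "\<And>J x. x \<noteq> 0 \<Longrightarrow> norm (dyadic_sum \<theta> \<eta> J x) \<le> (A * 2 powr (real J * \<theta>)) * norm x powr (- (2 * \<theta>))"
proof -
  have rd: "\<exists>A>0. (\<forall>x. norm (\<eta> x) \<le> A) \<and> (\<forall>x. x \<noteq> 0 \<longrightarrow> norm (\<eta> x) \<le> A * norm x powr (- t))" if "0 \<le> t" for t
    by (rule rapid_decay[OF schwartz_rapid[OF \<eta>] that]) blast
  have t: "0 \<le> \<theta> / 2" "0 \<le> 3 / 2 * \<theta>" "0 \<le> 2 * \<theta>" using \<theta> by simp_all
  obtain A1 where A1: "A1 > 0" "\<And>x. norm (\<eta> x) \<le> A1" "\<And>x. x \<noteq> 0 \<Longrightarrow> norm (\<eta> x) \<le> A1 * norm x powr (- (\<theta> / 2))"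
    using rd[OF t(1)] by blast
  obtain A2 where A2: "A2 > 0" "\<And>x. x \<noteq> 0 \<Longrightarrow> norm (\<eta> x) \<le> A2 * norm x powr (- (3 / 2 * \<theta>))"
    using rd[OF t(2)] by blast
  obtain A3 where A3: "A3 > 0" "\<And>x. x \<noteq> 0 \<Longrightarrow> norm (\<eta> x) \<le> A3 * norm x powr (- (2 * \<theta>))"
    using rd[OF t(3)] by blast
  define q where "q = (2::real) powr \<theta>"
  have q: "q > 1" using \<theta> by (simp add: q_def)
  have qj: "2 powr (real j * \<theta>) = q ^ j" for j by (simp add: q_def powr_power)
  have qj': "2 powr (- (real j * \<theta>)) = 1 / q ^ j" for j by (simp add: powr_minus_divide qj)
  \<comment> \<open>The ratio of consecutive terms \<open>u j\<close>, as required by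
    \<open>min_le_telescope\<close>.\<close>
  define l where "l = (2::real) powr (\<theta> / 2)"
  have l: "l > 1" using \<theta> by (simp add: l_def)
  define K where "K = 2 * (l + 1) / (l - 1)"
  have K: "K > 0" using l by (simp add: K_def)
  have nle: "norm (dyadic_sum \<theta> \<eta> J x) \<le> (\<Sum>j\<le>J. 2 powr (- (real j * \<theta>)) * norm (\<eta> ((1 / 2) ^ j *\<^sub>R x)))" for J x
    unfolding dyadic_sum_def by (rule order_trans[OF norm_sum]) (simp add: norm_mult)
  have b1: "norm (dyadic_sum \<theta> \<eta> J x) \<le> A1 * (1 / (1 - 1 / q))" for J x
  proof -
    have p: "2 powr (- (real j * \<theta>)) = (1 / q) ^ j" for j
      by (simp add: qj' power_one_over)
    have "norm (dyadic_sum \<theta> \<eta> J x) \<le> (\<Sum>j\<le>J. (1 / q) ^ j * A1)"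
      using q by (intro order_trans[OF nle] sum_mono) (auto simp: p intro!: mult_left_mono A1)
    also have "\<dots> = (\<Sum>j\<le>J. (1 / q) ^ j) * A1" by (simp add: sum_distrib_right)
    also have "(\<Sum>j\<le>J. (1 / q) ^ j) \<le> 1 / (1 - 1 / q)"
      using q by (subst sum_gp0) (auto intro!: divide_right_mono)
    finally show ?thesis using A1 by (simp add: mult_right_mono mult.commute)
  qed
  have b2: "norm (dyadic_sum \<theta> \<eta> J x) \<le> ((A1 + A2) * K) * norm x powr (- \<theta>)" if x: "x \<noteq> 0" for J x
  proof -
    define u where "u j = ((1 / 2) ^ j * norm x) powr (\<theta> / 2)" for j :: nat
    have u: "u j > 0" for j using x by (simp add: u_def)
    have lu: "l * u (Suc j) = u j" for j
    proof -
      have "(2 * ((1 / 2) ^ Suc j * norm x)) powr (\<theta> / 2) = l * u (Suc j)"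
        unfolding l_def u_def by (rule powr_mult)
      then show ?thesis by (simp add: u_def)
    qed
    have summand: "2 powr (- (real j * \<theta>)) * norm (\<eta> ((1 / 2) ^ j *\<^sub>R x)) \<le> ((A1 + A2) * norm x powr (- \<theta>)) * min (u j) (1 / u j)" for j
    proof -
      define y where "y = (1 / 2) ^ j * norm x"
      have y: "y > 0" using x by (simp add: y_def)
      have ny: "norm ((1 / 2) ^ j *\<^sub>R x) = y" by (simp add: y_def)
      have y\<theta>: "2 powr (- (real j * \<theta>)) = y powr \<theta> * norm x powr (- \<theta>)"
        using x by (simp add: y_def powr_mult half_power_powr powr_minus)
      have n1: "norm (\<eta> ((1 / 2) ^ j *\<^sub>R x)) \<le> A1 * y powr (- (\<theta> / 2))"
        using A1(3)[of "(1 / 2) ^ j *\<^sub>R x"] x unfolding ny by simp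
      have n2: "norm (\<eta> ((1 / 2) ^ j *\<^sub>R x)) \<le> A2 * y powr (- (3 / 2 * \<theta>))"
        using A2(2)[of "(1 / 2) ^ j *\<^sub>R x"] x unfolding ny by simp
      have "y powr \<theta> * norm (\<eta> ((1 / 2) ^ j *\<^sub>R x)) \<le> A1 * (y powr \<theta> * y powr (- (\<theta> / 2)))"
        using mult_left_mono[OF n1, of "y powr \<theta>"] by (simp add: mult_ac)
      also have "y powr \<theta> * y powr (- (\<theta> / 2)) = u j"
        unfolding powr_add[symmetric] by (simp add: u_def y_def)
      finally have m1: "y powr \<theta> * norm (\<eta> ((1 / 2) ^ j *\<^sub>R x)) \<le> A1 * u j" .
      have "y powr \<theta> * norm (\<eta> ((1 / 2) ^ j *\<^sub>R x)) \<le> A2 * (y powr \<theta> * y powr (- (3 / 2 * \<theta>)))"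
        using mult_left_mono[OF n2, of "y powr \<theta>"] by (simp add: mult_ac)
      also have "y powr \<theta> * y powr (- (3 / 2 * \<theta>)) = y powr (- (\<theta> / 2))"
        unfolding powr_add[symmetric] by (simp add: field_simps)
      also have "\<dots> = 1 / u j" by (simp add: u_def y_def powr_minus_divide)
      finally have m2: "y powr \<theta> * norm (\<eta> ((1 / 2) ^ j *\<^sub>R x)) \<le> A2 * (1 / u j)" .
      have "A1 * u j \<le> (A1 + A2) * u j" "A2 * (1 / u j) \<le> (A1 + A2) * (1 / u j)"
        using A1(1) A2(1) u[of j] by (auto intro!: mult_right_mono divide_right_mono)
      then have "y powr \<theta> * norm (\<eta> ((1 / 2) ^ j *\<^sub>R x)) \<le> (A1 + A2) * min (u j) (1 / u j)"
        using m1 m2 by (cases "u j \<le> 1 / u j") (auto simp: min_def)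
      then have "(y powr \<theta> * norm (\<eta> ((1 / 2) ^ j *\<^sub>R x))) * norm x powr (- \<theta>) \<le> ((A1 + A2) * min (u j) (1 / u j)) * norm x powr (- \<theta>)"
        by (intro mult_right_mono) auto
      then show ?thesis unfolding y\<theta> by (simp add: mult_ac)
    qed
    have "(\<Sum>j\<le>J. min (u j) (1 / u j)) \<le> (\<Sum>j\<le>J. K * (l * u j / (1 + l * u j) - l * u (Suc j) / (1 + l * u (Suc j))))"
      using min_le_telescope[OF l u] unfolding K_def lu by (intro sum_mono) auto
    also have "\<dots> = K * (l * u 0 / (1 + l * u 0) - l * u (Suc J) / (1 + l * u (Suc J)))"
      unfolding sum_distrib_left[symmetric] using sum_telescope[of "\<lambda>j. l * u j / (1 + l * u j)" J] by simp
    also have "\<dots> \<le> K * 1"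
    proof (intro mult_left_mono)
      have "0 < l * u 0" "0 < l * u (Suc J)" using l u by (auto intro!: mult_pos_pos)
      then have "l * u 0 / (1 + l * u 0) \<le> 1" "0 \<le> l * u (Suc J) / (1 + l * u (Suc J))" by auto
      then show "l * u 0 / (1 + l * u 0) - l * u (Suc J) / (1 + l * u (Suc J)) \<le> 1" by linarith
    qed (use K in simp)
    finally have S: "(\<Sum>j\<le>J. min (u j) (1 / u j)) \<le> K" by simp
    have "norm (dyadic_sum \<theta> \<eta> J x) \<le> (\<Sum>j\<le>J. ((A1 + A2) * norm x powr (- \<theta>)) * min (u j) (1 / u j))"
      by (intro order_trans[OF nle] sum_mono summand)
    also have "\<dots> = ((A1 + A2) * norm x powr (- \<theta>)) * (\<Sum>j\<le>J. min (u j) (1 / u j))"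
      by (simp add: sum_distrib_left)
    also have "\<dots> \<le> ((A1 + A2) * norm x powr (- \<theta>)) * K"
      using A1(1) A2(1) by (intro mult_left_mono S) auto
    finally show ?thesis by (simp add: mult_ac)
  qed
  \<comment> \<open>With decay rate \<open>2 * \<theta>\<close> the bounds on the summands grow like
    \<open>2^(j \<theta>)\<close>, so the last one dominates; this is the origin of the factor
    \<open>2^(J \<theta>)\<close>.\<close>
  have b3: "norm (dyadic_sum \<theta> \<eta> J x) \<le> ((A3 * (q / (q - 1))) * 2 powr (real J * \<theta>)) * norm x powr (- (2 * \<theta>))" if x: "x \<noteq> 0" for J x
  proof -
    have summand: "2 powr (- (real j * \<theta>)) * norm (\<eta> ((1 / 2) ^ j *\<^sub>R x)) \<le> (A3 * norm x powr (- (2 * \<theta>))) * q ^ j" for j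
    proof -
      define y where "y = (1 / 2) ^ j * norm x"
      have ny: "norm ((1 / 2) ^ j *\<^sub>R x) = y" by (simp add: y_def)
      have n3: "norm (\<eta> ((1 / 2) ^ j *\<^sub>R x)) \<le> A3 * y powr (- (2 * \<theta>))"
        using A3(2)[of "(1 / 2) ^ j *\<^sub>R x"] x unfolding ny by simp
      have e1: "2 powr (- (real j * \<theta>)) = 1 / q ^ j"
        by (rule qj')
      have "((1 / 2) ^ j) powr (- (2 * \<theta>)) = 2 powr (real j * \<theta> + real j * \<theta>)"
        unfolding half_power_powr by (simp add: algebra_simps)
      also have "\<dots> = q ^ j * q ^ j" unfolding powr_add qj ..
      finally have e2: "y powr (- (2 * \<theta>)) = q ^ j * q ^ j * norm x powr (- (2 * \<theta>))"
        by (simp add: y_def powr_mult)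
      have "2 powr (- (real j * \<theta>)) * norm (\<eta> ((1 / 2) ^ j *\<^sub>R x)) \<le> 2 powr (- (real j * \<theta>)) * (A3 * y powr (- (2 * \<theta>)))"
        by (intro mult_left_mono n3) simp
      also have "\<dots> = (A3 * norm x powr (- (2 * \<theta>))) * q ^ j"
        unfolding e1 e2 using q by simp
      finally show ?thesis .
    qed
    have "norm (dyadic_sum \<theta> \<eta> J x) \<le> (\<Sum>j\<le>J. (A3 * norm x powr (- (2 * \<theta>))) * q ^ j)"
      by (intro order_trans[OF nle] sum_mono summand)
    also have "\<dots> = (A3 * norm x powr (- (2 * \<theta>))) * (\<Sum>j\<le>J. q ^ j)" by (simp add: sum_distrib_left)
    also have "(\<Sum>j\<le>J. q ^ j) \<le> q / (q - 1) * q ^ J"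
    proof -
      have "(\<Sum>j\<le>J. q ^ j) = (q ^ Suc J - 1) / (q - 1)"
        using q by (simp add: sum_gp0 field_simps)
      also have "\<dots> \<le> q ^ Suc J / (q - 1)" using q by (intro divide_right_mono) auto
      finally show ?thesis by simp
    qed
    finally have "norm (dyadic_sum \<theta> \<eta> J x) \<le> (A3 * norm x powr (- (2 * \<theta>))) * (q / (q - 1) * q ^ J)"
      using A3(1) by (simp add: mult_left_mono)
    moreover have "q ^ J = 2 powr (real J * \<theta>)" by (rule qj[symmetric])
    ultimately show ?thesis by (simp add: mult_ac)
  qed
  define A where "A = max (A1 * (1 / (1 - 1 / q))) (max ((A1 + A2) * K) (A3 * (q / (q - 1))))"
  show ?thesis
  proof (rule that[of A])
    have "0 < (A1 + A2) * K" using A1(1) A2(1) K by simp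
    then show "A > 0" by (simp add: A_def less_max_iff_disj)
    show "norm (dyadic_sum \<theta> \<eta> J x) \<le> A" for J x
      by (rule order_trans[OF b1]) (simp add: A_def)
    show "norm (dyadic_sum \<theta> \<eta> J x) \<le> A * norm x powr (- \<theta>)" if "x \<noteq> 0" for J x
      by (rule order_trans[OF b2[OF that]]) (intro mult_right_mono, simp_all add: A_def)
    show "norm (dyadic_sum \<theta> \<eta> J x) \<le> (A * 2 powr (real J * \<theta>)) * norm x powr (- (2 * \<theta>))" if "x \<noteq> 0" for J x
      by (rule order_trans[OF b3[OF that]]) (intro mult_right_mono, simp_all add: A_def)
  qed
qed

text \<open>The ranges below 1 and above \<open>2^(J d)\<close> contribute bounded amounts, the
  middle range the \<open>dt / t\<close> length of \<open>[1, 2^(J d)]\<close>, which is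
  \<open>J d ln 2\<close>. Taking the root of order \<open>r\<close> gives
  \<open>J^(1/r)\<close>.\<close>

lemma dyadic_sum_lorentz_upper:
  fixes \<eta> :: "'a::euclidean_space \<Rightarrow> complex"
  assumes \<eta>: "\<eta> \<in> schwartz" and p: "0 < p" and r: "0 < r"
  shows "\<exists>C. \<forall>J\<ge>1. lorentz_qnorm p r (dyadic_sum (real DIM('a) / p) \<eta> J) \<le> ennreal (C * real J powr recip_exponent r)"
proof -
  define d where "d = real DIM('a)"
  have d: "d > 0" by (simp add: d_def)
  define \<theta> where "\<theta> = d / p"
  have \<theta>: "\<theta> > 0" using d p by (simp add: \<theta>_def)
  define v where "v = unit_ball_vol d"
  have v: "v > 0" by (simp add: v_def d_def)
  obtain A where A: "A > 0" "\<And>J x. norm (dyadic_sum \<theta> \<eta> J x) \<le> A"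
    "\<And>J x. x \<noteq> 0 \<Longrightarrow> norm (dyadic_sum \<theta> \<eta> J x) \<le> A * norm x powr (- \<theta>)"
    "\<And>J x. x \<noteq> 0 \<Longrightarrow> norm (dyadic_sum \<theta> \<eta> J x) \<le> (A * 2 powr (real J * \<theta>)) * norm x powr (- (2 * \<theta>))"
    by (rule dyadic_sum_decay[OF \<eta> \<theta>]) (rule that, assumption+)
  define B where "B = max A (max (A * v powr (1 / p)) (A * v powr (2 / p)))"
  have B: "B > 0" using A(1) by (simp add: B_def less_max_iff_disj)
  let ?R = "\<lambda>J. rearrangement (dyadic_sum \<theta> \<eta> J)"
  have fm: "dyadic_sum \<theta> \<eta> J \<in> borel_measurable lebesgue" for J
    by (intro borel_measurable_lebesgueI schwartz_measurable dyadic_sum_schwartz \<eta>)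
  have R1: "?R J t \<le> ennreal B" for J t
    by (rule order_trans[OF rearrangement_bounded[OF fm, of A] ennreal_leI]) (use A in \<open>auto simp: B_def\<close>)
  have R2: "?R J t \<le> ennreal (B * t powr (- 1 / p))" if t: "t > 0" for J t
  proof -
    have "?R J t \<le> ennreal (A * (v / t) powr (\<theta> / d))"
      unfolding v_def d_def by (rule rearrangement_decay) (use A \<theta> t in auto)
    also have "A * (v / t) powr (\<theta> / d) = (A * v powr (1 / p)) * t powr (- 1 / p)"
      using t v d by (simp add: \<theta>_def powr_divide powr_minus_divide)
    also have "ennreal \<dots> \<le> ennreal (B * t powr (- 1 / p))"
      by (intro ennreal_leI mult_right_mono) (auto simp: B_def)
    finally show ?thesis .
  qed
  have R3: "?R J t \<le> ennreal (B * 2 powr (real J * \<theta>) * t powr (- 2 / p))" if t: "t > 0" for J t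
  proof -
    have "?R J t \<le> ennreal ((A * 2 powr (real J * \<theta>)) * (v / t) powr (2 * \<theta> / d))"
      unfolding v_def d_def by (rule rearrangement_decay) (use A \<theta> t in auto)
    also have "(A * 2 powr (real J * \<theta>)) * (v / t) powr (2 * \<theta> / d) = (A * v powr (2 / p)) * (2 powr (real J * \<theta>) * t powr (- 2 / p))"
      using t v d by (simp add: \<theta>_def powr_divide powr_minus_divide)
    also have "ennreal \<dots> \<le> ennreal (B * (2 powr (real J * \<theta>) * t powr (- 2 / p)))"
      by (intro ennreal_leI mult_right_mono) (auto simp: B_def)
    finally show ?thesis by (simp add: mult.assoc)
  qed
  show ?thesis
  proof (cases "r = \<infinity>")
    case True
    have "lorentz_qnorm p r (dyadic_sum \<theta> \<eta> J) \<le> ennreal (B * real J powr recip_exponent r)" if "J \<ge> 1" for J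
    proof -
      have "ennreal (t powr (1 / p)) * ?R J t \<le> ennreal B" if t: "t > 0" for t
      proof -
        have "ennreal (t powr (1 / p)) * ?R J t \<le> ennreal (t powr (1 / p)) * ennreal (B * t powr (- 1 / p))"
          by (intro mult_left_mono R2 t) simp
        also have "\<dots> = ennreal B" using t B by (simp add: ennreal_mult[symmetric] powr_minus_divide)
        finally show ?thesis .
      qed
      then show ?thesis using True that by (auto simp: lorentz_qnorm_def recip_exponent_def intro!: SUP_least)
    qed
    then show ?thesis unfolding \<theta>_def d_def by blast
  next
    case False
    let ?r = "enn2real r"
    have r': "0 < ?r" using r False by (simp add: enn2real_positive_iff less_top)
    define C where "C = (?r / p * (B powr ?r * (2 * p / ?r + d * ln 2))) powr (1 / ?r)"
    have "lorentz_qnorm p r (dyadic_sum \<theta> \<eta> J) \<le> ennreal (C * real J powr recip_exponent r)" if J: "J \<ge> 1" for J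
    proof -
      \<comment> \<open>The crossover point of the bounds \<open>t^(-1/p)\<close> and
        \<open>2^(J d/p) t^(-2/p)\<close>.\<close>
      define T where "T = 2 powr (real J * d)"
      have T: "T \<ge> 1" "T > 0" using d by (auto simp: T_def ge_one_powr_ge_zero)
      have Tp: "(2 powr (real J * \<theta>)) powr ?r = T powr (?r / p)"
        by (simp add: T_def \<theta>_def powr_powr)
      let ?g1 = "\<lambda>t. indicator {0..1} t * ennreal (t powr (?r / p - 1))"
      let ?g2 = "\<lambda>t. indicator {1..T} t * ennreal (1 / t)"
      let ?g3 = "\<lambda>t. ennreal (T powr (?r / p)) * (indicator {T..} t * ennreal (t powr (- (?r / p) - 1)))"
      have bnd: "epowr (ennreal (t powr (1 / p)) * ?R J t) ?r \<le> ennreal (B powr ?r) * ennreal (X powr ?r * t powr (?r / p))"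
        if "?R J t \<le> ennreal (B * X)" "X \<ge> 0" for t X
      proof -
        have "epowr (ennreal (t powr (1 / p)) * ?R J t) ?r \<le> epowr (ennreal (t powr (1 / p)) * ennreal (B * X)) ?r"
          using r' that by (intro epowr_mono mult_left_mono) auto
        also have "\<dots> = ennreal (B powr ?r) * ennreal (X powr ?r * t powr (?r / p))"
          using B that(2) r' by (simp add: ennreal_mult[symmetric] epowr_ennreal powr_mult powr_powr mult_ac)
        finally show ?thesis .
      qed
      have "(\<integral>\<^sup>+t\<in>{0<..}. epowr (ennreal (t powr (1 / p)) * ?R J t) ?r * ennreal (1 / t) \<partial>lborel)
          \<le> (\<integral>\<^sup>+t. ennreal (B powr ?r) * (?g1 t + ?g2 t + ?g3 t) \<partial>lborel)"
      proof (intro nn_integral_mono)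
        fix t :: real
        show "epowr (ennreal (t powr (1 / p)) * ?R J t) ?r * ennreal (1 / t) * indicator {0<..} t \<le> ennreal (B powr ?r) * (?g1 t + ?g2 t + ?g3 t)"
        proof (cases "0 < t")
          case t: True
          have ti: "ennreal (1 / t) = ennreal (t powr (- 1))" using t by (simp add: powr_minus_divide)
          consider "t \<le> 1" | "1 \<le> t" "t \<le> T" | "T \<le> t" by linarith
          then have "epowr (ennreal (t powr (1 / p)) * ?R J t) ?r * ennreal (1 / t) \<le> ennreal (B powr ?r) * (?g1 t + ?g2 t + ?g3 t)"
          proof cases
            case 1
            have "epowr (ennreal (t powr (1 / p)) * ?R J t) ?r * ennreal (1 / t) \<le> ennreal (B powr ?r) * ennreal (1 powr ?r * t powr (?r / p)) * ennreal (1 / t)"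
              by (intro mult_right_mono bnd) (use R1 in auto)
            also have "\<dots> = ennreal (B powr ?r) * ?g1 t"
              using 1 t unfolding ti mult.assoc powr_one_eq_one mult_1_left ennreal_powr_minus_one by simp
            also have "\<dots> \<le> ennreal (B powr ?r) * (?g1 t + ?g2 t + ?g3 t)"
              by (intro mult_left_mono) (simp_all add: add.assoc)
            finally show ?thesis .
          next
            case 2
            have "epowr (ennreal (t powr (1 / p)) * ?R J t) ?r * ennreal (1 / t) \<le> ennreal (B powr ?r) * ennreal ((t powr (- 1 / p)) powr ?r * t powr (?r / p)) * ennreal (1 / t)"
              by (intro mult_right_mono bnd) (use R2[OF t] in auto)
            also have "(t powr (- 1 / p)) powr ?r * t powr (?r / p) = 1"
              using t by (simp add: powr_powr powr_add[symmetric])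
            also have "ennreal (B powr ?r) * ennreal 1 * ennreal (1 / t) = ennreal (B powr ?r) * ?g2 t"
              using 2 by simp
            also have "\<dots> \<le> ennreal (B powr ?r) * (?g1 t + ?g2 t + ?g3 t)"
              by (intro mult_left_mono) (simp_all add: add.assoc add_increasing)
            finally show ?thesis .
          next
            case 3
            have "epowr (ennreal (t powr (1 / p)) * ?R J t) ?r * ennreal (1 / t) \<le> ennreal (B powr ?r) * ennreal ((2 powr (real J * \<theta>) * t powr (- 2 / p)) powr ?r * t powr (?r / p)) * ennreal (1 / t)"
              by (intro mult_right_mono bnd) (use R3[OF t] in \<open>auto simp: mult.assoc\<close>)
            also have "(2 powr (real J * \<theta>) * t powr (- 2 / p)) powr ?r * t powr (?r / p) = T powr (?r / p) * t powr (- (?r / p))"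
            proof -
              have "(t powr (- 2 / p)) powr ?r * t powr (?r / p) = t powr (- (?r / p))"
                unfolding powr_powr powr_add[symmetric] using p by (simp add: field_simps)
              then show ?thesis by (simp add: powr_mult Tp mult.assoc)
            qed
            also have "ennreal (B powr ?r) * ennreal (T powr (?r / p) * t powr (- (?r / p))) * ennreal (1 / t) = ennreal (B powr ?r) * ?g3 t"
              using 3 unfolding ti ennreal_mult[OF powr_ge_zero powr_ge_zero] mult.assoc ennreal_powr_minus_one by simp
            also have "\<dots> \<le> ennreal (B powr ?r) * (?g1 t + ?g2 t + ?g3 t)"
              by (intro mult_left_mono) (simp_all add: add_increasing)
            finally show ?thesis .
          qed
          then show ?thesis using t by simp
        qed simp
      qed
      also have "\<dots> = ennreal (B powr ?r) * ((\<integral>\<^sup>+t. ?g1 t \<partial>lborel) + (\<integral>\<^sup>+t. ?g2 t \<partial>lborel)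
          + ennreal (T powr (?r / p)) * (\<integral>\<^sup>+t. indicator {T..} t * ennreal (t powr (- (?r / p) - 1)) \<partial>lborel))"
        by (simp add: nn_integral_cmult nn_integral_add)
      also have "(\<integral>\<^sup>+t. ?g1 t \<partial>lborel) = ennreal (p / ?r)"
        by (subst nn_integral_powr_near_0) (use r' p in auto)
      also have "(\<integral>\<^sup>+t. ?g2 t \<partial>lborel) = ennreal (real J * d * ln 2)"
        by (subst nn_integral_inverse) (use T in \<open>auto simp: T_def ln_powr\<close>)
      also have "(\<integral>\<^sup>+t. indicator {T..} t * ennreal (t powr (- (?r / p) - 1)) \<partial>lborel) = ennreal (T powr (- (?r / p)) * (p / ?r))"
        by (subst nn_integral_powr_near_infinity) (use r' p T in auto)
      also have "ennreal (T powr (?r / p)) * ennreal (T powr (- (?r / p)) * (p / ?r)) = ennreal (p / ?r)"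
        using T r' p by (simp add: ennreal_mult[symmetric] powr_minus_divide)
      also have "ennreal (B powr ?r) * (ennreal (p / ?r) + ennreal (real J * d * ln 2) + ennreal (p / ?r)) = ennreal (B powr ?r * (2 * p / ?r + real J * (d * ln 2)))"
        using r' p d by (simp add: ennreal_mult[symmetric] ennreal_plus[symmetric] mult.assoc del: ennreal_plus)
      also have "\<dots> \<le> ennreal (B powr ?r * (real J * (2 * p / ?r + d * ln 2)))"
      proof (intro ennreal_leI mult_left_mono)
        have "1 * (2 * p / ?r) \<le> real J * (2 * p / ?r)" using J p r' by (intro mult_right_mono) auto
        then show "2 * p / ?r + real J * (d * ln 2) \<le> real J * (2 * p / ?r + d * ln 2)" by (simp add: distrib_left)
      qed simp
      finally have "epowr (ennreal (?r / p) * (\<integral>\<^sup>+t\<in>{0<..}. epowr (ennreal (t powr (1 / p)) * ?R J t) ?r * ennreal (1 / t) \<partial>lborel)) (1 / ?r)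
          \<le> epowr (ennreal (?r / p) * ennreal (B powr ?r * (real J * (2 * p / ?r + d * ln 2)))) (1 / ?r)"
        using r' by (intro epowr_mono mult_left_mono) auto
      also have "\<dots> = ennreal ((?r / p * (B powr ?r * (2 * p / ?r + d * ln 2)) * real J) powr (1 / ?r))"
        using r' p d by (simp add: ennreal_mult[symmetric] epowr_ennreal mult_ac)
      also have "(?r / p * (B powr ?r * (2 * p / ?r + d * ln 2)) * real J) powr (1 / ?r) = C * real J powr recip_exponent r"
        by (subst powr_mult) (use False in \<open>simp add: C_def recip_exponent_def\<close>)
      finally show ?thesis using False by (simp add: lorentz_qnorm_def)
    qed
    then show ?thesis unfolding \<theta>_def d_def by blast
  qed
qed

text \<open>Nonnegativity of \<eta> excludes cancellation, so at each relevant \<open>t\<close> a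
  single summand suffices: the one whose scale gives a ball of measure comparable to
  \<open>t\<close>.\<close>

lemma dyadic_sum_lorentz_lower:
  fixes \<eta> :: "'a::euclidean_space \<Rightarrow> complex"
  assumes \<eta>: "\<eta> \<in> schwartz" "\<And>x. \<eta> x = of_real (norm (\<eta> x))" "\<eta> 0 \<noteq> 0"
    and p: "0 < p" and r: "0 < r" "r \<noteq> \<infinity>"
  shows "\<exists>c>0. \<forall>J\<ge>1. ennreal (c * real J powr recip_exponent r) \<le> lorentz_qnorm p r (dyadic_sum (real DIM('a) / p) \<eta> J)"
proof -
  define d where "d = real DIM('a)"
  have d: "d > 0" by (simp add: d_def)
  define \<theta> where "\<theta> = d / p"
  let ?r = "enn2real r"
  have r': "0 < ?r" using r by (simp add: enn2real_positive_iff less_top)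
  define c where "c = norm (\<eta> 0) / 2"
  have c: "c > 0" using \<eta>(3) by (simp add: c_def)
  have "open {y. c < norm (\<eta> y)}" by (intro open_Collect_less continuous_intros schwartz_continuous[OF \<eta>(1)])
  moreover have "0 \<in> {y. c < norm (\<eta> y)}" using \<eta>(3) by (simp add: c_def)
  ultimately obtain \<delta> where \<delta>: "\<delta> > 0" "ball 0 \<delta> \<subseteq> {y. c < norm (\<eta> y)}" by (meson openE)
  \<comment> \<open>Half of \<delta> is used so that the ball of radius
    \<open>\<delta> * 2^j\<close> has measure \<open>2^d W 2^(j d)\<close>, at least twice
    \<open>t\<close>; \<open>rearrangement_ge\<close> asks for a strict inequality.\<close>
  define W where "W = unit_ball_vol d * (\<delta> / 2) ^ DIM('a)"
  have W: "W > 0" using \<delta> by (simp add: W_def d_def)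
  define k where "k = c * (2 powr d / W) powr (- 1 / p)"
  have k: "k > 0" using c W by (simp add: k_def)
  have low: "ennreal k \<le> ennreal (t powr (1 / p)) * rearrangement (dyadic_sum \<theta> \<eta> J) t"
    if t: "W \<le> t" "t \<le> W * 2 powr (real J * d)" for J t
  proof -
    have t0: "t > 0" using t W by simp
    \<comment> \<open>At the least such scale the ball is large enough for \<open>t\<close> while
      the previous one is not, which bounds \<open>2^(j d)\<close> by a multiple of
      \<open>t\<close>. For \<open>j = 0\<close> the assumption \<open>W \<le> t\<close> takes this
      role.\<close>
    define j where "j = (LEAST j. t \<le> W * 2 powr (real j * d))"
    have j: "t \<le> W * 2 powr (real j * d)" unfolding j_def by (rule LeastI[of _ J]) (rule t)
    have jJ: "j \<le> J" unfolding j_def by (rule Least_le) (rule t)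
    have j2: "2 powr (real j * d) \<le> 2 powr d * t / W"
    proof (cases j)
      case 0
      have "1 * 1 \<le> 2 powr d * (t / W)" using t W d by (intro mult_mono) (auto simp: ge_one_powr_ge_zero)
      then show ?thesis using 0 by simp
    next
      case (Suc i)
      then have "\<not> t \<le> W * 2 powr (real i * d)" using not_less_Least[of i "\<lambda>j. t \<le> W * 2 powr (real j * d)"] by (simp add: j_def)
      then have "2 powr (real i * d) \<le> t / W" using W by (simp add: field_simps)
      then have "2 powr d * 2 powr (real i * d) \<le> 2 powr d * (t / W)" by (intro mult_left_mono) auto
      then show ?thesis by (simp add: Suc powr_add[symmetric] distrib_right)
    qed
    have "ennreal (2 powr (- (real j * \<theta>)) * c) \<le> rearrangement (dyadic_sum \<theta> \<eta> J) t"
    proof (rule rearrangement_ge[of _ _ "ball 0 (\<delta> * 2 ^ j)"])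
      show "dyadic_sum \<theta> \<eta> J \<in> borel_measurable lebesgue"
        by (intro borel_measurable_lebesgueI schwartz_measurable dyadic_sum_schwartz \<eta>(1))
      have "emeasure lebesgue (ball (0::'a) (\<delta> * 2 ^ j)) = ennreal (unit_ball_vol d * (\<delta> * 2 ^ j) ^ DIM('a))"
        using \<delta> by (simp add: emeasure_ball d_def)
      also have "unit_ball_vol d * (\<delta> * 2 ^ j) ^ DIM('a) = 2 ^ DIM('a) * (W * 2 powr (real j * d))"
      proof -
        have "2 powr (real j * d) = (2 ^ j) ^ DIM('a)"
          by (simp add: d_def powr_realpow[symmetric] powr_powr)
        then show ?thesis by (simp add: W_def power_mult_distrib power_divide)
      qed
      also have "ennreal \<dots> > ennreal t"
      proof (rule ennreal_lessI)
        have "t < 2 * t" using t0 by simp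
        also have "2 * t \<le> 2 ^ DIM('a) * (W * 2 powr (real j * d))"
        proof (intro mult_mono j)
          show "2 \<le> (2::real) ^ DIM('a)" using power_increasing[of 1 "DIM('a)" "2::real"] by (simp add: Suc_leI)
        qed (use W t0 in auto)
        finally show "t < 2 ^ DIM('a) * (W * 2 powr (real j * d))" .
        then show "0 < 2 ^ DIM('a) * (W * 2 powr (real j * d))" using t0 by simp
      qed
      finally show "ennreal t < emeasure lebesgue (ball (0::'a) (\<delta> * 2 ^ j))" .
      fix x :: 'a assume x: "x \<in> ball 0 (\<delta> * 2 ^ j)"
      have "(1 / 2) ^ j *\<^sub>R x \<in> ball 0 \<delta>" using x by (simp add: power_divide field_simps)
      then have cn: "c < norm (\<eta> ((1 / 2) ^ j *\<^sub>R x))" using \<delta>(2) by blast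
      let ?s = "\<lambda>i. 2 powr (- (real i * \<theta>)) * norm (\<eta> ((1 / 2) ^ i *\<^sub>R x))"
      have "dyadic_sum \<theta> \<eta> J x = of_real (\<Sum>i\<le>J. ?s i)"
        unfolding dyadic_sum_def of_real_sum of_real_mult by (intro sum.cong refl arg_cong2[where f="(*)"] \<eta>(2))
      moreover have "0 \<le> (\<Sum>i\<le>J. ?s i)" by (intro sum_nonneg) simp
      ultimately have "norm (dyadic_sum \<theta> \<eta> J x) = (\<Sum>i\<le>J. ?s i)" by (simp only: norm_of_real abs_of_nonneg)
      moreover have "?s j \<le> (\<Sum>i\<le>J. ?s i)" by (rule member_le_sum) (use jJ in auto)
      moreover have "2 powr (- (real j * \<theta>)) * c \<le> ?s j" using cn by (intro mult_left_mono) auto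
      ultimately show "2 powr (- (real j * \<theta>)) * c \<le> norm (dyadic_sum \<theta> \<eta> J x)" by linarith
    qed
    then have "ennreal (t powr (1 / p)) * ennreal (2 powr (- (real j * \<theta>)) * c) \<le> ennreal (t powr (1 / p)) * rearrangement (dyadic_sum \<theta> \<eta> J) t"
      by (intro mult_left_mono) auto
    moreover have "k \<le> t powr (1 / p) * (2 powr (- (real j * \<theta>)) * c)"
    proof -
      have "(2 powr d * t / W) powr (- 1 / p) \<le> (2 powr (real j * d)) powr (- 1 / p)"
        using j2 p by (intro powr_mono2') auto
      also have "\<dots> = 2 powr (- (real j * \<theta>))" by (simp add: powr_powr \<theta>_def)
      also have "(2 powr d * t / W) powr (- 1 / p) = (2 powr d / W) powr (- 1 / p) * t powr (- 1 / p)"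
        using W t0 powr_mult[of "2 powr d / W" t "- 1 / p"] by simp
      finally have "t powr (1 / p) * ((2 powr d / W) powr (- 1 / p) * t powr (- 1 / p)) * c \<le> t powr (1 / p) * 2 powr (- (real j * \<theta>)) * c"
        using c by (intro mult_right_mono mult_left_mono) auto
      moreover have "t powr (1 / p) * ((2 powr d / W) powr (- 1 / p) * t powr (- 1 / p)) * c = k"
        using t0 by (simp add: k_def powr_minus_divide)
      ultimately show ?thesis by (simp add: mult.assoc)
    qed
    ultimately show ?thesis using c
      by (simp add: ennreal_mult[symmetric]) (meson ennreal_leI order_trans)
  qed
  define K where "K = (?r / p * (k powr ?r * (d * ln 2))) powr (1 / ?r)"
  have "ennreal (K * real J powr recip_exponent r) \<le> lorentz_qnorm p r (dyadic_sum \<theta> \<eta> J)" if J: "J \<ge> 1" for J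
  proof -
    let ?R = "rearrangement (dyadic_sum \<theta> \<eta> J)"
    let ?b = "W * 2 powr (real J * d)"
    have b: "W \<le> ?b" using W d by (simp add: ge_one_powr_ge_zero)
    have "ln (?b / W) = real J * (d * ln 2)" using W by (simp add: ln_powr mult.assoc)
    moreover have "0 \<le> real J * (d * ln 2)" using d by simp
    ultimately have "ennreal (k powr ?r * (real J * (d * ln 2))) = ennreal (k powr ?r) * ennreal (ln (?b / W))"
      by (simp only: ennreal_mult[OF powr_ge_zero])
    also have "\<dots> = (\<integral>\<^sup>+t. ennreal (k powr ?r) * (indicator {W..?b} t * ennreal (1 / t)) \<partial>lborel)"
      using nn_integral_inverse[OF W b] by (simp add: nn_integral_cmult)
    also have "\<dots> \<le> (\<integral>\<^sup>+t\<in>{0<..}. epowr (ennreal (t powr (1 / p)) * ?R t) ?r * ennreal (1 / t) \<partial>lborel)"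
    proof (intro nn_integral_mono)
      fix t :: real
      show "ennreal (k powr ?r) * (indicator {W..?b} t * ennreal (1 / t)) \<le> epowr (ennreal (t powr (1 / p)) * ?R t) ?r * ennreal (1 / t) * indicator {0<..} t"
      proof (cases "t \<in> {W..?b}")
        case True
        then have "0 < t" using W by auto
        have "epowr (ennreal k) ?r \<le> epowr (ennreal (t powr (1 / p)) * ?R t) ?r"
          using True r' by (intro epowr_mono low) auto
        then show ?thesis using True \<open>0 < t\<close> k by (simp add: epowr_ennreal mult_right_mono)
      qed simp
    qed
    finally have "epowr (ennreal (?r / p) * ennreal (k powr ?r * (real J * (d * ln 2)))) (1 / ?r)
      \<le> epowr (ennreal (?r / p) * (\<integral>\<^sup>+t\<in>{0<..}. epowr (ennreal (t powr (1 / p)) * ?R t) ?r * ennreal (1 / t) \<partial>lborel)) (1 / ?r)"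
      using r' by (intro epowr_mono mult_left_mono) auto
    also have "\<dots> = lorentz_qnorm p r (dyadic_sum \<theta> \<eta> J)" using r by (simp add: lorentz_qnorm_def)
    also have "epowr (ennreal (?r / p) * ennreal (k powr ?r * (real J * (d * ln 2)))) (1 / ?r) = ennreal ((?r / p * (k powr ?r * (d * ln 2)) * real J) powr (1 / ?r))"
      using r' p d by (simp add: ennreal_mult[symmetric] epowr_ennreal mult_ac)
    also have "(?r / p * (k powr ?r * (d * ln 2)) * real J) powr (1 / ?r) = K * real J powr recip_exponent r"
      by (subst powr_mult) (use r in \<open>simp add: K_def recip_exponent_def\<close>)
    finally show ?thesis .
  qed
  moreover have "K > 0" using r' p k d by (simp add: K_def)
  ultimately show ?thesis unfolding \<theta>_def d_def by blast
qed

section \<open>Necessity\<close>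

lemma cont_embeds_bound:
  assumes "cont_embeds (besov_lorentz \<beta>0 s0 q0 p0 r0) (besov_lorentz_qnorm \<beta>0 s0 q0 p0 r0)
    (besov_lorentz \<beta>0 s1 q1 p1 r1) (besov_lorentz_qnorm \<beta>0 s1 q1 p1 r1)"
  obtains C where "\<And>F. F \<in> schwartz \<Longrightarrow> besov_lorentz_qnorm \<beta>0 s0 q0 p0 r0 (distr_of F) < \<infinity> \<Longrightarrow>
    besov_lorentz_qnorm \<beta>0 s1 q1 p1 r1 (distr_of F) \<le> ennreal C * besov_lorentz_qnorm \<beta>0 s0 q0 p0 r0 (distr_of F)"
  using assms distr_of_tempered unfolding cont_embeds_def besov_lorentz_def by blast

lemma besov_lorentz_embed_necessary:
  fixes \<beta>0 :: "'a::euclidean_space \<Rightarrow> complex"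
  assumes \<beta>: "LP_cutoff \<beta>0" and p: "0 < p0" "0 < p1" and q: "0 < q0" "0 < q1" and r: "0 < r0" "0 < r1"
    and emb: "cont_embeds (besov_lorentz \<beta>0 s0 q0 p0 r0) (besov_lorentz_qnorm \<beta>0 s0 q0 p0 r0)
      (besov_lorentz \<beta>0 s1 q1 p1 r1) (besov_lorentz_qnorm \<beta>0 s1 q1 p1 r1)"
  defines "D \<equiv> real DIM('a) / p0 - real DIM('a) / p1"
  shows "0 \<le> D" "D \<le> s0 - s1" "p0 = p1 \<Longrightarrow> r0 \<le> r1" "s0 - s1 = D \<Longrightarrow> q0 \<le> q1"
proof -
  define d where "d = real DIM('a)"
  obtain C where C: "\<And>F. F \<in> schwartz \<Longrightarrow> besov_lorentz_qnorm \<beta>0 s0 q0 p0 r0 (distr_of F) < \<infinity> \<Longrightarrow>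
    besov_lorentz_qnorm \<beta>0 s1 q1 p1 r1 (distr_of F) \<le> ennreal C * besov_lorentz_qnorm \<beta>0 s0 q0 p0 r0 (distr_of F)"
    using cont_embeds_bound[OF emb] by blast
  obtain \<eta> :: "'a \<Rightarrow> complex" where \<eta>: "\<eta> \<in> schwartz" "\<And>x. \<eta> x = of_real (norm (\<eta> x))" "\<eta> 0 \<noteq> 0"
    "\<And>\<xi>. norm \<xi> \<ge> 1 \<Longrightarrow> fourier \<eta> \<xi> = 0" using positive_bandlimited_exists[OF \<beta>] by metis
  obtain F :: "'a \<Rightarrow> complex" and x0 where F: "F \<in> schwartz" "F x0 \<noteq> 0"
    "\<And>\<xi>. fourier F \<xi> \<noteq> 0 \<Longrightarrow> 7 / 8 \<le> norm \<xi> \<and> norm \<xi> \<le> 3 / 2" using annulus_function_exists[OF \<beta>] by metis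
  \<comment> \<open>Only the piece at level 0 is present, and the source quasi-norm is finite
    because \<open>f\<close> is Schwartz.\<close>
  have lowfreq: "lorentz_qnorm p1 r1 f \<le> ennreal C * lorentz_qnorm p0 r0 f"
    if f: "f \<in> schwartz" "\<And>\<xi>. norm \<xi> > 3 / 2 \<Longrightarrow> fourier f \<xi> = 0" for f :: "'a \<Rightarrow> complex"
  proof -
    have "besov_lorentz_qnorm \<beta>0 s q p r (distr_of f) = lorentz_qnorm p r f" if "0 < q" "0 < r" for s q p r
      by (rule besov_qnorm_low_frequency[OF \<beta> f(1) _ that]) (rule f(2))
    then show ?thesis
      using C[OF f(1)] schwartz_lorentz_qnorm_finite[OF f(1) p(1) r(1)] q r by simp
  qed
  let ?X0 = "lorentz_qnorm p0 r0 F" and ?X1 = "lorentz_qnorm p1 r1 F"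
  have X: "?X0 < \<infinity>" "0 < ?X1"
    using schwartz_lorentz_qnorm_finite[OF F(1) p(1) r(1)]
      continuous_lorentz_qnorm_pos[OF schwartz_continuous[OF F(1)] F(2) p(2) r(2)] by auto
  have p2: "(2 ^ k) powr a = (2::real) powr (real k * a)" for k :: nat and a
    by (simp add: powr_realpow[symmetric] powr_powr)
  \<comment> \<open>The profile \<open>F\<close> enters only through \<open>?X0\<close> and
    \<open>?X1\<close>, since dilation by \<open>2^k\<close> multiplies its quasi-norm by
    \<open>2^(-k d/p)\<close>; the coefficients \<open>a\<close> remain free.\<close>
  have annulus: "seq_qnorm q1 (\<lambda>k. if k \<in> I then ennreal (a k * 2 powr (real k * (s1 - d / p1))) * ?X1 else 0)
      \<le> ennreal C * seq_qnorm q0 (\<lambda>k. if k \<in> I then ennreal (a k * 2 powr (real k * (s0 - d / p0))) * ?X0 else 0)"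
    if I: "finite I" "0 \<notin> I" and a: "\<And>k. a k > 0"
      and fin: "seq_qnorm q0 (\<lambda>k. if k \<in> I then ennreal (a k * 2 powr (real k * (s0 - d / p0))) * ?X0 else 0) < \<infinity>" for I a
  proof -
    have e: "ennreal (2 powr (real k * s)) * lorentz_qnorm p r (\<lambda>x. of_real (a k) * F (2 ^ k *\<^sub>R x)) = ennreal (a k * 2 powr (real k * (s - d / p))) * lorentz_qnorm p r F"
      if "0 < r" for k s p r
    proof -
      have "2 powr (real k * s) * (a k * (2 ^ k) powr (- d / p)) = a k * 2 powr (real k * (s - d / p))"
        unfolding p2 by (simp add: mult.left_commute[of _ "a k"] powr_add[symmetric] right_diff_distrib)
      then have "ennreal (2 powr (real k * s)) * ennreal (a k * (2 ^ k) powr (- d / p)) = ennreal (a k * 2 powr (real k * (s - d / p)))"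
        using a[of k] by (subst ennreal_mult[symmetric]) auto
      then show ?thesis
        unfolding lorentz_qnorm_dilate[OF a zero_less_power[OF zero_less_numeral] that] d_def[symmetric]
        by (simp only: mult.assoc[symmetric])
    qed
    let ?S = "\<lambda>x. \<Sum>k\<in>I. of_real (a k) * F (2 ^ k *\<^sub>R x)"
    have S: "?S \<in> schwartz" by (intro schwartz_sum schwartz_cmult schwartz_dilate F) simp
    have "besov_lorentz_qnorm \<beta>0 s q p r (distr_of ?S) = seq_qnorm q (\<lambda>k. if k \<in> I then ennreal (a k * 2 powr (real k * (s - d / p))) * lorentz_qnorm p r F else 0)"
      if "0 < q" "0 < r" for s q p r
      unfolding e[OF that(2), symmetric] by (rule besov_qnorm_annulus_sum(2)[OF \<beta> F(1) _ I that]) (rule F(3))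
    then show ?thesis using C[OF S] fin q r by simp
  qed
  show D0: "0 \<le> D"
  proof -
    \<comment> \<open>Stretching by \<open>2^m\<close> keeps the spectrum low and makes the two
      quasi-norms grow like \<open>2^(m d/p0)\<close> and \<open>2^(m d/p1)\<close>.\<close>
    have "d / p1 \<le> d / p0"
    proof (rule growth_rate_le)
      fix m :: nat
      let ?c = "(1 / 2) ^ m :: real"
      have s: "(\<lambda>x. of_real 1 * \<eta> (?c *\<^sub>R x)) \<in> schwartz" by (intro schwartz_cmult schwartz_dilate \<eta>(1)) simp
      have e: "?c powr (- d / p) = 2 powr (real m * (d / p))" for p unfolding half_power_powr by simp
      have "lorentz_qnorm p1 r1 (\<lambda>x. of_real 1 * \<eta> (?c *\<^sub>R x)) \<le> ennreal C * lorentz_qnorm p0 r0 (\<lambda>x. of_real 1 * \<eta> (?c *\<^sub>R x))"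
        by (rule lowfreq[OF s]) (simp add: fourier_dilate_low_frequency[OF \<eta>(1,4)])
      then show "ennreal (2 powr (real m * (d / p1))) * lorentz_qnorm p1 r1 \<eta> \<le> ennreal C * (ennreal (2 powr (real m * (d / p0))) * lorentz_qnorm p0 r0 \<eta>)"
        using lorentz_qnorm_dilate[OF zero_less_one zero_less_power[of "1/2" m] r(1), of p0 \<eta>]
          lorentz_qnorm_dilate[OF zero_less_one zero_less_power[of "1/2" m] r(2), of p1 \<eta>]
        unfolding d_def[symmetric] e by simp
    next
      show "0 < lorentz_qnorm p1 r1 \<eta>"
        by (rule continuous_lorentz_qnorm_pos[OF schwartz_continuous[OF \<eta>(1)] \<eta>(3) p(2) r(2)])
      show "lorentz_qnorm p0 r0 \<eta> < \<infinity>" by (rule schwartz_lorentz_qnorm_finite[OF \<eta>(1) p(1) r(1)])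
    qed
    then show ?thesis by (simp add: D_def d_def)
  qed
  show "D \<le> s0 - s1"
  proof -
    have "s1 - d / p1 \<le> s0 - d / p0"
    proof (rule growth_rate_le[OF _ X(2,1)])
      fix m :: nat assume m: "1 \<le> m"
      have e: "seq_qnorm q (\<lambda>k. if k \<in> {m} then ennreal (1 * 2 powr (real k * a)) * Y else 0) = ennreal (2 powr (real m * a)) * Y"
        if "0 < q" for q a Y
      proof -
        have "(\<lambda>k. if k \<in> {m} then ennreal (1 * 2 powr (real k * a)) * Y else 0) = (\<lambda>k. if k \<in> {m} then ennreal (2 powr (real m * a)) * Y else 0)"
          by auto
        then show ?thesis using seq_qnorm_const_on[OF that, of "{m}" "ennreal (2 powr (real m * a)) * Y"] by simp
      qed
      show "ennreal (2 powr (real m * (s1 - d / p1))) * ?X1 \<le> ennreal C * (ennreal (2 powr (real m * (s0 - d / p0))) * ?X0)"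
        using annulus[of "{m}" "\<lambda>_. 1"] X(1) m unfolding e[OF q(1)] e[OF q(2)] by (simp add: ennreal_mult_less_top)
    qed
    then show ?thesis by (simp add: D_def d_def)
  qed
  show "q0 \<le> q1" if sD: "s0 - s1 = D"
  proof -
    \<comment> \<open>In the critical case both weights equal \<open>2^(k \<tau>)\<close>.
      Coefficients \<open>2^(-k \<tau>)\<close> give all pieces the same size, and a block of
      \<open>2^m\<close> of them has a sequence quasi-norm of \<open>2^(m/q)\<close> times that
      size.\<close>
    define \<tau> where "\<tau> = s0 - d / p0"
    have \<tau>: "s1 - d / p1 = \<tau>" using sD by (simp add: \<tau>_def D_def d_def)
    have "recip_exponent q1 \<le> recip_exponent q0"
    proof (rule growth_rate_le[OF _ X(2,1)])
      fix m :: nat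
      let ?I = "{1..(2::nat) ^ m}"
      have one: "2 powr (- (real k * \<tau>)) * 2 powr (real k * \<tau>) = (1::real)" for k by (simp add: powr_minus)
      have e: "seq_qnorm q (\<lambda>k. if k \<in> ?I then ennreal (2 powr (- (real k * \<tau>)) * 2 powr (real k * \<tau>)) * Y else 0) = ennreal (2 powr (real m * recip_exponent q)) * Y"
        if "0 < q" for q Y
        unfolding one ennreal_1 mult_1_left using seq_qnorm_const_on[OF that, of ?I Y] by (simp add: p2)
      show "ennreal (2 powr (real m * recip_exponent q1)) * ?X1 \<le> ennreal C * (ennreal (2 powr (real m * recip_exponent q0)) * ?X0)"
        using annulus[of ?I "\<lambda>k. 2 powr (- (real k * \<tau>))"] X(1) unfolding \<tau> \<tau>_def[symmetric] e[OF q(1)] e[OF q(2)]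
        by (simp add: ennreal_mult_less_top)
    qed
    then show ?thesis using recip_exponent_le_imp q by blast
  qed
  show "r0 \<le> r1" if pp: "p0 = p1"
  proof (cases "r1 = \<infinity>")
    case False
    obtain c where c: "c > 0" "\<And>J. J \<ge> 1 \<Longrightarrow> ennreal (c * real J powr recip_exponent r1) \<le> lorentz_qnorm p1 r1 (dyadic_sum (real DIM('a) / p1) \<eta> J)"
      using dyadic_sum_lorentz_lower[OF \<eta>(1,2,3) p(2) r(2) False] by blast
    obtain K where K: "\<And>J. J \<ge> 1 \<Longrightarrow> lorentz_qnorm p0 r0 (dyadic_sum (real DIM('a) / p0) \<eta> J) \<le> ennreal (K * real J powr recip_exponent r0)"
      using dyadic_sum_lorentz_upper[OF \<eta>(1) p(1) r(1)] by blast
    have "recip_exponent r1 \<le> recip_exponent r0"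
    proof (rule growth_rate_le)
      fix m :: nat
      \<comment> \<open>Taking \<open>2^m\<close> for \<open>J\<close> turns \<open>J^(1/r)\<close>
        into \<open>2^(m/r)\<close>, the exponential form that \<open>growth_rate_le\<close>
        compares.\<close>
      let ?f = "dyadic_sum (real DIM('a) / p0) \<eta> (2 ^ m)"
      have J: "(2::nat) ^ m \<ge> 1" by simp
      have "ennreal (2 powr (real m * recip_exponent r1)) * ennreal c = ennreal (c * real (2 ^ m) powr recip_exponent r1)"
        using c(1) by (simp add: ennreal_mult p2 mult.commute)
      also have "\<dots> \<le> lorentz_qnorm p1 r1 ?f" using c(2)[OF J] by (simp add: pp)
      also have "\<dots> \<le> ennreal C * lorentz_qnorm p0 r0 ?f"
        by (rule lowfreq[OF dyadic_sum_schwartz[OF \<eta>(1)] dyadic_sum_low_frequency[OF \<eta>(1,4)]])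
      also have "\<dots> \<le> ennreal C * ennreal (\<bar>K\<bar> * real (2 ^ m) powr recip_exponent r0)"
        by (intro mult_left_mono order_trans[OF K[OF J]] ennreal_leI mult_right_mono) auto
      also have "ennreal (\<bar>K\<bar> * real (2 ^ m) powr recip_exponent r0) = ennreal (2 powr (real m * recip_exponent r0)) * ennreal \<bar>K\<bar>"
        by (simp add: ennreal_mult p2 mult.commute)
      finally show "ennreal (2 powr (real m * recip_exponent r1)) * ennreal c \<le> ennreal C * (ennreal (2 powr (real m * recip_exponent r0)) * ennreal \<bar>K\<bar>)" .
    qed (use c in auto)
    then show ?thesis using recip_exponent_le_imp r by blast
  qed simp
qed

theorem theorem1p5:
  fixes \<beta>0 :: "real ^ 'n \<Rightarrow> complex"
    and s0 s1 p0 p1 :: real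
    and q0 q1 r0 r1 :: ennreal
  assumes "LP_cutoff \<beta>0"
    and "0 < p0" "0 < p1" "0 < q0" "0 < q1" "0 < r0" "0 < r1"
  shows "cont_embeds
           (besov_lorentz \<beta>0 s0 q0 p0 r0) (besov_lorentz_qnorm \<beta>0 s0 q0 p0 r0)
           (besov_lorentz \<beta>0 s1 q1 p1 r1) (besov_lorentz_qnorm \<beta>0 s1 q1 p1 r1)
         \<longleftrightarrow>
           (s0 - s1 > real CARD('n) / p0 - real CARD('n) / p1 \<and> real CARD('n) / p0 - real CARD('n) / p1 > 0) \<or>
           (s0 > s1 \<and> p0 = p1 \<and> r0 \<le> r1) \<or>
           (s0 - s1 = real CARD('n) / p0 - real CARD('n) / p1 \<and> real CARD('n) / p0 - real CARD('n) / p1 > 0 \<and> q0 \<le> q1) \<or>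
           (s0 = s1 \<and> p0 = p1 \<and> r0 \<le> r1 \<and> q0 \<le> q1)"
proof -
  define d where "d = real CARD('n)"
  have d: "d > 0" by (simp add: d_def)
  have dim: "real DIM(real ^ 'n) = d" by (simp add: d_def)
  note pos = assms(2-7)
  \<comment> \<open>The sign of \<open>d / p0 - d / p1\<close> is decided by the order of
    \<open>p0\<close> and \<open>p1\<close>, which links the stated conditions to the split on
    \<open>p0 < p1\<close> in the sufficiency part.\<close>
  have pp: "0 < d / p0 - d / p1 \<longleftrightarrow> p0 < p1" "d / p0 - d / p1 = 0 \<longleftrightarrow> p0 = p1"
    using d pos(1,2) by (auto simp: field_simps)
  let ?cond = "(s0 - s1 > d / p0 - d / p1 \<and> d / p0 - d / p1 > 0) \<or> (s0 > s1 \<and> p0 = p1 \<and> r0 \<le> r1) \<or>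
    (s0 - s1 = d / p0 - d / p1 \<and> d / p0 - d / p1 > 0 \<and> q0 \<le> q1) \<or> (s0 = s1 \<and> p0 = p1 \<and> r0 \<le> r1 \<and> q0 \<le> q1)"
  have "cont_embeds (besov_lorentz \<beta>0 s0 q0 p0 r0) (besov_lorentz_qnorm \<beta>0 s0 q0 p0 r0)
    (besov_lorentz \<beta>0 s1 q1 p1 r1) (besov_lorentz_qnorm \<beta>0 s1 q1 p1 r1) \<longleftrightarrow> ?cond" (is "?emb \<longleftrightarrow> _")
  proof
    assume ?emb
    note nec = besov_lorentz_embed_necessary[OF assms(1) pos this, unfolded dim]
    \<comment> \<open>A negative value is excluded by \<open>nec(1)\<close>. In the positive case
      the smoothness is either in excess or critical, and only in the latter does
      \<open>nec(4)\<close> supply \<open>q0 \<le> q1\<close>.\<close>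
    consider "d / p0 - d / p1 > 0" | "d / p0 - d / p1 = 0" using nec(1) by linarith
    then show ?cond
    proof cases
      case 1
      then show ?thesis using nec(2,4) by argo
    next
      case 2
      then have "p0 = p1" using pp by simp
      then show ?thesis using nec(2-4) 2 by force
    qed
  next
    assume ?cond
    then show ?emb
      by (intro besov_lorentz_embed_sufficient[OF assms(1) pos, unfolded dim]) (use pp in auto)
  qed
  then show ?thesis unfolding d_def .
qed

end
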